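(* Let $\mathbb{D}^2$ be the bidisk in $\mathbb{C}^2$ and let $\phi,\psi\in C(\overline{\mathbb{D}^2})$ be such that $\phi\circ g$ and $\psi\circ g$ are harmonic for all holomorphic $g:\mathbb{D}\to\partial\mathbb{D}^2$. Then $H_{\psi}^*H_{\phi}$ is compact on $A^2(\mathbb{D}^2)$ if and only if for any holomorphic function $g:\mathbb{D}\to\partial\mathbb{D}^2$, either $\phi\circ g$ or $\psi\circ g$ is holomorphic.
   Context: $\mathbb{D}$ is the open unit disk in $\mathbb{C}$, $\mathbb{D}^2=\mathbb{D}\times\mathbb{D}$, and $\partial\mathbb{D}^2$ is its topological boundary in $\mathbb{C}^2$. A holomorphic function $g:\mathbb{D}\to\partial\mathbb{D}^2$ is a holomorphic map $g:\mathbb{D}\to\mathbb{C}^2$ whose image is contained in $\partial\mathbb{D}^2$. Symbols are complex-valued. For a domain $\Omega\subset\mathbb{C}^n$ with Lebesgue volume measure $dV$, the Bergman space $A^2(\Omega)$ is the closed subspace of $L^2(\Omega,dV)$ consisting of holomorphic functions, and $P:L^2(\Omega)\to A^2(\Omega)$ is the orthogonal projection. For $\phi\in L^\infty(\Omega)$, the Hankel operator $H_\phi:A^2(\Omega)\to A^2(\Omega)^\perp$ is $H_\phi f=(I-P)(\phi f)$, and $H_\phi^*$ is its Hilbert space adjoint. *)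

theory Defs
  imports "HOL-Complex_Analysis.Complex_Analysis"
begin

definition bidisk :: "(complex \<times> complex) set" where
  "bidisk = ball 0 1 \<times> ball 0 1"

(* Complex differentiability in two variables: the real Frechet derivative exists and is
   complex linear. *)
definition holomorphic2_on :: "(complex \<times> complex \<Rightarrow> complex) \<Rightarrow> (complex \<times> complex) set \<Rightarrow> bool" where
  "holomorphic2_on f \<Omega> \<longleftrightarrow>
     (\<forall>z\<in>\<Omega>. \<exists>a b. (f has_derivative (\<lambda>(h, k). a * h + b * k)) (at z within \<Omega>))"

definition holomorphic_disc :: "(complex \<Rightarrow> complex \<times> complex) \<Rightarrow> (complex \<times> complex) set \<Rightarrow> bool" where
  "holomorphic_disc g X \<longleftrightarrow>
     (\<lambda>\<zeta>. fst (g \<zeta>)) holomorphic_on ball 0 1 \<and>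
     (\<lambda>\<zeta>. snd (g \<zeta>)) holomorphic_on ball 0 1 \<and>
     g ` ball 0 1 \<subseteq> X"

(* Complex-valued harmonicity on an open set S: u is twice continuously differentiable and
   satisfies Laplace's equation; ux, uy, uxx, ... are the partial derivatives of u. *)
definition harmonic_on :: "(complex \<Rightarrow> complex) \<Rightarrow> complex set \<Rightarrow> bool" where
  "harmonic_on u S \<longleftrightarrow>
     (\<exists>ux uy uxx uxy uyx uyy :: complex \<Rightarrow> complex.
        (\<forall>z\<in>S. (u has_derivative (\<lambda>h. Re h *\<^sub>R ux z + Im h *\<^sub>R uy z)) (at z) \<and>
               (ux has_derivative (\<lambda>h. Re h *\<^sub>R uxx z + Im h *\<^sub>R uxy z)) (at z) \<and>
               (uy has_derivative (\<lambda>h. Re h *\<^sub>R uyx z + Im h *\<^sub>R uyy z)) (at z)) \<and>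
        continuous_on S uxx \<and> continuous_on S uxy \<and>
        continuous_on S uyx \<and> continuous_on S uyy \<and>
        (\<forall>z\<in>S. uxx z + uyy z = 0))"

(* Elements of L^2 are represented by functions rather than by classes modulo null sets;
   values outside \<Omega> are irrelevant. *)
definition l2_space :: "(complex \<times> complex) set \<Rightarrow> (complex \<times> complex \<Rightarrow> complex) set" where
  "l2_space \<Omega> = {f. f \<in> borel_measurable (lebesgue_on \<Omega>) \<and>
                     integrable (lebesgue_on \<Omega>) (\<lambda>z. (cmod (f z))\<^sup>2)}"

definition l2_inner ::
    "(complex \<times> complex) set \<Rightarrow> (complex \<times> complex \<Rightarrow> complex) \<Rightarrow> (complex \<times> complex \<Rightarrow> complex) \<Rightarrow> complex" where
  "l2_inner \<Omega> f g = (LINT z|lebesgue_on \<Omega>. f z * cnj (g z))"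

definition l2_norm :: "(complex \<times> complex) set \<Rightarrow> (complex \<times> complex \<Rightarrow> complex) \<Rightarrow> real" where
  "l2_norm \<Omega> f = sqrt (LINT z|lebesgue_on \<Omega>. (cmod (f z))\<^sup>2)"

(* On an open set a class in L^2 contains at most one holomorphic function. Prescribing the
   value 0 outside \<Omega> makes the representing HOL function unique, so that the definite
   descriptions below denote. *)
definition bergman_space :: "(complex \<times> complex) set \<Rightarrow> (complex \<times> complex \<Rightarrow> complex) set" where
  "bergman_space \<Omega> = {f \<in> l2_space \<Omega>. holomorphic2_on f \<Omega> \<and> (\<forall>z. z \<notin> \<Omega> \<longrightarrow> f z = 0)}"

definition bergman_projection ::
    "(complex \<times> complex) set \<Rightarrow> (complex \<times> complex \<Rightarrow> complex) \<Rightarrow> complex \<times> complex \<Rightarrow> complex" where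
  "bergman_projection \<Omega> f =
     (THE g. g \<in> bergman_space \<Omega> \<and>
             (\<forall>h\<in>bergman_space \<Omega>. l2_inner \<Omega> (\<lambda>z. f z - g z) h = 0))"

definition hankel ::
    "(complex \<times> complex) set \<Rightarrow> (complex \<times> complex \<Rightarrow> complex) \<Rightarrow>
     (complex \<times> complex \<Rightarrow> complex) \<Rightarrow> complex \<times> complex \<Rightarrow> complex" where
  "hankel \<Omega> \<phi> f = (\<lambda>z. \<phi> z * f z - bergman_projection \<Omega> (\<lambda>w. \<phi> w * f w) z)"

(* The Hilbert space adjoint of an operator T from the Bergman space into (a subspace of) L^2. *)
definition bergman_adjoint ::
    "(complex \<times> complex) set \<Rightarrow>
     ((complex \<times> complex \<Rightarrow> complex) \<Rightarrow> complex \<times> complex \<Rightarrow> complex) \<Rightarrow>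
     (complex \<times> complex \<Rightarrow> complex) \<Rightarrow> complex \<times> complex \<Rightarrow> complex" where
  "bergman_adjoint \<Omega> T u =
     (THE g. g \<in> bergman_space \<Omega> \<and>
             (\<forall>f\<in>bergman_space \<Omega>. l2_inner \<Omega> (T f) u = l2_inner \<Omega> f g))"

(* For a linear operator T on the Bergman space: the images of bounded sequences have
   subsequences converging in norm. *)
definition compact_on_bergman ::
    "(complex \<times> complex) set \<Rightarrow>
     ((complex \<times> complex \<Rightarrow> complex) \<Rightarrow> complex \<times> complex \<Rightarrow> complex) \<Rightarrow> bool" where
  "compact_on_bergman \<Omega> T \<longleftrightarrow>
     (\<forall>f :: nat \<Rightarrow> complex \<times> complex \<Rightarrow> complex.
        (\<forall>n. f n \<in> bergman_space \<Omega>) \<and> (\<exists>B. \<forall>n. l2_norm \<Omega> (f n) \<le> B) \<longrightarrow>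
        (\<exists>g\<in>bergman_space \<Omega>. \<exists>r :: nat \<Rightarrow> nat. strict_mono r \<and>
           (\<lambda>n. l2_norm \<Omega> (\<lambda>z. T (f (r n)) z - g z)) \<longlonglongrightarrow> 0))"

end

theory Submission imports Defs begin

text \<open>
  In terms of Taylor coefficients the Bergman space of the bidisk is a weighted sequence space, and the
  operator \<open>H\<^sub>\<psi>\<^sup>* H\<^sub>\<phi>\<close> is determined by the pairings \<open>\<langle>H\<^sub>\<phi> A, \<psi> h\<rangle>\<close>.

  Sufficiency. If \<open>A\<close> vanishes to high order in \<open>z\<close>, then its mass sits near \<open>|z| = 1\<close>, and, after \<open>\<phi>\<close> is replaced by
  a polynomial in \<open>z, w\<close> and their conjugates, the projection of \<open>\<phi> A\<close> is almost the projection in \<open>w\<close> alone. So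
  the pairing is an integral over \<open>z\<close> of one-variable pairings of Hankel operators with symbols close to
  \<open>\<phi>(e, _)\<close> and \<open>\<psi>(e, _)\<close>, \<open>e = z / |z|\<close>, one of which is holomorphic; hence it is small. The same holds
  in \<open>w\<close>, and only finitely many monomials remain.

  Necessity. Testing with functions \<open>k\<^sub>N(z) w\<^sup>i\<close>, where \<open>k\<^sub>N\<close> peaks at a point \<open>e\<close> of the circle, yields
  \<open>\<langle>H\<^sub>\<phi> w\<^sup>i, H\<^sub>\<psi> w\<^sup>j\<rangle> = 0\<close> for the restricted symbols \<open>\<phi>(e, _) = f\<^sub>1 + cnj g\<^sub>1\<close> and \<open>\<psi>(e, _) = f\<^sub>2 + cnj g\<^sub>2\<close>.
  With \<open>b\<^sub>m\<close>, \<open>c\<^sub>m\<close> the Taylor coefficients of \<open>g\<^sub>1\<close>, \<open>g\<^sub>2\<close>, these relations say that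
  \<open>\<Phi>(t) = \<Sum>m. cnj b\<^sub>m c\<^bsub>m + d\<^esub> t\<^sup>m\<close> equals a weighted average of itself over \<open>[0, 1]\<close>, so a maximum principle makes
  \<open>\<Phi>\<close> constant, and then zero. Hence \<open>g\<^sub>1\<close> or \<open>g\<^sub>2\<close> vanishes.
  By the maximum modulus principle every disc in the boundary lies in one of these fibres.
\<close>

section \<open>Integration over the disc and the bidisk\<close>

text \<open>In the sufficiency direction the fibre over \<open>e\<close> decides whether
  \<open>\<phi>\<close> or \<open>\<psi>\<close> is holomorphic there, and nothing links the choices
  for different \<open>e\<close>. The fibre bound is therefore made the same in both cases, so that
  it can be integrated without knowing which case occurs where. Polynomial approximation destroys
  holomorphy on the fibres; it serves only to compare the projection in both variables with the one
  in \<open>w\<close>, while smallness comes from the original symbols frozen at \<open>e\<close>.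
  No separate one-variable theory is set up: a function of \<open>w\<close> counts as a function on
  the bidisk that is constant in \<open>z\<close>, which explains stray factors \<open>pi\<close>.
  The ambient space of continuous representatives is not complete, so the projection is built from
  coefficients, by Bessel's inequality and a Riesz-Fischer argument in the Bergman space. In the
  necessity direction \<open>\<Phi>\<close> has to be continuous up to \<open>t = 1\<close> for its
  extrema to be attained. Boundedness of the symbols gives this, since it makes the coefficients of
  \<open>g\<^sub>1\<close> and \<open>g\<^sub>2\<close> square summable. Normalising
  \<open>g\<^sub>1\<close> to vanish at 0 makes the constant 0.\<close>

lemma lborel_complex:
  "distr (lborel \<Otimes>\<^sub>M lborel) borel (\<lambda>(x, y). Complex x y) = lborel"
proof (rule lborel_eqI[symmetric])
  have cont: "continuous_on UNIV (\<lambda>p. Complex (fst p) (snd p))"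
    unfolding Complex_eq by (intro continuous_intros)
  have meas: "(\<lambda>(x, y). Complex x y) \<in> lborel \<Otimes>\<^sub>M lborel \<rightarrow>\<^sub>M borel"
    unfolding lborel_prod using borel_measurable_continuous_onI[OF cont]
    by (simp add: split_beta' measurable_lborel1)
  fix l u :: complex
  assume le: "\<And>b. b \<in> Basis \<Longrightarrow> l \<bullet> b \<le> u \<bullet> b"
  have le': "Re l \<le> Re u" "Im l \<le> Im u"
    using le[of 1] le[of \<i>] by (auto simp: Basis_complex_def)
  have "(\<lambda>(x, y). Complex x y) -` box l u = {Re l <..< Re u} \<times> {Im l <..< Im u}"
    by (auto simp: in_box_complex_iff)
  then show "emeasure (distr (lborel \<Otimes>\<^sub>M lborel) borel (\<lambda>(x, y). Complex x y)) (box l u) =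
      ennreal (\<Prod>b\<in>Basis. (u - l) \<bullet> b)"
    using le' by (simp add: emeasure_distr meas lborel.emeasure_pair_measure_Times space_pair_measure
        Basis_complex_def ennreal_mult)
qed simp

lemma integral_complex_Fubini:
  fixes f :: "complex \<Rightarrow> complex"
  assumes "integrable lborel f"
  shows "(LINT z|lborel. f z) = (LINT y|lborel. LINT x|lborel. f (Complex x y))"
    and "(LINT z|lborel. f z) = (LINT x|lborel. LINT y|lborel. f (Complex x y))"
proof -
  have cont: "continuous_on UNIV (\<lambda>p. Complex (fst p) (snd p))"
    unfolding Complex_eq by (intro continuous_intros)
  have meas: "(\<lambda>(x, y). Complex x y) \<in> lborel \<Otimes>\<^sub>M lborel \<rightarrow>\<^sub>M borel"
    unfolding lborel_prod using borel_measurable_continuous_onI[OF cont]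
    by (simp add: split_beta' measurable_lborel1)
  have f: "f \<in> borel_measurable borel"
    using assms by auto
  have int: "integrable (lborel \<Otimes>\<^sub>M lborel) (\<lambda>(x, y). f (Complex x y))"
    using assms unfolding lborel_complex[symmetric] integrable_distr_eq[OF meas f] by (simp add: split_beta')
  have "(LINT z|lborel. f z) = (LINT p|(lborel \<Otimes>\<^sub>M lborel). f (Complex (fst p) (snd p)))"
    by (subst lborel_complex[symmetric], subst integral_distr[OF meas f]) (simp add: split_beta')
  then show "(LINT z|lborel. f z) = (LINT y|lborel. LINT x|lborel. f (Complex x y))"
    "(LINT z|lborel. f z) = (LINT x|lborel. LINT y|lborel. f (Complex x y))"
    using lborel_pair.integral_snd[OF int] lborel_pair.integral_fst'[OF int[unfolded split_beta']]
    by (simp_all add: split_beta')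
qed

text \<open>Fubini reduces the integral of a partial derivative to the chords of the disc. On each
  chord the fundamental theorem of calculus leaves the difference of two endpoint values, and the
  endpoints lie on the circle. The closed disc is taken so that chords are closed intervals.\<close>

lemma integral_ball_deriv_zero:
  fixes F Fx Fy :: "real \<Rightarrow> real \<Rightarrow> complex"
  assumes dx: "\<And>x y. ((\<lambda>x. F x y) has_vector_derivative Fx x y) (at x)"
    and dy: "\<And>x y. ((\<lambda>y. F x y) has_vector_derivative Fy x y) (at y)"
    and cx: "continuous_on UNIV (\<lambda>z. Fx (Re z) (Im z))"
    and cy: "continuous_on UNIV (\<lambda>z. Fy (Re z) (Im z))"
    and bd: "\<And>x y. x\<^sup>2 + y\<^sup>2 = 1 \<Longrightarrow> F x y = 0"
  shows "(LINT z|lborel. indicator (cball 0 1) z *\<^sub>R Fx (Re z) (Im z)) = 0"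
    and "(LINT z|lborel. indicator (cball 0 1) z *\<^sub>R Fy (Re z) (Im z)) = 0"
proof -
  have int: "integrable lborel (\<lambda>z. indicator (cball 0 1) z *\<^sub>R g z)" if "continuous_on UNIV g" for g :: "complex \<Rightarrow> complex"
    using borel_integrable_compact[OF compact_cball continuous_on_subset[OF that], of 0 1] by simp
  have dsk: "indicator (cball 0 1) (Complex x y) = (indicator {-sqrt (1 - y\<^sup>2)..sqrt (1 - y\<^sup>2)} x :: real)"
    if "\<bar>y\<bar> \<le> 1" for x y
  proof -
    have "0 \<le> 1 - y\<^sup>2" using that by (simp add: abs_square_le_1)
    moreover have "cmod (Complex x y) \<le> 1 \<longleftrightarrow> x\<^sup>2 \<le> 1 - y\<^sup>2"
      by (auto simp: cmod_def)
    moreover have "x\<^sup>2 \<le> 1 - y\<^sup>2 \<longleftrightarrow> \<bar>x\<bar> \<le> sqrt (1 - y\<^sup>2)"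
      using calculation(1) by (metis real_sqrt_abs real_sqrt_le_iff)
    ultimately show ?thesis by (auto simp: indicator_def)
  qed
  have dsk': "indicator (cball 0 1) (Complex x y) = (indicator {-sqrt (1 - x\<^sup>2)..sqrt (1 - x\<^sup>2)} y :: real)"
    if "\<bar>x\<bar> \<le> 1" for x y
    using dsk[OF that, of y] by (simp add: indicator_def cmod_def add.commute)
  have out: "indicator (cball 0 1) (Complex x y) = (0::real)" if "\<bar>y\<bar> > 1 \<or> \<bar>x\<bar> > 1" for x y
    using that abs_Im_le_cmod[of "Complex x y"] abs_Re_le_cmod[of "Complex x y"] by (auto simp: indicator_def)
  have cC: "continuous_on UNIV (\<lambda>x. Complex x y)" "continuous_on UNIV (\<lambda>x. Complex y x)" for y
    unfolding Complex_eq by (intro continuous_intros)+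
  have "(LINT x|lborel. indicator (cball 0 1) (Complex x y) *\<^sub>R Fx x y) = 0" for y
  proof (cases "\<bar>y\<bar> \<le> 1")
    case True
    then have *: "(sqrt (1 - y\<^sup>2))\<^sup>2 = 1 - y\<^sup>2" "0 \<le> sqrt (1 - y\<^sup>2)" by (auto simp: abs_square_le_1)
    have "has_bochner_integral lborel (\<lambda>x. indicator {-sqrt (1 - y\<^sup>2)..sqrt (1 - y\<^sup>2)} x *\<^sub>R Fx x y)
       (F (sqrt (1 - y\<^sup>2)) y - F (- sqrt (1 - y\<^sup>2)) y)"
    proof (rule has_bochner_integral_FTC_Icc)
      show "continuous_on {-sqrt (1 - y\<^sup>2)..sqrt (1 - y\<^sup>2)} (\<lambda>x. Fx x y)"
        using continuous_on_compose2[OF cx cC(1)[of y]] by (auto intro: continuous_on_subset)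
    qed (use dx * in \<open>auto intro: has_vector_derivative_at_within\<close>)
    then show ?thesis using * by (simp add: dsk[OF True] bd has_bochner_integral_integral_eq)
  qed (simp add: out)
  then show "(LINT z|lborel. indicator (cball 0 1) z *\<^sub>R Fx (Re z) (Im z)) = 0"
    by (subst integral_complex_Fubini(1)[OF int[OF cx]]) simp
  have "(LINT y|lborel. indicator (cball 0 1) (Complex x y) *\<^sub>R Fy x y) = 0" for x
  proof (cases "\<bar>x\<bar> \<le> 1")
    case True
    then have *: "(sqrt (1 - x\<^sup>2))\<^sup>2 = 1 - x\<^sup>2" "0 \<le> sqrt (1 - x\<^sup>2)" by (auto simp: abs_square_le_1)
    have "has_bochner_integral lborel (\<lambda>y. indicator {-sqrt (1 - x\<^sup>2)..sqrt (1 - x\<^sup>2)} y *\<^sub>R Fy x y)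
       (F x (sqrt (1 - x\<^sup>2)) - F x (- sqrt (1 - x\<^sup>2)))"
    proof (rule has_bochner_integral_FTC_Icc)
      show "continuous_on {-sqrt (1 - x\<^sup>2)..sqrt (1 - x\<^sup>2)} (\<lambda>y. Fy x y)"
        using continuous_on_compose2[OF cy cC(2)[of x]] by (auto intro: continuous_on_subset)
    qed (use dy * in \<open>auto intro: has_vector_derivative_at_within\<close>)
    then show ?thesis using * by (simp add: dsk'[OF True] bd has_bochner_integral_integral_eq)
  qed (simp add: out)
  then show "(LINT z|lborel. indicator (cball 0 1) z *\<^sub>R Fy (Re z) (Im z)) = 0"
    by (subst integral_complex_Fubini(2)[OF int[OF cy]]) simp
qed


section \<open>Lebesgue measure on the disc and on the bidisk\<close>

definition disc_measure :: "complex measure" where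
  "disc_measure = restrict_space lborel (ball 0 1)"

lemma space_disc [simp]: "space disc_measure = ball 0 1"
  by (simp add: disc_measure_def space_restrict_space)

lemma sets_disc: "sets disc_measure = sets (restrict_space borel (ball 0 1))"
  by (simp add: disc_measure_def sets_restrict_space)

lemma finite_measure_disc: "finite_measure disc_measure"
  using emeasure_lborel_ball_finite[of "0::complex" 1]
  by (intro finite_measureI) (simp add: disc_measure_def emeasure_restrict_space space_restrict_space)

interpretation disc: finite_measure disc_measure
  by (rule finite_measure_disc)

interpretation disc_pair: pair_sigma_finite disc_measure disc_measure ..

text \<open>Both measures come from \<open>lborel\<close> and not from its completion, because a
  product of completed measures is in general not complete. The Fubini theorems for pairs of finite
  measures then apply directly, and \<open>integral_lebesgue_bidisk\<close> leads back to the
  completed measure of the definitions.\<close>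

definition bidisk_measure :: "(complex \<times> complex) measure" where
  "bidisk_measure = disc_measure \<Otimes>\<^sub>M disc_measure"

lemma space_bidisk [simp]: "space bidisk_measure = bidisk"
  by (simp add: bidisk_measure_def space_pair_measure bidisk_def)

lemma open_bidisk: "open bidisk"
  by (simp add: bidisk_def open_Times)

lemma bidisk_measure_eq: "bidisk_measure = restrict_space lborel bidisk"
  unfolding bidisk_measure_def
proof (rule pair_measure_eqI)
  \<comment> \<open>The sigma-algebras agree because the identity is measurable in both
    directions.\<close>
  show "sets (disc_measure \<Otimes>\<^sub>M disc_measure) = sets (restrict_space lborel bidisk)"
  proof (rule antisym)
    have "(\<lambda>p. (fst p, snd p)) \<in> restrict_space lborel bidisk \<rightarrow>\<^sub>M disc_measure \<Otimes>\<^sub>M disc_measure"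
      unfolding disc_measure_def
      by (intro measurable_Pair measurable_restrict_space2)
        (auto simp: bidisk_def space_restrict_space lborel_prod[symmetric] intro!: measurable_restrict_space1)
    then have "id \<in> restrict_space lborel bidisk \<rightarrow>\<^sub>M disc_measure \<Otimes>\<^sub>M disc_measure"
      by (simp add: id_def)
    then show "sets (disc_measure \<Otimes>\<^sub>M disc_measure) \<subseteq> sets (restrict_space lborel bidisk)"
      using sets.sets_into_space[of _ "disc_measure \<Otimes>\<^sub>M disc_measure"]
      by (force dest: measurable_sets simp: space_restrict_space space_pair_measure bidisk_def Int_absorb2)
    have "(\<lambda>p. (fst p, snd p)) \<in> disc_measure \<Otimes>\<^sub>M disc_measure \<rightarrow>\<^sub>M lborel \<Otimes>\<^sub>M lborel"
      unfolding disc_measure_def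
      by (intro measurable_Pair measurable_compose[OF measurable_fst] measurable_compose[OF measurable_snd]
          measurable_restrict_space1) auto
    then have "id \<in> disc_measure \<Otimes>\<^sub>M disc_measure \<rightarrow>\<^sub>M lborel"
      by (simp add: id_def lborel_prod)
    then show "sets (restrict_space lborel bidisk) \<subseteq> sets (disc_measure \<Otimes>\<^sub>M disc_measure)"
      by (force dest: measurable_sets simp: sets_restrict_space space_pair_measure bidisk_def Int_commute)
  qed
next
  fix A B assume *: "A \<in> sets disc_measure" "B \<in> sets disc_measure"
  then have AB: "A \<subseteq> ball 0 1" "B \<subseteq> ball 0 1" "A \<in> sets lborel" "B \<in> sets lborel"
    by (auto simp: disc_measure_def sets_restrict_space_iff)
  then have "A \<times> B \<subseteq> bidisk"
    by (auto simp: bidisk_def)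
  have "emeasure (restrict_space lborel bidisk) (A \<times> B) = emeasure lborel (A \<times> B)"
    using \<open>A \<times> B \<subseteq> bidisk\<close> by (simp add: emeasure_restrict_space open_bidisk)
  also have "\<dots> = emeasure lborel A * emeasure lborel B"
    using AB by (simp add: lborel_prod[symmetric] lborel.emeasure_pair_measure_Times)
  finally show "emeasure disc_measure A * emeasure disc_measure B = emeasure (restrict_space lborel bidisk) (A \<times> B)"
    using AB by (simp add: disc_measure_def emeasure_restrict_space)
qed unfold_locales

interpretation bidisk: finite_measure bidisk_measure
  unfolding bidisk_measure_def by (rule finite_measure_pair_measure[OF finite_measure_disc finite_measure_disc])

lemma measurable_disc: "continuous_on (ball 0 1) f \<Longrightarrow> f \<in> borel_measurable disc_measure"
  for f :: "complex \<Rightarrow> 'b::topological_space"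
  using borel_measurable_continuous_on_restrict[of "ball 0 1" f] measurable_cong_sets[OF sets_disc refl] by blast

lemma measurable_bidisk: "continuous_on bidisk f \<Longrightarrow> f \<in> borel_measurable bidisk_measure"
  for f :: "complex \<times> complex \<Rightarrow> 'b::topological_space"
  using borel_measurable_continuous_on_restrict[of "bidisk" f] 
    measurable_cong_sets[of bidisk_measure "restrict_space borel bidisk" borel borel]
  by (auto simp: bidisk_measure_eq sets_restrict_space)

lemma integrable_disc_bounded:
  fixes f :: "complex \<Rightarrow> 'b::{banach, second_countable_topology}"
  assumes "continuous_on (ball 0 1) f" "\<And>z. z \<in> ball 0 1 \<Longrightarrow> norm (f z) \<le> B"
  shows "integrable disc_measure f"
  by (rule disc.integrable_const_bound[where B = B]) (use assms measurable_disc in auto)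

text \<open>The circle is a null set, so Stokes' formula on the closed disc can be used for
  \<open>disc_measure\<close>.\<close>

lemma integral_disc_cball:
  fixes f :: "complex \<Rightarrow> complex"
  assumes "continuous_on UNIV f"
  shows "(LINT z|disc_measure. f z) = (LINT z|lborel. indicator (cball 0 1) z *\<^sub>R f z)"
proof -
  have "(LINT z|disc_measure. f z) = (LINT z|lborel. indicator (ball 0 1) z *\<^sub>R f z)"
    by (simp add: disc_measure_def integral_restrict_space)
  also have "\<dots> = (LINT z|lborel. indicator (cball 0 1) z *\<^sub>R f z)"
  proof (rule integral_cong_AE)
    have "negligible (sphere (0::complex) 1)"
      by (rule negligible_sphere)
    then have "sphere (0::complex) 1 \<in> null_sets lborel"
      by (auto simp: negligible_iff_null_sets null_sets_completion_iff)
    then have "AE z in lborel. z \<notin> sphere (0::complex) 1"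
      by (rule AE_not_in)
    then show "AE z in lborel. indicator (ball 0 1) z *\<^sub>R f z = indicator (cball 0 1) z *\<^sub>R f z"
      by eventually_elim (auto simp: indicator_def)
    have f: "f \<in> borel_measurable lborel"
      using borel_measurable_continuous_onI[OF assms] by simp
    show "(\<lambda>z. indicator (ball 0 1) z *\<^sub>R f z) \<in> borel_measurable lborel"
      "(\<lambda>z. indicator (cball 0 1) z *\<^sub>R f z) \<in> borel_measurable lborel"
      by (intro borel_measurable_scaleR borel_measurable_indicator f; simp)+
  qed
  finally show ?thesis .
qed

lemma measure_disc [simp]: "measure disc_measure (ball 0 1) = pi"
  using content_ball[of 1 "0::complex"]
  by (simp add: disc_measure_def measure_restrict_space unit_ball_vol_2)

section \<open>Moments of monomials and Taylor coefficients as integrals\<close>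

definition moment :: "nat \<Rightarrow> nat \<Rightarrow> complex" where
  "moment m n = (LINT z|disc_measure. z ^ m * cnj z ^ n)"

lemma integrable_disc_monom: "integrable disc_measure (\<lambda>z. z ^ m * cnj z ^ n)"
proof (rule integrable_disc_bounded[where B=1])
  fix z :: complex assume "z \<in> ball 0 1"
  then show "norm (z ^ m * cnj z ^ n) \<le> 1"
    by (auto simp: norm_mult norm_power intro!: mult_le_one power_le_one)
qed (intro continuous_intros)

text \<open>Stokes' formula for \<open>(1 - |z|\<^sup>2) z\<^sup>m (cnj z)\<^sup>n\<close>, which vanishes on the circle.\<close>

lemma moment_Suc:
  "of_nat m * moment (m - 1) n = of_nat (Suc m) * moment m (Suc n)"
  "of_nat n * moment m (n - 1) = of_nat (Suc n) * moment (Suc m) n"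
proof -
  define Z where "Z x y = of_real x + \<i> * of_real y" for x y :: real
  define W where "W x y = of_real x - \<i> * of_real y" for x y :: real
  define F where "F x y = (1 - Z x y * W x y) * (Z x y ^ m * W x y ^ n)" for x y
  \<comment> \<open>The name \<open>bproj\<close> is local here and has nothing to do with the
    projection defined later. With \<open>w\<close> in the place of \<open>cnj z\<close>,
    \<open>bproj\<close> and \<open>Q\<close> are the Wirtinger derivatives of \<open>F\<close> in
    \<open>z\<close> and in \<open>cnj z\<close>, so the real partial derivatives are
    \<open>bproj + Q\<close> and \<open>\<i> * (bproj - Q)\<close>. Both integrate to 0, hence so do
    \<open>bproj\<close> and \<open>Q\<close>.\<close>
  define bproj where "bproj z w = of_nat m * (z ^ (m - 1) * w ^ n) - of_nat (Suc m) * (z ^ m * w ^ Suc n)" for z w :: complex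
  define Q where "Q z w = of_nat n * (z ^ m * w ^ (n - 1)) - of_nat (Suc n) * (z ^ Suc m * w ^ n)" for z w :: complex
  have Z: "Z (Re z) (Im z) = z" "W (Re z) (Im z) = cnj z" for z
    by (simp_all add: Z_def W_def complex_eq_iff)
  have eq1: "- (w * (z ^ m * w ^ n)) + (1 - z * w) * (of_nat m * z ^ (m - 1) * w ^ n) = bproj z w" for z w
    by (cases m) (simp_all add: bproj_def algebra_simps)
  have eq2: "- (z * (z ^ m * w ^ n)) + (1 - z * w) * (of_nat n * w ^ (n - 1) * z ^ m) = Q z w" for z w
    by (cases n) (simp_all add: Q_def algebra_simps)
  have dx: "((\<lambda>x. F x y) has_vector_derivative bproj (Z x y) (W x y) + Q (Z x y) (W x y)) (at x)" for x y
    unfolding F_def Z_def W_def eq1[symmetric] eq2[symmetric]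
    by (rule has_vector_derivative_real_field) (auto intro!: derivative_eq_intros simp: algebra_simps)
  have dy: "((\<lambda>y. F x y) has_vector_derivative \<i> * (bproj (Z x y) (W x y) - Q (Z x y) (W x y))) (at y)" for x y
    unfolding F_def Z_def W_def eq1[symmetric] eq2[symmetric]
    by (rule has_vector_derivative_real_field) (auto intro!: derivative_eq_intros simp: algebra_simps)
  have cont: "continuous_on UNIV (\<lambda>z. bproj z (cnj z))" "continuous_on UNIV (\<lambda>z. Q z (cnj z))"
    unfolding bproj_def Q_def by (intro continuous_intros)+
  have F0: "F x y = 0" if "x\<^sup>2 + y\<^sup>2 = 1" for x y
  proof -
    have "Z x y * W x y = of_real (x\<^sup>2 + y\<^sup>2)" by (simp add: Z_def W_def algebra_simps power2_eq_square)
    then show ?thesis by (simp add: F_def that)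
  qed
  have 1: "(LINT z|lborel. indicator (cball 0 1) z *\<^sub>R (bproj z (cnj z) + Q z (cnj z))) = 0"
    "(LINT z|lborel. indicator (cball 0 1) z *\<^sub>R (\<i> * (bproj z (cnj z) - Q z (cnj z)))) = 0"
    using integral_ball_deriv_zero[of F, OF dx dy _ _ F0] cont by (simp_all add: Z continuous_intros)
  have int: "integrable disc_measure (\<lambda>z. bproj z (cnj z))" "integrable disc_measure (\<lambda>z. Q z (cnj z))"
    unfolding bproj_def Q_def
    by (intro Bochner_Integration.integrable_diff integrable_mult_right integrable_disc_monom)+
  have "(LINT z|disc_measure. bproj z (cnj z) + Q z (cnj z)) = 0"
    "(LINT z|disc_measure. \<i> * (bproj z (cnj z) - Q z (cnj z))) = 0"
    using 1 cont by (subst integral_disc_cball; auto intro!: continuous_intros)+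
  then have "(LINT z|disc_measure. bproj z (cnj z)) = 0" "(LINT z|disc_measure. Q z (cnj z)) = 0"
    using int by auto
  then show "of_nat m * moment (m - 1) n = of_nat (Suc m) * moment m (Suc n)"
    "of_nat n * moment m (n - 1) = of_nat (Suc n) * moment (Suc m) n"
    unfolding bproj_def Q_def moment_def using integrable_disc_monom
    by (subst (asm) (1 2) Bochner_Integration.integral_diff; 
      (intro integrable_mult_right integrable_disc_monom)?; simp del: power_Suc)+
qed

text \<open>The recursion lowers both exponents together. Unequal exponents end with one of them 0
  and the other positive, where the recursion gives 0; equal ones end at the area \<open>pi\<close>,
  divided by \<open>m + 1\<close> after the factors telescope.\<close>

lemma moment_eq: "moment m n = (if m = n then of_real pi / of_nat (Suc m) else 0)"
proof (induction m arbitrary: n)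
  case 0
  show ?case
    using moment_Suc(1)[of 0 "n - 1"] by (cases n) (auto simp: moment_def scaleR_conv_of_real)
next
  case (Suc m)
  have "moment (Suc m) n = of_nat n * moment m (n - 1) / of_nat (Suc n)"
    using moment_Suc(2)[of n m] by (simp add: field_simps del: of_nat_Suc)
  then show ?case by (cases n) (auto simp: Suc.IH simp del: of_nat_Suc)
qed


lemma integral_disc_scale:
  fixes g :: "complex \<Rightarrow> complex"
  assumes g: "g \<in> borel_measurable disc_measure" and r: "0 < r" "r \<le> 1"
  shows "(LINT z|disc_measure. indicator (ball 0 r) z *\<^sub>R g z) = of_real (r\<^sup>2) * (LINT z|disc_measure. g (of_real r * z))"
proof -
  have g': "(\<lambda>z. indicator (ball 0 1) z *\<^sub>R g z) \<in> borel_measurable borel"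
    using g borel_measurable_restrict_space_iff[of "ball 0 1" lborel g] by (simp add: disc_measure_def)
  have h: "(\<lambda>z. indicator (ball 0 r) z *\<^sub>R indicator (ball 0 1) z *\<^sub>R g z) \<in> borel_measurable borel"
    by (intro borel_measurable_scaleR borel_measurable_indicator g'[unfolded]) auto
  have ind: "indicator (ball 0 r) (of_real r * z) = (indicator (ball 0 1) z :: real)" for z :: complex
    using r by (auto simp: indicator_def norm_mult)
  have "(LINT z|disc_measure. indicator (ball 0 r) z *\<^sub>R g z)
      = (LINT z|lborel. indicator (ball 0 r) z *\<^sub>R indicator (ball 0 1) z *\<^sub>R g z)"
    by (simp add: disc_measure_def integral_restrict_space mult.commute)
  also have "\<dots> = (LINT z|density (distr lborel borel (\<lambda>x. 0 + r *\<^sub>R x)) (\<lambda>_. \<bar>r\<bar> ^ DIM(complex)).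
      indicator (ball 0 r) z *\<^sub>R indicator (ball 0 1) z *\<^sub>R g z)"
    using r by (subst lborel_affine[of r 0]) auto
  also have "\<dots> = (LINT z|lborel. \<bar>r\<bar> ^ DIM(complex) *\<^sub>R 
      (indicator (ball 0 r) (of_real r * z) *\<^sub>R indicator (ball 0 1) (of_real r * z) *\<^sub>R g (of_real r * z)))"
    using h by (subst integral_density, simp, simp, simp, subst integral_distr; simp add: scaleR_conv_of_real)
  also have "\<dots> = (LINT z|lborel. of_real (r\<^sup>2) * (indicator (ball 0 1) z *\<^sub>R g (of_real r * z)))"
  proof (rule Bochner_Integration.integral_cong[OF refl])
    fix z :: complex
    have "z \<in> ball 0 1 \<Longrightarrow> of_real r * z \<in> ball 0 1"
      using r mult_le_one[of r "cmod z"] mult_left_le_one_le[of "cmod z" r] by (simp add: norm_mult)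
    then show "\<bar>r\<bar> ^ DIM(complex) *\<^sub>R (indicator (ball 0 r) (of_real r * z) *\<^sub>R indicator (ball 0 1) (of_real r * z) *\<^sub>R g (of_real r * z))
       = of_real (r\<^sup>2) * (indicator (ball 0 1) z *\<^sub>R g (of_real r * z))"
      by (cases "z \<in> ball 0 1") (simp_all only: ind, simp_all add: scaleR_conv_of_real)
  qed
  also have "\<dots> = of_real (r\<^sup>2) * (LINT z|disc_measure. g (of_real r * z))"
    by (simp only: integral_mult_right_zero disc_measure_def) (simp add: integral_restrict_space)
  finally show ?thesis .
qed

text \<open>The Taylor series of an integrable \<open>f\<close> need not converge in the mean on the
  whole disc. It is integrated over smaller concentric discs, where it converges absolutely, and the
  radius then tends to 1 by dominated convergence.\<close>

lemma integral_disc_taylor: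
  assumes f: "f holomorphic_on ball 0 1" and int: "integrable disc_measure f"
  shows "(LINT z|disc_measure. f z * cnj z ^ n) = of_real pi / of_nat (Suc n) * ((deriv ^^ n) f 0 / fact n)"
proof -
  define a where "a k = (deriv ^^ k) f 0 / fact k" for k
  have sums: "(\<lambda>k. a k * z ^ k) sums f z" if "z \<in> ball 0 1" for z
    using holomorphic_power_series[OF f that] by (simp add: a_def)
  have sm: "summable (\<lambda>k. norm (a k) * r ^ k)" if "0 \<le> r" "r < 1" for r
  proof -
    obtain s where s: "r < s" "s < 1" using \<open>r < 1\<close> dense by blast
    have "summable (\<lambda>k. a k * of_real s ^ k)"
      using sums_summable[OF sums[of "of_real s"]] s that by simp
    from powser_insidea[OF this, of "of_real r"] show ?thesis
      using that s by (simp add: norm_mult norm_power)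
  qed
  have fm: "(\<lambda>z. f z * cnj z ^ n) \<in> borel_measurable disc_measure"
    by (intro measurable_disc continuous_intros holomorphic_on_imp_continuous_on[OF f])
  have intn: "integrable disc_measure (\<lambda>z. f z * cnj z ^ n)"
  proof (rule Bochner_Integration.integrable_bound[OF int fm])
    show "AE z in disc_measure. norm (f z * cnj z ^ n) \<le> norm (f z)"
      by (auto simp: norm_mult norm_power intro!: AE_I2 mult_right_le_one_le power_le_one)
  qed
  \<comment> \<open>Only the term of degree \<open>n\<close> survives by orthogonality. It carries
    \<open>r ^ n\<close> from the Taylor series and another \<open>r ^ n\<close> from the conjugate
    monomial.\<close>
  have dil: "(LINT z|disc_measure. f (of_real r * z) * cnj (of_real r * z) ^ n) = of_real (r ^ (2 * n)) * (a n * (of_real pi / of_nat (Suc n)))"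
    if r: "0 < r" "r < 1" for r
  proof -
    let ?f = "\<lambda>k z. (a k * of_real r ^ k * of_real r ^ n) * (z ^ k * cnj z ^ n)"
    have b: "norm (?f k z) \<le> norm (a k) * r ^ k" if "z \<in> ball 0 1" for k z
    proof -
      have "norm (?f k z) = (norm (a k) * r ^ k) * (r ^ n * (norm z ^ k * norm z ^ n))"
        using r by (simp add: norm_mult norm_power)
      also have "\<dots> \<le> (norm (a k) * r ^ k) * 1"
        using that r by (intro mult_left_mono mult_le_one power_le_one) auto
      finally show ?thesis by simp
    qed
    have i: "integrable disc_measure (?f k)" for k
      by (intro integrable_mult_right integrable_disc_monom)
    have "(LINT z|disc_measure. (\<Sum>k. ?f k z)) = (\<Sum>k. LINT z|disc_measure. ?f k z)"
    proof (rule integral_suminf[OF i])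
      show "AE z in disc_measure. summable (\<lambda>k. norm (?f k z))"
        using b sm[of r] r by (intro AE_I2 summable_comparison_test'[OF sm[of r]]) auto
      show "summable (\<lambda>k. LINT z|disc_measure. norm (?f k z))"
      proof (rule summable_comparison_test'[where N=0])
        show "summable (\<lambda>k. norm (a k) * r ^ k * pi)"
          using sm[of r] r by (intro summable_mult2) auto
        show "norm (LINT z|disc_measure. norm (?f k z)) \<le> norm (a k) * r ^ k * pi" for k
        proof -
          have "(LINT z|disc_measure. norm (?f k z)) \<le> (LINT z|disc_measure. norm (a k) * r ^ k)"
            using b by (intro integral_mono integrable_norm i) auto
          then show ?thesis by (simp add: mult_ac)
        qed
      qed
    qed
    also have "\<dots> = (\<Sum>k. a k * of_real r ^ k * of_real r ^ n * moment k n)"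
      by (simp add: moment_def integrable_disc_monom)
    also have "\<dots> = (\<Sum>k\<in>{n}. a k * of_real r ^ k * of_real r ^ n * moment k n)"
      by (rule suminf_finite) (auto simp: moment_eq)
    also have "\<dots> = of_real (r ^ (2 * n)) * (a n * (of_real pi / of_nat (Suc n)))"
    proof -
      have "r ^ (2 * n) = r ^ n * r ^ n" by (simp add: mult_2 power_add)
      then show ?thesis by (simp add: moment_eq)
    qed
    also have "(LINT z|disc_measure. (\<Sum>k. ?f k z)) = (LINT z|disc_measure. f (of_real r * z) * cnj (of_real r * z) ^ n)"
    proof (rule Bochner_Integration.integral_cong[OF refl])
      fix z assume "z \<in> space disc_measure"
      then have "of_real r * z \<in> ball 0 1"
        using r mult_left_le_one_le[of "cmod z" r] by (simp add: norm_mult)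
      from sums_mult2[OF sums[OF this], of "cnj (of_real r * z) ^ n"]
      show "(\<Sum>k. ?f k z) = f (of_real r * z) * cnj (of_real r * z) ^ n"
        by (intro sums_unique[symmetric]) (simp add: power_mult_distrib mult_ac)
    qed
    finally show ?thesis .
  qed
  define r :: "nat \<Rightarrow> real" where "r k = 1 - 1 / (real k + 2)" for k
  have r: "0 < r k" "r k < 1" for k by (auto simp: r_def field_simps)
  have rlim: "r \<longlonglongrightarrow> 1" unfolding r_def by real_asymp
  have "(\<lambda>k. LINT z|disc_measure. indicator (ball 0 (r k)) z *\<^sub>R (f z * cnj z ^ n)) \<longlonglongrightarrow> (LINT z|disc_measure. f z * cnj z ^ n)"
  proof (rule integral_dominated_convergence[where w="\<lambda>z. norm (f z * cnj z ^ n)"])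
    show "(\<lambda>z. indicator (ball 0 (r k)) z *\<^sub>R (f z * cnj z ^ n)) \<in> borel_measurable disc_measure" for k
      by (intro borel_measurable_scaleR borel_measurable_indicator fm)
        (use r[of k] in \<open>auto simp: disc_measure_def sets_restrict_space_iff\<close>)
    show "AE z in disc_measure. (\<lambda>k. indicator (ball 0 (r k)) z *\<^sub>R (f z * cnj z ^ n)) \<longlonglongrightarrow> f z * cnj z ^ n"
    proof (rule AE_I2, rule tendsto_eventually)
      fix z assume "z \<in> space disc_measure"
      then have "\<forall>\<^sub>F k in sequentially. norm z < r k"
        using order_tendstoD(1)[OF rlim] by simp
      then show "\<forall>\<^sub>F k in sequentially. indicator (ball 0 (r k)) z *\<^sub>R (f z * cnj z ^ n) = f z * cnj z ^ n"
        by eventually_elim simp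
    qed
  qed (use fm intn in \<open>auto simp: indicator_def intro!: integrable_norm\<close>)
  moreover have "(LINT z|disc_measure. indicator (ball 0 (r k)) z *\<^sub>R (f z * cnj z ^ n))
      = of_real ((r k)\<^sup>2) * (of_real (r k ^ (2 * n)) * (a n * (of_real pi / of_nat (Suc n))))" for k
    using r[of k] dil[OF r[of k]] by (subst integral_disc_scale[OF fm]) auto
  moreover have "(\<lambda>k. of_real ((r k)\<^sup>2) * (of_real (r k ^ (2 * n)) * (a n * (of_real pi / of_nat (Suc n)))))
      \<longlonglongrightarrow> of_real (1\<^sup>2) * (of_real (1 ^ (2 * n)) * (a n * (of_real pi / of_nat (Suc n))))"
    by (intro tendsto_intros rlim)
  ultimately show ?thesis
    using LIMSEQ_unique by (fastforce simp: a_def mult_ac)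
qed

lemma holomorphic_disc_eq_0:
  assumes f: "f holomorphic_on ball 0 1" and int: "integrable disc_measure f"
    and 0: "\<And>n. (LINT z|disc_measure. f z * cnj z ^ n) = 0" and z: "z \<in> ball 0 1"
  shows "f z = 0"
proof -
  have "(deriv ^^ n) f 0 / fact n = 0" for n
    using integral_disc_taylor[OF f int, of n] 0[of n] by (simp del: of_nat_Suc)
  then have "(\<lambda>n. 0) sums f z"
    using holomorphic_power_series[OF f z] by simp
  then show ?thesis using sums_unique2 sums_zero by blast
qed

text \<open>A continuous function is already Borel measurable, so completing the measure changes
  neither its integrability nor its integral.\<close>

lemma integral_lebesgue_bidisk:
  fixes f :: "complex \<times> complex \<Rightarrow> 'b::{banach, second_countable_topology}"
  assumes "continuous_on bidisk f"
  shows "(LINT z|lebesgue_on bidisk. f z) = (LINT z|bidisk_measure. f z)"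
    and "integrable (lebesgue_on bidisk) f \<longleftrightarrow> integrable bidisk_measure f"
    and "f \<in> borel_measurable (lebesgue_on bidisk)"
proof -
  have m: "(\<lambda>z. indicator bidisk z *\<^sub>R f z) \<in> borel_measurable lborel"
    using borel_measurable_continuous_on_indicator[OF _ assms] open_bidisk by simp
  have b: "bidisk \<inter> space lborel \<in> sets lborel" "bidisk \<inter> space lebesgue \<in> sets lebesgue"
    using open_bidisk by auto
  show "(LINT z|lebesgue_on bidisk. f z) = (LINT z|bidisk_measure. f z)"
    unfolding bidisk_measure_eq integral_restrict_space[OF b(1)] integral_restrict_space[OF b(2)]
    by (rule integral_completion[OF m])
  show "integrable (lebesgue_on bidisk) f \<longleftrightarrow> integrable bidisk_measure f"
    unfolding bidisk_measure_eq integrable_restrict_space[OF b(1)] integrable_restrict_space[OF b(2)]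
    by (rule integrable_completion[OF m])
  show "f \<in> borel_measurable (lebesgue_on bidisk)"
    unfolding borel_measurable_restrict_space_iff[OF b(2)] by (rule measurable_completion[OF m])
qed

section \<open>Continuous square-integrable functions on the bidisk\<close>

definition l2fun :: "(complex \<times> complex \<Rightarrow> complex) \<Rightarrow> bool" where
  "l2fun F \<longleftrightarrow> continuous_on bidisk F \<and> integrable bidisk_measure (\<lambda>z. (cmod (F z))\<^sup>2)"

lemma l2funI:
  assumes "continuous_on bidisk F" "integrable bidisk_measure g" "\<And>z. z \<in> bidisk \<Longrightarrow> (cmod (F z))\<^sup>2 \<le> g z"
  shows "l2fun F"
  unfolding l2fun_def
proof
  show "integrable bidisk_measure (\<lambda>z. (cmod (F z))\<^sup>2)"
    by (rule Bochner_Integration.integrable_bound[OF assms(2)])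
      (use assms(3) in \<open>force intro!: measurable_bidisk continuous_intros assms(1) AE_I2\<close>)+
qed (rule assms)

lemma l2fun_cong: "l2fun F \<Longrightarrow> (\<And>z. z \<in> bidisk \<Longrightarrow> G z = F z) \<Longrightarrow> l2fun G"
  by (rule l2funI[where g="\<lambda>z. (cmod (F z))\<^sup>2"]) (auto simp: l2fun_def cong: continuous_on_cong)

lemma l2fun_zero: "l2fun (\<lambda>z. 0)"
  by (simp add: l2fun_def)

lemma l2fun_add:
  assumes "l2fun F" "l2fun G" shows "l2fun (\<lambda>z. F z + G z)"
proof (rule l2funI[where g="\<lambda>z. 2 * ((cmod (F z))\<^sup>2 + (cmod (G z))\<^sup>2)"])
  fix z
  have "(cmod (F z + G z))\<^sup>2 \<le> (cmod (F z) + cmod (G z))\<^sup>2"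
    by (intro power_mono norm_triangle_ineq) auto
  also have "\<dots> \<le> 2 * ((cmod (F z))\<^sup>2 + (cmod (G z))\<^sup>2)"
    using sum_squares_bound[of "cmod (F z)" "cmod (G z)"] by (simp add: power2_sum)
  finally show "(cmod (F z + G z))\<^sup>2 \<le> 2 * ((cmod (F z))\<^sup>2 + (cmod (G z))\<^sup>2)" .
qed (use assms in \<open>auto simp: l2fun_def intro: continuous_intros\<close>)

lemma l2fun_mult:
  assumes "l2fun F" "continuous_on bidisk \<phi>" "\<And>z. z \<in> bidisk \<Longrightarrow> cmod (\<phi> z) \<le> B"
  shows "l2fun (\<lambda>z. \<phi> z * F z)"
proof (rule l2funI[where g="\<lambda>z. B\<^sup>2 * (cmod (F z))\<^sup>2"])
  fix z assume "z \<in> bidisk"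
  then show "(cmod (\<phi> z * F z))\<^sup>2 \<le> B\<^sup>2 * (cmod (F z))\<^sup>2"
    using assms(3) by (simp add: norm_mult power_mult_distrib mult_right_mono power_mono)
qed (use assms in \<open>auto simp: l2fun_def intro: continuous_intros\<close>)

lemma l2fun_cmult: "l2fun F \<Longrightarrow> l2fun (\<lambda>z. c * F z)"
  using l2fun_mult[of F "\<lambda>_. c" "cmod c"] by (simp add: continuous_on_const)

lemma l2fun_bounded:
  assumes "continuous_on bidisk F" "\<And>z. z \<in> bidisk \<Longrightarrow> cmod (F z) \<le> B"
  shows "l2fun F"
proof (rule l2funI[where g="\<lambda>_. B\<^sup>2"])
  fix z assume "z \<in> bidisk"
  then show "(cmod (F z))\<^sup>2 \<le> B\<^sup>2" using assms(2)[of z] by (intro power_mono) auto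
qed (use assms in auto)

lemma l2fun_integrable:
  assumes "l2fun F" "l2fun G"
  shows "integrable bidisk_measure (\<lambda>z. F z * cnj (G z))"
proof (rule Bochner_Integration.integrable_bound)
  show "integrable bidisk_measure (\<lambda>z. (cmod (F z))\<^sup>2 + (cmod (G z))\<^sup>2)"
    using assms by (auto simp: l2fun_def)
  show "(\<lambda>z. F z * cnj (G z)) \<in> borel_measurable bidisk_measure"
    using assms by (intro measurable_bidisk continuous_intros) (auto simp: l2fun_def)
  have "cmod a * cmod b \<le> (cmod a)\<^sup>2 + (cmod b)\<^sup>2" for a b
    using sum_squares_bound[of "cmod a" "cmod b"] mult_nonneg_nonneg[OF norm_ge_zero norm_ge_zero, of a b] by linarith
  then show "AE z in bidisk_measure. norm (F z * cnj (G z)) \<le> norm ((cmod (F z))\<^sup>2 + (cmod (G z))\<^sup>2)"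
    by (auto simp: norm_mult)
qed

text \<open>Only products of bounded continuous symbols with elements of the Bergman space and their projections
  occur, so continuous representatives suffice; they are determined by their classes modulo null sets.\<close>

typedef l2c = "{F. l2fun F \<and> (\<forall>z. z \<notin> bidisk \<longrightarrow> F z = 0)}" morphisms ev Abs_l2c
  by (rule exI[of _ "\<lambda>_. 0"]) (simp add: l2fun_zero)

setup_lifting type_definition_l2c

lemma l2fun_ev: "l2fun (ev F)"
  using ev[of F] by simp

lemma ev_outside: "z \<notin> bidisk \<Longrightarrow> ev F z = 0"
  using ev[of F] by blast

lemma continuous_ev: "continuous_on bidisk (ev F)"
  using l2fun_ev l2fun_def by blast

lemma l2c_eqI: "(\<And>z. z \<in> bidisk \<Longrightarrow> ev F z = ev G z) \<Longrightarrow> F = G"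
proof -
  assume "\<And>z. z \<in> bidisk \<Longrightarrow> ev F z = ev G z"
  then have "ev F z = ev G z" for z by (cases "z \<in> bidisk") (simp_all add: ev_outside)
  then show "F = G" by (simp add: ev_inject[symmetric] ext)
qed

lift_definition to_l2 :: "(complex \<times> complex \<Rightarrow> complex) \<Rightarrow> l2c" is
  "\<lambda>F z. if l2fun F \<and> z \<in> bidisk then F z else 0"
proof
  fix F :: "complex \<times> complex \<Rightarrow> complex"
  show "l2fun (\<lambda>z. if l2fun F \<and> z \<in> bidisk then F z else 0)"
    by (cases "l2fun F") (auto simp: l2fun_zero intro: l2fun_cong)
qed simp

lemma ev_to_l2: "l2fun F \<Longrightarrow> z \<in> bidisk \<Longrightarrow> ev (to_l2 F) z = F z"
  by transfer simp

lift_definition cinner :: "l2c \<Rightarrow> l2c \<Rightarrow> complex" is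
  "\<lambda>F G. LINT z|bidisk_measure. F z * cnj (G z)" .

text \<open>The set where \<open>f\<close> does not vanish is open, and a nonempty open set is not
  null. This makes the norm on continuous representatives definite.\<close>

lemma continuous_zero_AE:
  fixes f :: "complex \<times> complex \<Rightarrow> real"
  assumes f: "continuous_on bidisk f" and AE: "AE z in bidisk_measure. f z = 0" and z: "z \<in> bidisk"
  shows "f z = 0"
proof (rule ccontr)
  assume nz: "f z \<noteq> 0"
  define U where "U = {z \<in> bidisk. f z \<noteq> 0}"
  have "open (bidisk \<inter> f -` (- {0}))"
    by (rule continuous_open_preimage[OF f open_bidisk]) auto
  then have "open U" by (simp add: U_def vimage_def Int_def)
  have "AE z in lborel. z \<in> bidisk \<longrightarrow> f z = 0"
    using AE unfolding bidisk_measure_eq by (subst (asm) AE_restrict_space_iff) (auto simp: open_bidisk)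
  then have "AE z in lborel. z \<notin> U"
    by eventually_elim (auto simp: U_def)
  then have "U \<in> null_sets lborel"
    using \<open>open U\<close> AE_iff_null_sets[of U lborel] by simp
  then have "negligible U"
    using \<open>open U\<close> by (simp add: negligible_iff_null_sets null_sets_completion_iff)
  then show False
    using open_not_negligible[OF \<open>open U\<close>] nz z unfolding U_def by blast
qed

instantiation l2c :: real_inner
begin

lift_definition zero_l2c :: l2c is "\<lambda>_. 0" by (simp add: l2fun_zero)
lift_definition plus_l2c :: "l2c \<Rightarrow> l2c \<Rightarrow> l2c" is "\<lambda>F G z. F z + G z" by (simp add: l2fun_add)
lift_definition uminus_l2c :: "l2c \<Rightarrow> l2c" is "\<lambda>F z. - F z"
  using l2fun_cmult[of _ "-1"] by simp
lift_definition minus_l2c :: "l2c \<Rightarrow> l2c \<Rightarrow> l2c" is "\<lambda>F G z. F z - G z"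
proof -
  fix F G :: "complex \<times> complex \<Rightarrow> complex"
  assume "l2fun F \<and> (\<forall>z. z \<notin> bidisk \<longrightarrow> F z = 0)" "l2fun G \<and> (\<forall>z. z \<notin> bidisk \<longrightarrow> G z = 0)"
  then show "l2fun (\<lambda>z. F z - G z) \<and> (\<forall>z. z \<notin> bidisk \<longrightarrow> F z - G z = 0)"
    using l2fun_add[of F "\<lambda>z. (-1) * G z"] l2fun_cmult[of G "-1"] by simp
qed
lift_definition scaleR_l2c :: "real \<Rightarrow> l2c \<Rightarrow> l2c" is "\<lambda>r F z. of_real r * F z"
  by (simp add: l2fun_cmult)
definition inner_l2c :: "l2c \<Rightarrow> l2c \<Rightarrow> real" where "inner_l2c F G = Re (cinner F G)"
definition norm_l2c :: "l2c \<Rightarrow> real" where "norm_l2c F = sqrt (inner F F)"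
definition sgn_l2c :: "l2c \<Rightarrow> l2c" where "sgn_l2c F = scaleR (inverse (norm F)) F"
definition dist_l2c :: "l2c \<Rightarrow> l2c \<Rightarrow> real" where "dist_l2c F G = norm (F - G)"
definition uniformity_l2c :: "(l2c \<times> l2c) filter" where
  "uniformity_l2c = (INF e\<in>{0<..}. principal {(x, y). dist x y < e})"
definition open_l2c :: "l2c set \<Rightarrow> bool" where
  "open_l2c U \<longleftrightarrow> (\<forall>x\<in>U. eventually (\<lambda>(x', y). x' = x \<longrightarrow> y \<in> U) uniformity)"

instance
proof
  fix F G H :: l2c and r s :: real
  show "F + G + H = F + (G + H)" "F + G = G + F" "0 + F = F" "- F + F = 0" "F - G = F + - G"
    by (transfer; simp add: fun_eq_iff)+
  show "r *\<^sub>R (F + G) = r *\<^sub>R F + r *\<^sub>R G" "(r + s) *\<^sub>R F = r *\<^sub>R F + s *\<^sub>R F"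
    "r *\<^sub>R s *\<^sub>R F = (r * s) *\<^sub>R F" "1 *\<^sub>R F = F"
    by (transfer; simp add: fun_eq_iff algebra_simps)+
  show "dist F G = norm (F - G)" by (rule dist_l2c_def)
  show "sgn F = scaleR (inverse (norm F)) F" by (rule sgn_l2c_def)
  show "uniformity = (INF e\<in>{0<..}. principal {(x::l2c, y). dist x y < e})" by (rule uniformity_l2c_def)
  show "open U \<longleftrightarrow> (\<forall>x\<in>U. eventually (\<lambda>(x', y). x' = x \<longrightarrow> y \<in> U) uniformity)" for U :: "l2c set"
    by (rule open_l2c_def)
  have re: "Re (LINT z|bidisk_measure. F z * cnj (G z)) = (LINT z|bidisk_measure. Re (F z * cnj (G z)))"
    if "l2fun F" "l2fun G" for F G
    using integral_Re[OF l2fun_integrable[OF that]] by simp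
  have int: "integrable bidisk_measure (\<lambda>z. Re (F z * cnj (G z)))" if "l2fun F" "l2fun G" for F G
    by (rule integrable_Re[OF l2fun_integrable[OF that]])
  show "inner F G = inner G F"
    unfolding inner_l2c_def
  proof (transfer, clarify)
    fix F G :: "complex \<times> complex \<Rightarrow> complex" assume "l2fun F" "l2fun G"
    then show "Re (LINT z|bidisk_measure. F z * cnj (G z)) = Re (LINT z|bidisk_measure. G z * cnj (F z))"
      unfolding re[OF \<open>l2fun F\<close> \<open>l2fun G\<close>] re[OF \<open>l2fun G\<close> \<open>l2fun F\<close>]
      by (intro Bochner_Integration.integral_cong) auto
  qed
  show "inner (F + G) H = inner F H + inner G H"
    unfolding inner_l2c_def
  proof (transfer, clarify)
    fix F G H :: "complex \<times> complex \<Rightarrow> complex" assume "l2fun F" "l2fun G" "l2fun H"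
    then show "Re (LINT z|bidisk_measure. (F z + G z) * cnj (H z))
        = Re (LINT z|bidisk_measure. F z * cnj (H z)) + Re (LINT z|bidisk_measure. G z * cnj (H z))"
      by (simp add: distrib_right l2fun_integrable)
  qed
  show "inner (r *\<^sub>R F) G = r * inner F G"
    unfolding inner_l2c_def by transfer (simp add: mult.assoc)
  have sq: "Re (LINT z|bidisk_measure. F z * cnj (F z)) = (LINT z|bidisk_measure. (cmod (F z))\<^sup>2)" if "l2fun F" for F
    unfolding re[OF that that]
  proof (rule Bochner_Integration.integral_cong[OF refl])
    show "Re (F z * cnj (F z)) = (cmod (F z))\<^sup>2" for z
      by (metis Re_complex_of_real complex_norm_square)
  qed
  show "0 \<le> inner F F"
    unfolding inner_l2c_def
  proof (transfer, clarify)
    fix F :: "complex \<times> complex \<Rightarrow> complex" assume "l2fun F"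
    then show "0 \<le> Re (LINT z|bidisk_measure. F z * cnj (F z))"
      unfolding sq[OF \<open>l2fun F\<close>] by simp
  qed
  show "inner F F = 0 \<longleftrightarrow> F = 0"
    unfolding inner_l2c_def
  proof (transfer, clarify)
    fix F :: "complex \<times> complex \<Rightarrow> complex" assume F: "l2fun F" and out: "\<forall>z. z \<notin> bidisk \<longrightarrow> F z = 0"
    have "F z = 0" if "(LINT z|bidisk_measure. (cmod (F z))\<^sup>2) = 0" for z
    proof (cases "z \<in> bidisk")
      case True
      have "AE z in bidisk_measure. (cmod (F z))\<^sup>2 = 0"
        using integral_nonneg_eq_0_iff_AE[of bidisk_measure "\<lambda>z. (cmod (F z))\<^sup>2"] F that
        by (simp add: l2fun_def)
      moreover have "continuous_on bidisk (\<lambda>z. (cmod (F z))\<^sup>2)"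
        using F unfolding l2fun_def by (intro continuous_intros) auto
      ultimately have "(cmod (F z))\<^sup>2 = 0"
        using continuous_zero_AE True by blast
      then show ?thesis by simp
    qed (use out in blast)
    then have "F = (\<lambda>_. 0)" if "(LINT z|bidisk_measure. (cmod (F z))\<^sup>2) = 0"
      using that by blast
    moreover have "(LINT z|bidisk_measure. (cmod (F z))\<^sup>2) = 0" if "F = (\<lambda>_. 0)"
      unfolding that by simp
    ultimately show "Re (LINT z|bidisk_measure. F z * cnj (F z)) = 0 \<longleftrightarrow> F = (\<lambda>_. 0)"
      unfolding sq[OF F] by blast
  qed
  show "norm F = sqrt (inner F F)" by (rule norm_l2c_def)
qed

end

lemma ev_simps [simp]: "ev 0 z = 0" "ev (F + G) z = ev F z + ev G z" "ev (F - G) z = ev F z - ev G z"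
    "ev (- F) z = - ev F z" "ev (r *\<^sub>R F) z = of_real r * ev F z"
  by (transfer; simp)+

lemma ev_sum: "ev (sum F A) z = (\<Sum>i\<in>A. ev (F i) z)"
  by (induction A rule: infinite_finite_induct) auto

lift_definition cscale :: "complex \<Rightarrow> l2c \<Rightarrow> l2c" (infixr "*\<^sub>C" 75) is "\<lambda>c F z. c * F z"
  by (simp add: l2fun_cmult)

lemma ev_cscale [simp]: "ev (c *\<^sub>C F) z = c * ev F z"
  by transfer simp

lemma cinner_int: "integrable bidisk_measure (\<lambda>z. ev F z * cnj (ev G z))"
  by (rule l2fun_integrable[OF l2fun_ev l2fun_ev])

lemma cinner_eq: "cinner F G = (LINT z|bidisk_measure. ev F z * cnj (ev G z))"
  by transfer simp

lemma cinner_add_left: "cinner (F + G) H = cinner F H + cinner G H"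
  and cinner_diff_left: "cinner (F - G) H = cinner F H - cinner G H"
  and cinner_add_right: "cinner H (F + G) = cinner H F + cinner H G"
  and cinner_diff_right: "cinner H (F - G) = cinner H F - cinner H G"
  by (simp_all add: cinner_eq cinner_int ring_distribs)

lemma cinner_cscale_left [simp]: "cinner (c *\<^sub>C F) G = c * cinner F G"
  by (simp add: cinner_eq mult.assoc)

lemma cinner_cnj: "cnj (cinner F G) = cinner G F"
proof -
  have "cnj (cinner F G) = (LINT z|bidisk_measure. cnj (ev F z * cnj (ev G z)))"
    unfolding cinner_eq by (simp only: Bochner_Integration.integral_cnj)
  also have "\<dots> = cinner G F"
    unfolding cinner_eq by (rule Bochner_Integration.integral_cong) (auto simp: mult.commute)
  finally show ?thesis .
qed

lemma cinner_cscale_right [simp]: "cinner F (c *\<^sub>C G) = cnj c * cinner F G"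
  by (metis cinner_cnj cinner_cscale_left complex_cnj_mult)

lemma cinner_zero [simp]: "cinner 0 F = 0" "cinner F 0 = 0"
  by (simp_all add: cinner_eq)

lemma cinner_sum_left: "cinner (sum F A) G = (\<Sum>i\<in>A. cinner (F i) G)"
  by (induction A rule: infinite_finite_induct) (auto simp: cinner_add_left)

lemma cinner_sum_right: "cinner G (sum F A) = (\<Sum>i\<in>A. cinner G (F i))"
  by (induction A rule: infinite_finite_induct) (auto simp: cinner_add_right)

lemma cinner_self: "cinner F F = of_real ((norm F)\<^sup>2)"
proof -
  have "Im (cinner F F) = 0"
    using cinner_cnj[of F F] by (simp add: complex_eq_iff)
  moreover have "Re (cinner F F) = (norm F)\<^sup>2"
    by (metis inner_l2c_def power2_norm_eq_inner)
  ultimately show ?thesis by (simp add: complex_eq_iff)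
qed

lemma norm_sq: "(norm F)\<^sup>2 = (LINT z|bidisk_measure. (cmod (ev F z))\<^sup>2)"
proof -
  have "of_real ((norm F)\<^sup>2) = (LINT z|bidisk_measure. complex_of_real ((cmod (ev F z))\<^sup>2))"
    unfolding cinner_self[symmetric] cinner_eq by (simp add: complex_norm_square del: of_real_power)
  then show ?thesis by (simp del: of_real_power)
qed

lemma norm_cscale [simp]: "norm (c *\<^sub>C F) = cmod c * norm F"
proof -
  have "(norm (c *\<^sub>C F))\<^sup>2 = (cmod c * norm F)\<^sup>2"
    by (simp add: norm_sq norm_mult power_mult_distrib)
  then show ?thesis by (simp add: power2_eq_iff_nonneg)
qed

text \<open>Multiplying \<open>F\<close> by a unimodular constant makes the pairing real and
  nonnegative, and then the real Cauchy-Schwarz inequality applies.\<close>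

lemma cmod_cinner_le: "cmod (cinner F G) \<le> norm F * norm G"
proof (cases "cinner F G = 0")
  case False
  define c where "c = cnj (cinner F G) / cmod (cinner F G)"
  have "c * cinner F G = (of_real (cmod (cinner F G)))\<^sup>2 / of_real (cmod (cinner F G))"
    using complex_norm_square[of "cinner F G"] by (simp add: c_def mult.commute)
  also have "\<dots> = of_real (cmod (cinner F G))"
    using False by (simp add: power2_eq_square)
  finally have "c * cinner F G = of_real (cmod (cinner F G))" .
  then have "cmod (cinner F G) = inner (c *\<^sub>C F) G"
    by (simp add: inner_l2c_def)
  also have "\<dots> \<le> norm (c *\<^sub>C F) * norm G" by (rule norm_cauchy_schwarz)
  also have "norm (c *\<^sub>C F) = norm F" using False by (simp add: c_def norm_divide)
  finally show ?thesis .
qed simp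

lemma cscale_simps: "c *\<^sub>C (F + G) = c *\<^sub>C F + c *\<^sub>C G" "c *\<^sub>C (F - G) = c *\<^sub>C F - c *\<^sub>C G"
  "(a + b) *\<^sub>C F = a *\<^sub>C F + b *\<^sub>C F" "a *\<^sub>C b *\<^sub>C F = (a * b) *\<^sub>C F" "(a - b) *\<^sub>C F = a *\<^sub>C F - b *\<^sub>C F"
  "0 *\<^sub>C F = 0" "c *\<^sub>C 0 = 0" "1 *\<^sub>C F = F"
  by (auto intro!: l2c_eqI simp: algebra_simps)

lemma tendsto_cinner:
  assumes "F \<longlonglongrightarrow> L" shows "(\<lambda>n. cinner (F n) G) \<longlonglongrightarrow> cinner L G"
proof -
  have "(\<lambda>n. norm (F n - L) * norm G) \<longlonglongrightarrow> 0"
    by (rule tendsto_mult_left_zero[OF tendsto_norm_zero[OF LIM_zero[OF assms]]])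
  then have "(\<lambda>n. cinner (F n) G - cinner L G) \<longlonglongrightarrow> 0"
    unfolding cinner_diff_left[symmetric] by (rule Lim_null_comparison[rotated]) (simp add: cmod_cinner_le)
  then show ?thesis by (rule LIM_zero_cancel)
qed

text \<open>Pythagoras.\<close>

lemma norm_diff_sq: "(norm (F + G))\<^sup>2 = (norm F)\<^sup>2 + (norm G)\<^sup>2" if "cinner F G = 0"
proof -
  have "inner F G = 0" using that by (simp add: inner_l2c_def)
  moreover then have "inner G F = 0" by (metis inner_commute)
  ultimately show ?thesis by (simp add: power2_norm_eq_inner inner_simps)
qed

section \<open>Multiplication by bounded continuous symbols\<close>

definition symb :: "(complex \<times> complex \<Rightarrow> complex) \<Rightarrow> bool" where
  "symb \<phi> \<longleftrightarrow> continuous_on bidisk \<phi> \<and> bounded (\<phi> ` bidisk)"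

lemma symbI: "continuous_on bidisk \<phi> \<Longrightarrow> (\<And>z. z \<in> bidisk \<Longrightarrow> cmod (\<phi> z) \<le> B) \<Longrightarrow> symb \<phi>"
  unfolding symb_def bounded_iff by blast

lemma symb_bound: "symb \<phi> \<Longrightarrow> \<exists>B\<ge>0. \<forall>z\<in>bidisk. cmod (\<phi> z) \<le> B"
proof -
  assume "symb \<phi>"
  then obtain B where "\<forall>z\<in>bidisk. cmod (\<phi> z) \<le> B" by (auto simp: symb_def bounded_iff)
  then have "\<forall>z\<in>bidisk. cmod (\<phi> z) \<le> \<bar>B\<bar>" by (meson abs_ge_self order_trans)
  then show ?thesis by (intro exI[of _ "\<bar>B\<bar>"]) simp
qed

lemma symb_l2fun: "symb \<phi> \<Longrightarrow> l2fun (\<lambda>z. \<phi> z * ev F z)"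
  using symb_bound[of \<phi>] l2fun_mult[OF l2fun_ev, of \<phi>] unfolding symb_def by blast

lemma symb_const: "symb (\<lambda>_. c)"
  by (rule symbI[where B="cmod c"]) auto

lemma symb_cnj: "symb \<phi> \<Longrightarrow> symb (\<lambda>z. cnj (\<phi> z))"
proof -
  assume \<phi>: "symb \<phi>"
  then obtain B where "\<forall>z\<in>bidisk. cmod (\<phi> z) \<le> B" using symb_bound by blast
  then show ?thesis using \<phi> by (intro symbI[where B=B]) (auto simp: symb_def intro!: continuous_intros)
qed

lemma symb_add: "symb (\<lambda>z. \<phi> z + \<psi> z)" and symb_diff: "symb (\<lambda>z. \<phi> z - \<psi> z)"
  and symb_mult: "symb (\<lambda>z. \<phi> z * \<psi> z)"
  if \<phi>: "symb \<phi>" and \<psi>: "symb \<psi>"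
proof -
  obtain A where A: "0 \<le> A" "\<And>z. z \<in> bidisk \<Longrightarrow> cmod (\<phi> z) \<le> A" using symb_bound[OF \<phi>] by blast
  obtain B where B: "0 \<le> B" "\<And>z. z \<in> bidisk \<Longrightarrow> cmod (\<psi> z) \<le> B" using symb_bound[OF \<psi>] by blast
  have c: "continuous_on bidisk \<phi>" "continuous_on bidisk \<psi>" using \<phi> \<psi> by (simp_all add: symb_def)
  show "symb (\<lambda>z. \<phi> z + \<psi> z)"
    by (rule symbI[where B="A + B"]) (intro continuous_intros c norm_triangle_mono A B)+
  show "symb (\<lambda>z. \<phi> z - \<psi> z)"
    by (rule symbI[where B="A + B"])
      (intro continuous_intros c order_trans[OF norm_triangle_ineq4] add_mono A B | assumption)+
  show "symb (\<lambda>z. \<phi> z * \<psi> z)"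
    by (rule symbI[where B="A * B"]) (auto simp: norm_mult intro!: continuous_intros c mult_mono A B)
qed

lemmas symb_simps = symb_add symb_mult symb_cnj symb_const symb_diff

definition Mul :: "(complex \<times> complex \<Rightarrow> complex) \<Rightarrow> l2c \<Rightarrow> l2c" where
  "Mul \<phi> F = to_l2 (\<lambda>z. \<phi> z * ev F z)"

lemma ev_Mul: "symb \<phi> \<Longrightarrow> ev (Mul \<phi> F) z = \<phi> z * ev F z"
  by (cases "z \<in> bidisk") (auto simp: Mul_def ev_to_l2 symb_l2fun ev_outside)

lemma norm_Mul_le:
  assumes "symb \<phi>" "\<And>z. z \<in> bidisk \<Longrightarrow> cmod (\<phi> z) \<le> B" "0 \<le> B"
  shows "norm (Mul \<phi> F) \<le> B * norm F"
proof -
  have i: "integrable bidisk_measure (\<lambda>z. (cmod (ev F z))\<^sup>2)" for F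
    using l2fun_ev by (simp add: l2fun_def)
  have "(norm (Mul \<phi> F))\<^sup>2 \<le> (LINT z|bidisk_measure. B\<^sup>2 * (cmod (ev F z))\<^sup>2)"
    unfolding norm_sq
  proof (intro integral_mono i integrable_mult_right)
    fix z assume "z \<in> space bidisk_measure"
    then show "(cmod (ev (Mul \<phi> F) z))\<^sup>2 \<le> B\<^sup>2 * (cmod (ev F z))\<^sup>2"
      using assms(2)[of z] by (simp add: ev_Mul assms(1) norm_mult power_mult_distrib mult_right_mono power_mono)
  qed
  also have "\<dots> = (B * norm F)\<^sup>2" by (simp add: norm_sq power_mult_distrib)
  finally show ?thesis using assms(3) by (simp add: power2_le_iff_abs_le)
qed

lemma Mul_simps:
  assumes "symb \<phi>"
  shows "Mul \<phi> (F + G) = Mul \<phi> F + Mul \<phi> G" "Mul \<phi> (F - G) = Mul \<phi> F - Mul \<phi> G"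
    "Mul \<phi> (c *\<^sub>C F) = c *\<^sub>C Mul \<phi> F" "Mul \<phi> 0 = 0"
  using assms by (auto intro!: l2c_eqI simp: ev_Mul algebra_simps)

lemma cinner_Mul: "symb \<phi> \<Longrightarrow> cinner (Mul \<phi> F) G = cinner F (Mul (\<lambda>z. cnj (\<phi> z)) G)"
  by (simp add: cinner_eq ev_Mul symb_simps mult_ac)

lemma cinner_Fubini: "cinner F G = (LINT z|disc_measure. LINT w|disc_measure. ev F (z, w) * cnj (ev G (z, w)))"
    "integrable disc_measure (\<lambda>z. LINT w|disc_measure. ev F (z, w) * cnj (ev G (z, w)))"
    "AE z in disc_measure. integrable disc_measure (\<lambda>w. ev F (z, w) * cnj (ev G (z, w)))"
proof -
  note int = cinner_int[of F G, unfolded bidisk_measure_def]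
  show "cinner F G = (LINT z|disc_measure. LINT w|disc_measure. ev F (z, w) * cnj (ev G (z, w)))"
    unfolding cinner_eq bidisk_measure_def by (rule disc_pair.integral_fst'[OF int, symmetric])
  show "integrable disc_measure (\<lambda>z. LINT w|disc_measure. ev F (z, w) * cnj (ev G (z, w)))"
    by (rule disc_pair.integrable_fst'[OF int])
  show "AE z in disc_measure. integrable disc_measure (\<lambda>w. ev F (z, w) * cnj (ev G (z, w)))"
    by (rule disc_pair.AE_integrable_fst'[OF int])
qed

section \<open>Taylor coefficients and the Bergman space\<close>

definition zmono :: "nat \<times> nat \<Rightarrow> l2c" where
  "zmono p = to_l2 (\<lambda>z. fst z ^ fst p * snd z ^ snd p)"

text \<open>The squared norm of \<open>zmono p\<close>: one diagonal moment for each
  variable.\<close>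

definition sqnorm :: "nat \<times> nat \<Rightarrow> real" where
  "sqnorm p = (pi / real (Suc (fst p))) * (pi / real (Suc (snd p)))"

lemma sqnorm_pos: "0 < sqnorm p"
  by (simp add: sqnorm_def)

lemma monom_le_1: "z \<in> bidisk \<Longrightarrow> cmod (fst z ^ m * snd z ^ n) \<le> 1"
  by (auto simp: bidisk_def norm_mult norm_power intro!: mult_le_one power_le_one)

lemma monom_le_1': "(a, b) \<in> bidisk \<Longrightarrow> cmod (a ^ m * b ^ n) \<le> 1"
  using monom_le_1[of "(a, b)"] by simp

lemma ev_zmono: "z \<in> bidisk \<Longrightarrow> ev (zmono p) z = fst z ^ fst p * snd z ^ snd p"
  unfolding zmono_def
  by (subst ev_to_l2) (auto intro!: l2fun_bounded[where B=1] continuous_intros simp: monom_le_1')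

text \<open>The standard way of computing pairings below. Integrals of non-integrable functions have
  the value 0, so constant factors can be pulled out in any case.\<close>

lemma Fubini_product:
  assumes "\<And>z w. z \<in> ball 0 1 \<Longrightarrow> w \<in> ball 0 1 \<Longrightarrow> ev F (z, w) * cnj (ev G (z, w)) = f z * g w"
  shows "cinner F G = (LINT z|disc_measure. f z) * (LINT w|disc_measure. g w)"
proof -
  have "cinner F G = (LINT z|disc_measure. LINT w|disc_measure. f z * g w)"
    unfolding cinner_Fubini(1) by (intro Bochner_Integration.integral_cong refl) (use assms in auto)
  then show ?thesis by simp
qed

lemma cinner_zmono: "cinner (zmono p) (zmono q) = (if p = q then of_real (sqnorm p) else 0)"
proof -
  have "cinner (zmono p) (zmono q) = moment (fst p) (fst q) * moment (snd p) (snd q)"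
    unfolding moment_def
    by (rule Fubini_product) (simp add: ev_zmono bidisk_def)
  then show ?thesis
    by (cases p; cases q) (auto simp: moment_eq sqnorm_def)
qed

definition lincomb :: "(nat \<times> nat \<Rightarrow> complex) \<Rightarrow> (nat \<times> nat) set \<Rightarrow> l2c" where
  "lincomb c S = (\<Sum>p\<in>S. c p *\<^sub>C zmono p)"

text \<open>For holomorphic \<open>F\<close> these are the Taylor coefficients at the origin. For
  any other \<open>F\<close> they are the Taylor coefficients of its projection to the Bergman
  space, which is how that projection is going to be defined.\<close>

definition coef :: "l2c \<Rightarrow> nat \<times> nat \<Rightarrow> complex" where
  "coef F p = cinner F (zmono p) / of_real (sqnorm p)"

lemma cinner_zmono_coef: "cinner F (zmono p) = coef F p * of_real (sqnorm p)"
  using sqnorm_pos[of p] by (simp add: coef_def)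

lemma coef_simps: "coef (F + G) p = coef F p + coef G p" "coef (F - G) p = coef F p - coef G p"
  "coef (c *\<^sub>C F) p = c * coef F p" "coef 0 p = 0"
  by (simp_all add: coef_def cinner_add_left cinner_diff_left add_divide_distrib diff_divide_distrib)

lemma coef_zmono: "coef (zmono p) q = (if p = q then 1 else 0)"
  using sqnorm_pos[of q] by (auto simp: coef_def cinner_zmono)

lemma cinner_lincomb_left: "finite S \<Longrightarrow> cinner (lincomb c S) (zmono q) = (if q \<in> S then c q * of_real (sqnorm q) else 0)"
  by (simp add: lincomb_def cinner_sum_left cinner_zmono if_distrib sum.delta cong: if_cong)

lemma coef_lincomb: "finite S \<Longrightarrow> coef (lincomb c S) q = (if q \<in> S then c q else 0)"
  using sqnorm_pos[of q] by (simp add: coef_def cinner_lincomb_left)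

lemma cinner_lincomb_right: "cinner F (lincomb c S) = (\<Sum>p\<in>S. cnj (c p) * coef F p * of_real (sqnorm p))"
  by (simp add: lincomb_def cinner_sum_right cinner_zmono_coef mult.assoc)

lemma norm_lincomb: "finite S \<Longrightarrow> (norm (lincomb c S))\<^sup>2 = (\<Sum>p\<in>S. (cmod (c p))\<^sup>2 * sqnorm p)"
proof -
  assume S: "finite S"
  have "of_real ((norm (lincomb c S))\<^sup>2) = (\<Sum>p\<in>S. cnj (c p) * c p * of_real (sqnorm p))"
    unfolding cinner_self[symmetric] cinner_lincomb_right by (rule sum.cong) (simp_all add: coef_lincomb S)
  also have "\<dots> = of_real (\<Sum>p\<in>S. (cmod (c p))\<^sup>2 * sqnorm p)"
    unfolding of_real_sum of_real_mult complex_norm_square by (simp add: mult_ac)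
  finally show ?thesis by (simp only: of_real_eq_iff)
qed

text \<open>\<open>lincomb (coef F) S\<close> is the orthogonal projection of \<open>F\<close> to
  the span of the monomials in \<open>S\<close>.\<close>

lemma bessel:
  assumes S: "finite S"
  shows "(\<Sum>p\<in>S. (cmod (coef F p))\<^sup>2 * sqnorm p) \<le> (norm F)\<^sup>2"
proof -
  let ?L = "lincomb (coef F) S"
  have "cinner (F - ?L) ?L = 0"
    unfolding cinner_lincomb_right by (rule sum.neutral) (simp add: coef_simps coef_lincomb S)
  from norm_diff_sq[OF this] have "(norm F)\<^sup>2 = (norm (F - ?L))\<^sup>2 + (norm ?L)\<^sup>2" by simp
  then show ?thesis using norm_lincomb[OF S, of "coef F"] by simp
qed

section \<open>The Bergman space and its monomial expansion\<close>

definition A2 :: "l2c set" where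
  "A2 = {F. holomorphic2_on (ev F) bidisk}"

lemma holomorphic2_on_cong: "(\<And>z. z \<in> S \<Longrightarrow> f z = g z) \<Longrightarrow> holomorphic2_on f S \<Longrightarrow> holomorphic2_on g S"
  unfolding holomorphic2_on_def by (metis has_derivative_transform)

lemma holomorphic2_on_const: "holomorphic2_on (\<lambda>_. c) S"
  unfolding holomorphic2_on_def
proof
  fix z show "\<exists>a b. ((\<lambda>_. c) has_derivative (\<lambda>(h, k). a * h + b * k)) (at z within S)"
    by (intro exI[of _ 0]) (auto intro!: derivative_eq_intros)
qed

lemma holomorphic2_on_mult:
  assumes "holomorphic2_on f S" "holomorphic2_on g S" shows "holomorphic2_on (\<lambda>z. f z * g z) S"
  unfolding holomorphic2_on_def
proof
  fix z assume z: "z \<in> S"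
  obtain a b where 1: "(f has_derivative (\<lambda>(h, k). a * h + b * k)) (at z within S)"
    using assms(1) z unfolding holomorphic2_on_def by blast
  obtain a' b' where 2: "(g has_derivative (\<lambda>(h, k). a' * h + b' * k)) (at z within S)"
    using assms(2) z unfolding holomorphic2_on_def by blast
  have "((\<lambda>z. f z * g z) has_derivative (\<lambda>(h, k). (f z * a' + a * g z) * h + (f z * b' + b * g z) * k)) (at z within S)"
    by (rule has_derivative_eq_rhs[OF has_derivative_mult[OF 1 2]]) (auto simp: fun_eq_iff algebra_simps)
  then show "\<exists>a b. ((\<lambda>z. f z * g z) has_derivative (\<lambda>(h, k). a * h + b * k)) (at z within S)" by blast
qed

lemma holomorphic2_on_add:
  assumes "holomorphic2_on f S" "holomorphic2_on g S" shows "holomorphic2_on (\<lambda>z. f z + g z) S"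
  unfolding holomorphic2_on_def
proof
  fix z assume z: "z \<in> S"
  obtain a b where 1: "(f has_derivative (\<lambda>(h, k). a * h + b * k)) (at z within S)"
    using assms(1) z unfolding holomorphic2_on_def by blast
  obtain a' b' where 2: "(g has_derivative (\<lambda>(h, k). a' * h + b' * k)) (at z within S)"
    using assms(2) z unfolding holomorphic2_on_def by blast
  have "((\<lambda>z. f z + g z) has_derivative (\<lambda>(h, k). (a + a') * h + (b + b') * k)) (at z within S)"
    by (rule has_derivative_eq_rhs[OF has_derivative_add[OF 1 2]]) (auto simp: fun_eq_iff algebra_simps)
  then show "\<exists>a b. ((\<lambda>z. f z + g z) has_derivative (\<lambda>(h, k). a * h + b * k)) (at z within S)" by blast
qed

lemma holomorphic2_on_fst:
  assumes "f holomorphic_on ball 0 1" shows "holomorphic2_on (\<lambda>z. f (fst z)) bidisk"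
  unfolding holomorphic2_on_def
proof
  fix z assume z: "z \<in> bidisk"
  then have "(f has_field_derivative deriv f (fst z)) (at (fst z))"
    using assms holomorphic_derivI[of f "ball 0 1"] by (auto simp: bidisk_def)
  then have "(f has_derivative (\<lambda>h. deriv f (fst z) * h)) (at (fst z))"
    by (simp add: has_field_derivative_def)
  from has_derivative_compose[OF has_derivative_fst[OF has_derivative_ident] this]
  have "((\<lambda>z. f (fst z)) has_derivative (\<lambda>(h, k). deriv f (fst z) * h + 0 * k)) (at z within bidisk)"
    by (simp add: split_beta')
  then show "\<exists>a b. ((\<lambda>z. f (fst z)) has_derivative (\<lambda>(h, k). a * h + b * k)) (at z within bidisk)" by blast
qed

lemma holomorphic2_on_snd:
  assumes "f holomorphic_on ball 0 1" shows "holomorphic2_on (\<lambda>z. f (snd z)) bidisk"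
  unfolding holomorphic2_on_def
proof
  fix z assume z: "z \<in> bidisk"
  then have "(f has_field_derivative deriv f (snd z)) (at (snd z))"
    using assms holomorphic_derivI[of f "ball 0 1"] by (auto simp: bidisk_def)
  then have "(f has_derivative (\<lambda>h. deriv f (snd z) * h)) (at (snd z))"
    by (simp add: has_field_derivative_def)
  from has_derivative_compose[OF has_derivative_snd[OF has_derivative_ident] this]
  have "((\<lambda>z. f (snd z)) has_derivative (\<lambda>(h, k). 0 * h + deriv f (snd z) * k)) (at z within bidisk)"
    by (simp add: split_beta')
  then show "\<exists>a b. ((\<lambda>z. f (snd z)) has_derivative (\<lambda>(h, k). a * h + b * k)) (at z within bidisk)" by blast
qed

lemma holomorphic2_on_slice1:
  assumes "holomorphic2_on f bidisk" "w \<in> ball 0 1" shows "(\<lambda>z. f (z, w)) holomorphic_on ball 0 1"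
  unfolding holomorphic_on_def
proof
  fix z :: complex assume z: "z \<in> ball 0 1"
  then have "(z, w) \<in> bidisk" using assms(2) by (simp add: bidisk_def)
  then obtain a b where "(f has_derivative (\<lambda>(h, k). a * h + b * k)) (at (z, w))"
    using assms(1) unfolding holomorphic2_on_def by (metis at_within_open open_bidisk)
  from has_derivative_compose[of "\<lambda>z. (z, w)", OF has_derivative_Pair[OF has_derivative_ident has_derivative_const] this]
  have "((\<lambda>z. f (z, w)) has_derivative (\<lambda>h. a * h)) (at z within ball 0 1)" by simp
  then show "(\<lambda>z. f (z, w)) field_differentiable at z within ball 0 1"
    unfolding field_differentiable_def has_field_derivative_def by blast
qed

lemma holomorphic2_on_slice2:
  assumes "holomorphic2_on f bidisk" "z \<in> ball 0 1" shows "(\<lambda>w. f (z, w)) holomorphic_on ball 0 1"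
  unfolding holomorphic_on_def
proof
  fix w :: complex assume w: "w \<in> ball 0 1"
  then have "(z, w) \<in> bidisk" using assms(2) by (simp add: bidisk_def)
  then obtain a b where "(f has_derivative (\<lambda>(h, k). a * h + b * k)) (at (z, w))"
    using assms(1) unfolding holomorphic2_on_def by (metis at_within_open open_bidisk)
  from has_derivative_compose[of "\<lambda>w. (z, w)", OF has_derivative_Pair[OF has_derivative_const has_derivative_ident] this]
  have "((\<lambda>w. f (z, w)) has_derivative (\<lambda>h. b * h)) (at w within ball 0 1)" by simp
  then show "(\<lambda>w. f (z, w)) field_differentiable at w within ball 0 1"
    unfolding field_differentiable_def has_field_derivative_def by blast
qed

lemma A2_zero: "0 \<in> A2"
  unfolding A2_def using holomorphic2_on_cong[OF _ holomorphic2_on_const[of 0]] by simp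

lemma A2_add: "F \<in> A2 \<Longrightarrow> G \<in> A2 \<Longrightarrow> F + G \<in> A2"
  unfolding A2_def by (auto intro: holomorphic2_on_cong[OF _ holomorphic2_on_add])

lemma A2_cscale: "F \<in> A2 \<Longrightarrow> c *\<^sub>C F \<in> A2"
  unfolding A2_def by (auto intro: holomorphic2_on_cong[OF _ holomorphic2_on_mult[OF holomorphic2_on_const[of c]]])

lemma A2_diff: "F \<in> A2 \<Longrightarrow> G \<in> A2 \<Longrightarrow> F - G \<in> A2"
  using A2_add[OF _ A2_cscale[of G "-1"], of F] by (metis (no_types, lifting) add.left_neutral
      cscale_simps(5) cscale_simps(6) cscale_simps(8) diff_0 uminus_add_conv_diff add.commute)

lemma A2_sum: "(\<And>i. i \<in> S \<Longrightarrow> F i \<in> A2) \<Longrightarrow> sum F S \<in> A2"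
  by (induction S rule: infinite_finite_induct) (auto intro: A2_add A2_zero)

lemma A2_to_l2: "l2fun f \<Longrightarrow> holomorphic2_on f bidisk \<Longrightarrow> to_l2 f \<in> A2"
  unfolding A2_def by (auto intro: holomorphic2_on_cong[of bidisk f] simp: ev_to_l2)

lemma A2_Mul: "symb \<phi> \<Longrightarrow> holomorphic2_on \<phi> bidisk \<Longrightarrow> F \<in> A2 \<Longrightarrow> Mul \<phi> F \<in> A2"
  unfolding A2_def by (auto intro: holomorphic2_on_cong[OF _ holomorphic2_on_mult[of \<phi> _ "ev F"]] simp: ev_Mul)

lemma A2_zmono: "zmono p \<in> A2"
  unfolding zmono_def
proof (rule A2_to_l2)
  show "l2fun (\<lambda>z. fst z ^ fst p * snd z ^ snd p)"
    by (rule l2fun_bounded[where B=1]) (auto intro!: continuous_intros simp: monom_le_1')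
  show "holomorphic2_on (\<lambda>z. fst z ^ fst p * snd z ^ snd p) bidisk"
    by (intro holomorphic2_on_mult holomorphic2_on_fst[of "\<lambda>z. z ^ fst p"] holomorphic2_on_snd[of "\<lambda>z. z ^ snd p"] holomorphic_intros)
qed

lemma A2_lincomb: "lincomb c S \<in> A2"
  unfolding lincomb_def by (intro A2_sum A2_cscale A2_zmono)

text \<open>Fatou's lemma replaces completeness: a continuous pointwise limit of a norm-bounded
  sequence is again square integrable, with the same bound.\<close>

lemma fatou_l2c:
  assumes lim: "\<And>z. z \<in> bidisk \<Longrightarrow> (\<lambda>k. ev (F k) z) \<longlonglongrightarrow> f z" and f: "continuous_on bidisk f"
    and le: "\<And>k. k \<ge> N \<Longrightarrow> norm (F k) \<le> C"
  shows "l2fun f" "norm (to_l2 f) \<le> C"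
proof -
  have C: "0 \<le> C" using le[of N] norm_ge_zero[of "F N"] by linarith
  have i: "integrable bidisk_measure (\<lambda>z. (cmod (ev F z))\<^sup>2)" for F
    using l2fun_ev by (simp add: l2fun_def)
  have "(\<integral>\<^sup>+z. ennreal ((cmod (f z))\<^sup>2) \<partial>bidisk_measure)
      = (\<integral>\<^sup>+z. liminf (\<lambda>k. ennreal ((cmod (ev (F k) z))\<^sup>2)) \<partial>bidisk_measure)"
  proof (rule nn_integral_cong)
    fix z assume "z \<in> space bidisk_measure"
    then have "(\<lambda>k. ennreal ((cmod (ev (F k) z))\<^sup>2)) \<longlonglongrightarrow> ennreal ((cmod (f z))\<^sup>2)"
      using lim[of z] by (intro tendsto_ennrealI tendsto_power tendsto_norm) simp
    from lim_imp_Liminf[OF _ this] show "ennreal ((cmod (f z))\<^sup>2) = liminf (\<lambda>k. ennreal ((cmod (ev (F k) z))\<^sup>2))"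
      by simp
  qed
  also have "\<dots> \<le> liminf (\<lambda>k. \<integral>\<^sup>+z. ennreal ((cmod (ev (F k) z))\<^sup>2) \<partial>bidisk_measure)"
    using i by (intro nn_integral_liminf measurable_compose[OF _ measurable_ennreal] borel_measurable_integrable)
  also have "\<dots> = liminf (\<lambda>k. ennreal ((norm (F k))\<^sup>2))"
    by (simp add: norm_sq nn_integral_eq_integral[OF i])
  also have "\<dots> \<le> ennreal (C\<^sup>2)"
  proof (rule Liminf_le)
    show "\<forall>\<^sub>F k in sequentially. ennreal ((norm (F k))\<^sup>2) \<le> ennreal (C\<^sup>2)"
      using eventually_ge_at_top[of N] by eventually_elim (auto intro!: ennreal_leI power_mono le)
  qed simp
  finally have le': "(\<integral>\<^sup>+z. ennreal ((cmod (f z))\<^sup>2) \<partial>bidisk_measure) \<le> ennreal (C\<^sup>2)" .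
  have "integrable bidisk_measure (\<lambda>z. (cmod (f z))\<^sup>2)"
  proof (rule integrableI_nonneg)
    show "(\<lambda>z. (cmod (f z))\<^sup>2) \<in> borel_measurable bidisk_measure"
      by (intro measurable_bidisk continuous_intros f)
    show "(\<integral>\<^sup>+z. ennreal ((cmod (f z))\<^sup>2) \<partial>bidisk_measure) < \<infinity>"
      using le' by (rule le_less_trans) simp
  qed simp
  then show l2: "l2fun f" using f by (simp add: l2fun_def)
  then have "(\<integral>\<^sup>+z. ennreal ((cmod (f z))\<^sup>2) \<partial>bidisk_measure) = ennreal (LINT z|bidisk_measure. (cmod (f z))\<^sup>2)"
    unfolding l2fun_def by (intro nn_integral_eq_integral) auto
  also have "(LINT z|bidisk_measure. (cmod (f z))\<^sup>2) = (norm (to_l2 f))\<^sup>2"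
    unfolding norm_sq by (rule Bochner_Integration.integral_cong) (auto simp: ev_to_l2 l2)
  finally have "(norm (to_l2 f))\<^sup>2 \<le> C\<^sup>2" using le' by simp
  then show "norm (to_l2 f) \<le> C" using C by (rule power2_le_imp_le)
qed


lemma lincomb_pointwise_bound:
  assumes \<rho>: "0 < \<rho>" "\<rho> < (1::real)"
  obtains \<kappa> where "0 \<le> \<kappa>"
    "\<And>S d u. finite S \<Longrightarrow> (\<And>p. p \<in> S \<Longrightarrow> cmod (u p) \<le> real (Suc (fst p)) * real (Suc (snd p)) * \<rho> ^ (fst p + snd p) / \<rho>) \<Longrightarrow>
       cmod (\<Sum>p\<in>S. d p * u p) \<le> \<kappa> * norm (lincomb d S)"
proof -
  \<comment> \<open>The square of the bound for \<open>u p\<close>, divided by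
    \<open>sqnorm p\<close>, splits into one such factor for each variable: two powers of
    \<open>Suc m\<close> come from the square and one from \<open>sqnorm\<close>.\<close>
  define f where "f m = real (Suc m) ^ 3 * (\<rho>\<^sup>2) ^ m" for m
  \<comment> \<open>The fourth power of \<open>t\<close> is the square of \<open>\<rho>\<close>.
    Three of the four factors \<open>t ^ m\<close> absorb the cube of \<open>Suc m\<close>, and the
    last one leaves a geometric series.\<close>
  define t where "t = sqrt \<rho>"
  have t: "0 < t" "t < 1" "t ^ 4 = \<rho>\<^sup>2" using \<rho> by (auto simp: t_def power4_eq_xxxx power2_eq_square)
  have "(\<lambda>n. real n * t ^ n + t ^ n) \<longlonglongrightarrow> 0 + 0"
    by (intro tendsto_add powser_times_n_limit_0 LIMSEQ_realpow_zero) (use t in auto)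
  then have "Bseq (\<lambda>n. real n * t ^ n + t ^ n)"
    by (rule convergent_imp_Bseq[OF convergentI])
  then obtain M where M: "0 < M" "\<And>n. norm (real n * t ^ n + t ^ n) \<le> M"
    by (auto elim: BseqE)
  have fle: "f m \<le> M ^ 3 * t ^ m" for m
  proof -
    have "(\<rho>\<^sup>2) ^ m = (t ^ m) ^ 4"
      unfolding t(3)[symmetric] by (simp add: power_mult[symmetric] mult.commute)
    also have "\<dots> = (t ^ m) ^ 3 * t ^ m" by (simp add: eval_nat_numeral)
    also have "real (Suc m) ^ 3 * \<dots> = (real (Suc m) * t ^ m) ^ 3 * t ^ m"
      by (simp add: power_mult_distrib)
    finally have "f m = (real m * t ^ m + t ^ m) ^ 3 * t ^ m"
      by (simp add: f_def algebra_simps)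
    also have "\<dots> \<le> M ^ 3 * t ^ m"
      using M(2)[of m] t by (intro mult_right_mono power_mono) auto
    finally show ?thesis .
  qed
  have f0: "0 \<le> f m" for m by (simp add: f_def)
  have sf: "summable f"
  proof (rule summable_comparison_test'[where N=0])
    show "summable (\<lambda>m. M ^ 3 * t ^ m)" using t by (intro summable_mult summable_geometric) auto
    show "norm (f m) \<le> M ^ 3 * t ^ m" for m using fle[of m] f0[of m] by simp
  qed
  define \<kappa> where "\<kappa> = sqrt ((suminf f)\<^sup>2 / (pi\<^sup>2 * \<rho>\<^sup>2))"
  show thesis
  proof (rule that[of \<kappa>])
    show "0 \<le> \<kappa>" by (simp add: \<kappa>_def)
    fix S :: "(nat \<times> nat) set" and d u :: "nat \<times> nat \<Rightarrow> complex"
    assume S: "finite S" and u: "\<And>p. p \<in> S \<Longrightarrow> cmod (u p) \<le> real (Suc (fst p)) * real (Suc (snd p)) * \<rho> ^ (fst p + snd p) / \<rho>"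
    define b where "b p = cmod (u p) / sqrt (sqnorm p)" for p
    have g: "(sqrt (sqnorm p))\<^sup>2 = sqnorm p" for p using sqnorm_pos[of p] by simp
    have b2: "(b p)\<^sup>2 \<le> f (fst p) * f (snd p) / (pi\<^sup>2 * \<rho>\<^sup>2)" if "p \<in> S" for p
    proof -
      have "(b p)\<^sup>2 = (cmod (u p))\<^sup>2 / sqnorm p" by (simp add: b_def power_divide g)
      also have "\<dots> \<le> (real (Suc (fst p)) * real (Suc (snd p)) * \<rho> ^ (fst p + snd p) / \<rho>)\<^sup>2 / sqnorm p"
        by (intro divide_right_mono power_mono u that less_imp_le[OF sqnorm_pos]) simp
      also have "\<dots> = f (fst p) * f (snd p) / (pi\<^sup>2 * \<rho>\<^sup>2)"
        using \<rho> by (simp add: f_def sqnorm_def power_mult[symmetric] power_add power_mult_distrib power2_eq_square power3_eq_cube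
            mult.commute[of 2] field_simps del: of_nat_Suc)
      finally show ?thesis .
    qed
    obtain K where K: "S \<subseteq> {..<K} \<times> {..<K}"
    proof -
      obtain K where "fst ` S \<union> snd ` S \<subseteq> {..<K}"
        using finite_nat_iff_bounded[of "fst ` S \<union> snd ` S"] S by auto
      then show ?thesis by (intro that[of K]) force
    qed
    have "(\<Sum>p\<in>S. (b p)\<^sup>2) \<le> (\<Sum>p\<in>S. f (fst p) * f (snd p) / (pi\<^sup>2 * \<rho>\<^sup>2))"
      by (intro sum_mono b2)
    also have "\<dots> \<le> (\<Sum>p\<in>{..<K} \<times> {..<K}. f (fst p) * f (snd p) / (pi\<^sup>2 * \<rho>\<^sup>2))"
      by (intro sum_mono2 K) (auto intro!: divide_nonneg_nonneg mult_nonneg_nonneg f0)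
    also have "\<dots> = (\<Sum>m<K. f m) * (\<Sum>n<K. f n) / (pi\<^sup>2 * \<rho>\<^sup>2)"
      by (simp add: sum_product sum.cartesian_product sum_divide_distrib split_beta')
    also have "\<dots> \<le> (suminf f)\<^sup>2 / (pi\<^sup>2 * \<rho>\<^sup>2)"
      unfolding power2_eq_square[of "suminf f"]
      by (intro divide_right_mono mult_mono sum_le_suminf sf sum_nonneg suminf_nonneg) (auto intro: f0)
    finally have bs: "(\<Sum>p\<in>S. (b p)\<^sup>2) \<le> (suminf f)\<^sup>2 / (pi\<^sup>2 * \<rho>\<^sup>2)" .
    have "cmod (\<Sum>p\<in>S. d p * u p) \<le> (\<Sum>p\<in>S. cmod (d p * u p))" by (rule norm_sum)
    also have "\<dots> = (\<Sum>p\<in>S. (cmod (d p) * sqrt (sqnorm p)) * b p)"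
      using sqnorm_pos by (intro sum.cong refl) (simp add: b_def norm_mult less_imp_neq[symmetric])
    also have "\<dots> \<le> sqrt ((norm (lincomb d S))\<^sup>2 * (\<Sum>p\<in>S. (b p)\<^sup>2))"
    proof (rule real_le_rsqrt)
      show "(\<Sum>p\<in>S. (cmod (d p) * sqrt (sqnorm p)) * b p)\<^sup>2 \<le> (norm (lincomb d S))\<^sup>2 * (\<Sum>p\<in>S. (b p)\<^sup>2)"
        unfolding norm_lincomb[OF S] using Cauchy_Schwarz_ineq_sum[of "\<lambda>p. cmod (d p) * sqrt (sqnorm p)" b S]
        by (simp add: power_mult_distrib g)
    qed
    also have "\<dots> \<le> sqrt ((norm (lincomb d S))\<^sup>2 * ((suminf f)\<^sup>2 / (pi\<^sup>2 * \<rho>\<^sup>2)))"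
      by (intro real_sqrt_le_mono mult_left_mono bs) simp
    also have "\<dots> = \<kappa> * norm (lincomb d S)"
      by (simp only: \<kappa>_def real_sqrt_mult real_sqrt_abs abs_norm_cancel mult.commute)
    finally show "cmod (\<Sum>p\<in>S. d p * u p) \<le> \<kappa> * norm (lincomb d S)" .
  qed
qed

abbreviation sq :: "nat \<Rightarrow> (nat \<times> nat) set" where
  "sq k \<equiv> {..<k} \<times> {..<k}"

lemma sq_mono: "j \<le> k \<Longrightarrow> sq j \<subseteq> sq k"
  by auto

lemma lincomb_diff: "finite T \<Longrightarrow> S \<subseteq> T \<Longrightarrow> lincomb c T - lincomb c S = lincomb c (T - S)"
  unfolding lincomb_def by (metis add_diff_cancel_right' sum.subset_diff)

lemma ev_lincomb: "z \<in> bidisk \<Longrightarrow> ev (lincomb c S) z = (\<Sum>p\<in>S. c p * (fst z ^ fst p * snd z ^ snd p))"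
  by (simp add: lincomb_def ev_sum ev_zmono)

lemma uniformly_convergent_lincomb:
  assumes \<rho>: "0 < \<rho>" "\<rho> < (1::real)"
    and u: "\<And>x p. x \<in> X \<Longrightarrow> cmod (u x p) \<le> real (Suc (fst p)) * real (Suc (snd p)) * \<rho> ^ (fst p + snd p) / \<rho>"
    and C: "Cauchy (\<lambda>k. lincomb c (sq k))"
  shows "uniformly_convergent_on X (\<lambda>k x. \<Sum>p\<in>sq k. c p * u x p)"
proof (rule Cauchy_uniformly_convergent, rule uniformly_Cauchy_onI')
  fix e :: real assume e: "e > 0"
  obtain \<kappa> where \<kappa>: "0 \<le> \<kappa>"
    "\<And>S d u. finite S \<Longrightarrow> (\<And>p. p \<in> S \<Longrightarrow> cmod (u p) \<le> real (Suc (fst p)) * real (Suc (snd p)) * \<rho> ^ (fst p + snd p) / \<rho>) \<Longrightarrow>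
       cmod (\<Sum>p\<in>S. d p * u p) \<le> \<kappa> * norm (lincomb d S)"
    by (rule lincomb_pointwise_bound[OF \<rho>]) (rule that, assumption, blast)
  have "0 < e / (\<kappa> + 1)" using e \<kappa>(1) by simp
  then obtain M where M: "\<And>m n. m \<ge> M \<Longrightarrow> n \<ge> M \<Longrightarrow> dist (lincomb c (sq m)) (lincomb c (sq n)) < e / (\<kappa> + 1)"
    using C unfolding Cauchy_def by blast
  have "dist (\<Sum>p\<in>sq m. c p * u x p) (\<Sum>p\<in>sq n. c p * u x p) < e" if x: "x \<in> X" and mn: "m \<ge> M" "n > m" for x m n
  proof -
    have "dist (\<Sum>p\<in>sq m. c p * u x p) (\<Sum>p\<in>sq n. c p * u x p) = cmod (\<Sum>p\<in>sq n - sq m. c p * u x p)"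
      using mn by (subst sum_diff) (auto simp: dist_norm norm_minus_commute)
    also have "\<dots> \<le> \<kappa> * norm (lincomb c (sq n - sq m))"
      by (rule \<kappa>(2)) (simp, rule u[OF x])
    also have "\<dots> = \<kappa> * dist (lincomb c (sq n)) (lincomb c (sq m))"
      using mn by (subst lincomb_diff[symmetric]) (auto simp: dist_norm)
    also have "\<dots> \<le> \<kappa> * (e / (\<kappa> + 1))"
      using M[of n m] mn \<kappa>(1) by (intro mult_left_mono) auto
    also have "\<dots> < e" using e \<kappa>(1) by (simp add: field_simps)
    finally show ?thesis .
  qed
  then show "\<exists>M. \<forall>x\<in>X. \<forall>m\<ge>M. \<forall>n>m. dist (\<Sum>p\<in>sq m. c p * u x p) (\<Sum>p\<in>sq n. c p * u x p) < e" by blast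
qed


text \<open>By orthogonality the squared distance of two partial sums is a difference of values of
  \<open>T\<close>, and \<open>T\<close> is increasing and bounded.\<close>

lemma Cauchy_lincomb:
  assumes bd: "\<And>S. finite S \<Longrightarrow> (\<Sum>p\<in>S. (cmod (c p))\<^sup>2 * sqnorm p) \<le> B"
  shows "Cauchy (\<lambda>k. lincomb c (sq k))"
proof (rule CauchyI)
  define T where "T k = (\<Sum>p\<in>sq k. (cmod (c p))\<^sup>2 * sqnorm p)" for k
  have q: "0 \<le> (cmod (c p))\<^sup>2 * sqnorm p" for p using sqnorm_pos[of p] by simp
  have "incseq T" unfolding T_def incseq_def by (auto intro!: sum_mono2 q)
  moreover have "T k \<le> B" for k unfolding T_def by (rule bd) simp
  ultimately have "convergent T"
    by (metis incseq_convergent convergentI)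
  then have CT: "Cauchy T" by (simp add: Cauchy_convergent_iff)
  have d: "(norm (lincomb c (sq m) - lincomb c (sq n)))\<^sup>2 = T m - T n" if "n \<le> m" for m n
    unfolding lincomb_diff[OF finite_cartesian_product[OF finite_lessThan finite_lessThan] sq_mono[OF that]]
    using sq_mono[OF that] by (subst norm_lincomb) (auto simp: T_def sum_diff)
  fix e :: real assume e: "0 < e"
  then obtain M where M: "\<And>m n. m \<ge> M \<Longrightarrow> n \<ge> M \<Longrightarrow> norm (T m - T n) < e\<^sup>2"
    using CauchyD[OF CT, of "e\<^sup>2"] by auto
  have *: "norm (lincomb c (sq m) - lincomb c (sq n)) < e" if "m \<ge> M" "n \<ge> M" "n \<le> m" for m n
  proof (rule power2_less_imp_less)
    show "(norm (lincomb c (sq m) - lincomb c (sq n)))\<^sup>2 < e\<^sup>2"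
      unfolding d[OF that(3)] using M[of m n] that by auto
  qed (use e in simp)
  have "norm (lincomb c (sq m) - lincomb c (sq n)) < e" if "m \<ge> M" "n \<ge> M" for m n
    using *[of m n] *[of n m] that by (cases "n \<le> m") (auto simp: norm_minus_commute)
  then show "\<exists>M. \<forall>m\<ge>M. \<forall>n\<ge>M. norm (lincomb c (sq m) - lincomb c (sq n)) < e" by blast
qed

text \<open>The Cauchy sequence of partial sums has no limit in \<open>l2c\<close> for free. The
  limit is built as the locally uniform limit of the polynomials; the uniform convergence of their
  partial derivatives makes it holomorphic, and Fatou's lemma shows that it is square integrable and
  is also the limit in norm.\<close>

lemma riesz_fischer:
  assumes bd: "\<And>S. finite S \<Longrightarrow> (\<Sum>p\<in>S. (cmod (c p))\<^sup>2 * sqnorm p) \<le> B"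
  obtains g where "g \<in> A2" "(\<lambda>k. lincomb c (sq k)) \<longlonglongrightarrow> g" "\<And>p. coef g p = c p"
    "\<And>\<rho>. 0 < \<rho> \<Longrightarrow> \<rho> < 1 \<Longrightarrow> uniform_limit (ball 0 \<rho> \<times> ball 0 \<rho>) (\<lambda>k. ev (lincomb c (sq k))) (ev g) sequentially"
proof -
  let ?L = "\<lambda>k. lincomb c (sq k)"
  have C: "Cauchy ?L" by (rule Cauchy_lincomb[OF bd])
  define f where "f x = lim (\<lambda>k. ev (?L k) x)" for x
  define u1 u2 where "u1 x p = of_nat (fst p) * fst x ^ (fst p - 1) * snd x ^ snd p"
    and "u2 x p = of_nat (snd p) * fst x ^ fst p * snd x ^ (snd p - 1)" for x :: "complex \<times> complex" and p :: "nat \<times> nat"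
  have sub: "ball 0 \<rho> \<times> ball 0 \<rho> \<subseteq> bidisk" if "\<rho> < 1" for \<rho> :: real
    using that by (auto simp: bidisk_def)
  have der: "((\<lambda>x. ev (lincomb c S) x) has_derivative (\<lambda>(h, k). (\<Sum>p\<in>S. c p * u1 x p) * h + (\<Sum>p\<in>S. c p * u2 x p) * k)) (at x)"
    if "x \<in> bidisk" for x S
  proof -
    have "((\<lambda>x. \<Sum>p\<in>S. c p * (fst x ^ fst p * snd x ^ snd p)) has_derivative
      (\<lambda>y. (\<Sum>p\<in>S. c p * u1 x p) * fst y + (\<Sum>p\<in>S. c p * u2 x p) * snd y)) (at x)"
    proof (rule has_derivative_eq_rhs)
      show "((\<lambda>x. \<Sum>p\<in>S. c p * (fst x ^ fst p * snd x ^ snd p)) has_derivative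
        (\<lambda>y. \<Sum>p\<in>S. c p * (u1 x p * fst y + u2 x p * snd y))) (at x)"
        by (intro has_derivative_sum) (auto intro!: derivative_eq_intros simp: u1_def u2_def algebra_simps)
    qed (simp add: fun_eq_iff sum_distrib_left sum_distrib_right sum.distrib[symmetric] algebra_simps)
    then have "(ev (lincomb c S) has_derivative (\<lambda>y. (\<Sum>p\<in>S. c p * u1 x p) * fst y + (\<Sum>p\<in>S. c p * u2 x p) * snd y)) (at x)"
      by (rule has_derivative_transform_within_open[OF _ open_bidisk that]) (simp add: ev_lincomb)
    then show ?thesis by (simp add: split_beta')
  qed
  have fst_snd: "cmod (fst x) \<le> \<rho>" "cmod (snd x) \<le> \<rho>" if "x \<in> ball 0 \<rho> \<times> ball 0 \<rho>" for x :: "complex \<times> complex" and \<rho>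
    using that by auto
  \<comment> \<open>Convergence is uniform only on smaller bidisks, so \<open>f\<close> is defined
    beforehand by pointwise limits that do not depend on \<open>\<rho>\<close>.\<close>
  have main: "uniform_limit (ball 0 \<rho> \<times> ball 0 \<rho>) (\<lambda>k. ev (?L k)) f sequentially \<and>
      (\<forall>x\<in>ball 0 \<rho> \<times> ball 0 \<rho>. \<exists>a b. (f has_derivative (\<lambda>(h, k). a * h + b * k)) (at x))"
    if \<rho>: "0 < \<rho>" "\<rho> < 1" for \<rho>
  proof -
    let ?X = "ball 0 \<rho> \<times> ball 0 \<rho> :: (complex \<times> complex) set"
    let ?W = "\<lambda>p. real (Suc (fst p)) * real (Suc (snd p)) * \<rho> ^ (fst p + snd p) / \<rho>"
    \<comment> \<open>The side condition lets the total degree drop by one, as it does for a partial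
      derivative; the missing factor is the division by \<open>\<rho>\<close> in
      \<open>?W\<close>.\<close>
    have W: "a * (x ^ i * y ^ j) \<le> ?W (m, n)"
      if "0 \<le> a" "a \<le> real (Suc m) * real (Suc n)" "0 \<le> x" "x \<le> \<rho>" "0 \<le> y" "y \<le> \<rho>" "m + n \<le> Suc (i + j)" for a x y :: real and i j m n
    proof -
      have "a * (x ^ i * y ^ j) \<le> (real (Suc m) * real (Suc n)) * (\<rho> ^ i * \<rho> ^ j)"
        using that \<rho> by (intro mult_mono power_mono) auto
      also have "\<rho> ^ i * \<rho> ^ j = \<rho> ^ Suc (i + j) / \<rho>" using \<rho> by (simp add: power_add)
      also have "\<rho> ^ Suc (i + j) \<le> \<rho> ^ (m + n)" using \<rho> that by (intro power_decreasing) auto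
      finally show ?thesis using \<rho> by (simp add: divide_right_mono mult_left_mono)
    qed
    have b0: "cmod (fst x ^ fst p * snd x ^ snd p) \<le> ?W p" if "x \<in> ?X" for x p
      using W[of 1 "fst p" "snd p" "cmod (fst x)" "cmod (snd x)" "fst p" "snd p"] fst_snd[OF that]
      by (cases p) (auto simp: norm_mult norm_power algebra_simps)
    have b1: "cmod (u1 x p) \<le> ?W p" if "x \<in> ?X" for x p
      using W[of "real (fst p)" "fst p" "snd p" "cmod (fst x)" "cmod (snd x)" "fst p - 1" "snd p"] fst_snd[OF that]
      by (cases p) (auto simp: u1_def norm_mult norm_power algebra_simps)
    have b2: "cmod (u2 x p) \<le> ?W p" if "x \<in> ?X" for x p
      using W[of "real (snd p)" "fst p" "snd p" "cmod (fst x)" "cmod (snd x)" "fst p" "snd p - 1"] fst_snd[OF that]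
      by (cases p) (auto simp: u2_def norm_mult norm_power algebra_simps)
    have "uniformly_convergent_on ?X (\<lambda>k x. \<Sum>p\<in>sq k. c p * (fst x ^ fst p * snd x ^ snd p))"
      by (rule uniformly_convergent_lincomb[OF \<rho> _ C]) (rule b0)
    then obtain f0 where "uniform_limit ?X (\<lambda>k x. \<Sum>p\<in>sq k. c p * (fst x ^ fst p * snd x ^ snd p)) f0 sequentially"
      unfolding uniformly_convergent_on_def by blast
    moreover have eq: "(\<Sum>p\<in>sq k. c p * (fst x ^ fst p * snd x ^ snd p)) = ev (?L k) x" if "x \<in> ?X" for x k
      using that sub[OF \<rho>(2)] by (subst ev_lincomb) auto
    ultimately have ul0: "uniform_limit ?X (\<lambda>k. ev (?L k)) f0 sequentially"
      by (subst (asm) uniform_limit_cong'[where g="\<lambda>k. ev (?L k)" and i=f0]) auto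
    have lim0: "(\<lambda>k. ev (?L k) x) \<longlonglongrightarrow> f0 x" if "x \<in> ?X" for x
      by (rule tendsto_uniform_limitI[OF ul0 that])
    have f0: "f0 x = f x" if "x \<in> ?X" for x
      unfolding f_def using limI[OF lim0[OF that]] by simp
    have ul: "uniform_limit ?X (\<lambda>k. ev (?L k)) f sequentially"
      using ul0 by (subst (asm) uniform_limit_cong'[where g="\<lambda>k. ev (?L k)" and i=f]) (auto simp: f0)
    have "uniformly_convergent_on ?X (\<lambda>k x. \<Sum>p\<in>sq k. c p * u1 x p)"
      by (rule uniformly_convergent_lincomb[OF \<rho> _ C]) (rule b1)
    then obtain a where a: "uniform_limit ?X (\<lambda>k x. \<Sum>p\<in>sq k. c p * u1 x p) a sequentially"
      unfolding uniformly_convergent_on_def by blast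
    have "uniformly_convergent_on ?X (\<lambda>k x. \<Sum>p\<in>sq k. c p * u2 x p)"
      by (rule uniformly_convergent_lincomb[OF \<rho> _ C]) (rule b2)
    then obtain b where b: "uniform_limit ?X (\<lambda>k x. \<Sum>p\<in>sq k. c p * u2 x p) b sequentially"
      unfolding uniformly_convergent_on_def by blast
    have op: "open ?X" by (intro open_Times) auto
    have "\<exists>g. \<forall>x\<in>?X. (\<lambda>k. ev (?L k) x) \<longlonglongrightarrow> g x \<and> (g has_derivative (\<lambda>(h, k). a x * h + b x * k)) (at x within ?X)"
    proof (rule has_derivative_sequence)
      show "convex ?X" by (intro convex_Times) auto
      show "(0, 0) \<in> ?X" using \<rho> by simp
      then show "(\<lambda>k. ev (?L k) (0, 0)) \<longlonglongrightarrow> f0 (0, 0)" by (rule lim0)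
      show "(ev (?L k) has_derivative (\<lambda>(h, j). (\<Sum>p\<in>sq k. c p * u1 x p) * h + (\<Sum>p\<in>sq k. c p * u2 x p) * j)) (at x within ?X)"
        if "x \<in> ?X" for x k
        by (rule has_derivative_at_withinI[OF der]) (use that sub[OF \<rho>(2)] in blast)
    next
      fix e :: real assume e: "0 < e"
      have "\<forall>\<^sub>F k in sequentially. \<forall>x\<in>?X. dist (\<Sum>p\<in>sq k. c p * u1 x p) (a x) < e / 2"
        "\<forall>\<^sub>F k in sequentially. \<forall>x\<in>?X. dist (\<Sum>p\<in>sq k. c p * u2 x p) (b x) < e / 2"
        using uniform_limitD[OF a, of "e / 2"] uniform_limitD[OF b, of "e / 2"] e by auto
      then show "\<forall>\<^sub>F n in sequentially. \<forall>x\<in>?X. \<forall>h. norm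
         ((case h of (h, j) \<Rightarrow> (\<Sum>p\<in>sq n. c p * u1 x p) * h + (\<Sum>p\<in>sq n. c p * u2 x p) * j) -
         (case h of (h, k) \<Rightarrow> a x * h + b x * k)) \<le> e * norm h"
      proof eventually_elim
        case (elim n)
        show ?case
        proof (intro ballI allI)
          fix x and h :: "complex \<times> complex" assume x: "x \<in> ?X"
          let ?A = "(\<Sum>p\<in>sq n. c p * u1 x p) - a x" and ?B = "(\<Sum>p\<in>sq n. c p * u2 x p) - b x"
          have "norm ?A \<le> e / 2" "norm ?B \<le> e / 2" using elim x by (auto simp: dist_norm less_imp_le)
          moreover have "norm (fst h) \<le> norm h" "norm (snd h) \<le> norm h"
            using norm_fst_le[of "fst h" "snd h"] norm_snd_le[of "snd h" "fst h"] by auto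
          ultimately have "norm (?A * fst h) \<le> e / 2 * norm h" "norm (?B * snd h) \<le> e / 2 * norm h"
            unfolding norm_mult using e by (intro mult_mono; simp)+
          then have "norm (?A * fst h + ?B * snd h) \<le> e / 2 * norm h + e / 2 * norm h"
            by (rule norm_triangle_mono)
          then show "norm ((case h of (h, j) \<Rightarrow> (\<Sum>p\<in>sq n. c p * u1 x p) * h + (\<Sum>p\<in>sq n. c p * u2 x p) * j) -
              (case h of (h, k) \<Rightarrow> a x * h + b x * k)) \<le> e * norm h"
            by (simp add: split_beta' algebra_simps)
        qed
      qed
    qed
    then obtain g where g: "\<And>x. x \<in> ?X \<Longrightarrow> (\<lambda>k. ev (?L k) x) \<longlonglongrightarrow> g x"
      "\<And>x. x \<in> ?X \<Longrightarrow> (g has_derivative (\<lambda>(h, k). a x * h + b x * k)) (at x within ?X)"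
      by blast
    have gf: "g x = f x" if "x \<in> ?X" for x
      using LIMSEQ_unique[OF g(1)[OF that] lim0[OF that]] f0[OF that] by simp
    have "(f has_derivative (\<lambda>(h, k). a x * h + b x * k)) (at x)" if "x \<in> ?X" for x
      using has_derivative_transform_within_open[OF g(2)[OF that, unfolded at_within_open[OF that op]] op that gf] .
    then show ?thesis using ul by blast
  qed
  have ex\<rho>: "\<exists>\<rho>. 0 < \<rho> \<and> \<rho> < 1 \<and> x \<in> ball 0 \<rho> \<times> ball 0 \<rho>" if "x \<in> bidisk" for x
  proof -
    have "max (cmod (fst x)) (cmod (snd x)) < 1" using that by (auto simp: bidisk_def)
    then obtain \<rho> where "max (cmod (fst x)) (cmod (snd x)) < \<rho>" "\<rho> < 1" using dense by blast
    moreover then have "0 < \<rho>" using norm_ge_zero[of "fst x"] by linarith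
    ultimately show ?thesis by (intro exI[of _ \<rho>]) (auto simp: mem_Times_iff)
  qed
  have dfa: "\<exists>a b. (f has_derivative (\<lambda>(h, k). a * h + b * k)) (at x)" if x: "x \<in> bidisk" for x
  proof -
    obtain \<rho> where "0 < \<rho>" "\<rho> < 1" "x \<in> ball 0 \<rho> \<times> ball 0 \<rho>" using ex\<rho>[OF x] by blast
    then show ?thesis using main[of \<rho>] by blast
  qed
  then have hol: "holomorphic2_on f bidisk"
    unfolding holomorphic2_on_def by (blast intro: has_derivative_at_withinI)
  have cf: "continuous_on bidisk f"
  proof (rule continuous_at_imp_continuous_on, rule ballI)
    fix x assume "x \<in> bidisk"
    then obtain a b where "(f has_derivative (\<lambda>(h, k). a * h + b * k)) (at x)" using dfa by blast
    then show "isCont f x" by (rule has_derivative_continuous)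
  qed
  have lim: "(\<lambda>k. ev (?L k) x) \<longlonglongrightarrow> f x" if x: "x \<in> bidisk" for x
  proof -
    obtain \<rho> where "0 < \<rho>" "\<rho> < 1" "x \<in> ball 0 \<rho> \<times> ball 0 \<rho>" using ex\<rho>[OF x] by blast
    then show ?thesis by (intro tendsto_uniform_limitI[OF conjunct1[OF main]])
  qed
  have "norm (?L k) \<le> sqrt B" for k
    by (rule real_le_rsqrt) (subst norm_lincomb, simp, rule bd, simp)
  \<comment> \<open>First use of Fatou: the partial sums are bounded in norm, hence their pointwise
    limit is square integrable.\<close>
  then have l2: "l2fun f" using fatou_l2c(1)[OF lim cf, of 0 "sqrt B"] by simp
  define g where "g = to_l2 f"
  have evg: "ev g x = f x" if "x \<in> bidisk" for x unfolding g_def by (rule ev_to_l2[OF l2 that])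
  have conv: "?L \<longlonglongrightarrow> g"
  proof (rule LIMSEQ_I)
    fix e :: real assume e: "0 < e"
    then obtain M where M: "\<And>m n. m \<ge> M \<Longrightarrow> n \<ge> M \<Longrightarrow> norm (?L m - ?L n) < e / 2"
      using CauchyD[OF C, of "e / 2"] by auto
    have "norm (?L n - g) < e" if "n \<ge> M" for n
    proof -
      \<comment> \<open>Second use of Fatou, with \<open>n\<close> fixed and \<open>k\<close>
        tending to infinity: the Cauchy bound passes to the distance from the limit.\<close>
      have lim': "(\<lambda>k. ev (?L k - ?L n) x) \<longlonglongrightarrow> f x - ev (?L n) x" if "x \<in> bidisk" for x
        unfolding ev_simps by (intro tendsto_diff lim that tendsto_const)
      have c': "continuous_on bidisk (\<lambda>x. f x - ev (?L n) x)"
        by (intro continuous_on_diff cf continuous_ev)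
      have le': "norm (?L k - ?L n) \<le> e / 2" if "k \<ge> M" for k
        using M[OF that \<open>n \<ge> M\<close>] by simp
      have "norm (to_l2 (\<lambda>x. f x - ev (?L n) x)) \<le> e / 2" "l2fun (\<lambda>x. f x - ev (?L n) x)"
        using fatou_l2c[OF lim' c' le'] by blast+
      moreover have "to_l2 (\<lambda>x. f x - ev (?L n) x) = g - ?L n"
        by (rule l2c_eqI) (simp add: ev_to_l2 calculation(2) evg)
      ultimately show ?thesis using e by (simp add: norm_minus_commute)
    qed
    then show "\<exists>M. \<forall>n\<ge>M. norm (?L n - g) < e" by blast
  qed
  show thesis
  proof (rule that[of g])
    show "g \<in> A2" unfolding g_def by (rule A2_to_l2[OF l2 hol])
    show "?L \<longlonglongrightarrow> g" by (rule conv)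
    show "coef g p = c p" for p
    proof -
      have "(\<lambda>k. coef (?L k) p) \<longlonglongrightarrow> coef g p"
        unfolding coef_def by (intro tendsto_divide tendsto_cinner conv tendsto_const) (use sqnorm_pos[of p] in simp)
      moreover have "\<forall>\<^sub>F k in sequentially. coef (?L k) p = c p"
        using eventually_gt_at_top[of "max (fst p) (snd p)"]
        by eventually_elim (auto simp: coef_lincomb mem_Times_iff)
      ultimately show ?thesis
        by (rule LIMSEQ_unique[OF _ tendsto_eventually])
    qed
    fix \<rho> :: real assume \<rho>: "0 < \<rho>" "\<rho> < 1"
    show "uniform_limit (ball 0 \<rho> \<times> ball 0 \<rho>) (\<lambda>k. ev (?L k)) (ev g) sequentially"
      using main[OF \<rho>] sub[OF \<rho>(2)] evg
      by (subst uniform_limit_cong'[where g="\<lambda>k. ev (?L k)" and i=f]) auto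
  qed
qed


lemma ev_l1:
  shows "integrable bidisk_measure (ev F)"
proof (rule Bochner_Integration.integrable_bound)
  show "integrable bidisk_measure (\<lambda>z. 1 + (cmod (ev F z))\<^sup>2)"
    using l2fun_ev[of F] by (auto simp: l2fun_def)
  show "ev F \<in> borel_measurable bidisk_measure" by (rule measurable_bidisk[OF continuous_ev])
  have "x \<le> 1 + x\<^sup>2" for x :: real
  proof -
    have "2 * x \<le> x\<^sup>2 + 1" using sum_squares_bound[of x 1] by simp
    moreover have "0 \<le> x\<^sup>2" by simp
    ultimately show ?thesis by linarith
  qed
  then show "AE z in bidisk_measure. norm (ev F z) \<le> norm (1 + (cmod (ev F z))\<^sup>2)" by auto
qed

text \<open>The monomials span a dense subspace. Two one-variable expansions are combined: for fixed
  \<open>w\<close> the function is expanded in \<open>z\<close> with coefficients given by the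
  integrals \<open>y m w\<close>. Every conjugate moment of \<open>y m\<close> vanishes, so after
  exchanging sum and integral every \<open>w\<close>-moment of every slice vanishes, and a
  holomorphic integrable slice with this property is 0.\<close>

lemma A2_coef_eq_0:
  assumes F: "F \<in> A2" and 0: "\<And>p. cinner F (zmono p) = 0"
  shows "F = 0"
proof -
  let ?f = "ev F"
  have hol: "holomorphic2_on ?f bidisk" using F by (simp add: A2_def)
  note int = ev_l1[of F, unfolded bidisk_measure_def]
  have int': "integrable (disc_measure \<Otimes>\<^sub>M disc_measure) (\<lambda>(w, z). ?f (z, w))"
    using disc_pair.integrable_product_swap[OF int] by simp
  have AE1: "AE z in disc_measure. integrable disc_measure (\<lambda>w. ?f (z, w))"
    by (rule disc_pair.AE_integrable_fst'[OF int])
  have AE2: "AE w in disc_measure. integrable disc_measure (\<lambda>z. ?f (z, w))"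
    using disc_pair.AE_integrable_fst'[OF int'] by simp
  \<comment> \<open>An integrable majorant for all \<open>y m\<close> at once, needed to exchange
    the series with the integral over \<open>w\<close>.\<close>
  define Y where "Y w = (LINT z|disc_measure. norm (?f (z, w)))" for w
  have Y: "integrable disc_measure Y"
    using disc_pair.integrable_fst'[OF integrable_norm[OF int']] unfolding Y_def by simp
  define y where "y m w = (LINT z|disc_measure. ?f (z, w) * cnj z ^ m)" for m w
  have intm: "integrable (disc_measure \<Otimes>\<^sub>M disc_measure) (\<lambda>(w, z). ?f (z, w) * cnj z ^ m * cnj w ^ n)" for m n
  proof (rule Bochner_Integration.integrable_bound[OF int'])
    have "continuous_on bidisk (\<lambda>(z, w). ?f (z, w) * cnj z ^ m * cnj w ^ n)"
      unfolding split_beta' by (intro continuous_intros) (simp add: continuous_ev)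
    from measurable_pair_swap[OF measurable_bidisk[OF this, unfolded bidisk_measure_def]]
    show "(\<lambda>(w, z). ?f (z, w) * cnj z ^ m * cnj w ^ n) \<in> borel_measurable (disc_measure \<Otimes>\<^sub>M disc_measure)"
      by simp
    show "AE x in disc_measure \<Otimes>\<^sub>M disc_measure. norm (case x of (w, z) \<Rightarrow> ?f (z, w) * cnj z ^ m * cnj w ^ n)
        \<le> norm (case x of (w, z) \<Rightarrow> ?f (z, w))"
    proof (rule AE_I2)
      fix x assume "x \<in> space (disc_measure \<Otimes>\<^sub>M disc_measure)"
      then have "cmod (snd x ^ m * fst x ^ n) \<le> 1"
        using monom_le_1'[of "snd x" "fst x"] by (auto simp: space_pair_measure bidisk_def)
      then show "norm (case x of (w, z) \<Rightarrow> ?f (z, w) * cnj z ^ m * cnj w ^ n) \<le> norm (case x of (w, z) \<Rightarrow> ?f (z, w))"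
        by (auto simp: split_beta' norm_mult norm_power mult.assoc intro!: mult_right_le_one_le)
    qed
  qed
  have y_int: "integrable disc_measure (\<lambda>w. y m w * cnj w ^ n)" for m n
    using disc_pair.integrable_fst'[OF intm[of m n]] by (simp add: y_def)
  have y0: "(LINT w|disc_measure. y m w * cnj w ^ n) = 0" for m n
  proof -
    have "(LINT w|disc_measure. y m w * cnj w ^ n) = (LINT p|(disc_measure \<Otimes>\<^sub>M disc_measure). (case p of (w, z) \<Rightarrow> ?f (z, w) * cnj z ^ m * cnj w ^ n))"
      using disc_pair.integral_fst'[OF intm[of m n]] by (simp add: y_def)
    also have "\<dots> = (LINT p|(disc_measure \<Otimes>\<^sub>M disc_measure). ?f p * cnj (fst p) ^ m * cnj (snd p) ^ n)"
    proof -
      have "(\<lambda>p. ?f p * cnj (fst p) ^ m * cnj (snd p) ^ n) \<in> borel_measurable (disc_measure \<Otimes>\<^sub>M disc_measure)"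
        unfolding bidisk_measure_def[symmetric]
        by (intro measurable_bidisk continuous_intros) (simp add: continuous_ev)
      from disc_pair.integral_product_swap[OF this] show ?thesis by simp
    qed
    also have "\<dots> = cinner F (zmono (m, n))"
      unfolding cinner_eq bidisk_measure_def[symmetric]
      by (rule Bochner_Integration.integral_cong) (auto simp: ev_zmono)
    finally show ?thesis using 0 by simp
  qed
  \<comment> \<open>Holds at every point \<open>z\<close> of the disc: the factors
    \<open>Suc m\<close> from the Taylor coefficients are harmless against the powers of
    \<open>cmod z < 1\<close>.\<close>
  have J0: "(LINT w|disc_measure. ?f (z, w) * cnj w ^ n) = 0" if z: "z \<in> ball 0 1" for z n
  proof -
    let ?c = "\<lambda>m. of_nat (Suc m) / of_real pi * z ^ m"
    have s: "summable (\<lambda>m. real (Suc m) * cmod z ^ m)"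
      using z by (intro sums_summable[OF geometric_deriv_sums]) simp
    have yb: "norm (y m w) \<le> Y w" if w: "integrable disc_measure (\<lambda>z. ?f (z, w))" for m w
    proof -
      have "norm (y m w) \<le> (LINT z|disc_measure. norm (?f (z, w) * cnj z ^ m))"
        unfolding y_def by (rule integral_norm_bound)
      also have "\<dots> \<le> Y w"
        unfolding Y_def using w
        by (intro integral_mono_AE' AE_I2) (auto simp: norm_mult norm_power intro!: mult_right_le_one_le power_le_one)
      finally show ?thesis .
    qed
    have exp: "(\<lambda>m. ?c m * (y m w * cnj w ^ n)) sums (?f (z, w) * cnj w ^ n)"
      if w: "integrable disc_measure (\<lambda>z. ?f (z, w))" "w \<in> ball 0 1" for w
    proof -
      have h: "(\<lambda>z. ?f (z, w)) holomorphic_on ball 0 1"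
        by (rule holomorphic2_on_slice1[OF hol w(2)])
      have "(deriv ^^ m) (\<lambda>z. ?f (z, w)) 0 / fact m = of_nat (Suc m) / of_real pi * y m w" for m
        unfolding y_def integral_disc_taylor[OF h w(1)] by (simp del: of_nat_Suc)
      then have "(\<lambda>m. ?c m * y m w) sums ?f (z, w)"
        using holomorphic_power_series[OF h z] by (simp add: mult_ac)
      from sums_mult2[OF this, of "cnj w ^ n"] show ?thesis by (simp add: mult.assoc)
    qed
    have "(LINT w|disc_measure. ?f (z, w) * cnj w ^ n) = (LINT w|disc_measure. (\<Sum>m. ?c m * (y m w * cnj w ^ n)))"
    proof (rule integral_cong_AE)
      have ci: "integrable disc_measure (\<lambda>w. ?c m * (y m w * cnj w ^ n))" for m
        using y_int by (intro integrable_mult_right)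
      show "(\<lambda>w. \<Sum>m. ?c m * (y m w * cnj w ^ n)) \<in> borel_measurable disc_measure"
        by (intro borel_measurable_suminf borel_measurable_integrable ci)
      show "(\<lambda>w. ?f (z, w) * cnj w ^ n) \<in> borel_measurable disc_measure"
        by (intro measurable_disc continuous_intros holomorphic_on_imp_continuous_on holomorphic2_on_slice2[OF hol z])
      show "AE w in disc_measure. ?f (z, w) * cnj w ^ n = (\<Sum>m. ?c m * (y m w * cnj w ^ n))"
        using AE2 AE_space by eventually_elim (use exp sums_unique in auto)
    qed
    also have "\<dots> = (\<Sum>m. LINT w|disc_measure. ?c m * (y m w * cnj w ^ n))"
    proof (rule integral_suminf)
      show ci: "integrable disc_measure (\<lambda>w. ?c m * (y m w * cnj w ^ n))" for m
        using y_int by (intro integrable_mult_right)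
      have b: "norm (?c m * (y m w * cnj w ^ n)) \<le> real (Suc m) * cmod z ^ m * Y w"
        if "integrable disc_measure (\<lambda>z. ?f (z, w))" "w \<in> ball 0 1" for m w
      proof -
        have "norm (?c m * (y m w * cnj w ^ n)) = real (Suc m) * cmod z ^ m * (cmod (y m w) * (cmod w ^ n / pi))"
          by (simp add: norm_mult norm_divide norm_power del: of_nat_Suc)
        also have "\<dots> \<le> real (Suc m) * cmod z ^ m * (Y w * 1)"
        proof (intro mult_left_mono mult_mono yb that)
          have "cmod w ^ n \<le> 1" using that by (intro power_le_one) auto
          then show "cmod w ^ n / pi \<le> 1" using pi_ge_two by (simp add: field_simps)
          show "0 \<le> Y w" by (simp add: Y_def)
        qed auto
        finally show ?thesis by simp
      qed
      show "AE w in disc_measure. summable (\<lambda>m. norm (?c m * (y m w * cnj w ^ n)))"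
        using AE2 AE_space
      proof eventually_elim
        case (elim w)
        then show ?case
          by (intro summable_comparison_test'[OF summable_mult2[OF s, of "Y w"], of 0]) (use b[of w] in simp)
      qed
      show "summable (\<lambda>m. LINT w|disc_measure. norm (?c m * (y m w * cnj w ^ n)))"
      proof (rule summable_comparison_test'[OF summable_mult2[OF s, of "LINT w|disc_measure. Y w"], of 0])
        fix m
        have "(LINT w|disc_measure. norm (?c m * (y m w * cnj w ^ n))) \<le> (LINT w|disc_measure. real (Suc m) * cmod z ^ m * Y w)"
        proof (rule integral_mono_AE[OF integrable_norm[OF ci] integrable_mult_right[OF Y]])
          show "AE w in disc_measure. norm (?c m * (y m w * cnj w ^ n)) \<le> real (Suc m) * cmod z ^ m * Y w"
            using AE2 AE_space by eventually_elim (use b in auto)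
        qed
        then show "norm (LINT w|disc_measure. norm (?c m * (y m w * cnj w ^ n))) \<le> real (Suc m) * cmod z ^ m * (LINT w|disc_measure. Y w)"
          by simp
      qed
    qed
    also have "\<dots> = (\<Sum>m. ?c m * (LINT w|disc_measure. y m w * cnj w ^ n))"
      using y_int by simp
    finally show ?thesis by (simp add: y0)
  qed
  \<comment> \<open>Only almost every slice is known to be integrable in \<open>w\<close>, which is
    enough to make the norm of \<open>F\<close> vanish.\<close>
  have "AE z in disc_measure. (LINT w|disc_measure. ?f (z, w) * cnj (?f (z, w))) = 0"
    using AE1 AE_space
  proof eventually_elim
    case (elim z)
    have "?f (z, w) = 0" if "w \<in> ball 0 1" for w
      by (rule holomorphic_disc_eq_0[of "\<lambda>w. ?f (z, w)"]) (use elim J0 that holomorphic2_on_slice2[OF hol] in auto)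
    then have "(LINT w|disc_measure. ?f (z, w) * cnj (?f (z, w))) = (LINT w|disc_measure. 0)"
      by (intro Bochner_Integration.integral_cong) auto
    then show ?case by simp
  qed
  then have "cinner F F = 0"
    unfolding cinner_Fubini(1) by (rule integral_eq_zero_AE)
  then show ?thesis by (simp add: cinner_self)
qed

lemma riesz_fischer_ex:
  assumes "\<And>S. finite S \<Longrightarrow> (\<Sum>p\<in>S. (cmod (c p))\<^sup>2 * sqnorm p) \<le> B"
  shows "\<exists>g. g \<in> A2 \<and> (\<lambda>k. lincomb c (sq k)) \<longlonglongrightarrow> g \<and> (\<forall>p. coef g p = c p) \<and>
    (\<forall>\<rho>. 0 < \<rho> \<longrightarrow> \<rho> < 1 \<longrightarrow> uniform_limit (ball 0 \<rho> \<times> ball 0 \<rho>) (\<lambda>k. ev (lincomb c (sq k))) (ev g) sequentially)"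
proof (rule riesz_fischer[of c B])
  show "(\<Sum>p\<in>S. (cmod (c p))\<^sup>2 * sqnorm p) \<le> B" if "finite S" for S using assms that .
qed blast

text \<open>Riesz-Fischer produces an element of the Bergman space with the coefficients of
  \<open>F\<close>; by \<open>A2_coef_eq_0\<close> it is \<open>F\<close> itself.\<close>

lemma A2_expand:
  assumes F: "F \<in> A2"
  shows "(\<lambda>k. lincomb (coef F) (sq k)) \<longlonglongrightarrow> F"
    and "0 < \<rho> \<Longrightarrow> \<rho> < 1 \<Longrightarrow> uniform_limit (ball 0 \<rho> \<times> ball 0 \<rho>) (\<lambda>k. ev (lincomb (coef F) (sq k))) (ev F) sequentially"
proof -
  obtain g where g: "g \<in> A2" "(\<lambda>k. lincomb (coef F) (sq k)) \<longlonglongrightarrow> g" "\<And>p. coef g p = coef F p"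
    "\<And>\<rho>. 0 < \<rho> \<Longrightarrow> \<rho> < 1 \<Longrightarrow> uniform_limit (ball 0 \<rho> \<times> ball 0 \<rho>) (\<lambda>k. ev (lincomb (coef F) (sq k))) (ev g) sequentially"
    using riesz_fischer_ex[OF bessel[of _ F]] by blast
  have "F - g = 0"
    using F g by (intro A2_coef_eq_0 A2_diff) (simp_all add: cinner_zmono_coef coef_simps)
  then have "F = g" by simp
  then show "(\<lambda>k. lincomb (coef F) (sq k)) \<longlonglongrightarrow> F"
    "0 < \<rho> \<Longrightarrow> \<rho> < 1 \<Longrightarrow> uniform_limit (ball 0 \<rho> \<times> ball 0 \<rho>) (\<lambda>k. ev (lincomb (coef F) (sq k))) (ev F) sequentially"
    using g by simp_all
qed

lemma A2_orth:
  assumes nul: "\<And>p. cinner G (zmono p) = 0" and h: "h \<in> A2"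
  shows "cinner G h = 0" "cinner h G = 0"
proof -
  have nul': "cinner (zmono p) G = 0" for p using nul[of p] cinner_cnj[of G "zmono p"] by simp
  have "(\<lambda>k. cinner (lincomb (coef h) (sq k)) G) \<longlonglongrightarrow> cinner h G"
    by (rule tendsto_cinner[OF A2_expand(1)[OF h]])
  moreover have "cinner (lincomb (coef h) (sq k)) G = 0" for k
    by (simp add: lincomb_def cinner_sum_left nul')
  ultimately show "cinner h G = 0" using LIMSEQ_unique[of "\<lambda>_. 0 :: complex"] by simp
  then show "cinner G h = 0" using cinner_cnj[of h G] by simp
qed

section \<open>Bergman projection and Hankel operators\<close>

text \<open>The orthogonal projection, specified through coefficients because the projection theorem
  would require completeness. Bessel and Riesz-Fischer give existence, \<open>A2_coef_eq_0\<close>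
  gives uniqueness.\<close>

definition bproj :: "l2c \<Rightarrow> l2c" where
  "bproj F = (SOME g. g \<in> A2 \<and> (\<forall>p. coef g p = coef F p))"

lemma bproj_in [simp]: "bproj F \<in> A2" and coef_bproj [simp]: "coef (bproj F) p = coef F p"
proof -
  obtain g where "g \<in> A2" "\<And>p. coef g p = coef F p"
    using riesz_fischer_ex[OF bessel[of _ F]] by blast
  then have "\<exists>g. g \<in> A2 \<and> (\<forall>p. coef g p = coef F p)" by blast
  from someI_ex[OF this] show "bproj F \<in> A2" "coef (bproj F) p = coef F p" unfolding bproj_def by blast+
qed

lemma bproj_orth: "h \<in> A2 \<Longrightarrow> cinner (F - bproj F) h = 0" "h \<in> A2 \<Longrightarrow> cinner h (F - bproj F) = 0"
  by (rule A2_orth; simp add: cinner_zmono_coef coef_simps)+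

lemma A2_eqI: "F \<in> A2 \<Longrightarrow> G \<in> A2 \<Longrightarrow> (\<And>p. coef F p = coef G p) \<Longrightarrow> F = G"
  using A2_coef_eq_0[of "F - G"] A2_diff by (simp add: cinner_zmono_coef coef_simps)

lemma bproj_unique: "g \<in> A2 \<Longrightarrow> (\<And>p. coef F p = coef g p) \<Longrightarrow> bproj F = g"
  by (rule A2_eqI) simp_all

lemma bproj_A2: "F \<in> A2 \<Longrightarrow> bproj F = F"
  by (rule bproj_unique) auto

lemma bproj_linear: "bproj (F + G) = bproj F + bproj G" "bproj (F - G) = bproj F - bproj G" "bproj (c *\<^sub>C F) = c *\<^sub>C bproj F" "bproj 0 = 0"
  by (rule bproj_unique; simp add: A2_add A2_diff A2_cscale A2_zero coef_simps)+

lemma norm_bproj_split: "(norm F)\<^sup>2 = (norm (F - bproj F))\<^sup>2 + (norm (bproj F))\<^sup>2"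
  using norm_diff_sq[OF bproj_orth(1)[of "bproj F" F]] by simp

lemma norm_bproj_le: "norm (bproj F) \<le> norm F"
proof (rule power2_le_imp_le)
  show "(norm (bproj F))\<^sup>2 \<le> (norm F)\<^sup>2"
    using norm_bproj_split[of F] zero_le_power2[of "norm (F - bproj F)"] by linarith
qed simp

text \<open>The projection is the best approximation. Upper bounds for Hankel operators are obtained
  from it by exhibiting holomorphic competitors.\<close>

lemma norm_minus_bproj_le: assumes "g \<in> A2" shows "norm (F - bproj F) \<le> norm (F - g)"
proof -
  have "F - g = (F - bproj F) + (bproj F - g)" by simp
  moreover have "(norm ((F - bproj F) + (bproj F - g)))\<^sup>2 = (norm (F - bproj F))\<^sup>2 + (norm (bproj F - g))\<^sup>2"
    by (rule norm_diff_sq[OF bproj_orth(1)]) (simp add: A2_diff assms)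
  ultimately have "(norm (F - bproj F))\<^sup>2 \<le> (norm (F - g))\<^sup>2"
    using zero_le_power2[of "norm (bproj F - g)"] by (metis le_add_same_cancel1)
  then show ?thesis by (rule power2_le_imp_le) simp
qed

lemma cinner_bproj: "h \<in> A2 \<Longrightarrow> cinner (bproj F) h = cinner F h" "h \<in> A2 \<Longrightarrow> cinner h (bproj F) = cinner h F"
  using bproj_orth[of h F] by (simp_all add: cinner_diff_left cinner_diff_right)

section \<open>Hankel operators on continuous representatives\<close>

definition hankel_l2 :: "(complex \<times> complex \<Rightarrow> complex) \<Rightarrow> l2c \<Rightarrow> l2c" where
  "hankel_l2 \<phi> F = Mul \<phi> F - bproj (Mul \<phi> F)"

lemma hankel_l2_orth: "h \<in> A2 \<Longrightarrow> cinner (hankel_l2 \<phi> F) h = 0" "h \<in> A2 \<Longrightarrow> cinner h (hankel_l2 \<phi> F) = 0"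
  by (simp_all add: hankel_l2_def bproj_orth)

lemma hankel_l2_linear:
  assumes "symb \<phi>"
  shows "hankel_l2 \<phi> (F + G) = hankel_l2 \<phi> F + hankel_l2 \<phi> G" "hankel_l2 \<phi> (F - G) = hankel_l2 \<phi> F - hankel_l2 \<phi> G" "hankel_l2 \<phi> (c *\<^sub>C F) = c *\<^sub>C hankel_l2 \<phi> F"
  using assms by (simp_all add: hankel_l2_def Mul_simps bproj_linear cscale_simps)

lemma cinner_hankel_l2_Mul: "cinner (hankel_l2 \<phi> F) (Mul \<psi> G) = cinner (hankel_l2 \<phi> F) (hankel_l2 \<psi> G)"
  using hankel_l2_orth(1)[of "bproj (Mul \<psi> G)" \<phi> F] by (simp add: hankel_l2_def[of \<psi>] cinner_diff_right)

lemma norm_hankel_l2_le_Mul: "norm (hankel_l2 \<phi> F) \<le> norm (Mul \<phi> F)"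
  using norm_minus_bproj_le[OF A2_zero, of "Mul \<phi> F"] by (simp add: hankel_l2_def)

lemma hankel_l2_diff_symbol:
  assumes "symb \<phi>" "symb \<psi>"
  shows "hankel_l2 \<phi> F - hankel_l2 \<psi> F = hankel_l2 (\<lambda>z. \<phi> z - \<psi> z) F"
proof -
  have "Mul (\<lambda>z. \<phi> z - \<psi> z) F = Mul \<phi> F - Mul \<psi> F"
    using assms by (intro l2c_eqI) (simp add: ev_Mul symb_simps algebra_simps)
  then show ?thesis by (simp add: hankel_l2_def bproj_linear)
qed

section \<open>Monomial symbols and their action on coefficients\<close>

definition monom_symb :: "nat \<Rightarrow> nat \<Rightarrow> nat \<Rightarrow> nat \<Rightarrow> complex \<times> complex \<Rightarrow> complex" where
  "monom_symb i j k l z = (fst z ^ i * cnj (fst z) ^ j) * (snd z ^ k * cnj (snd z) ^ l)"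

lemma monom_symb_le_1: "z \<in> bidisk \<Longrightarrow> cmod (monom_symb i j k l z) \<le> 1"
  by (cases z) (auto simp: monom_symb_def bidisk_def norm_mult norm_power intro!: mult_le_one power_le_one)

lemma symb_monom_symb [simp]: "symb (monom_symb i j k l)"
proof (rule symbI[where B=1])
  show "continuous_on bidisk (monom_symb i j k l)" unfolding monom_symb_def[abs_def] by (intro continuous_intros)
qed (rule monom_symb_le_1)

lemma norm_monom_symb_le: "norm (Mul (monom_symb i j k l) F) \<le> norm F"
  using norm_Mul_le[OF symb_monom_symb monom_symb_le_1, of i j k l F] by simp

lemma holomorphic2_monom_symb: "holomorphic2_on (monom_symb i 0 k 0) bidisk"
  unfolding monom_symb_def[abs_def]
  by (simp, intro holomorphic2_on_mult holomorphic2_on_fst[of "\<lambda>z. z ^ i"] holomorphic2_on_snd[of "\<lambda>z. z ^ k"] holomorphic_intros)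

text \<open>Multiplication by a monomial followed by projection is a weighted shift of the
  coefficients. On monomials this is a product of two moments; linearity and the expansion of
  \<open>A\<close> do the rest.\<close>

lemma cinner_Mul_monom_symb_zmono:
  assumes A: "A \<in> A2"
  shows "cinner (Mul (monom_symb i j k l) A) (zmono (m, n)) =
    (if i \<le> j + m \<and> k \<le> l + n then coef A (j + m - i, l + n - k) * of_real (sqnorm (j + m, l + n)) else 0)" (is "_ = ?R A")
proof -
  let ?S = "Mul (monom_symb i j k l)"
  have mo: "cinner (?S (zmono q)) (zmono (m, n)) = ?R (zmono q)" for q
  proof -
    have "cinner (?S (zmono q)) (zmono (m, n)) = moment (fst q + i) (j + m) * moment (snd q + k) (l + n)"
      unfolding moment_def
      by (rule Fubini_product) (simp add: ev_Mul ev_zmono monom_symb_def bidisk_def power_add mult_ac)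
    then show ?thesis by (cases q) (auto simp: moment_eq coef_zmono sqnorm_def)
  qed
  have lin: "cinner (?S (lincomb c T)) (zmono (m, n)) = ?R (lincomb c T)" if "finite T" for c T
    using that
  proof (induction T)
    case empty
    then show ?case by (simp add: lincomb_def Mul_simps coef_simps)
  next
    case (insert p T)
    then show ?case by (auto simp: lincomb_def Mul_simps cinner_add_left coef_simps mo algebra_simps)
  qed
  \<comment> \<open>The multiplier is moved to the fixed right argument, so only continuity of the
    pairing in its left argument is used.\<close>
  have "(\<lambda>K. cinner (?S (lincomb (coef A) (sq K))) (zmono (m, n))) \<longlonglongrightarrow> cinner (?S A) (zmono (m, n))"
    unfolding cinner_Mul[OF symb_monom_symb] by (rule tendsto_cinner[OF A2_expand(1)[OF A]])
  moreover have "(\<lambda>K. ?R (lincomb (coef A) (sq K))) \<longlonglongrightarrow> ?R A"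
  proof (cases "i \<le> j + m \<and> k \<le> l + n")
    case True
    have "(\<lambda>K. coef (lincomb (coef A) (sq K)) q) \<longlonglongrightarrow> coef A q" for q
      unfolding coef_def using sqnorm_pos[of q]
      by (intro tendsto_divide tendsto_const tendsto_cinner[OF A2_expand(1)[OF A, unfolded coef_def]]) auto
    then show ?thesis unfolding if_P[OF True] by (intro tendsto_mult tendsto_const)
  next
    case False
    show ?thesis unfolding if_not_P[OF False] by (rule tendsto_const)
  qed
  ultimately show ?thesis
    using lin by (auto intro: LIMSEQ_unique simp del: if_split)
qed

section \<open>Functions of high order in one variable\<close>

lemma norm_A2_le:
  assumes A: "A \<in> A2" and B: "\<And>S. finite S \<Longrightarrow> (\<Sum>p\<in>S. (cmod (coef A p))\<^sup>2 * sqnorm p) \<le> B"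
  shows "(norm A)\<^sup>2 \<le> B"
proof (rule LIMSEQ_le_const2)
  show "(\<lambda>k. (norm (lincomb (coef A) (sq k)))\<^sup>2) \<longlonglongrightarrow> (norm A)\<^sup>2"
    by (intro tendsto_intros A2_expand(1) A)
  show "\<exists>N. \<forall>n\<ge>N. (norm (lincomb (coef A) (sq n)))\<^sup>2 \<le> B"
    by (subst norm_lincomb) (auto intro!: B)
qed

text \<open>Termwise comparison of two coefficient sums. Injectivity of \<open>\<iota>\<close> on
  the support of \<open>A\<close> keeps the images of different indices from being counted twice in
  Bessel's inequality for \<open>G\<close>.\<close>

lemma norm_lower_bound:
  assumes A: "A \<in> A2" and inj: "inj_on \<iota> {p. coef A p \<noteq> 0}" and t: "0 < t"
    and le: "\<And>p. coef A p \<noteq> 0 \<Longrightarrow> t * ((cmod (coef A p))\<^sup>2 * sqnorm p) \<le> (cmod (coef G (\<iota> p)))\<^sup>2 * sqnorm (\<iota> p)"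
  shows "t * (norm A)\<^sup>2 \<le> (norm G)\<^sup>2"
proof -
  have "(norm A)\<^sup>2 \<le> (norm G)\<^sup>2 / t"
  proof (rule norm_A2_le[OF A])
    fix S :: "(nat \<times> nat) set" assume S: "finite S"
    let ?S = "{p \<in> S. coef A p \<noteq> 0}"
    have "(\<Sum>p\<in>S. (cmod (coef A p))\<^sup>2 * sqnorm p) = (\<Sum>p\<in>?S. (cmod (coef A p))\<^sup>2 * sqnorm p)"
      using S by (intro sum.mono_neutral_right) auto
    also have "t * \<dots> \<le> (\<Sum>p\<in>?S. (cmod (coef G (\<iota> p)))\<^sup>2 * sqnorm (\<iota> p))"
      unfolding sum_distrib_left by (intro sum_mono le) auto
    also have "\<dots> = (\<Sum>p\<in>\<iota> ` ?S. (cmod (coef G p))\<^sup>2 * sqnorm p)"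
      by (subst sum.reindex) (auto intro: inj_on_subset[OF inj])
    also have "\<dots> \<le> (norm G)\<^sup>2"
      using S by (intro bessel) auto
    finally show "(\<Sum>p\<in>S. (cmod (coef A p))\<^sup>2 * sqnorm p) \<le> (norm G)\<^sup>2 / t"
      using t by (simp add: field_simps)
  qed
  then show ?thesis using t by (simp add: field_simps)
qed

text \<open>The multiples of the \<open>N\<close>-th power of \<open>z\<close>. This subspace has
  infinite codimension when \<open>N > 0\<close>, which is why the counterpart in \<open>w\<close>
  is needed as well.\<close>

definition order_z :: "nat \<Rightarrow> l2c set" where
  "order_z N = {A \<in> A2. \<forall>m<N. \<forall>n. coef A (m, n) = 0}"

text \<open>The left side is the integral of \<open>1 - |z|^2\<close> against the squared modulus of
  \<open>A\<close>. Multiplication by \<open>z\<close> raises the first index \<open>m\<close> by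
  one and multiplies the squared norm of the monomial by \<open>(m + 1) / (m + 2)\<close>, which is
  close to 1 when \<open>m\<close> is at least \<open>N\<close>.\<close>

lemma order_z_concentration:
  assumes A: "A \<in> order_z N"
  shows "(norm A)\<^sup>2 - (norm (Mul (monom_symb 1 0 0 0) A))\<^sup>2 \<le> (norm A)\<^sup>2 / (real N + 2)"
proof -
  have A2: "A \<in> A2" using A by (simp add: order_z_def)
  have "(1 - 1 / (real N + 2)) * (norm A)\<^sup>2 \<le> (norm (Mul (monom_symb 1 0 0 0) A))\<^sup>2"
  proof (rule norm_lower_bound[OF A2, where \<iota>="\<lambda>p. (Suc (fst p), snd p)"])
    fix p assume p: "coef A p \<noteq> 0"
    then have N: "N \<le> fst p" using A by (cases p) (auto simp: order_z_def not_less[symmetric])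
    have c: "coef (Mul (monom_symb 1 0 0 0) A) (Suc (fst p), snd p) = coef A p"
      using cinner_Mul_monom_symb_zmono[OF A2, of 1 0 0 0 "Suc (fst p)" "snd p"] sqnorm_pos[of "(Suc (fst p), snd p)"]
      by (simp add: coef_def)
    have "1 - 1 / (real N + 2) \<le> (real (fst p) + 1) / (real (fst p) + 2)"
    proof -
      have "1 / (real (fst p) + 2) \<le> 1 / (real N + 2)" using N by (simp add: frac_le)
      moreover have "(real (fst p) + 1) / (real (fst p) + 2) = 1 - 1 / (real (fst p) + 2)" by (simp add: field_simps)
      ultimately show ?thesis by linarith
    qed
    then have "(1 - 1 / (real N + 2)) * sqnorm p \<le> (real (fst p) + 1) / (real (fst p) + 2) * sqnorm p"
      using sqnorm_pos[of p] by (intro mult_right_mono) auto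
    also have "\<dots> = sqnorm (Suc (fst p), snd p)"
    proof -
      have *: "x / (x + 1) * (pi / x * c) = pi / (x + 1) * c" if "0 < x" for x c :: real
        using that by simp
      show ?thesis using *[of "real (fst p) + 1" "pi / (real (snd p) + 1)"] by (simp add: sqnorm_def add_ac)
    qed
    finally have "(1 - 1 / (real N + 2)) * sqnorm p * (cmod (coef A p))\<^sup>2 \<le> sqnorm (Suc (fst p), snd p) * (cmod (coef A p))\<^sup>2"
      by (rule mult_right_mono) simp
    then show "(1 - 1 / (real N + 2)) * ((cmod (coef A p))\<^sup>2 * sqnorm p)
        \<le> (cmod (coef (Mul (monom_symb 1 0 0 0) A) (Suc (fst p), snd p)))\<^sup>2 * sqnorm (Suc (fst p), snd p)"
      by (simp only: c mult_ac)
  qed (auto simp: inj_on_def prod_eq_iff field_simps)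
  then show ?thesis by (simp add: field_simps)
qed

text \<open>Multiplication by the \<open>j\<close>-th power of \<open>cnj z\<close>, followed by
  projection, lowers the first index from \<open>m + j\<close> to \<open>m\<close> and keeps the
  fraction \<open>(m + 1) / (m + j + 1)\<close> of the squared norm. Since \<open>m + j\<close> is
  at least \<open>N\<close>, little is lost. The condition \<open>j \<le> N\<close> makes the index
  shift injective.\<close>

lemma order_z_almost_invariant:
  assumes A: "A \<in> order_z N" and j: "j \<le> N"
  shows "(norm (Mul (monom_symb 0 j 0 0) A - bproj (Mul (monom_symb 0 j 0 0) A)))\<^sup>2 \<le> real j / (real N + 1) * (norm A)\<^sup>2"
proof -
  let ?G = "Mul (monom_symb 0 j 0 0) A"
  have A2: "A \<in> A2" using A by (simp add: order_z_def)
  have "(1 - real j / (real N + 1)) * (norm A)\<^sup>2 \<le> (norm (bproj ?G))\<^sup>2"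
  proof (rule norm_lower_bound[OF A2, where \<iota>="\<lambda>p. (fst p - j, snd p)"])
    have N: "N \<le> fst p" if "coef A p \<noteq> 0" for p using A that by (cases p) (auto simp: order_z_def not_less[symmetric])
    show "inj_on (\<lambda>p. (fst p - j, snd p)) {p. coef A p \<noteq> 0}"
    proof (rule inj_onI)
      fix p q assume "p \<in> {p. coef A p \<noteq> 0}" "q \<in> {p. coef A p \<noteq> 0}" "(fst p - j, snd p) = (fst q - j, snd q)"
      moreover then have "j \<le> fst p" "j \<le> fst q" using N[of p] N[of q] j by auto
      ultimately show "p = q" by (auto simp: prod_eq_iff)
    qed
    fix p assume p: "coef A p \<noteq> 0"
    obtain m where m: "fst p = m + j" using N[OF p] j by (metis add.commute le_Suc_ex le_trans)
    have g: "sqnorm (m, snd p) * (real m + 1) = sqnorm p * (real m + real j + 1)"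
    proof -
      have *: "pi / x * c * x = pi * c" if "0 < x" for x c :: real using that by simp
      show ?thesis using *[of "real m + 1" "pi / (real (snd p) + 1)"] *[of "real m + real j + 1" "pi / (real (snd p) + 1)"]
        by (simp add: sqnorm_def m add_ac)
    qed
    have "coef (bproj ?G) (m, snd p) * of_real (sqnorm (m, snd p)) = coef A p * of_real (sqnorm p)"
    proof -
      have "(j + m, snd p) = p" using m by (simp add: prod_eq_iff)
      then show ?thesis
        using cinner_Mul_monom_symb_zmono[OF A2, of 0 j 0 0 m "snd p"] by (simp add: cinner_zmono_coef)
    qed
    then have "cmod (coef (bproj ?G) (m, snd p)) * sqnorm (m, snd p) = cmod (coef A p) * sqnorm p"
      using sqnorm_pos by (metis abs_of_pos norm_mult norm_of_real)
    then have c: "cmod (coef (bproj ?G) (m, snd p)) = cmod (coef A p) * sqnorm p / sqnorm (m, snd p)"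
      using sqnorm_pos[of "(m, snd p)"] by (simp add: field_simps)
    have "1 - real j / (real N + 1) \<le> (real m + 1) / (real m + real j + 1)"
    proof -
      have "real j / (real m + real j + 1) \<le> real j / (real N + 1)" using N[OF p] m by (intro divide_left_mono) auto
      moreover have "(real m + 1) / (real m + real j + 1) = 1 - real j / (real m + real j + 1)" by (simp add: field_simps)
      ultimately show ?thesis by linarith
    qed
    also have "\<dots> = sqnorm p / sqnorm (m, snd p)"
      using g sqnorm_pos[of "(m, snd p)"] by (simp add: field_simps)
    finally have "(1 - real j / (real N + 1)) * ((cmod (coef A p))\<^sup>2 * sqnorm p) \<le> sqnorm p / sqnorm (m, snd p) * ((cmod (coef A p))\<^sup>2 * sqnorm p)"
      using sqnorm_pos[of p] by (intro mult_right_mono) auto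
    also have "\<dots> = (cmod (coef (bproj ?G) (m, snd p)))\<^sup>2 * sqnorm (m, snd p)"
      unfolding c using sqnorm_pos[of "(m, snd p)"] by (simp add: power2_eq_square field_simps)
    finally show "(1 - real j / (real N + 1)) * ((cmod (coef A p))\<^sup>2 * sqnorm p)
        \<le> (cmod (coef (bproj ?G) (fst p - j, snd p)))\<^sup>2 * sqnorm (fst p - j, snd p)"
      by (simp add: m)
  qed (use j in \<open>simp add: field_simps\<close>)
  moreover have "(norm ?G)\<^sup>2 \<le> (norm A)\<^sup>2"
    by (intro power_mono norm_monom_symb_le) simp
  ultimately show ?thesis
    using norm_bproj_split[of ?G] unfolding left_diff_distrib mult_1_left by linarith
qed

section \<open>Restriction to the fibres\<close>

lemma integrable_bidisk_snd:
  fixes h :: "complex \<Rightarrow> 'b::{banach, second_countable_topology}"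
  assumes "integrable disc_measure h"
  shows "integrable bidisk_measure (\<lambda>p. h (snd p))"
  unfolding bidisk_measure_def
proof (rule disc_pair.Fubini_integrable)
  show "(\<lambda>p. h (snd p)) \<in> borel_measurable (disc_measure \<Otimes>\<^sub>M disc_measure)"
    using assms by (intro measurable_compose[OF measurable_snd]) auto
qed (use assms in auto)

lemma l2fun_snd:
  assumes "continuous_on (ball 0 1) g" "integrable disc_measure (\<lambda>w. (cmod (g w))\<^sup>2)"
  shows "l2fun (\<lambda>p. g (snd p))"
  unfolding l2fun_def
proof
  show "continuous_on bidisk (\<lambda>p. g (snd p))"
    by (rule continuous_on_compose2[OF assms(1)]) (auto simp: bidisk_def intro: continuous_intros)
  show "integrable bidisk_measure (\<lambda>z. (cmod (g (snd z)))\<^sup>2)"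
    by (rule integrable_bidisk_snd[OF assms(2)])
qed

definition slice_ok :: "complex \<Rightarrow> l2c \<Rightarrow> bool" where
  "slice_ok z F \<longleftrightarrow> z \<in> ball 0 1 \<and> integrable disc_measure (\<lambda>w. (cmod (ev F (z, w)))\<^sup>2)"

text \<open>The slice is stored as a function on the bidisk that ignores its first variable, so the
  operators on \<open>l2c\<close> can be applied to it; the price is the area \<open>pi\<close> in
  norms and pairings. For a slice that is not square integrable \<open>to_l2\<close> returns 0,
  hence the guard \<open>slice_ok\<close>.\<close>

definition slice :: "complex \<Rightarrow> l2c \<Rightarrow> l2c" where
  "slice z F = to_l2 (\<lambda>p. ev F (z, snd p))"

lemma AE_slice_ok: "AE z in disc_measure. slice_ok z F"
  using cinner_Fubini(3)[of F F] AE_space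
proof eventually_elim
  case (elim z)
  have "(\<lambda>w. Re (ev F (z, w) * cnj (ev F (z, w)))) = (\<lambda>w. (cmod (ev F (z, w)))\<^sup>2)"
    by (metis Re_complex_of_real complex_norm_square)
  then show ?case using integrable_Re[OF elim(1)] elim(2) by (simp add: slice_ok_def)
qed

lemma continuous_ev_slice: "z \<in> ball 0 1 \<Longrightarrow> continuous_on (ball 0 1) (\<lambda>w. ev F (z, w))"
  by (rule continuous_on_compose2[OF continuous_ev]) (auto simp: bidisk_def intro!: continuous_intros)

lemma l2fun_slice: "slice_ok z F \<Longrightarrow> l2fun (\<lambda>p. ev F (z, snd p))"
  unfolding slice_ok_def by (intro l2fun_snd) (auto intro: continuous_ev_slice)

lemma ev_slice: "slice_ok z F \<Longrightarrow> p \<in> bidisk \<Longrightarrow> ev (slice z F) p = ev F (z, snd p)"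
  unfolding slice_def by (rule ev_to_l2[OF l2fun_slice])

lemma cinner_slice:
  assumes "slice_ok z F" "slice_ok z G"
  shows "cinner (slice z F) (slice z G) = of_real pi * (LINT w|disc_measure. ev F (z, w) * cnj (ev G (z, w)))"
proof -
  have "cinner (slice z F) (slice z G) = (LINT z|disc_measure. 1) * (LINT w|disc_measure. ev F (z, w) * cnj (ev G (z, w)))"
    by (rule Fubini_product) (simp add: ev_slice assms bidisk_def)
  then show ?thesis by (simp add: scaleR_conv_of_real)
qed


definition fibre_sq :: "l2c \<Rightarrow> complex \<Rightarrow> real" where
  "fibre_sq F z = (LINT w|disc_measure. (cmod (ev F (z, w)))\<^sup>2)"

lemma fibre_sq_nonneg: "0 \<le> fibre_sq F z"
  by (simp add: fibre_sq_def)

lemma fibre_sq_integral: "integrable disc_measure (fibre_sq F)" "(LINT z|disc_measure. fibre_sq F z) = (norm F)\<^sup>2"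
proof -
  have int: "integrable (disc_measure \<Otimes>\<^sub>M disc_measure) (\<lambda>p. (cmod (ev F p))\<^sup>2)"
    using l2fun_ev[of F] unfolding l2fun_def bidisk_measure_def by blast
  show "integrable disc_measure (fibre_sq F)"
    unfolding fibre_sq_def[abs_def] by (rule disc_pair.integrable_fst'[OF int])
  show "(LINT z|disc_measure. fibre_sq F z) = (norm F)\<^sup>2"
    unfolding fibre_sq_def norm_sq bidisk_measure_def by (rule disc_pair.integral_fst'[OF int])
qed

lemma norm_slice: "slice_ok z F \<Longrightarrow> norm (slice z F) = sqrt pi * sqrt (fibre_sq F z)"
proof -
  assume ok: "slice_ok z F"
  have "complex_of_real ((norm (slice z F))\<^sup>2) = of_real pi * (LINT w|disc_measure. complex_of_real ((cmod (ev F (z, w)))\<^sup>2))"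
    unfolding cinner_self[symmetric] cinner_slice[OF ok ok] by (simp add: complex_norm_square del: of_real_power)
  also have "\<dots> = of_real (pi * fibre_sq F z)"
    by (simp add: fibre_sq_def del: of_real_power)
  finally have "(norm (slice z F))\<^sup>2 = pi * fibre_sq F z" by (simp only: of_real_eq_iff)
  then show ?thesis by (metis norm_ge_zero real_sqrt_mult real_sqrt_unique)
qed

lemma slice_simps:
  assumes "slice_ok z F" "slice_ok z G"
  shows "slice z (F + G) = slice z F + slice z G" "slice_ok z (F + G)"
    "slice z (F - G) = slice z F - slice z G" "slice_ok z (F - G)"
proof -
  have z: "z \<in> ball 0 1" using assms by (simp add: slice_ok_def)
  have le: "(cmod (a + b))\<^sup>2 \<le> 2 * ((cmod a)\<^sup>2 + (cmod b)\<^sup>2)" for a b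
  proof -
    have "(cmod (a + b))\<^sup>2 \<le> (cmod a + cmod b)\<^sup>2"
      by (intro power_mono norm_triangle_ineq) auto
    also have "\<dots> \<le> 2 * ((cmod a)\<^sup>2 + (cmod b)\<^sup>2)"
      using sum_squares_bound[of "cmod a" "cmod b"] by (simp add: power2_sum)
    finally show ?thesis .
  qed
  have int: "integrable disc_measure (\<lambda>w. 2 * ((cmod (ev F (z, w)))\<^sup>2 + (cmod (ev G (z, w)))\<^sup>2))"
    using assms by (simp add: slice_ok_def)
  have m: "(\<lambda>w. (cmod (ev H (z, w)))\<^sup>2) \<in> borel_measurable disc_measure" for H
    by (intro measurable_disc continuous_intros continuous_ev_slice z)
  show ok: "slice_ok z (F + G)" unfolding slice_ok_def
  proof (rule conjI[OF z], rule Bochner_Integration.integrable_bound[OF int m])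
    show "AE w in disc_measure. norm ((cmod (ev (F + G) (z, w)))\<^sup>2) \<le> norm (2 * ((cmod (ev F (z, w)))\<^sup>2 + (cmod (ev G (z, w)))\<^sup>2))"
      using le by (intro AE_I2) simp
  qed
  show ok': "slice_ok z (F - G)" unfolding slice_ok_def
  proof (rule conjI[OF z], rule Bochner_Integration.integrable_bound[OF int m])
    show "AE w in disc_measure. norm ((cmod (ev (F - G) (z, w)))\<^sup>2) \<le> norm (2 * ((cmod (ev F (z, w)))\<^sup>2 + (cmod (ev G (z, w)))\<^sup>2))"
      using le[of "ev F (z, w)" "- ev G (z, w)" for w] by (intro AE_I2) simp
  qed
  show "slice z (F + G) = slice z F + slice z G" "slice z (F - G) = slice z F - slice z G"
    by (rule l2c_eqI; simp add: ev_slice assms ok ok')+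
qed

lemma slice_Mul:
  assumes ok: "slice_ok z F" and \<phi>: "symb \<phi>"
  shows "slice z (Mul \<phi> F) = Mul (\<lambda>p. \<phi> (z, snd p)) (slice z F)" "slice_ok z (Mul \<phi> F)" "symb (\<lambda>p. \<phi> (z, snd p))"
proof -
  have z: "z \<in> ball 0 1" using ok by (simp add: slice_ok_def)
  have zb: "(z, snd p) \<in> bidisk" if "p \<in> bidisk" for p using z that by (auto simp: bidisk_def)
  obtain B where B: "0 \<le> B" "\<And>p. p \<in> bidisk \<Longrightarrow> cmod (\<phi> p) \<le> B" using symb_bound[OF \<phi>] by blast
  have "continuous_on bidisk (\<lambda>p. \<phi> (z, snd p))"
    by (rule continuous_on_compose2[of bidisk \<phi>]) (use \<phi> zb in \<open>auto simp: symb_def intro!: continuous_intros\<close>)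
  then show s: "symb (\<lambda>p. \<phi> (z, snd p))"
    by (rule symbI[where B=B]) (use B zb in auto)
  show ok': "slice_ok z (Mul \<phi> F)" unfolding slice_ok_def
  proof (rule conjI[OF z], rule Bochner_Integration.integrable_bound)
    show "integrable disc_measure (\<lambda>w. B\<^sup>2 * (cmod (ev F (z, w)))\<^sup>2)"
      using ok by (simp add: slice_ok_def)
    show "(\<lambda>w. (cmod (ev (Mul \<phi> F) (z, w)))\<^sup>2) \<in> borel_measurable disc_measure"
      by (intro measurable_disc continuous_intros continuous_ev_slice z)
    show "AE w in disc_measure. norm ((cmod (ev (Mul \<phi> F) (z, w)))\<^sup>2) \<le> norm (B\<^sup>2 * (cmod (ev F (z, w)))\<^sup>2)"
    proof (rule AE_I2)
      fix w assume "w \<in> space disc_measure"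
      then have "cmod (\<phi> (z, w)) \<le> B" using z by (intro B) (simp add: bidisk_def)
      then show "norm ((cmod (ev (Mul \<phi> F) (z, w)))\<^sup>2) \<le> norm (B\<^sup>2 * (cmod (ev F (z, w)))\<^sup>2)"
        by (simp add: ev_Mul \<phi> norm_mult power_mult_distrib mult_right_mono power_mono)
    qed
  qed
  show "slice z (Mul \<phi> F) = Mul (\<lambda>p. \<phi> (z, snd p)) (slice z F)"
    by (rule l2c_eqI) (simp add: ev_slice ok ok' ev_Mul \<phi> s)
qed

lemma slice_cscale:
  assumes ok: "slice_ok z F"
  shows "slice z (c *\<^sub>C F) = c *\<^sub>C slice z F" "slice_ok z (c *\<^sub>C F)"
proof -
  show ok': "slice_ok z (c *\<^sub>C F)"
    using ok by (simp add: slice_ok_def norm_mult power_mult_distrib)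
  show "slice z (c *\<^sub>C F) = c *\<^sub>C slice z F"
    by (rule l2c_eqI) (simp add: ev_slice ok ok')
qed

lemma slice_A2: "slice_ok z F \<Longrightarrow> F \<in> A2 \<Longrightarrow> slice z F \<in> A2"
proof -
  assume ok: "slice_ok z F" and F: "F \<in> A2"
  have "(\<lambda>w. ev F (z, w)) holomorphic_on ball 0 1"
    using F ok by (intro holomorphic2_on_slice2) (auto simp: A2_def slice_ok_def)
  from holomorphic2_on_snd[OF this] show ?thesis
    unfolding slice_def by (intro A2_to_l2 l2fun_slice ok)
qed

lemma slice_ok_l1: "slice_ok z F \<Longrightarrow> integrable disc_measure (\<lambda>w. ev F (z, w))"
proof -
  assume ok: "slice_ok z F"
  have x: "x \<le> 1 + x\<^sup>2" for x :: real
  proof -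
    have "2 * x \<le> x\<^sup>2 + 1" using sum_squares_bound[of x 1] by simp
    moreover have "0 \<le> x\<^sup>2" by simp
    ultimately show ?thesis by linarith
  qed
  show ?thesis
  proof (rule Bochner_Integration.integrable_bound)
    show "integrable disc_measure (\<lambda>w. 1 + (cmod (ev F (z, w)))\<^sup>2)"
      using ok by (simp add: slice_ok_def)
    show "(\<lambda>w. ev F (z, w)) \<in> borel_measurable disc_measure"
      using ok by (intro measurable_disc continuous_ev_slice) (simp add: slice_ok_def)
    show "AE w in disc_measure. norm (ev F (z, w)) \<le> norm (1 + (cmod (ev F (z, w)))\<^sup>2)"
      using x by (intro AE_I2) simp
  qed
qed

text \<open>The \<open>w\<close>-moments of the slices of \<open>A\<close> are power series in
  \<open>z\<close> whose coefficients are read off from \<open>A\<close>. This makes slices of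
  different functions comparable through \<open>coef\<close>.\<close>

lemma slice_moment:
  assumes A: "A \<in> A2" and ok: "slice_ok z A"
  shows "(\<lambda>K. \<Sum>m<K. coef A (m, q) * (of_real pi / of_nat (Suc q)) * z ^ m) \<longlonglongrightarrow> (LINT w|disc_measure. ev A (z, w) * cnj w ^ q)"
proof -
  have z: "z \<in> ball 0 1" using ok by (simp add: slice_ok_def)
  define f where "f w = ev A (z, w)" for w
  define g where "g K w = ev (lincomb (coef A) (sq K)) (z, w)" for K w
  have hol: "f holomorphic_on ball 0 1" unfolding f_def
    using A z by (intro holomorphic2_on_slice2) (auto simp: A2_def)
  have holg: "g K holomorphic_on ball 0 1" for K unfolding g_def
    using A2_lincomb z by (intro holomorphic2_on_slice2) (auto simp: A2_def)
  have g: "g K w = (\<Sum>p\<in>sq K. coef A p * z ^ fst p * w ^ snd p)" if "w \<in> ball 0 1" for K w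
    unfolding g_def using that z by (subst ev_lincomb) (auto simp: bidisk_def mult.assoc)
  have intg: "integrable disc_measure (g K)" for K
  proof -
    have "integrable disc_measure (\<lambda>w. \<Sum>p\<in>sq K. coef A p * z ^ fst p * w ^ snd p)"
      using integrable_disc_monom[of _ 0] by (intro Bochner_Integration.integrable_sum integrable_mult_right) simp
    then show ?thesis by (subst Bochner_Integration.integrable_cong[OF refl, of _ _ "\<lambda>w. \<Sum>p\<in>sq K. coef A p * z ^ fst p * w ^ snd p"]) (auto simp: g)
  qed
  have gi: "(LINT w|disc_measure. g K w * cnj w ^ q) = (\<Sum>m<K. coef A (m, q) * (of_real pi / of_nat (Suc q)) * z ^ m)" if "q < K" for K
  proof -
    have "(LINT w|disc_measure. g K w * cnj w ^ q) = (LINT w|disc_measure. (\<Sum>p\<in>sq K. coef A p * z ^ fst p * (w ^ snd p * cnj w ^ q)))"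
      by (intro Bochner_Integration.integral_cong) (auto simp: g sum_distrib_right mult.assoc)
    also have "\<dots> = (\<Sum>p\<in>sq K. coef A p * z ^ fst p * moment (snd p) q)"
      unfolding moment_def by (subst Bochner_Integration.integral_sum) (auto intro!: integrable_mult_right integrable_disc_monom)
    also have "\<dots> = (\<Sum>m<K. \<Sum>n<K. coef A (m, n) * z ^ m * moment n q)"
      by (simp add: sum.cartesian_product split_beta')
    also have "\<dots> = (\<Sum>m<K. \<Sum>n<K. if n = q then coef A (m, q) * z ^ m * (of_real pi / of_nat (Suc q)) else 0)"
      by (intro sum.cong refl) (auto simp: moment_eq)
    also have "\<dots> = (\<Sum>m<K. coef A (m, q) * (of_real pi / of_nat (Suc q)) * z ^ m)"
      using that by (simp add: mult_ac)
    finally show ?thesis .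
  qed
  have "cmod z < 1" using z by simp
  then obtain \<rho> where \<rho>: "cmod z < \<rho>" "\<rho> < 1" using dense by blast
  then have \<rho>0: "0 < \<rho>" using norm_ge_zero[of z] by linarith
  have ul: "uniform_limit (ball 0 \<rho>) g f sequentially"
    unfolding g_def f_def
    by (rule uniform_limit_compose'[OF A2_expand(2)[OF A \<rho>0 \<rho>(2)]]) (use \<rho> in auto)
  \<comment> \<open>The slices of the partial sums are only known to converge locally uniformly.
    That suffices, since a moment is a multiple of a derivative at 0.\<close>
  have "(\<lambda>K. (deriv ^^ q) (g K) 0) \<longlonglongrightarrow> (deriv ^^ q) f 0"
    by (rule higher_deriv_complex_uniform_limit[OF ul])
      (use \<rho>0 \<rho> holg in \<open>auto intro!: always_eventually holomorphic_on_subset[OF holg]\<close>)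
  then have "(\<lambda>K. of_real pi / of_nat (Suc q) * ((deriv ^^ q) (g K) 0 / fact q)) \<longlonglongrightarrow> of_real pi / of_nat (Suc q) * ((deriv ^^ q) f 0 / fact q)"
    by (intro tendsto_mult tendsto_divide tendsto_const) simp_all
  then have "(\<lambda>K. LINT w|disc_measure. g K w * cnj w ^ q) \<longlonglongrightarrow> (LINT w|disc_measure. f w * cnj w ^ q)"
    unfolding integral_disc_taylor[OF holg intg] integral_disc_taylor[OF hol slice_ok_l1[OF ok, folded f_def]] .
  then show ?thesis unfolding f_def
  proof (rule Lim_transform_eventually)
    show "\<forall>\<^sub>F K in sequentially. (LINT w|disc_measure. g K w * cnj w ^ q) = (\<Sum>m<K. coef A (m, q) * (of_real pi / of_nat (Suc q)) * z ^ m)"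
      using eventually_gt_at_top[of q] by eventually_elim (rule gi)
  qed
qed

lemma coef_slice:
  assumes ok: "slice_ok z F"
  shows "coef (slice z F) (m, n) = (LINT w|disc_measure. cnj w ^ m) * (LINT w|disc_measure. ev F (z, w) * cnj w ^ n) / of_real (sqnorm (m, n))"
proof -
  have "cinner (slice z F) (zmono (m, n)) = (LINT w|disc_measure. cnj w ^ m) * (LINT w|disc_measure. ev F (z, w) * cnj w ^ n)"
    by (rule Fubini_product) (simp add: ev_slice ok ev_zmono bidisk_def mult_ac)
  then show ?thesis by (simp add: coef_def)
qed

text \<open>The symbol does not involve \<open>z\<close>, so the projection acts on the second index
  alone: the weight \<open>pi / (m + 1)\<close> from the first variable occurs on both sides and
  cancels. Hence both slices have the same \<open>w\<close>-moments.\<close>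

lemma AE_slice_bproj_cnj:
  assumes A: "A \<in> A2"
  shows "AE z in disc_measure. slice z (bproj (Mul (monom_symb 0 0 0 l) A)) = bproj (slice z (Mul (monom_symb 0 0 0 l) A))"
  using AE_slice_ok[of A] AE_slice_ok[of "bproj (Mul (monom_symb 0 0 0 l) A)"]
proof eventually_elim
  case (elim z)
  let ?B = "bproj (Mul (monom_symb 0 0 0 l) A)"
  have ok: "slice_ok z (Mul (monom_symb 0 0 0 l) A)" by (rule slice_Mul(2)[OF elim(1) symb_monom_symb])
  have "(LINT w|disc_measure. ev (Mul (monom_symb 0 0 0 l) A) (z, w) * cnj w ^ n) = (LINT w|disc_measure. ev ?B (z, w) * cnj w ^ n)" for n
  proof -
    have c: "coef ?B (m, n) * (of_real pi / of_nat (Suc n)) = coef A (m, l + n) * (of_real pi / of_nat (Suc (l + n)))" for m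
    proof -
      have "coef ?B (m, n) * of_real (sqnorm (m, n)) = coef A (m, l + n) * of_real (sqnorm (m, l + n))"
        using cinner_Mul_monom_symb_zmono[OF A, of 0 0 0 l m n] by (simp add: cinner_zmono_coef)
      then have "(of_real pi / of_nat (Suc m)) * (coef ?B (m, n) * (of_real pi / of_nat (Suc n)))
          = (of_real pi / of_nat (Suc m)) * (coef A (m, l + n) * (of_real pi / of_nat (Suc (l + n))))"
        by (simp add: sqnorm_def mult_ac del: of_nat_Suc)
      then show ?thesis by (subst (asm) mult_left_cancel) (simp_all del: of_nat_Suc)
    qed
    have "(LINT w|disc_measure. ev (Mul (monom_symb 0 0 0 l) A) (z, w) * cnj w ^ n) = (LINT w|disc_measure. ev A (z, w) * cnj w ^ (l + n))"
      by (simp add: ev_Mul monom_symb_def power_add mult_ac)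
    moreover have "(LINT w|disc_measure. ev A (z, w) * cnj w ^ (l + n)) = (LINT w|disc_measure. ev ?B (z, w) * cnj w ^ n)"
      using slice_moment[OF A elim(1), of "l + n"] slice_moment[OF bproj_in elim(2), of n]
      unfolding c by (rule LIMSEQ_unique)
    ultimately show ?thesis by simp
  qed
  then have "coef (slice z (Mul (monom_symb 0 0 0 l) A)) p = coef (slice z ?B) p" for p
    by (cases p) (simp add: coef_slice ok elim(2))
  then show ?case by (intro bproj_unique[symmetric] slice_A2 elim bproj_in)
qed

text \<open>The holomorphic factor \<open>w ^ k\<close> is absorbed into \<open>A\<close>, which
  reduces the claim to a power of \<open>cnj w\<close>.\<close>

lemma AE_slice_bproj:
  assumes A: "A \<in> A2"
  shows "AE z in disc_measure. slice z (bproj (Mul (monom_symb 0 0 k l) A)) = bproj (slice z (Mul (monom_symb 0 0 k l) A))"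
proof -
  have "Mul (monom_symb 0 0 k l) A = Mul (monom_symb 0 0 0 l) (Mul (monom_symb 0 0 k 0) A)"
    by (rule l2c_eqI) (simp add: ev_Mul monom_symb_def)
  then show ?thesis
    using AE_slice_bproj_cnj[OF A2_Mul[OF symb_monom_symb holomorphic2_monom_symb A]] by simp
qed

section \<open>Estimates on single fibres and their integration\<close>

lemma closure_bidisk: "closure bidisk = cball 0 1 \<times> cball 0 1"
  by (simp add: bidisk_def closure_Times)

lemma symb_continuous_closure:
  assumes "continuous_on (closure bidisk) \<phi>" shows "symb \<phi>"
  unfolding symb_def
proof
  show "continuous_on bidisk \<phi>" by (rule continuous_on_subset[OF assms closure_subset])
  have "compact (closure bidisk)" unfolding closure_bidisk by (intro compact_Times) auto
  then have "bounded (\<phi> ` closure bidisk)" using assms compact_continuous_image compact_imp_bounded by blast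
  then show "bounded (\<phi> ` bidisk)" by (rule bounded_subset) (intro image_mono closure_subset)
qed

text \<open>If \<open>a0\<close> is holomorphic, \<open>a0\<close> times \<open>F\<close> is a
  competitor for the projection, and the Hankel vector is small. If \<open>b0\<close> is
  holomorphic, the Hankel vector is orthogonal to \<open>b0\<close> times \<open>K\<close>, and only
  \<open>b - b0\<close> contributes. The bound is the same in both cases, so later nothing depends
  on which one holds in a given fibre.\<close>

lemma fibre_estimate:
  assumes F: "F \<in> A2" and K: "K \<in> A2" and s: "symb a" "symb b" "symb a0" "symb b0"
    and M: "\<And>p. p \<in> bidisk \<Longrightarrow> cmod (a p) \<le> M" "\<And>p. p \<in> bidisk \<Longrightarrow> cmod (b p) \<le> M"
    and \<epsilon>: "\<And>p. p \<in> bidisk \<Longrightarrow> cmod (a p - a0 p) \<le> \<epsilon>" "\<And>p. p \<in> bidisk \<Longrightarrow> cmod (b p - b0 p) \<le> \<epsilon>"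
    and hol: "holomorphic2_on a0 bidisk \<or> holomorphic2_on b0 bidisk"
  shows "cmod (cinner (hankel_l2 a F) (Mul b K)) \<le> \<epsilon> * M * (norm F * norm K)"
proof -
  have "(0, 0) \<in> bidisk" by (simp add: bidisk_def)
  then have nn: "0 \<le> M" "0 \<le> \<epsilon>" using M(1) \<epsilon>(1) norm_ge_zero order_trans by blast+
  have Muld: "Mul (\<lambda>z. f z - g z) X = Mul f X - Mul g X" if "symb f" "symb g" for f g X
    using that by (intro l2c_eqI) (simp add: ev_Mul symb_simps algebra_simps)
  show ?thesis using hol
  proof
    assume "holomorphic2_on a0 bidisk"
    then have "norm (hankel_l2 a F) \<le> norm (Mul a F - Mul a0 F)"
      unfolding hankel_l2_def by (intro norm_minus_bproj_le A2_Mul s F)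
    also have "\<dots> \<le> \<epsilon> * norm F"
      unfolding Muld[OF s(1) s(3), symmetric] by (intro norm_Mul_le symb_diff s \<epsilon> nn)
    finally have "norm (hankel_l2 a F) * norm (Mul b K) \<le> (\<epsilon> * norm F) * (M * norm K)"
      using nn by (intro mult_mono norm_Mul_le s M) auto
    then show ?thesis using cmod_cinner_le[of "hankel_l2 a F" "Mul b K"] by (simp add: mult_ac)
  next
    assume h: "holomorphic2_on b0 bidisk"
    have "cinner (hankel_l2 a F) (Mul b0 K) = 0" by (intro hankel_l2_orth A2_Mul s h K)
    then have "cinner (hankel_l2 a F) (Mul b K) = cinner (hankel_l2 a F) (Mul b K - Mul b0 K)"
      by (simp add: cinner_diff_right)
    also have "cmod \<dots> \<le> norm (hankel_l2 a F) * norm (Mul b K - Mul b0 K)" by (rule cmod_cinner_le)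
    also have "\<dots> \<le> (M * norm F) * (\<epsilon> * norm K)"
      unfolding Muld[OF s(2) s(4), symmetric] using nn
      by (intro mult_mono order_trans[OF norm_hankel_l2_le_Mul] norm_Mul_le symb_diff s \<epsilon> M) auto
    finally show ?thesis by (simp add: mult_ac)
  qed
qed

text \<open>Weighted inequality between geometric and arithmetic mean; the free weight
  \<open>t\<close> balances the two terms after integration.\<close>

lemma sqrt_mult_le:
  fixes x y t :: real
  assumes "0 \<le> x" "0 \<le> y" "0 < t" shows "sqrt x * sqrt y \<le> (t * x + y / t) / 2"
proof -
  have "0 \<le> (sqrt (t * x) - sqrt (y / t))\<^sup>2" by simp
  also have "\<dots> = t * x + y / t - 2 * (sqrt (t * x) * sqrt (y / t))"
    using assms by (simp add: power2_diff)
  also have "sqrt (t * x) * sqrt (y / t) = sqrt x * sqrt y"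
    using assms by (simp add: real_sqrt_mult[symmetric])
  finally show ?thesis by simp
qed

text \<open>Cauchy-Schwarz over the fibres in the form of pointwise weighted means, which linearises
  the integrand. The part with \<open>1 - |z|^2\<close> gains \<open>1 / sqrt (N + 2)\<close>,
  because \<open>A\<close> has little mass away from \<open>|z| = 1\<close>.\<close>

lemma integrate_fibre_estimate:
  assumes A: "A \<in> order_z N" and c: "0 \<le> c1" "0 \<le> c2"
    and le: "AE z in disc_measure. cmod (LINT w|disc_measure. ev X (z, w) * cnj (ev Y (z, w)))
       \<le> (c1 + c2 * (1 - (cmod z)\<^sup>2)) * (sqrt (fibre_sq A z) * sqrt (fibre_sq h z))"
  shows "cmod (cinner X Y) \<le> (c1 + c2 / sqrt (real N + 2)) * (norm A * norm h)"
proof (cases "A = 0 \<or> h = 0")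
  case True
  then have "AE z in disc_measure. (LINT w|disc_measure. ev X (z, w) * cnj (ev Y (z, w))) = 0"
    using le by (auto simp: fibre_sq_def)
  then have "cinner X Y = 0" unfolding cinner_Fubini(1) by (rule integral_eq_zero_AE)
  then show ?thesis using c by simp
next
  case False
  \<comment> \<open>The weights that make the two terms equal: \<open>t\<close> turns both into
    \<open>\<alpha> * \<beta>\<close>, and \<open>t * s\<close> turns both into
    \<open>\<alpha> * \<beta> / s\<close>. This requires nonzero norms, hence the case
    distinction.\<close>
  define \<alpha> \<beta> t s where "\<alpha> = norm A" and "\<beta> = norm h" and "t = \<beta> / \<alpha>" and "s = sqrt (real N + 2)"
  have pos: "0 < \<alpha>" "0 < \<beta>" "0 < t" "0 < s" using False by (auto simp: \<alpha>_def \<beta>_def t_def s_def)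
  let ?z2 = "\<lambda>z::complex. 1 - (cmod z)\<^sup>2"
  let ?B = "\<lambda>z. c1 * ((t * fibre_sq A z + fibre_sq h z / t) / 2) + c2 * ((t * s * (?z2 z * fibre_sq A z) + fibre_sq h z / (t * s)) / 2)"
  have z1: "(\<lambda>z. ?z2 z * fibre_sq A z) = (\<lambda>z. fibre_sq A z - fibre_sq (Mul (monom_symb 1 0 0 0) A) z)"
    by (simp add: fibre_sq_def ev_Mul monom_symb_def norm_mult power_mult_distrib algebra_simps)
  have iz: "integrable disc_measure (\<lambda>z. ?z2 z * fibre_sq A z)"
    unfolding z1 by (intro Bochner_Integration.integrable_diff fibre_sq_integral)
  have "(LINT z|disc_measure. ?z2 z * fibre_sq A z) \<le> \<alpha>\<^sup>2 / s\<^sup>2"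
    unfolding z1 using order_z_concentration[OF A] by (simp add: fibre_sq_integral \<alpha>_def s_def)
  then have iz': "t * s * (LINT z|disc_measure. ?z2 z * fibre_sq A z) \<le> t * s * (\<alpha>\<^sup>2 / s\<^sup>2)"
    using pos by (intro mult_left_mono) auto
  have iB: "integrable disc_measure ?B"
    by (intro Bochner_Integration.integrable_add integrable_mult_right integrable_divide iz fibre_sq_integral)
  have "cmod (cinner X Y) \<le> (LINT z|disc_measure. cmod (LINT w|disc_measure. ev X (z, w) * cnj (ev Y (z, w))))"
    unfolding cinner_Fubini(1) by (rule integral_norm_bound)
  also have "\<dots> \<le> (LINT z|disc_measure. ?B z)"
  proof (rule integral_mono_AE[OF integrable_norm[OF cinner_Fubini(2)] iB])
    show "AE z in disc_measure. cmod (LINT w|disc_measure. ev X (z, w) * cnj (ev Y (z, w))) \<le> ?B z"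
      using le AE_space
    proof eventually_elim
      case (elim z)
      then have z: "0 \<le> ?z2 z" "?z2 z \<le> 1" by (auto simp: abs_square_le_1 power_le_one_iff)
      \<comment> \<open>Only the square root of \<open>1 - |z|^2\<close> is assigned to the factor
        \<open>A\<close>, so that its square meets \<open>order_z_concentration\<close>.\<close>
      have "?z2 z \<le> sqrt (?z2 z)"
        using z by (intro real_le_rsqrt) (simp add: power2_eq_square mult_left_le)
      then have "?z2 z * (sqrt (fibre_sq A z) * sqrt (fibre_sq h z)) \<le> sqrt (?z2 z * fibre_sq A z) * sqrt (fibre_sq h z)"
        unfolding real_sqrt_mult mult.assoc by (intro mult_right_mono) (auto simp: fibre_sq_nonneg)
      also have "\<dots> \<le> (t * s * (?z2 z * fibre_sq A z) + fibre_sq h z / (t * s)) / 2"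
        using z pos by (intro sqrt_mult_le) (auto simp: fibre_sq_nonneg)
      finally have 1: "?z2 z * (sqrt (fibre_sq A z) * sqrt (fibre_sq h z)) \<le> (t * s * (?z2 z * fibre_sq A z) + fibre_sq h z / (t * s)) / 2" .
      have 2: "sqrt (fibre_sq A z) * sqrt (fibre_sq h z) \<le> (t * fibre_sq A z + fibre_sq h z / t) / 2"
        using pos by (intro sqrt_mult_le fibre_sq_nonneg)
      have "(c1 + c2 * ?z2 z) * (sqrt (fibre_sq A z) * sqrt (fibre_sq h z)) =
        c1 * (sqrt (fibre_sq A z) * sqrt (fibre_sq h z)) + c2 * (?z2 z * (sqrt (fibre_sq A z) * sqrt (fibre_sq h z)))"
        by (simp add: algebra_simps)
      also have "\<dots> \<le> ?B z" by (intro add_mono mult_left_mono 1 2 c)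
      finally show ?case using elim by linarith
    qed
  qed
  also have "\<dots> = c1 * ((t * \<alpha>\<^sup>2 + \<beta>\<^sup>2 / t) / 2) + c2 * ((t * s * (LINT z|disc_measure. ?z2 z * fibre_sq A z) + \<beta>\<^sup>2 / (t * s)) / 2)"
    using iz fibre_sq_integral[of A] fibre_sq_integral[of h]
    by (subst Bochner_Integration.integral_add; (intro integrable_mult_right integrable_divide Bochner_Integration.integrable_add)?; simp add: \<alpha>_def \<beta>_def)
  also have "\<dots> \<le> c1 * ((t * \<alpha>\<^sup>2 + \<beta>\<^sup>2 / t) / 2) + c2 * ((t * s * (\<alpha>\<^sup>2 / s\<^sup>2) + \<beta>\<^sup>2 / (t * s)) / 2)"
    by (intro add_left_mono mult_left_mono[OF _ c(2)] divide_right_mono add_right_mono iz') simp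
  also have "\<dots> = (c1 + c2 / s) * (\<alpha> * \<beta>)"
  proof -
    have "t * \<alpha>\<^sup>2 = \<alpha> * \<beta>" "\<beta>\<^sup>2 / t = \<alpha> * \<beta>" using pos by (simp_all add: t_def power2_eq_square)
    moreover have "t * s * (\<alpha>\<^sup>2 / s\<^sup>2) = (t * \<alpha>\<^sup>2) / s" "\<beta>\<^sup>2 / (t * s) = (\<beta>\<^sup>2 / t) / s"
      using pos by (simp_all add: power2_eq_square)
    ultimately show ?thesis by (simp add: algebra_simps)
  qed
  finally show ?thesis by (simp add: \<alpha>_def \<beta>_def s_def)
qed

section \<open>Polynomial symbols in the variables and their conjugates\<close>

inductive mixpoly :: "(complex \<times> complex \<Rightarrow> complex) \<Rightarrow> bool" where
  mixpoly_monom_symb: "mixpoly (\<lambda>z. c * monom_symb i j k l z)"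
| mixpoly_add: "mixpoly f \<Longrightarrow> mixpoly g \<Longrightarrow> mixpoly (\<lambda>z. f z + g z)"

lemma mixpoly_const: "mixpoly (\<lambda>_. c)"
  using mixpoly_monom_symb[of c 0 0 0 0] by (simp add: monom_symb_def)

lemma mixpoly_mult_monom_symb: "mixpoly f \<Longrightarrow> mixpoly (\<lambda>z. (c * monom_symb i j k l z) * f z)"
proof (induction rule: mixpoly.induct)
  case (mixpoly_monom_symb d i' j' k' l')
  have "(\<lambda>z. (c * monom_symb i j k l z) * (d * monom_symb i' j' k' l' z)) = (\<lambda>z. (c * d) * monom_symb (i + i') (j + j') (k + k') (l + l') z)"
    by (simp add: monom_symb_def power_add mult_ac fun_eq_iff)
  then show ?case using mixpoly.mixpoly_monom_symb[of "c * d"] by simp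
next
  case (mixpoly_add f g)
  then show ?case using mixpoly.mixpoly_add by (simp add: distrib_left)
qed

lemma mixpoly_mult: "mixpoly f \<Longrightarrow> mixpoly g \<Longrightarrow> mixpoly (\<lambda>z. f z * g z)"
proof (induction rule: mixpoly.induct)
  case (mixpoly_monom_symb c i j k l)
  then show ?case by (rule mixpoly_mult_monom_symb)
next
  case (mixpoly_add f f')
  then show ?case using mixpoly.mixpoly_add by (simp add: distrib_right)
qed

lemma mixpoly_continuous: "mixpoly f \<Longrightarrow> continuous_on S f"
  by (induction rule: mixpoly.induct) (auto simp: monom_symb_def intro!: continuous_intros)

text \<open>Stone-Weierstrass for real functions, applied to the real and the imaginary part; the
  real coordinates are mixed polynomials and separate points.\<close>

lemma mixpoly_approximation:
  assumes "continuous_on (closure bidisk) \<phi>" "0 < \<epsilon>"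
  obtains \<phi>' where "mixpoly \<phi>'" "\<And>z. z \<in> closure bidisk \<Longrightarrow> cmod (\<phi> z - \<phi>' z) \<le> \<epsilon>"
proof -
  let ?R = "{f :: complex \<times> complex \<Rightarrow> real. mixpoly (\<lambda>z. of_real (f z))}"
  interpret R: function_ring_on ?R "closure bidisk"
  proof
    show "compact (closure bidisk)" unfolding closure_bidisk by (intro compact_Times) auto
    show "continuous_on (closure bidisk) f" if "f \<in> ?R" for f
      using continuous_on_Re[OF mixpoly_continuous[of "\<lambda>z. of_real (f z)"]] that by simp
    show "(\<lambda>x. f x + g x) \<in> ?R" "(\<lambda>x. f x * g x) \<in> ?R" if "f \<in> ?R" "g \<in> ?R" for f g
      using that mixpoly_add mixpoly_mult by auto
    show "(\<lambda>_. c) \<in> ?R" for c by (simp add: mixpoly_const)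
    have "(\<lambda>z. complex_of_real (Re (fst z))) = (\<lambda>z. 1/2 * monom_symb 1 0 0 0 z + 1/2 * monom_symb 0 1 0 0 z)"
      "(\<lambda>z. complex_of_real (Im (fst z))) = (\<lambda>z. -\<i>/2 * monom_symb 1 0 0 0 z + \<i>/2 * monom_symb 0 1 0 0 z)"
      "(\<lambda>z. complex_of_real (Re (snd z))) = (\<lambda>z. 1/2 * monom_symb 0 0 1 0 z + 1/2 * monom_symb 0 0 0 1 z)"
      "(\<lambda>z. complex_of_real (Im (snd z))) = (\<lambda>z. -\<i>/2 * monom_symb 0 0 1 0 z + \<i>/2 * monom_symb 0 0 0 1 z)"
      by (auto simp: monom_symb_def complex_eq_iff)
    then have "(\<lambda>z. Re (fst z)) \<in> ?R" "(\<lambda>z. Im (fst z)) \<in> ?R" "(\<lambda>z. Re (snd z)) \<in> ?R" "(\<lambda>z. Im (snd z)) \<in> ?R"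
      by (simp_all only: mem_Collect_eq) (intro mixpoly_add mixpoly_monom_symb)+
    then show "\<exists>f\<in>?R. f x \<noteq> f y" if "x \<noteq> y" for x y :: "complex \<times> complex"
      using that by (metis complex_eqI prod_eqI)
  qed
  have c: "continuous_on (closure bidisk) (\<lambda>z. Re (\<phi> z))" "continuous_on (closure bidisk) (\<lambda>z. Im (\<phi> z))"
    by (intro continuous_intros assms)+
  obtain f where f: "f \<in> ?R" "\<And>x. x \<in> closure bidisk \<Longrightarrow> \<bar>Re (\<phi> x) - f x\<bar> < \<epsilon> / 2"
    using R.Stone_Weierstrass_basic[OF c(1), of "\<epsilon> / 2"] assms(2) by auto
  obtain g where g: "g \<in> ?R" "\<And>x. x \<in> closure bidisk \<Longrightarrow> \<bar>Im (\<phi> x) - g x\<bar> < \<epsilon> / 2"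
    using R.Stone_Weierstrass_basic[OF c(2), of "\<epsilon> / 2"] assms(2) by auto
  show thesis
  proof (rule that[of "\<lambda>z. of_real (f z) + \<i> * of_real (g z)"])
    show "mixpoly (\<lambda>z. of_real (f z) + \<i> * of_real (g z))"
      using f g by (intro mixpoly_add mixpoly_mult mixpoly_const) auto
    fix z assume "z \<in> closure bidisk"
    then show "cmod (\<phi> z - (of_real (f z) + \<i> * of_real (g z))) \<le> \<epsilon>"
      using cmod_le[of "\<phi> z - (of_real (f z) + \<i> * of_real (g z))"] f(2)[of z] g(2)[of z] by simp
  qed
qed

lemma mixpoly_symb: "mixpoly f \<Longrightarrow> symb f"
  by (rule symb_continuous_closure[OF mixpoly_continuous])

text \<open>Here \<open>G\<close> is the projection of \<open>\<phi> A\<close> in the variable \<open>w\<close> alone, which is nearly holomorphic in \<open>z\<close> as well.\<close>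

definition fibre_approximable :: "(complex \<times> complex \<Rightarrow> complex) \<Rightarrow> bool" where
  "fibre_approximable \<phi> \<longleftrightarrow> (\<forall>\<eta>>0. \<exists>N. \<forall>A\<in>order_z N. \<exists>G. norm (G - bproj G) \<le> \<eta> * norm A \<and>
     (AE z in disc_measure. slice z G = bproj (slice z (Mul \<phi> A))))"

lemma order_z_mono: "N \<le> M \<Longrightarrow> order_z M \<subseteq> order_z N"
  by (auto simp: order_z_def)

lemma order_z_A2: "A \<in> order_z N \<Longrightarrow> A \<in> A2"
  by (simp add: order_z_def)

text \<open>For one monomial, \<open>w\<close> is treated first and exactly, since projection and
  slicing commute there. The powers of \<open>z\<close> are constants on a slice, and only the power
  of \<open>cnj z\<close> spoils holomorphy, by an amount that is small at high order.\<close>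

lemma mixpoly_fibre_approximable: "mixpoly \<phi> \<Longrightarrow> fibre_approximable \<phi>"
proof (induction rule: mixpoly.induct)
  case (mixpoly_monom_symb c i j k l)
  show ?case unfolding fibre_approximable_def
  proof (intro allI impI)
    fix \<eta> :: real assume \<eta>: "0 < \<eta>"
    have "(\<lambda>N. (cmod c)\<^sup>2 * (real j / (real N + 1))) \<longlonglongrightarrow> 0" by real_asymp
    then have "\<forall>\<^sub>F N in sequentially. (cmod c)\<^sup>2 * (real j / (real N + 1)) < \<eta>\<^sup>2"
      using \<eta> by (intro order_tendstoD) auto
    then have "\<forall>\<^sub>F N in sequentially. j \<le> N \<and> (cmod c)\<^sup>2 * (real j / (real N + 1)) < \<eta>\<^sup>2"
      using eventually_ge_at_top[of j] by eventually_elim simp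
    then obtain N where N: "j \<le> N" "(cmod c)\<^sup>2 * (real j / (real N + 1)) < \<eta>\<^sup>2"
      by (auto dest: eventually_happens)
    have "\<exists>G. norm (G - bproj G) \<le> \<eta> * norm A \<and> (AE z in disc_measure. slice z G = bproj (slice z (Mul (\<lambda>z. c * monom_symb i j k l z) A)))"
      if A: "A \<in> order_z N" for A
    proof -
      define B where "B = bproj (Mul (monom_symb 0 0 k l) A)"
      \<comment> \<open>The projection of a symbol in \<open>w\<close> alone leaves the first index
        unchanged, so the high order in \<open>z\<close> is preserved.\<close>
      have B: "B \<in> order_z N"
        using A cinner_Mul_monom_symb_zmono[OF order_z_A2[OF A], of 0 0 k l] unfolding order_z_def B_def
        by (auto simp: coef_def[of "Mul (monom_symb 0 0 k l) A"])
      have nB: "norm B \<le> norm A" unfolding B_def by (rule order_trans[OF norm_bproj_le norm_monom_symb_le])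
      define G where "G = c *\<^sub>C Mul (monom_symb i j 0 0) B"
      let ?C = "Mul (monom_symb 0 j 0 0) B"
      \<comment> \<open>The competitor keeps the factor \<open>z ^ i\<close> and projects only the
        product of \<open>B\<close> with the power of \<open>cnj z\<close>; it is therefore
        holomorphic.\<close>
      have "norm (G - bproj G) \<le> norm (G - c *\<^sub>C Mul (monom_symb i 0 0 0) (bproj ?C))"
        by (intro norm_minus_bproj_le A2_cscale A2_Mul symb_monom_symb holomorphic2_monom_symb bproj_in)
      also have "G - c *\<^sub>C Mul (monom_symb i 0 0 0) (bproj ?C) = c *\<^sub>C Mul (monom_symb i 0 0 0) (?C - bproj ?C)"
        unfolding G_def by (rule l2c_eqI) (simp add: ev_Mul monom_symb_def algebra_simps)
      also have "norm \<dots> \<le> cmod c * norm (?C - bproj ?C)"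
        by (simp add: mult_left_mono norm_monom_symb_le)
      also have "\<dots> \<le> \<eta> * norm A"
      proof (rule power2_le_imp_le)
        have "(cmod c * norm (?C - bproj ?C))\<^sup>2 \<le> (cmod c)\<^sup>2 * (real j / (real N + 1) * (norm B)\<^sup>2)"
          unfolding power_mult_distrib by (intro mult_left_mono order_z_almost_invariant B N) simp
        also have "\<dots> = ((cmod c)\<^sup>2 * (real j / (real N + 1))) * (norm B)\<^sup>2" by simp
        also have "\<dots> \<le> \<eta>\<^sup>2 * (norm A)\<^sup>2"
          using N(2) nB by (intro mult_mono power_mono) auto
        finally show "(cmod c * norm (?C - bproj ?C))\<^sup>2 \<le> (\<eta> * norm A)\<^sup>2" by (simp add: power_mult_distrib)
      qed (use \<eta> in simp)
      finally have 1: "norm (G - bproj G) \<le> \<eta> * norm A" .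
      have "AE z in disc_measure. slice z G = bproj (slice z (Mul (\<lambda>z. c * monom_symb i j k l z) A))"
        using AE_slice_ok[of A] AE_slice_ok[of B] AE_slice_bproj[OF order_z_A2[OF A], of k l]
      proof eventually_elim
        case (elim z)
        define d where "d = c * (z ^ i * cnj z ^ j)"
        note ok = slice_Mul[OF elim(1) symb_monom_symb[of 0 0 k l]] slice_Mul[OF elim(2) symb_monom_symb[of i j 0 0]]
        have s: "symb (\<lambda>z. c * monom_symb i j k l z)" by (intro symb_mult symb_const symb_monom_symb)
        note ok' = slice_Mul[OF elim(1) s]
        have "slice z G = d *\<^sub>C slice z B"
          unfolding G_def slice_cscale(1)[OF ok(5)]
          by (rule l2c_eqI) (simp add: ev_slice ok elim ev_Mul, simp add: monom_symb_def d_def)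
        also have "\<dots> = bproj (d *\<^sub>C slice z (Mul (monom_symb 0 0 k l) A))"
          by (simp add: B_def elim(3) bproj_linear)
        also have "d *\<^sub>C slice z (Mul (monom_symb 0 0 k l) A) = slice z (Mul (\<lambda>z. c * monom_symb i j k l z) A)"
          by (rule l2c_eqI) (simp add: ev_slice ok ok' ev_Mul s, simp add: monom_symb_def d_def)
        finally show ?case .
      qed
      then show ?thesis using 1 by blast
    qed
    then show "\<exists>N. \<forall>A\<in>order_z N. \<exists>G. norm (G - bproj G) \<le> \<eta> * norm A \<and> (AE z in disc_measure. slice z G = bproj (slice z (Mul (\<lambda>z. c * monom_symb i j k l z) A)))"
      by blast
  qed
next
  case (mixpoly_add f g)
  show ?case unfolding fibre_approximable_def
  proof (intro allI impI)
    fix \<eta> :: real assume "0 < \<eta>"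
    then have "0 < \<eta> / 2" by simp
    then obtain N1 N2 where N1: "\<And>A. A \<in> order_z N1 \<Longrightarrow> \<exists>G. norm (G - bproj G) \<le> \<eta> / 2 * norm A \<and> (AE z in disc_measure. slice z G = bproj (slice z (Mul f A)))"
      and N2: "\<And>A. A \<in> order_z N2 \<Longrightarrow> \<exists>G. norm (G - bproj G) \<le> \<eta> / 2 * norm A \<and> (AE z in disc_measure. slice z G = bproj (slice z (Mul g A)))"
      using mixpoly_add.IH unfolding fibre_approximable_def by meson
    have s: "symb f" "symb g" using mixpoly_add.hyps mixpoly_symb by auto
    have "\<exists>G. norm (G - bproj G) \<le> \<eta> * norm A \<and> (AE z in disc_measure. slice z G = bproj (slice z (Mul (\<lambda>z. f z + g z) A)))"
      if A: "A \<in> order_z (max N1 N2)" for A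
    proof -
      have "A \<in> order_z N1" "A \<in> order_z N2" using A order_z_mono[of N1 "max N1 N2"] order_z_mono[of N2 "max N1 N2"] by auto
      then obtain G1 G2 where G: "norm (G1 - bproj G1) \<le> \<eta> / 2 * norm A" "AE z in disc_measure. slice z G1 = bproj (slice z (Mul f A))"
        "norm (G2 - bproj G2) \<le> \<eta> / 2 * norm A" "AE z in disc_measure. slice z G2 = bproj (slice z (Mul g A))"
        using N1 N2 by meson
      have "G1 + G2 - bproj (G1 + G2) = (G1 - bproj G1) + (G2 - bproj G2)" by (simp add: bproj_linear)
      then have "norm (G1 + G2 - bproj (G1 + G2)) \<le> \<eta> / 2 * norm A + \<eta> / 2 * norm A"
        using G norm_triangle_mono by metis
      moreover have "AE z in disc_measure. slice z (G1 + G2) = bproj (slice z (Mul (\<lambda>z. f z + g z) A))"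
        using G(2) G(4) AE_slice_ok[of G1] AE_slice_ok[of G2] AE_slice_ok[of A]
      proof eventually_elim
        case (elim z)
        have "Mul (\<lambda>z. f z + g z) A = Mul f A + Mul g A"
          using s by (intro l2c_eqI) (simp add: ev_Mul symb_simps algebra_simps)
        then show ?case
          using slice_simps(1)[OF elim(3,4)] slice_simps(1)[OF slice_Mul(2)[OF elim(5) s(1)] slice_Mul(2)[OF elim(5) s(2)]]
          by (simp add: elim bproj_linear)
      qed
      ultimately show ?thesis by (intro exI[of _ "G1 + G2"]) simp
    qed
    then show "\<exists>N. \<forall>A\<in>order_z N. \<exists>G. norm (G - bproj G) \<le> \<eta> * norm A \<and> (AE z in disc_measure. slice z G = bproj (slice z (Mul (\<lambda>z. f z + g z) A)))"
      by blast
  qed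
qed


lemma complex_sgn_dist: "z \<noteq> 0 \<Longrightarrow> cmod z \<le> 1 \<Longrightarrow> cmod (z - sgn z) = 1 - cmod z"
proof -
  assume z: "z \<noteq> 0" "cmod z \<le> 1"
  have "z - sgn z = (cmod z - 1) *\<^sub>R sgn z"
    using z by (simp add: sgn_eq scaleR_conv_of_real field_simps)
  then have "cmod (z - sgn z) = \<bar>cmod z - 1\<bar> * cmod (sgn z)"
    by (simp only: norm_scaleR)
  then show ?thesis using z by (simp add: norm_sgn)
qed

lemma uniform_radial:
  assumes "continuous_on (closure bidisk) \<phi>" "0 < \<epsilon>"
  shows "\<exists>r<1. \<forall>z w. r < cmod z \<longrightarrow> cmod z \<le> 1 \<longrightarrow> cmod w \<le> 1 \<longrightarrow> cmod (\<phi> (z, w) - \<phi> (sgn z, w)) \<le> \<epsilon>"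
proof -
  have "compact (closure bidisk)" unfolding closure_bidisk by (intro compact_Times) auto
  then have "uniformly_continuous_on (closure bidisk) \<phi>"
    using assms(1) compact_uniformly_continuous by blast
  then obtain d where d: "0 < d" "\<And>x x'. x \<in> closure bidisk \<Longrightarrow> x' \<in> closure bidisk \<Longrightarrow> dist x' x < d \<Longrightarrow> dist (\<phi> x') (\<phi> x) < \<epsilon>"
    using assms(2) unfolding uniformly_continuous_on_def by metis
  \<comment> \<open>The maximum with 0 excludes \<open>z = 0\<close>, where \<open>sgn z\<close>
    would not lie on the circle.\<close>
  have "cmod (\<phi> (z, w) - \<phi> (sgn z, w)) \<le> \<epsilon>" if "max 0 (1 - d) < cmod z" "cmod z \<le> 1" "cmod w \<le> 1" for z w
  proof -
    have "z \<noteq> 0" using that by auto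
    then have "dist (z, w) (sgn z, w) < d"
      using complex_sgn_dist[of z] that by (simp add: dist_Pair_Pair dist_norm)
    then show ?thesis
      using d(2)[of "(sgn z, w)" "(z, w)"] that \<open>z \<noteq> 0\<close> by (simp add: closure_bidisk dist_norm norm_sgn)
  qed
  then show ?thesis using d(1) by (intro exI[of _ "max 0 (1 - d)"]) auto
qed

lemma hankel_product_small_z:
  assumes cont: "continuous_on (closure bidisk) \<phi>" "continuous_on (closure bidisk) \<psi>"
    and hol: "\<And>e. cmod e = 1 \<Longrightarrow> (\<lambda>w. \<phi> (e, w)) holomorphic_on ball 0 1 \<or> (\<lambda>w. \<psi> (e, w)) holomorphic_on ball 0 1"
    and \<delta>: "0 < \<delta>"
  shows "\<exists>N. \<forall>A\<in>order_z N. \<forall>h\<in>A2. cmod (cinner (hankel_l2 \<phi> A) (Mul \<psi> h)) \<le> \<delta> * (norm A * norm h)"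
proof -
  have s: "symb \<phi>" "symb \<psi>" using cont symb_continuous_closure by auto
  obtain M0 where M0: "0 \<le> M0" "\<And>p. p \<in> bidisk \<Longrightarrow> cmod (\<phi> p) \<le> M0" using symb_bound[OF s(1)] by blast
  obtain M1 where M1: "0 \<le> M1" "\<And>p. p \<in> bidisk \<Longrightarrow> cmod (\<psi> p) \<le> M1" using symb_bound[OF s(2)] by blast
  define M where "M = M0 + M1 + 1"
  have M: "1 \<le> M" using M0 M1 by (simp add: M_def)
  \<comment> \<open>The five portions \<open>\<epsilon> * M\<close>: two in \<open>c1\<close>, one
    for the term with \<open>c2\<close>, one for \<open>G - bproj G\<close> and one for
    \<open>\<phi> - \<phi>'\<close>. The bound \<open>\<epsilon> \<le> 1\<close> together with the
    summand 1 in \<open>M\<close> makes \<open>M\<close> a bound for \<open>\<phi>'\<close>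
    too.\<close>
  define \<epsilon> where "\<epsilon> = min 1 (\<delta> / (5 * M))"
  have \<epsilon>: "0 < \<epsilon>" "\<epsilon> \<le> 1" "5 * (\<epsilon> * M) \<le> \<delta>"
    using \<delta> M by (auto simp: \<epsilon>_def min_def field_simps)
  obtain \<phi>' where \<phi>': "mixpoly \<phi>'" "\<And>z. z \<in> closure bidisk \<Longrightarrow> cmod (\<phi> z - \<phi>' z) \<le> \<epsilon>"
    by (rule mixpoly_approximation[OF cont(1) \<epsilon>(1)]) (rule that, assumption, blast)
  have s': "symb \<phi>'" by (rule mixpoly_symb[OF \<phi>'(1)])
  have cl: "p \<in> closure bidisk" if "p \<in> bidisk" for p using that closure_subset by blast
  have bM: "cmod (\<phi>' p) \<le> M" "cmod (\<psi> p) \<le> M" if "p \<in> bidisk" for p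
    using M0 M1(1) M1(2)[OF that] M0(2)[OF that] \<phi>'(2)[OF cl[OF that]] \<epsilon>(2) norm_triangle_sub[of "\<phi>' p" "\<phi> p"]
    by (auto simp: M_def norm_minus_commute)
  obtain r1 where r1: "r1 < 1" "\<And>z w. r1 < cmod z \<Longrightarrow> cmod z \<le> 1 \<Longrightarrow> cmod w \<le> 1 \<Longrightarrow> cmod (\<phi> (z, w) - \<phi> (sgn z, w)) \<le> \<epsilon>"
    using uniform_radial[OF cont(1) \<epsilon>(1)] by blast
  obtain r2 where r2: "r2 < 1" "\<And>z w. r2 < cmod z \<Longrightarrow> cmod z \<le> 1 \<Longrightarrow> cmod w \<le> 1 \<Longrightarrow> cmod (\<psi> (z, w) - \<psi> (sgn z, w)) \<le> \<epsilon>"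
    using uniform_radial[OF cont(2) \<epsilon>(1)] by blast
  define r where "r = Max {0, r1, r2}"
  have r: "0 \<le> r" "r < 1" "r1 \<le> r" "r2 \<le> r" using r1 r2 by (auto simp: r_def)
  then have r2': "r\<^sup>2 < 1" by (simp add: power_less_one_iff abs_square_less_1)
  \<comment> \<open>\<open>c1\<close> is the fibre bound near the circle, where frozen and actual
    symbols differ by at most \<open>2 * \<epsilon>\<close>. \<open>c2\<close> is chosen so that for
    \<open>|z| \<le> r\<close> the term \<open>c2 * (1 - |z|^2)\<close> already exceeds the trivial
    bound \<open>M * M\<close>.\<close>
  define c1 c2 where "c1 = 2 * \<epsilon> * M" and "c2 = M * M / (1 - r\<^sup>2)"
  have c: "0 \<le> c1" "0 \<le> c2" using \<epsilon> M r2' by (auto simp: c1_def c2_def)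
  obtain N1 where N1: "\<And>A. A \<in> order_z N1 \<Longrightarrow> \<exists>G. norm (G - bproj G) \<le> \<epsilon> * norm A \<and> (AE z in disc_measure. slice z G = bproj (slice z (Mul \<phi>' A)))"
    using mixpoly_fibre_approximable[OF \<phi>'(1)] \<epsilon>(1) unfolding fibre_approximable_def by meson
  have "(\<lambda>N. c2 / sqrt (real N + 2)) \<longlonglongrightarrow> 0" by real_asymp
  then have "\<forall>\<^sub>F N in sequentially. c2 / sqrt (real N + 2) < \<epsilon> * M"
    using \<epsilon> M by (intro order_tendstoD) auto
  then have "\<forall>\<^sub>F N in sequentially. N1 \<le> N \<and> c2 / sqrt (real N + 2) < \<epsilon> * M"
    using eventually_ge_at_top[of N1] by eventually_elim simp
  then obtain N where N: "N1 \<le> N" "c2 / sqrt (real N + 2) < \<epsilon> * M"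
    by (auto dest: eventually_happens)
  have "cmod (cinner (hankel_l2 \<phi> A) (Mul \<psi> h)) \<le> \<delta> * (norm A * norm h)" if A: "A \<in> order_z N" and h: "h \<in> A2" for A h
  proof -
    obtain G where G: "norm (G - bproj G) \<le> \<epsilon> * norm A" "AE z in disc_measure. slice z G = bproj (slice z (Mul \<phi>' A))"
      using N1 A order_z_mono[OF N(1)] by blast
    let ?X = "Mul \<phi>' A - G" and ?Y = "Mul \<psi> h"
    have AEs: "AE z in disc_measure. slice z ?X = hankel_l2 (\<lambda>p. \<phi>' (z, snd p)) (slice z A)"
      using G(2) AE_slice_ok[of A] AE_slice_ok[of G]
    proof eventually_elim
      case (elim z)
      show ?case
        unfolding slice_simps(3)[OF slice_Mul(2)[OF elim(2) s'] elim(3)] elim(1) slice_Mul(1)[OF elim(2) s'] hankel_l2_def ..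
    qed
    have AEp: "AE z in disc_measure. of_real pi * (LINT w|disc_measure. ev ?X (z, w) * cnj (ev K (z, w))) = cinner (hankel_l2 (\<lambda>p. \<phi>' (z, snd p)) (slice z A)) (slice z K)" for K
      using AEs AE_slice_ok[of ?X] AE_slice_ok[of K]
      by eventually_elim (metis cinner_slice)
    \<comment> \<open>\<open>?X\<close> is orthogonal to the Bergman space because almost all its
      slices are. Hence \<open>G\<close> and \<open>\<phi>'\<close> times \<open>A\<close> have the
      same projection.\<close>
    have orth: "cinner ?X f = 0" if f: "f \<in> A2" for f
    proof -
      have "AE z in disc_measure. (LINT w|disc_measure. ev ?X (z, w) * cnj (ev f (z, w))) = 0"
        using AEp[of f] AE_slice_ok[of f]
      proof eventually_elim
        case (elim z)
        then show ?case using hankel_l2_orth(1)[OF slice_A2[OF elim(2) f]] by simp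
      qed
      then show ?thesis unfolding cinner_Fubini(1) by (rule integral_eq_zero_AE)
    qed
    have PG: "bproj (Mul \<phi>' A) = bproj G"
    proof (rule bproj_unique[OF bproj_in])
      fix p
      have "cinner (Mul \<phi>' A) (zmono p) = cinner G (zmono p)"
        using orth[OF A2_zmono[of p]] by (simp add: cinner_diff_left)
      then show "coef (Mul \<phi>' A) p = coef (bproj G) p" unfolding coef_bproj by (simp add: coef_def)
    qed
    have main: "cmod (cinner ?X ?Y) \<le> (c1 + c2 / sqrt (real N + 2)) * (norm A * norm h)"
    proof (rule integrate_fibre_estimate[OF A c])
      show "AE z in disc_measure. cmod (LINT w|disc_measure. ev ?X (z, w) * cnj (ev ?Y (z, w)))
         \<le> (c1 + c2 * (1 - (cmod z)\<^sup>2)) * (sqrt (fibre_sq A z) * sqrt (fibre_sq h z))"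
        using AEp[of ?Y] AE_slice_ok[of A] AE_slice_ok[of h]
      proof eventually_elim
        case (elim z)
        have z: "z \<in> ball 0 1" using elim(2) by (simp add: slice_ok_def)
        have zb: "(z, snd p) \<in> bidisk" if "p \<in> bidisk" for p using z that by (auto simp: bidisk_def)
        let ?a = "\<lambda>p. \<phi>' (z, snd p)" and ?b = "\<lambda>p. \<psi> (z, snd p)"
        let ?F = "slice z A" and ?K = "slice z h"
        note F = slice_A2[OF elim(2) order_z_A2[OF A]] and K = slice_A2[OF elim(3) h]
        note sa = slice_Mul(3)[OF elim(2) s'] and sb = slice_Mul(3)[OF elim(3) s(2)]
        have ab: "cmod (?a p) \<le> M" "cmod (?b p) \<le> M" if "p \<in> bidisk" for p
          using bM zb[OF that] by auto
        have est: "cmod (cinner (hankel_l2 ?a ?F) (Mul ?b ?K)) \<le> (c1 + c2 * (1 - (cmod z)\<^sup>2)) * (norm ?F * norm ?K)"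
        proof (cases "r < cmod z")
          case True
          then have "z \<noteq> 0" using r by auto
          then have e: "cmod (sgn z) = 1" by (simp add: norm_sgn)
          let ?aa = "\<lambda>p::complex \<times> complex. \<phi> (sgn z, snd p)" and ?bb = "\<lambda>p::complex \<times> complex. \<psi> (sgn z, snd p)"
          have eb: "(sgn z, snd p) \<in> closure bidisk" if "p \<in> closure bidisk" for p
            using e that by (auto simp: closure_bidisk)
          have "continuous_on (closure bidisk) ?aa" "continuous_on (closure bidisk) ?bb"
            by (rule continuous_on_compose2[OF cont(1)] continuous_on_compose2[OF cont(2)];
                use eb in \<open>auto intro!: continuous_intros\<close>)+
          then have s0: "symb ?aa" "symb ?bb" using symb_continuous_closure by blast+
          have "cmod (cinner (hankel_l2 ?a ?F) (Mul ?b ?K)) \<le> (2 * \<epsilon>) * M * (norm ?F * norm ?K)"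
          proof (rule fibre_estimate[OF F K sa sb s0])
            fix p :: "complex \<times> complex" assume p: "p \<in> bidisk"
            then have w: "cmod (snd p) \<le> 1" by (auto simp: bidisk_def)
            have "cmod (\<phi> (z, snd p) - \<phi> (sgn z, snd p)) \<le> \<epsilon>"
              using True r z w by (intro r1) auto
            moreover have "cmod (\<phi> (z, snd p) - \<phi>' (z, snd p)) \<le> \<epsilon>"
              using zb[OF p] cl \<phi>'(2) by blast
            ultimately show "cmod (?a p - ?aa p) \<le> 2 * \<epsilon>"
              using norm_triangle_ineq4[of "\<phi> (z, snd p) - \<phi> (sgn z, snd p)" "\<phi> (z, snd p) - \<phi>' (z, snd p)"] by simp
            have "cmod (\<psi> (z, snd p) - \<psi> (sgn z, snd p)) \<le> \<epsilon>"
              using True r z w by (intro r2) auto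
            then show "cmod (?b p - ?bb p) \<le> 2 * \<epsilon>" using \<epsilon>(1) by linarith
          next
            show "holomorphic2_on ?aa bidisk \<or> holomorphic2_on ?bb bidisk"
              using hol[OF e] holomorphic2_on_snd by blast
          qed (use ab in auto)
          also have "\<dots> \<le> (c1 + c2 * (1 - (cmod z)\<^sup>2)) * (norm ?F * norm ?K)"
            using z c by (intro mult_right_mono) (auto simp: c1_def abs_square_le_1)
          finally show ?thesis .
        next
          case False
          have "cmod (cinner (hankel_l2 ?a ?F) (Mul ?b ?K)) \<le> norm (hankel_l2 ?a ?F) * norm (Mul ?b ?K)" by (rule cmod_cinner_le)
          also have "\<dots> \<le> (M * norm ?F) * (M * norm ?K)"
            using M by (intro mult_mono order_trans[OF norm_hankel_l2_le_Mul] norm_Mul_le sa sb ab) auto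
          also have "\<dots> = M * M * (norm ?F * norm ?K)" by simp
          also have "\<dots> \<le> (c1 + c2 * (1 - (cmod z)\<^sup>2)) * (norm ?F * norm ?K)"
          proof (rule mult_right_mono)
            have "(cmod z)\<^sup>2 \<le> r\<^sup>2" using False by (intro power_mono) auto
            then have "c2 * (1 - r\<^sup>2) \<le> c2 * (1 - (cmod z)\<^sup>2)" using c by (intro mult_left_mono) auto
            moreover have "c2 * (1 - r\<^sup>2) = M * M" using r2' by (simp add: c2_def)
            ultimately show "M * M \<le> c1 + c2 * (1 - (cmod z)\<^sup>2)" using c by linarith
          qed simp
          finally show ?thesis .
        qed
        let ?I = "LINT w|disc_measure. ev ?X (z, w) * cnj (ev ?Y (z, w))"
        have "of_real pi * ?I = cinner (hankel_l2 ?a ?F) (Mul ?b ?K)"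
          using elim(1) slice_Mul(1)[OF elim(3) s(2)] by simp
        then have "pi * cmod ?I \<le> (c1 + c2 * (1 - (cmod z)\<^sup>2)) * (norm ?F * norm ?K)"
        proof -
          assume "of_real pi * ?I = cinner (hankel_l2 ?a ?F) (Mul ?b ?K)"
          from arg_cong[OF this, of cmod] est show ?thesis by (simp add: norm_mult)
        qed
        also have "norm ?F * norm ?K = pi * (sqrt (fibre_sq A z) * sqrt (fibre_sq h z))"
          by (simp add: norm_slice elim)
        finally have "pi * cmod ?I \<le> pi * ((c1 + c2 * (1 - (cmod z)\<^sup>2)) * (sqrt (fibre_sq A z) * sqrt (fibre_sq h z)))"
          by (simp only: mult_ac)
        then show ?case by (subst (asm) mult_le_cancel_left_pos) simp_all
      qed
    qed
    \<comment> \<open>The fibrewise Hankel vector, the defect of holomorphy of \<open>G\<close> and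
      the approximation error. The first two add up to the Hankel vector of
      \<open>\<phi>'\<close>.\<close>
    have "hankel_l2 \<phi> A = ?X + (G - bproj G) + hankel_l2 (\<lambda>z. \<phi> z - \<phi>' z) A"
      unfolding hankel_l2_diff_symbol[OF s(1) s', symmetric] by (simp add: hankel_l2_def PG)
    then have "cinner (hankel_l2 \<phi> A) ?Y = cinner ?X ?Y + cinner (G - bproj G) ?Y + cinner (hankel_l2 (\<lambda>z. \<phi> z - \<phi>' z) A) ?Y"
      by (simp only: cinner_add_left)
    also have "cmod \<dots> \<le> (c1 + c2 / sqrt (real N + 2)) * (norm A * norm h) + \<epsilon> * M * (norm A * norm h) + \<epsilon> * M * (norm A * norm h)"
    proof (intro norm_triangle_mono main)
      have Y: "norm ?Y \<le> M * norm h" using M by (intro norm_Mul_le s bM) auto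
      have "cmod (cinner (G - bproj G) ?Y) \<le> norm (G - bproj G) * norm ?Y" by (rule cmod_cinner_le)
      also have "\<dots> \<le> (\<epsilon> * norm A) * (M * norm h)" using \<epsilon> by (intro mult_mono G Y) auto
      finally show "cmod (cinner (G - bproj G) ?Y) \<le> \<epsilon> * M * (norm A * norm h)" by (simp add: mult_ac)
      have "norm (hankel_l2 (\<lambda>z. \<phi> z - \<phi>' z) A) \<le> \<epsilon> * norm A"
        using \<epsilon> cl \<phi>'(2) by (intro order_trans[OF norm_hankel_l2_le_Mul] norm_Mul_le symb_diff s s') auto
      then have "norm (hankel_l2 (\<lambda>z. \<phi> z - \<phi>' z) A) * norm ?Y \<le> (\<epsilon> * norm A) * (M * norm h)"
        using \<epsilon> by (intro mult_mono Y) auto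
      then show "cmod (cinner (hankel_l2 (\<lambda>z. \<phi> z - \<phi>' z) A) ?Y) \<le> \<epsilon> * M * (norm A * norm h)"
        using cmod_cinner_le[of "hankel_l2 (\<lambda>z. \<phi> z - \<phi>' z) A" ?Y] by (simp add: mult_ac)
    qed
    also have "\<dots> = (c1 + c2 / sqrt (real N + 2) + 2 * (\<epsilon> * M)) * (norm A * norm h)" by (simp add: algebra_simps)
    also have "\<dots> \<le> \<delta> * (norm A * norm h)"
    proof (rule mult_right_mono)
      show "c1 + c2 / sqrt (real N + 2) + 2 * (\<epsilon> * M) \<le> \<delta>"
        using N(2) \<epsilon>(3) unfolding c1_def mult.assoc[of 2 \<epsilon> M] by linarith
    qed simp
    finally show ?thesis .
  qed
  then show ?thesis by blast
qed

section \<open>Exchange of the two variables\<close>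

lemma bij_swap_bidisk: "prod.swap p \<in> bidisk \<longleftrightarrow> p \<in> bidisk"
  by (cases p) (auto simp: bidisk_def)

lemma continuous_swap: "continuous_on bidisk f \<Longrightarrow> continuous_on bidisk (\<lambda>p. f (prod.swap p))"
  by (rule continuous_on_compose2[of bidisk f]) (auto simp: bidisk_def intro: continuous_on_swap)

lemma integrable_swap: "integrable bidisk_measure f \<Longrightarrow> integrable bidisk_measure (\<lambda>p. f (prod.swap p))"
  for f :: "complex \<times> complex \<Rightarrow> 'b::{banach, second_countable_topology}"
  using disc_pair.integrable_product_swap[of f] by (simp add: bidisk_measure_def split_beta' prod.swap_def)

lemma integral_swap:
  fixes f :: "complex \<times> complex \<Rightarrow> 'b::{banach, second_countable_topology}"
  assumes "integrable bidisk_measure f"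
  shows "(LINT p|bidisk_measure. f (prod.swap p)) = (LINT p|bidisk_measure. f p)"
  using disc_pair.integral_product_swap[OF borel_measurable_integrable[OF assms[unfolded bidisk_measure_def]]]
  by (simp add: bidisk_measure_def split_beta' prod.swap_def)

definition swap_l2 :: "l2c \<Rightarrow> l2c" where
  "swap_l2 F = to_l2 (\<lambda>p. ev F (prod.swap p))"

lemma ev_swap_l2: "ev (swap_l2 F) p = ev F (prod.swap p)"
proof (cases "p \<in> bidisk")
  case True
  have "l2fun (\<lambda>p. ev F (prod.swap p))"
    unfolding l2fun_def using l2fun_ev[of F] integrable_swap[of "\<lambda>p. (cmod (ev F p))\<^sup>2"]
    by (auto simp: l2fun_def intro: continuous_swap)
  then show ?thesis unfolding swap_l2_def using True by (simp add: ev_to_l2)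
next
  case False
  then show ?thesis using bij_swap_bidisk[of p] by (simp add: ev_outside)
qed

lemma swap_l2_involution [simp]: "swap_l2 (swap_l2 F) = F"
  by (rule l2c_eqI) (simp add: ev_swap_l2)

lemma cinner_swap_l2: "cinner (swap_l2 F) (swap_l2 G) = cinner F G"
  using integral_swap[OF cinner_int[of F G]] by (simp add: cinner_eq ev_swap_l2)

lemma norm_swap_l2 [simp]: "norm (swap_l2 F) = norm F"
  by (simp add: norm_l2c_def inner_l2c_def cinner_swap_l2)

lemma swap_l2_zmono: "swap_l2 (zmono p) = zmono (prod.swap p)"
  by (rule l2c_eqI) (simp add: ev_swap_l2 ev_zmono bij_swap_bidisk mult.commute)

lemma coef_swap_l2: "coef (swap_l2 F) p = coef F (prod.swap p)"
  using cinner_swap_l2[of F "zmono (prod.swap p)"] by (simp add: coef_def swap_l2_zmono sqnorm_def mult.commute)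

lemma A2_swap_l2: "F \<in> A2 \<Longrightarrow> swap_l2 F \<in> A2"
  unfolding A2_def holomorphic2_on_def
proof (rule CollectI, rule ballI)
  fix z assume F: "F \<in> {F. \<forall>z\<in>bidisk. \<exists>a b. (ev F has_derivative (\<lambda>(h, k). a * h + b * k)) (at z within bidisk)}"
    and z: "z \<in> bidisk"
  then have "prod.swap z \<in> bidisk" by (simp add: bij_swap_bidisk)
  then obtain a b where ab: "(ev F has_derivative (\<lambda>(h, k). a * h + b * k)) (at (prod.swap z))"
    using F at_within_open[OF _ open_bidisk] by fastforce
  have "(prod.swap has_derivative prod.swap) (at z within bidisk)"
    unfolding prod.swap_def by (auto intro!: derivative_eq_intros)
  from has_derivative_compose[OF this ab]
  have "((\<lambda>p. ev F (prod.swap p)) has_derivative (\<lambda>(h, k). b * h + a * k)) (at z within bidisk)"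
    by (rule has_derivative_eq_rhs) (auto simp: fun_eq_iff)
  then show "\<exists>a b. (ev (swap_l2 F) has_derivative (\<lambda>(h, k). a * h + b * k)) (at z within bidisk)"
    unfolding ev_swap_l2[abs_def, symmetric] by (metis (no_types, lifting) ev_swap_l2 ext)
qed

lemma swap_l2_bproj: "swap_l2 (bproj F) = bproj (swap_l2 F)"
  by (rule bproj_unique[symmetric]) (simp_all add: A2_swap_l2 coef_swap_l2)

lemma swap_l2_diff: "swap_l2 (F - G) = swap_l2 F - swap_l2 G"
  by (rule l2c_eqI) (simp add: ev_swap_l2)

lemma symb_swap: "symb \<phi> \<Longrightarrow> symb (\<lambda>p. \<phi> (prod.swap p))"
  unfolding symb_def
proof (intro conjI continuous_swap; elim conjE)
  assume "bounded (\<phi> ` bidisk)"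
  then show "bounded ((\<lambda>p. \<phi> (prod.swap p)) ` bidisk)"
    by (rule bounded_subset) (auto simp: bidisk_def)
qed

lemma swap_l2_Mul: "symb \<phi> \<Longrightarrow> swap_l2 (Mul \<phi> F) = Mul (\<lambda>p. \<phi> (prod.swap p)) (swap_l2 F)"
  by (rule l2c_eqI) (simp add: ev_swap_l2 ev_Mul symb_swap)

lemma cinner_hankel_l2_swap_l2:
  assumes "symb \<phi>" "symb \<psi>"
  shows "cinner (hankel_l2 (\<lambda>p. \<phi> (prod.swap p)) (swap_l2 A)) (Mul (\<lambda>p. \<psi> (prod.swap p)) (swap_l2 h)) = cinner (hankel_l2 \<phi> A) (Mul \<psi> h)"
  using cinner_swap_l2[of "hankel_l2 \<phi> A" "Mul \<psi> h"] assms by (simp add: hankel_l2_def swap_l2_diff swap_l2_bproj swap_l2_Mul)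

definition order_w :: "nat \<Rightarrow> l2c set" where
  "order_w N = {A \<in> A2. \<forall>m. \<forall>n<N. coef A (m, n) = 0}"

lemma continuous_closure_swap:
  assumes "continuous_on (closure bidisk) \<phi>"
  shows "continuous_on (closure bidisk) (\<lambda>p. \<phi> (prod.swap p))"
  by (rule continuous_on_compose2[OF assms]) (auto simp: closure_bidisk intro: continuous_on_swap)

lemma hankel_product_small_w:
  assumes cont: "continuous_on (closure bidisk) \<phi>" "continuous_on (closure bidisk) \<psi>"
    and hol: "\<And>e. cmod e = 1 \<Longrightarrow> (\<lambda>z. \<phi> (z, e)) holomorphic_on ball 0 1 \<or> (\<lambda>z. \<psi> (z, e)) holomorphic_on ball 0 1"
    and \<delta>: "0 < \<delta>"
  shows "\<exists>N. \<forall>A\<in>order_w N. \<forall>h\<in>A2. cmod (cinner (hankel_l2 \<phi> A) (Mul \<psi> h)) \<le> \<delta> * (norm A * norm h)"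
proof -
  have s: "symb \<phi>" "symb \<psi>" using cont symb_continuous_closure by auto
  obtain N where N: "\<And>A h. A \<in> order_z N \<Longrightarrow> h \<in> A2 \<Longrightarrow>
      cmod (cinner (hankel_l2 (\<lambda>p. \<phi> (prod.swap p)) A) (Mul (\<lambda>p. \<psi> (prod.swap p)) h)) \<le> \<delta> * (norm A * norm h)"
    using hankel_product_small_z[OF continuous_closure_swap[OF cont(1)] continuous_closure_swap[OF cont(2)] _ \<delta>] hol
    by auto
  have "cmod (cinner (hankel_l2 \<phi> A) (Mul \<psi> h)) \<le> \<delta> * (norm A * norm h)" if "A \<in> order_w N" "h \<in> A2" for A h
    using N[of "swap_l2 A" "swap_l2 h"] that by (simp add: cinner_hankel_l2_swap_l2 s A2_swap_l2 order_z_def order_w_def coef_swap_l2)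
  then show ?thesis by blast
qed

section \<open>Compactness of the Hankel product\<close>

text \<open>A formula for the product of Hankel operators: on the complement of the Bergman space
  the adjoint for \<open>\<psi>\<close> is multiplication by \<open>cnj \<psi>\<close> followed by
  projection. \<open>bergman_adjoint_ev\<close> confirms the agreement with the abstract
  adjoint.\<close>

definition hankel_prod :: "(complex \<times> complex \<Rightarrow> complex) \<Rightarrow> (complex \<times> complex \<Rightarrow> complex) \<Rightarrow> l2c \<Rightarrow> l2c" where
  "hankel_prod \<psi> \<phi> A = bproj (Mul (\<lambda>z. cnj (\<psi> z)) (hankel_l2 \<phi> A))"

lemma hankel_prod_in [simp]: "hankel_prod \<psi> \<phi> A \<in> A2"
  by (simp add: hankel_prod_def)

lemma cinner_hankel_prod: "symb \<psi> \<Longrightarrow> h \<in> A2 \<Longrightarrow> cinner (hankel_prod \<psi> \<phi> A) h = cinner (hankel_l2 \<phi> A) (Mul \<psi> h)"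
  by (simp add: hankel_prod_def cinner_bproj cinner_Mul symb_cnj)

lemma hankel_prod_linear:
  assumes "symb \<phi>" "symb \<psi>"
  shows "hankel_prod \<psi> \<phi> (F + G) = hankel_prod \<psi> \<phi> F + hankel_prod \<psi> \<phi> G" "hankel_prod \<psi> \<phi> (F - G) = hankel_prod \<psi> \<phi> F - hankel_prod \<psi> \<phi> G"
  using assms by (simp_all add: hankel_prod_def hankel_l2_linear Mul_simps bproj_linear symb_cnj)

lemma hankel_prod_bounded:
  assumes "symb \<phi>" "symb \<psi>" shows "\<exists>K\<ge>0. \<forall>A. norm (hankel_prod \<psi> \<phi> A) \<le> K * norm A"
proof -
  obtain a where a: "0 \<le> a" "\<And>p. p \<in> bidisk \<Longrightarrow> cmod (\<phi> p) \<le> a" using symb_bound[OF assms(1)] by blast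
  obtain b where b: "0 \<le> b" "\<And>p. p \<in> bidisk \<Longrightarrow> cmod (\<psi> p) \<le> b" using symb_bound[OF assms(2)] by blast
  have "norm (hankel_prod \<psi> \<phi> A) \<le> b * (a * norm A)" for A
  proof -
    have "norm (hankel_prod \<psi> \<phi> A) \<le> norm (Mul (\<lambda>z. cnj (\<psi> z)) (hankel_l2 \<phi> A))" unfolding hankel_prod_def by (rule norm_bproj_le)
    also have "\<dots> \<le> b * norm (hankel_l2 \<phi> A)" using b assms by (intro norm_Mul_le symb_cnj) auto
    also have "\<dots> \<le> b * (a * norm A)"
      using a b assms by (intro mult_left_mono order_trans[OF norm_hankel_l2_le_Mul] norm_Mul_le) auto
    finally show ?thesis .
  qed
  then show ?thesis using a b by (intro exI[of _ "b * a"]) (simp add: mult.assoc)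
qed

text \<open>The bound on pairings is tested with \<open>h\<close> equal to the image vector
  itself.\<close>

lemma norm_hankel_prod_le:
  assumes "symb \<psi>" "0 \<le> \<delta>" "\<And>h. h \<in> A2 \<Longrightarrow> cmod (cinner (hankel_l2 \<phi> A) (Mul \<psi> h)) \<le> \<delta> * (norm A * norm h)"
  shows "norm (hankel_prod \<psi> \<phi> A) \<le> \<delta> * norm A"
proof (cases "hankel_prod \<psi> \<phi> A = 0")
  case True
  then show ?thesis using assms(2) by simp
next
  case False
  let ?X = "hankel_prod \<psi> \<phi> A"
  have "(norm ?X)\<^sup>2 = cmod (cinner ?X ?X)" by (simp add: cinner_self norm_power)
  also have "cinner ?X ?X = cinner (hankel_l2 \<phi> A) (Mul \<psi> ?X)" by (rule cinner_hankel_prod[OF assms(1) hankel_prod_in])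
  also have "cmod \<dots> \<le> \<delta> * (norm A * norm ?X)" by (rule assms(3)[OF hankel_prod_in])
  finally have "norm ?X * norm ?X \<le> (\<delta> * norm A) * norm ?X" by (simp add: power2_eq_square mult.assoc)
  then show ?thesis using False by (subst (asm) mult_le_cancel_right_pos) simp_all
qed

text \<open>Each \<open>d n\<close> is split into a part of high order in \<open>z\<close>, a part
  of high order in \<open>w\<close> and a polynomial with a fixed finite index set. The first two
  have small images uniformly in \<open>n\<close>; the third tends to 0 because finitely many
  coefficients do.\<close>

lemma hankel_prod_null:
  assumes s: "symb \<phi>" "symb \<psi>"
    and z: "\<And>\<delta>. 0 < \<delta> \<Longrightarrow> \<exists>N. \<forall>A\<in>order_z N. \<forall>h\<in>A2. cmod (cinner (hankel_l2 \<phi> A) (Mul \<psi> h)) \<le> \<delta> * (norm A * norm h)"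
    and w: "\<And>\<delta>. 0 < \<delta> \<Longrightarrow> \<exists>N. \<forall>A\<in>order_w N. \<forall>h\<in>A2. cmod (cinner (hankel_l2 \<phi> A) (Mul \<psi> h)) \<le> \<delta> * (norm A * norm h)"
    and d: "\<And>n. d n \<in> A2" "\<And>n. norm (d n) \<le> C" "\<And>p. (\<lambda>n. coef (d n) p) \<longlonglongrightarrow> 0"
  shows "(\<lambda>n. norm (hankel_prod \<psi> \<phi> (d n))) \<longlonglongrightarrow> 0"
proof (rule LIMSEQ_I)
  fix \<epsilon> :: real assume \<epsilon>: "0 < \<epsilon>"
  have C: "0 \<le> C" using d(2)[of 0] norm_ge_zero order_trans by blast
  \<comment> \<open>Each of the two high-order parts has norm at most \<open>2 * C\<close>, so
    together they cost \<open>4 * \<delta> * C\<close>. The summand 1 admits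
    \<open>C = 0\<close>.\<close>
  define \<delta> where "\<delta> = \<epsilon> / (8 * (C + 1))"
  have \<delta>: "0 < \<delta>" "4 * (\<delta> * C) \<le> \<epsilon> / 2" using \<epsilon> C by (auto simp: \<delta>_def field_simps)
  obtain N1 where N1: "\<And>A h. A \<in> order_z N1 \<Longrightarrow> h \<in> A2 \<Longrightarrow> cmod (cinner (hankel_l2 \<phi> A) (Mul \<psi> h)) \<le> \<delta> * (norm A * norm h)"
    using z[OF \<delta>(1)] by blast
  obtain N2 where N2: "\<And>A h. A \<in> order_w N2 \<Longrightarrow> h \<in> A2 \<Longrightarrow> cmod (cinner (hankel_l2 \<phi> A) (Mul \<psi> h)) \<le> \<delta> * (norm A * norm h)"
    using w[OF \<delta>(1)] by blast
  define N where "N = max N1 N2"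
  obtain K where K: "0 \<le> K" "\<And>A. norm (hankel_prod \<psi> \<phi> A) \<le> K * norm A" using hankel_prod_bounded[OF s] by blast
  define S where "S n = lincomb (coef (d n)) (sq N)" for n
  have "(\<lambda>n. \<Sum>p\<in>sq N. (cmod (coef (d n) p))\<^sup>2 * sqnorm p) \<longlonglongrightarrow> (\<Sum>p\<in>sq N. (cmod 0)\<^sup>2 * sqnorm p)"
    by (intro tendsto_sum tendsto_mult tendsto_power tendsto_norm d tendsto_const)
  then have "(\<lambda>n. (norm (S n))\<^sup>2) \<longlonglongrightarrow> 0" by (simp add: S_def norm_lincomb)
  then have "(\<lambda>n. sqrt ((norm (S n))\<^sup>2)) \<longlonglongrightarrow> sqrt 0" by (rule tendsto_real_sqrt)
  then have "(\<lambda>n. K * norm (S n)) \<longlonglongrightarrow> K * 0" by (intro tendsto_mult tendsto_const) simp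
  then have ev: "\<forall>\<^sub>F n in sequentially. K * norm (S n) < \<epsilon> / 2"
    using \<epsilon> by (intro order_tendstoD) auto
  have bound: "norm (hankel_prod \<psi> \<phi> (d n)) \<le> \<epsilon> / 2 + K * norm (S n)" for n
  proof -
    \<comment> \<open>Truncation in the first index alone leaves infinitely many coefficients, so
      the truncated function \<open>E\<close> has to come from Riesz-Fischer.\<close>
    let ?c = "\<lambda>p. if fst p < N then coef (d n) p else 0"
    have cb: "(\<Sum>p\<in>T. (cmod (?c p))\<^sup>2 * sqnorm p) \<le> (norm (d n))\<^sup>2" if "finite T" for T
    proof -
      have "(\<Sum>p\<in>T. (cmod (?c p))\<^sup>2 * sqnorm p) \<le> (\<Sum>p\<in>T. (cmod (coef (d n) p))\<^sup>2 * sqnorm p)"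
        using sqnorm_pos by (intro sum_mono mult_right_mono) (auto intro: less_imp_le)
      then show ?thesis using bessel[OF that, of "d n"] by linarith
    qed
    obtain E where E: "E \<in> A2" "\<And>p. coef E p = ?c p"
      using riesz_fischer_ex[OF cb] by blast
    have "(norm E)\<^sup>2 \<le> (norm (d n))\<^sup>2"
      by (rule norm_A2_le[OF E(1)]) (simp only: E(2) cb)
    then have nE: "norm E \<le> C" using d(2)[of n] power2_le_imp_le norm_ge_zero order_trans by blast
    have "(norm (S n))\<^sup>2 \<le> (norm (d n))\<^sup>2" unfolding S_def by (subst norm_lincomb) (auto intro!: bessel)
    then have nS: "norm (S n) \<le> C" using d(2)[of n] power2_le_imp_le norm_ge_zero order_trans by blast
    have "d n - E \<in> order_z N1"
      unfolding order_z_def using E d(1) by (auto simp: A2_diff coef_simps N_def)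
    then have "norm (hankel_prod \<psi> \<phi> (d n - E)) \<le> \<delta> * norm (d n - E)"
      using \<delta>(1) by (intro norm_hankel_prod_le s N1) auto
    also have "\<dots> \<le> \<delta> * (C + C)"
      using \<delta>(1) d(2)[of n] nE norm_triangle_ineq4[of "d n" E] by (intro mult_left_mono) auto
    finally have 1: "norm (hankel_prod \<psi> \<phi> (d n - E)) \<le> \<delta> * (C + C)" .
    have "E - S n \<in> order_w N2"
      unfolding order_w_def using E by (auto simp: A2_diff coef_simps N_def S_def A2_lincomb coef_lincomb)
    then have "norm (hankel_prod \<psi> \<phi> (E - S n)) \<le> \<delta> * norm (E - S n)"
      using \<delta>(1) by (intro norm_hankel_prod_le s N2) auto
    also have "\<dots> \<le> \<delta> * (C + C)"
      using \<delta>(1) nE nS norm_triangle_ineq4[of E "S n"] by (intro mult_left_mono) auto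
    finally have 2: "norm (hankel_prod \<psi> \<phi> (E - S n)) \<le> \<delta> * (C + C)" .
    have "hankel_prod \<psi> \<phi> (d n) = hankel_prod \<psi> \<phi> (d n - E) + hankel_prod \<psi> \<phi> (E - S n) + hankel_prod \<psi> \<phi> (S n)"
      by (simp add: hankel_prod_linear s)
    also have "norm \<dots> \<le> \<delta> * (C + C) + \<delta> * (C + C) + K * norm (S n)"
      by (intro norm_triangle_mono 1 2 K)
    finally show ?thesis using \<delta>(2) by (simp add: algebra_simps)
  qed
  from ev have "\<forall>\<^sub>F n in sequentially. norm (norm (hankel_prod \<psi> \<phi> (d n)) - 0) < \<epsilon>"
    by eventually_elim (use bound in \<open>smt (verit) norm_ge_zero real_norm_def field_sum_of_halves\<close>)
  then show "\<exists>no. \<forall>n\<ge>no. norm (norm (hankel_prod \<psi> \<phi> (d n)) - 0) < \<epsilon>"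
    by (simp add: eventually_sequentially)
qed

text \<open>Weak compactness of balls by a diagonal argument over the countably many coefficients.
  The limits inherit the Bessel bound, so they are the coefficients of an element of the Bergman
  space.\<close>

lemma weakly_convergent_subsequence:
  assumes f: "\<And>n. f n \<in> A2" "\<And>n. norm (f n) \<le> B"
  shows "\<exists>g r. g \<in> A2 \<and> strict_mono (r :: nat \<Rightarrow> nat) \<and> norm g \<le> B \<and> (\<forall>p. (\<lambda>n. coef (f (r n)) p) \<longlonglongrightarrow> coef g p)"
proof -
  have B: "0 \<le> B" using f(2)[of 0] norm_ge_zero order_trans by blast
  \<comment> \<open>The coefficients themselves have no bound common to all indices; scaling by the
    norm of the monomial provides one, as the diagonal argument requires.\<close>
  have b: "cmod (coef (f n) p * of_real (sqrt (sqnorm p))) \<le> B" for n p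
  proof (rule power2_le_imp_le)
    have "(cmod (coef (f n) p * of_real (sqrt (sqnorm p))))\<^sup>2 = (\<Sum>p\<in>{p}. (cmod (coef (f n) p))\<^sup>2 * sqnorm p)"
      using sqnorm_pos[of p] by (simp add: norm_mult power_mult_distrib)
    also have "\<dots> \<le> (norm (f n))\<^sup>2" by (rule bessel) simp
    also have "\<dots> \<le> B\<^sup>2" by (intro power_mono f) simp
    finally show "(cmod (coef (f n) p * of_real (sqrt (sqnorm p))))\<^sup>2 \<le> B\<^sup>2" .
  qed (rule B)
  obtain r where r: "strict_mono (r :: nat \<Rightarrow> nat)"
    "\<And>p. p \<in> UNIV \<Longrightarrow> \<exists>l. (\<lambda>n. coef (f (r n)) p * of_real (sqrt (sqnorm p))) \<longlonglongrightarrow> l"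
    by (rule function_convergent_subsequence[of "UNIV :: (nat \<times> nat) set" "\<lambda>n p. coef (f n) p * of_real (sqrt (sqnorm p))" B])
      (use b in auto)
  have "\<exists>l. (\<lambda>n. coef (f (r n)) p) \<longlonglongrightarrow> l" for p
  proof -
    obtain l where "(\<lambda>n. coef (f (r n)) p * of_real (sqrt (sqnorm p))) \<longlonglongrightarrow> l" using r(2) by blast
    then have "(\<lambda>n. coef (f (r n)) p * of_real (sqrt (sqnorm p)) / of_real (sqrt (sqnorm p))) \<longlonglongrightarrow> l / of_real (sqrt (sqnorm p))"
      using sqnorm_pos[of p] by (intro tendsto_divide tendsto_const) auto
    then show ?thesis using sqnorm_pos[of p] by auto
  qed
  then obtain c where c: "\<And>p. (\<lambda>n. coef (f (r n)) p) \<longlonglongrightarrow> c p" by metis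
  have cb: "(\<Sum>p\<in>S. (cmod (c p))\<^sup>2 * sqnorm p) \<le> B\<^sup>2" if S: "finite S" for S
  proof (rule LIMSEQ_le_const2)
    show "(\<lambda>n. \<Sum>p\<in>S. (cmod (coef (f (r n)) p))\<^sup>2 * sqnorm p) \<longlonglongrightarrow> (\<Sum>p\<in>S. (cmod (c p))\<^sup>2 * sqnorm p)"
      by (intro tendsto_sum tendsto_mult tendsto_power tendsto_norm c tendsto_const)
    have "(\<Sum>p\<in>S. (cmod (coef (f (r n)) p))\<^sup>2 * sqnorm p) \<le> B\<^sup>2" for n
      using bessel[OF S, of "f (r n)"] power_mono[OF f(2)[of "r n"] norm_ge_zero, of 2] by linarith
    then show "\<exists>N. \<forall>n\<ge>N. (\<Sum>p\<in>S. (cmod (coef (f (r n)) p))\<^sup>2 * sqnorm p) \<le> B\<^sup>2" by blast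
  qed
  obtain g where g: "g \<in> A2" "\<And>p. coef g p = c p" using riesz_fischer_ex[OF cb] by blast
  have "(norm g)\<^sup>2 \<le> B\<^sup>2" by (rule norm_A2_le[OF g(1)]) (simp only: g(2) cb)
  then have "norm g \<le> B" using B by (rule power2_le_imp_le)
  then show ?thesis using g r(1) c by (intro exI[of _ g] exI[of _ r] conjI allI) simp_all
qed

text \<open>Differences from the weak limit are bounded and have coefficients tending to 0, so their
  images tend to 0 in norm.\<close>

lemma hankel_prod_compact:
  assumes cont: "continuous_on (closure bidisk) \<phi>" "continuous_on (closure bidisk) \<psi>"
    and hol: "\<And>e. cmod e = 1 \<Longrightarrow> (\<lambda>w. \<phi> (e, w)) holomorphic_on ball 0 1 \<or> (\<lambda>w. \<psi> (e, w)) holomorphic_on ball 0 1"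
      "\<And>e. cmod e = 1 \<Longrightarrow> (\<lambda>z. \<phi> (z, e)) holomorphic_on ball 0 1 \<or> (\<lambda>z. \<psi> (z, e)) holomorphic_on ball 0 1"
    and f: "\<And>n. f n \<in> A2" "\<And>n. norm (f n) \<le> B"
  shows "\<exists>g\<in>A2. \<exists>r. strict_mono (r :: nat \<Rightarrow> nat) \<and> (\<lambda>n. norm (hankel_prod \<psi> \<phi> (f (r n)) - g)) \<longlonglongrightarrow> 0"
proof -
  have s: "symb \<phi>" "symb \<psi>" using cont symb_continuous_closure by auto
  obtain g r where g: "g \<in> A2" "strict_mono (r :: nat \<Rightarrow> nat)" "norm g \<le> B" "\<And>p. (\<lambda>n. coef (f (r n)) p) \<longlonglongrightarrow> coef g p"
    using weakly_convergent_subsequence[of f B, OF f] by blast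
  have "(\<lambda>n. norm (hankel_prod \<psi> \<phi> (f (r n) - g))) \<longlonglongrightarrow> 0"
  proof (rule hankel_prod_null[OF s, where C="B + B"])
    show "norm (f (r n) - g) \<le> B + B" for n
      using norm_triangle_ineq4[of "f (r n)" g] f(2)[of "r n"] g(3) by linarith
    show "(\<lambda>n. coef (f (r n) - g) p) \<longlonglongrightarrow> 0" for p
      unfolding coef_simps by (rule LIM_zero[OF g(4)])
  qed (use hankel_product_small_z[OF cont hol(1)] hankel_product_small_w[OF cont hol(2)] f g in \<open>auto intro: A2_diff\<close>)
  then show ?thesis using g(2) by (intro bexI[of _ "hankel_prod \<psi> \<phi> g"] exI[of _ r]) (simp_all add: hankel_prod_linear s)
qed

section \<open>Passage to operators on functions\<close>

lemma holomorphic2_continuous: "holomorphic2_on f S \<Longrightarrow> continuous_on S f"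
  unfolding holomorphic2_on_def continuous_on_eq_continuous_within
  by (meson has_derivative_continuous)

text \<open>The value 0 outside the bidisk is prescribed on both sides, so the correspondence is an
  equality of sets of functions and statements transfer by rewriting.\<close>

lemma bergman_space_bidisk: "bergman_space bidisk = ev ` A2"
proof (intro equalityI subsetI)
  fix f assume f: "f \<in> bergman_space bidisk"
  then have h: "holomorphic2_on f bidisk" and o: "\<And>z. z \<notin> bidisk \<Longrightarrow> f z = 0"
    and i: "integrable (lebesgue_on bidisk) (\<lambda>z. (cmod (f z))\<^sup>2)"
    by (auto simp: bergman_space_def l2_space_def)
  have c: "continuous_on bidisk f" by (rule holomorphic2_continuous[OF h])
  have "continuous_on bidisk (\<lambda>z. (cmod (f z))\<^sup>2)" by (intro continuous_intros c)
  then have l2: "l2fun f"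
    using c i integral_lebesgue_bidisk(2) unfolding l2fun_def by blast
  have "f = ev (to_l2 f)"
  proof
    fix z show "f z = ev (to_l2 f) z" by (cases "z \<in> bidisk") (simp_all add: ev_to_l2 l2 o ev_outside)
  qed
  then show "f \<in> ev ` A2" using A2_to_l2[OF l2 h] by blast
next
  fix f assume "f \<in> ev ` A2"
  then obtain F where F: "F \<in> A2" "f = ev F" by blast
  have "continuous_on bidisk (\<lambda>z. (cmod (ev F z))\<^sup>2)" by (intro continuous_intros continuous_ev)
  then have "integrable (lebesgue_on bidisk) (\<lambda>z. (cmod (ev F z))\<^sup>2)"
    using integral_lebesgue_bidisk(2) l2fun_ev[of F] unfolding l2fun_def by blast
  then show "f \<in> bergman_space bidisk"
    using F integral_lebesgue_bidisk(3)[OF continuous_ev] by (simp add: bergman_space_def l2_space_def A2_def ev_outside)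
qed

lemma l2_inner_ev: "l2_inner bidisk (ev F) (ev G) = cinner F G"
  unfolding l2_inner_def cinner_eq by (intro integral_lebesgue_bidisk(1) continuous_intros continuous_ev)

lemma l2_norm_ev: "l2_norm bidisk (ev F) = norm F"
proof -
  have "(LINT z|lebesgue_on bidisk. (cmod (ev F z))\<^sup>2) = (norm F)\<^sup>2"
    unfolding norm_sq by (intro integral_lebesgue_bidisk(1) continuous_intros continuous_ev)
  then show ?thesis by (simp add: l2_norm_def)
qed

lemma ev_diff_fun: "(\<lambda>z. ev F z - ev G z) = ev (F - G)"
  by auto

lemma ev_Mul_fun: "symb \<phi> \<Longrightarrow> (\<lambda>z. \<phi> z * ev F z) = ev (Mul \<phi> F)"
  by (simp add: ev_Mul fun_eq_iff)

text \<open>The definite description denotes: testing against monomials fixes all coefficients of a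
  candidate.\<close>

lemma bergman_projection_ev: "bergman_projection bidisk (ev F) = ev (bproj F)"
  unfolding bergman_projection_def bergman_space_bidisk
proof (rule the_equality)
  show "ev (bproj F) \<in> ev ` A2 \<and> (\<forall>h\<in>ev ` A2. l2_inner bidisk (\<lambda>z. ev F z - ev (bproj F) z) h = 0)"
    by (auto simp: ev_diff_fun l2_inner_ev bproj_orth)
  fix g assume g: "g \<in> ev ` A2 \<and> (\<forall>h\<in>ev ` A2. l2_inner bidisk (\<lambda>z. ev F z - g z) h = 0)"
  then obtain G where G: "G \<in> A2" "g = ev G" by blast
  have "cinner (F - G) (zmono p) = 0" for p
    using g A2_zmono[of p] unfolding G(2) ev_diff_fun by (auto simp: l2_inner_ev)
  then have "bproj F = G" using G by (intro bproj_unique) (auto simp: coef_def cinner_diff_left)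
  then show "g = ev (bproj F)" using G by simp
qed

lemma hankel_ev: "symb \<phi> \<Longrightarrow> hankel bidisk \<phi> (ev F) = ev (hankel_l2 \<phi> F)"
  by (simp add: hankel_def ev_Mul_fun bergman_projection_ev ev_diff_fun[symmetric] hankel_l2_def ev_Mul fun_eq_iff)

text \<open>Here too monomials determine the candidate. The defining identity holds because a Hankel
  vector is orthogonal to the holomorphic part of \<open>\<psi> * f\<close>, so it pairs with
  \<open>\<psi> * f\<close> as it does with the Hankel vector of \<open>f\<close>.\<close>

lemma bergman_adjoint_ev:
  assumes s: "symb \<phi>" "symb \<psi>"
  shows "bergman_adjoint bidisk (hankel bidisk \<psi>) (ev (hankel_l2 \<phi> F)) = ev (hankel_prod \<psi> \<phi> F)"
  unfolding bergman_adjoint_def bergman_space_bidisk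
proof (rule the_equality)
  have eq: "cinner (hankel_l2 \<psi> f) (hankel_l2 \<phi> F) = cinner f (hankel_prod \<psi> \<phi> F)" if f: "f \<in> A2" for f
  proof -
    have "cinner (hankel_prod \<psi> \<phi> F) f = cinner (hankel_l2 \<phi> F) (hankel_l2 \<psi> f)"
      using cinner_hankel_prod[OF s(2) f] cinner_hankel_l2_Mul by simp
    then show ?thesis by (metis cinner_cnj)
  qed
  then show "ev (hankel_prod \<psi> \<phi> F) \<in> ev ` A2 \<and>
      (\<forall>f\<in>ev ` A2. l2_inner bidisk (hankel bidisk \<psi> f) (ev (hankel_l2 \<phi> F)) = l2_inner bidisk f (ev (hankel_prod \<psi> \<phi> F)))"
    by (auto simp: hankel_ev s l2_inner_ev)
  fix g assume g: "g \<in> ev ` A2 \<and> (\<forall>f\<in>ev ` A2. l2_inner bidisk (hankel bidisk \<psi> f) (ev (hankel_l2 \<phi> F)) = l2_inner bidisk f g)"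
  then obtain G where G: "G \<in> A2" "g = ev G" by blast
  have "cinner (hankel_prod \<psi> \<phi> F - G) (zmono p) = 0" for p
  proof -
    have "cinner (zmono p) (hankel_prod \<psi> \<phi> F) = cinner (zmono p) G"
      using g A2_zmono[of p] unfolding G(2) by (auto simp: hankel_ev s l2_inner_ev eq)
    then have "cinner (hankel_prod \<psi> \<phi> F) (zmono p) = cinner G (zmono p)" by (metis cinner_cnj)
    then show ?thesis by (simp add: cinner_diff_left)
  qed
  then have "hankel_prod \<psi> \<phi> F - G = 0" by (intro A2_coef_eq_0 A2_diff G hankel_prod_in)
  then show "g = ev (hankel_prod \<psi> \<phi> F)" using G by simp
qed

definition compact_hankel_prod :: "(complex \<times> complex \<Rightarrow> complex) \<Rightarrow> (complex \<times> complex \<Rightarrow> complex) \<Rightarrow> bool" where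
  "compact_hankel_prod \<psi> \<phi> \<longleftrightarrow> (\<forall>f B. (\<forall>n. f n \<in> A2 \<and> norm (f n) \<le> B) \<longrightarrow>
     (\<exists>g\<in>A2. \<exists>r. strict_mono (r :: nat \<Rightarrow> nat) \<and> (\<lambda>n. norm (hankel_prod \<psi> \<phi> (f (r n)) - g)) \<longlonglongrightarrow> 0))"

lemma compact_on_bergman_iff:
  assumes s: "symb \<phi>" "symb \<psi>"
  shows "compact_on_bergman bidisk (bergman_adjoint bidisk (hankel bidisk \<psi>) \<circ> hankel bidisk \<phi>) \<longleftrightarrow> compact_hankel_prod \<psi> \<phi>"
proof -
  let ?T = "bergman_adjoint bidisk (hankel bidisk \<psi>) \<circ> hankel bidisk \<phi>"
  have T: "l2_norm bidisk (\<lambda>z. ?T (ev F) z - ev G z) = norm (hankel_prod \<psi> \<phi> F - G)" for F G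
    by (simp add: hankel_ev s bergman_adjoint_ev ev_diff_fun l2_norm_ev)
  show ?thesis
  proof
    assume c: "compact_on_bergman bidisk ?T"
    show "compact_hankel_prod \<psi> \<phi>" unfolding compact_hankel_prod_def
    proof (intro allI impI)
      fix f :: "nat \<Rightarrow> l2c" and B assume f: "\<forall>n. f n \<in> A2 \<and> norm (f n) \<le> B"
      have "(\<forall>n. ev (f n) \<in> bergman_space bidisk) \<and> (\<exists>B. \<forall>n. l2_norm bidisk (ev (f n)) \<le> B)"
        using f by (auto simp: bergman_space_bidisk l2_norm_ev)
      then have "\<exists>g\<in>bergman_space bidisk. \<exists>r. strict_mono r \<and> (\<lambda>n. l2_norm bidisk (\<lambda>z. ?T (ev (f (r n))) z - g z)) \<longlonglongrightarrow> 0"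
        using c unfolding compact_on_bergman_def by meson
      then show "\<exists>g\<in>A2. \<exists>r. strict_mono r \<and> (\<lambda>n. norm (hankel_prod \<psi> \<phi> (f (r n)) - g)) \<longlonglongrightarrow> 0"
        unfolding bergman_space_bidisk by (auto simp only: T bex_simps image_iff)
    qed
  next
    assume c: "compact_hankel_prod \<psi> \<phi>"
    show "compact_on_bergman bidisk ?T" unfolding compact_on_bergman_def
    proof (intro allI impI)
      fix f :: "nat \<Rightarrow> complex \<times> complex \<Rightarrow> complex"
      assume f: "(\<forall>n. f n \<in> bergman_space bidisk) \<and> (\<exists>B. \<forall>n. l2_norm bidisk (f n) \<le> B)"
      then have "\<forall>n. \<exists>F. F \<in> A2 \<and> f n = ev F" by (auto simp: bergman_space_bidisk)
      then obtain F where F: "\<And>n. F n \<in> A2" "\<And>n. f n = ev (F n)" by metis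
      obtain B where "\<And>n. norm (F n) \<le> B" using f F by (auto simp: l2_norm_ev)
      then obtain g r where "g \<in> A2" "strict_mono r" "(\<lambda>n. norm (hankel_prod \<psi> \<phi> (F (r n)) - g)) \<longlonglongrightarrow> 0"
        using c F unfolding compact_hankel_prod_def by meson
      then show "\<exists>g\<in>bergman_space bidisk. \<exists>r. strict_mono r \<and> (\<lambda>n. l2_norm bidisk (\<lambda>z. ?T (f (r n)) z - g z)) \<longlonglongrightarrow> 0"
        unfolding bergman_space_bidisk by (intro bexI[of _ "ev g"] exI[of _ r]) (simp_all only: F T imageI simp_thms)
    qed
  qed
qed

lemma compact_hankel_prod_swap:
  assumes "symb \<phi>" "symb \<psi>" "compact_hankel_prod \<psi> \<phi>"
  shows "compact_hankel_prod (\<lambda>p. \<psi> (prod.swap p)) (\<lambda>p. \<phi> (prod.swap p))"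
  unfolding compact_hankel_prod_def
proof (intro allI impI)
  fix f :: "nat \<Rightarrow> l2c" and B assume f: "\<forall>n. f n \<in> A2 \<and> norm (f n) \<le> B"
  have X: "hankel_prod (\<lambda>p. \<psi> (prod.swap p)) (\<lambda>p. \<phi> (prod.swap p)) F = swap_l2 (hankel_prod \<psi> \<phi> (swap_l2 F))" for F
    using assms by (simp add: hankel_prod_def hankel_l2_def swap_l2_bproj swap_l2_Mul swap_l2_diff symb_cnj)
  have "\<forall>n. swap_l2 (f n) \<in> A2 \<and> norm (swap_l2 (f n)) \<le> B" using f by (simp add: A2_swap_l2)
  then obtain g r where g: "g \<in> A2" "strict_mono r" "(\<lambda>n. norm (hankel_prod \<psi> \<phi> (swap_l2 (f (r n))) - g)) \<longlonglongrightarrow> 0"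
    using assms(3)[unfolded compact_hankel_prod_def, rule_format, of "\<lambda>n. swap_l2 (f n)" B] by blast
  have "norm (hankel_prod (\<lambda>p. \<psi> (prod.swap p)) (\<lambda>p. \<phi> (prod.swap p)) F - swap_l2 g) = norm (hankel_prod \<psi> \<phi> (swap_l2 F) - g)" for F
    unfolding X swap_l2_diff[symmetric] by simp
  then show "\<exists>g\<in>A2. \<exists>r. strict_mono r \<and> (\<lambda>n. norm (hankel_prod (\<lambda>p. \<psi> (prod.swap p)) (\<lambda>p. \<phi> (prod.swap p)) (f (r n)) - g)) \<longlonglongrightarrow> 0"
    using g A2_swap_l2 by (intro bexI[of _ "swap_l2 g"] exI[of _ r]) auto
qed

text \<open>Bounded norms and vanishing coefficients give weak convergence: \<open>g\<close> is
  approximated by a finite partial sum, against which only finitely many coefficients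
  matter.\<close>

lemma weak_null_cinner:
  assumes g: "g \<in> A2" and h: "\<And>n. norm (h n) \<le> C" "\<And>p. (\<lambda>n. coef (h n) p) \<longlonglongrightarrow> 0"
  shows "(\<lambda>n. cinner g (h n)) \<longlonglongrightarrow> 0"
proof (rule LIMSEQ_I)
  fix \<epsilon> :: real assume \<epsilon>: "0 < \<epsilon>"
  have C: "0 \<le> C" using h(1)[of 0] norm_ge_zero order_trans by blast
  have "0 < \<epsilon> / (2 * (C + 1))" using \<epsilon> C by simp
  then obtain k where k: "norm (lincomb (coef g) (sq k) - g) < \<epsilon> / (2 * (C + 1))"
    using LIMSEQ_D[OF A2_expand(1)[OF g]] by blast
  let ?S = "lincomb (coef g) (sq k)"
  have "(\<lambda>n. cinner (h n) ?S) \<longlonglongrightarrow> (\<Sum>p\<in>sq k. cnj (coef g p) * 0 * of_real (sqnorm p))"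
    unfolding cinner_lincomb_right by (intro tendsto_sum tendsto_mult tendsto_const h)
  then have "(\<lambda>n. cmod (cinner (h n) ?S)) \<longlonglongrightarrow> 0" using tendsto_norm_zero by simp
  then have "\<forall>\<^sub>F n in sequentially. cmod (cinner (h n) ?S) < \<epsilon> / 2"
    using \<epsilon> by (intro order_tendstoD) auto
  then have "\<forall>\<^sub>F n in sequentially. norm (cinner g (h n) - 0) < \<epsilon>"
  proof eventually_elim
    case (elim n)
    have "cinner g (h n) = cinner ?S (h n) - cinner (?S - g) (h n)" by (simp add: cinner_diff_left)
    also have "cmod \<dots> \<le> cmod (cinner ?S (h n)) + cmod (cinner (?S - g) (h n))" by (rule norm_triangle_ineq4)
    also have "cmod (cinner ?S (h n)) = cmod (cinner (h n) ?S)" by (metis cinner_cnj complex_mod_cnj)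
    also have "cmod (cinner (?S - g) (h n)) \<le> norm (?S - g) * norm (h n)" by (rule cmod_cinner_le)
    also have "norm (?S - g) * norm (h n) \<le> \<epsilon> / (2 * (C + 1)) * C"
      using k h(1)[of n] C \<epsilon> by (intro mult_mono) auto
    also have "\<dots> \<le> \<epsilon> / 2" using \<epsilon> C by (simp add: field_simps)
    finally show ?case using elim by simp
  qed
  then show "\<exists>no. \<forall>n\<ge>no. norm (cinner g (h n) - 0) < \<epsilon>" by (simp add: eventually_sequentially)
qed


section \<open>Peak functions\<close>

text \<open>A partial sum of \<open>1 / (1 - cnj e * z)^2\<close>, which is \<open>pi\<close> times
  the Bergman kernel of the disc with its pole moved to the circle point \<open>e\<close>. The full
  series is not square integrable, hence the truncation.\<close>

definition peak :: "complex \<Rightarrow> nat \<Rightarrow> complex \<Rightarrow> complex" where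
  "peak e N z = (\<Sum>m<N. of_nat (Suc m) * cnj e ^ m * z ^ m)"

lemma peak_mult: "peak e N z * cnj (peak e N z) = (\<Sum>m<N. \<Sum>l<N. (of_nat (Suc m) * cnj e ^ m) * (of_nat (Suc l) * e ^ l) * (z ^ m * cnj z ^ l))"
  unfolding peak_def cnj_sum sum_product by (intro sum.cong refl) (simp add: mult_ac)

lemma sum_Suc_real: "(\<Sum>m<N. of_nat (Suc m) :: complex) = of_nat N * of_nat (Suc N) / 2"
  by (induction N) (simp_all add: field_simps)

text \<open>The total mass of the squared modulus and its first moment. Their quotient is
  \<open>e\<close> times \<open>(N - 1) / (N + 1)\<close>, so the normalised mass gathers at
  \<open>e\<close>.\<close>

lemma peak_integrals:
  assumes e: "cmod e = 1"
  shows "(LINT z|disc_measure. peak e N z * cnj (peak e N z)) = of_real pi * (of_nat N * of_nat (Suc N) / 2)"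
    and "(LINT z|disc_measure. z * (peak e N z * cnj (peak e N z))) = of_real pi * e * (of_nat (N - 1) * of_nat N / 2)"
proof -
  have ee: "cnj e ^ m * e ^ m = 1" for m
    using e complex_norm_square[of e] by (simp add: power_mult_distrib[symmetric] mult.commute)
  have "(LINT z|disc_measure. peak e N z * cnj (peak e N z)) = (\<Sum>m<N. \<Sum>l<N. (of_nat (Suc m) * cnj e ^ m) * (of_nat (Suc l) * e ^ l) * moment m l)"
    unfolding peak_mult moment_def
    by (simp only: Bochner_Integration.integral_sum integrable_mult_right integrable_disc_monom Bochner_Integration.integrable_sum integral_mult_right_zero)
  also have "\<dots> = (\<Sum>m<N. \<Sum>l<N. if l = m then of_real pi * of_nat (Suc m) else 0)"
    using ee by (intro sum.cong refl) (auto simp: moment_eq mult_ac simp del: of_nat_Suc)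
  also have "\<dots> = of_real pi * (of_nat N * of_nat (Suc N) / 2)"
    by (simp only: sum.delta' finite_lessThan sum_distrib_left[symmetric] sum_Suc_real[symmetric]) (simp add: sum_distrib_left)
  finally show "(LINT z|disc_measure. peak e N z * cnj (peak e N z)) = of_real pi * (of_nat N * of_nat (Suc N) / 2)" .
  have zp: "z * (peak e N z * cnj (peak e N z)) = (\<Sum>m<N. \<Sum>l<N. (of_nat (Suc m) * cnj e ^ m) * (of_nat (Suc l) * e ^ l) * (z ^ Suc m * cnj z ^ l))" for z
    unfolding peak_mult sum_distrib_left by (intro sum.cong refl) (simp add: mult_ac)
  have "(LINT z|disc_measure. z * (peak e N z * cnj (peak e N z))) = (\<Sum>m<N. \<Sum>l<N. (of_nat (Suc m) * cnj e ^ m) * (of_nat (Suc l) * e ^ l) * moment (Suc m) l)"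
    unfolding zp moment_def
    by (simp only: Bochner_Integration.integral_sum integrable_mult_right integrable_disc_monom Bochner_Integration.integrable_sum integral_mult_right_zero)
  also have "\<dots> = (\<Sum>m<N. \<Sum>l<N. if l = Suc m then of_real pi * e * of_nat (Suc m) else 0)"
  proof (intro sum.cong refl)
    fix m l
    have "(of_nat (Suc m) * cnj e ^ m) * (of_nat (Suc (Suc m)) * e ^ Suc m) * (complex_of_real pi / of_nat (Suc (Suc m))) = of_real pi * e * of_nat (Suc m) * (cnj e ^ m * e ^ m)"
      by (simp add: mult_ac del: of_nat_Suc)
    then show "(of_nat (Suc m) * cnj e ^ m) * (of_nat (Suc l) * e ^ l) * moment (Suc m) l = (if l = Suc m then of_real pi * e * of_nat (Suc m) else 0)"
      by (auto simp: moment_eq ee simp del: of_nat_Suc power_Suc)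
  qed
  \<comment> \<open>The factor \<open>z\<close> pairs the index \<open>m\<close> with
    \<open>m + 1\<close>; the top index has no partner, which leaves \<open>N - 1\<close>
    terms.\<close>
  also have "\<dots> = (\<Sum>m<N. if Suc m < N then of_real pi * e * of_nat (Suc m) else 0)"
    by (intro sum.cong refl) (simp del: of_nat_Suc)
  also have "\<dots> = (\<Sum>m<N - 1. of_real pi * e * of_nat (Suc m))"
    by (rule sum.mono_neutral_cong_right) auto
  also have "\<dots> = of_real pi * e * (of_nat (N - 1) * of_nat N / 2)"
    unfolding sum_distrib_left[symmetric] sum_Suc_real by (cases N) simp_all
  finally show "(LINT z|disc_measure. z * (peak e N z * cnj (peak e N z))) = of_real pi * e * (of_nat (N - 1) * of_nat N / 2)" .
qed

lemma ev_z_independent: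
  assumes F: "F \<in> A2" and 0: "\<And>m n. 0 < m \<Longrightarrow> coef F (m, n) = 0" and zw: "(z, w) \<in> bidisk"
  shows "ev F (z, w) = ev F (0, w)"
proof -
  have "cmod z < 1" "cmod w < 1" using zw by (auto simp: bidisk_def)
  then obtain \<rho> where \<rho>: "max (cmod z) (cmod w) < \<rho>" "\<rho> < 1" using dense[of "max (cmod z) (cmod w)" 1] by auto
  then have \<rho>0: "0 < \<rho>" using norm_ge_zero[of z] by linarith
  have zw0: "(0, w) \<in> bidisk" using zw by (auto simp: bidisk_def)
  have "(\<lambda>k. ev (lincomb (coef F) (sq k)) (z, w)) \<longlonglongrightarrow> ev F (z, w)" "(\<lambda>k. ev (lincomb (coef F) (sq k)) (0, w)) \<longlonglongrightarrow> ev F (0, w)"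
    using \<rho> \<rho>0 by (auto intro!: tendsto_uniform_limitI[OF A2_expand(2)[OF F \<rho>0 \<rho>(2)]])
  moreover have "ev (lincomb (coef F) (sq k)) (z, w) = ev (lincomb (coef F) (sq k)) (0, w)" for k
    unfolding ev_lincomb[OF zw] ev_lincomb[OF zw0]
  proof (rule sum.cong[OF refl])
    fix p show "coef F p * (fst (z, w) ^ fst p * snd (z, w) ^ snd p) = coef F p * (fst (0, w) ^ fst p * snd (0, w) ^ snd p)"
      using 0[of "fst p" "snd p"] by (cases "fst p = 0") simp_all
  qed
  ultimately show ?thesis using LIMSEQ_unique by auto
qed

lemma symb_fst_cont: "continuous_on (cball 0 1) k \<Longrightarrow> symb (\<lambda>p. k (fst p))"
  by (rule symb_continuous_closure) (auto simp: closure_bidisk intro!: continuous_on_compose2[of "cball 0 1" k] continuous_intros)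

lemma symb_snd_cont: "continuous_on (cball 0 1) k \<Longrightarrow> symb (\<lambda>p. k (snd p))"
  by (rule symb_continuous_closure) (auto simp: closure_bidisk intro!: continuous_on_compose2[of "cball 0 1" k] continuous_intros)

text \<open>The projection of a function of \<open>w\<close> has no coefficients with positive first
  index, since \<open>1\<close> is orthogonal to the positive powers of \<open>z\<close>. So the
  Hankel vector is again a function of \<open>w\<close>.\<close>

lemma hankel_l2_snd_z_independent:
  assumes a: "continuous_on (cball 0 1) a"
  shows "\<exists>v. \<forall>z w. (z, w) \<in> bidisk \<longrightarrow> ev (hankel_l2 (\<lambda>p. a (snd p)) (zmono (0, i))) (z, w) = v w"
proof -
  let ?a = "\<lambda>p. a (snd p)"
  have s: "symb ?a" by (rule symb_snd_cont[OF a])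
  define u where "u = bproj (Mul ?a (zmono (0, i)))"
  have c0: "coef u (m, n) = 0" if "0 < m" for m n
  proof -
    have "cinner (Mul ?a (zmono (0, i))) (zmono (m, n)) = moment 0 m * (LINT w|disc_measure. a w * w ^ i * cnj w ^ n)"
      unfolding moment_def by (rule Fubini_product) (simp add: ev_Mul s ev_zmono bidisk_def mult_ac)
    moreover have "coef u (m, n) = cinner (Mul ?a (zmono (0, i))) (zmono (m, n)) / of_real (sqnorm (m, n))"
      by (simp only: u_def coef_bproj) (simp only: coef_def)
    ultimately show ?thesis using that by (simp add: moment_eq)
  qed
  have "ev (hankel_l2 ?a (zmono (0, i))) (z, w) = a w * w ^ i - ev u (0, w)" if "(z, w) \<in> bidisk" for z w
    using ev_z_independent[OF _ c0 that] that by (simp add: hankel_l2_def u_def ev_Mul s ev_zmono)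
  then show ?thesis by (intro exI[of _ "\<lambda>w. a w * w ^ i - ev u (0, w)"]) blast
qed

lemma peak_continuous: "continuous_on S (peak e N)"
  unfolding peak_def[abs_def] by (intro continuous_intros)

lemma peak_holomorphic: "peak e N holomorphic_on S"
  unfolding peak_def[abs_def] by (intro holomorphic_intros)

text \<open>The factor normalises the peak function in \<open>z\<close> to norm 1, see \<open>peak_integrals\<close>.\<close>

definition peak_fun :: "complex \<Rightarrow> nat \<Rightarrow> nat \<Rightarrow> l2c" where
  "peak_fun e i N = of_real (1 / sqrt (pi * (real (Suc N) * real (Suc (Suc N)) / 2))) *\<^sub>C Mul (\<lambda>p. peak e (Suc N) (fst p)) (zmono (0, i))"

lemma peak_fun_A2: "peak_fun e i N \<in> A2"
  unfolding peak_fun_def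
  by (intro A2_cscale A2_Mul symb_fst_cont peak_continuous A2_zmono holomorphic2_on_fst peak_holomorphic)

lemma ev_peak_fun: "(z, w) \<in> bidisk \<Longrightarrow> ev (peak_fun e i N) (z, w)
   = of_real (1 / sqrt (pi * (real (Suc N) * real (Suc (Suc N)) / 2))) * (peak e (Suc N) z * w ^ i)"
  unfolding peak_fun_def by (simp add: ev_Mul symb_fst_cont peak_continuous ev_zmono)

text \<open>The normalised peak factor in \<open>z\<close> contributes exactly 1, so the pairing
  does not depend on \<open>N\<close>.\<close>

lemma peak_fun_tensor:
  assumes e: "cmod e = 1"
    and F: "\<And>z w. (z, w) \<in> bidisk \<Longrightarrow> ev F (z, w) = of_real (1 / sqrt (pi * (real (Suc N) * real (Suc (Suc N)) / 2))) * peak e (Suc N) z * f w"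
    and G: "\<And>z w. (z, w) \<in> bidisk \<Longrightarrow> ev G (z, w) = of_real (1 / sqrt (pi * (real (Suc N) * real (Suc (Suc N)) / 2))) * peak e (Suc N) z * g w"
  shows "cinner F G = (LINT w|disc_measure. f w * cnj (g w))"
proof -
  let ?v = "pi * (real (Suc N) * real (Suc (Suc N)) / 2)"
  have v: "0 < ?v" by simp
  have "cinner F G = (LINT z|disc_measure. of_real (1 / ?v) * (peak e (Suc N) z * cnj (peak e (Suc N) z))) * (LINT w|disc_measure. f w * cnj (g w))"
  proof (rule Fubini_product)
    fix z w :: complex assume "z \<in> ball 0 1" "w \<in> ball 0 1"
    then have b: "(z, w) \<in> bidisk" by (simp add: bidisk_def)
    have cc: "complex_of_real (1 / sqrt ?v) * of_real (1 / sqrt ?v) = of_real (1 / ?v)"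
      using real_sqrt_mult_self[of ?v] v unfolding of_real_mult[symmetric] times_divide_times_eq by simp
    have alg: "(c * p * x) * cnj (c * p * y) = (c * c) * (p * cnj p) * (x * cnj y)" if "cnj c = c" for c p x y :: complex
      using that by (simp add: mult_ac)
    show "ev F (z, w) * cnj (ev G (z, w)) = of_real (1 / ?v) * (peak e (Suc N) z * cnj (peak e (Suc N) z)) * (f w * cnj (g w))"
      unfolding F[OF b] G[OF b] cc[symmetric] by (rule alg) (rule complex_cnj_complex_of_real)
  qed
  also have "(LINT z|disc_measure. of_real (1 / ?v) * (peak e (Suc N) z * cnj (peak e (Suc N) z))) = of_real (1 / ?v) * of_real ?v"
    unfolding integral_mult_right_zero peak_integrals(1)[OF e] by simp
  also have "\<dots> = 1" using v by (simp only: of_real_mult[symmetric]) simp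
  finally show ?thesis by simp
qed


lemma norm_diff_expand: "(norm (X - Y))\<^sup>2 = (norm X)\<^sup>2 + (norm Y)\<^sup>2 - 2 * Re (cinner X Y)"
  unfolding power2_norm_eq_inner inner_diff_left inner_diff_right
  by (simp add: inner_commute[of Y X]) (simp add: inner_l2c_def)

lemma peak_fun_norm:
  assumes e: "cmod e = 1"
  shows "(norm (peak_fun e i N))\<^sup>2 = pi / real (Suc i)"
proof -
  have "cinner (peak_fun e i N) (peak_fun e i N) = (LINT w|disc_measure. w ^ i * cnj (w ^ i))"
    by (rule peak_fun_tensor[OF e]) (simp_all add: ev_peak_fun)
  also have "\<dots> = moment i i" by (simp add: moment_def)
  finally have "complex_of_real ((norm (peak_fun e i N))\<^sup>2) = of_real (pi / real (Suc i))"
    unfolding cinner_self by (simp add: moment_eq)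
  then show ?thesis by (simp only: of_real_eq_iff)
qed

lemma peak_fun_norm_le:
  assumes e: "cmod e = 1" shows "(norm (peak_fun e i N))\<^sup>2 \<le> pi" "norm (peak_fun e i N) \<le> 2"
proof -
  show *: "(norm (peak_fun e i N))\<^sup>2 \<le> pi"
    unfolding peak_fun_norm[OF e] by (simp add: field_simps)
  have "(norm (peak_fun e i N))\<^sup>2 \<le> 2\<^sup>2" using * pi_less_4 by simp
  then show "norm (peak_fun e i N) \<le> 2" by (rule power2_le_imp_le) simp
qed

text \<open>Expanding the squared norm of \<open>(z - e)\<close> times the peak function leaves the
  cross term, known from the first moment. With the truncation at \<open>Suc N\<close> the quotient
  of moments is \<open>N / (N + 2)\<close>, and \<open>2 - 2 * N / (N + 2)\<close> is
  \<open>4 / (N + 2)\<close>.\<close>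

lemma peak_fun_concentrates:
  assumes e: "cmod e = 1"
  shows "(norm (Mul (\<lambda>p. fst p - e) (peak_fun e i N)))\<^sup>2 \<le> 4 * pi / (real N + 2)"
proof -
  let ?f = "peak_fun e i N" and ?v = "pi * (real (Suc N) * real (Suc (Suc N)) / 2)"
  have v: "0 < ?v" by simp
  let ?Z = "Mul (monom_symb 1 0 0 0) ?f"
  have s: "symb (\<lambda>p. fst p - e)" by (intro symb_fst_cont[of "\<lambda>z. z - e"] continuous_intros)
  have X: "Mul (\<lambda>p. fst p - e) ?f = ?Z - e *\<^sub>C ?f"
    by (rule l2c_eqI) (simp add: ev_Mul s, simp add: monom_symb_def algebra_simps)
  have "cinner ?Z ?f = (LINT z|disc_measure. of_real (1 / ?v) * (z * (peak e (Suc N) z * cnj (peak e (Suc N) z)))) * (LINT w|disc_measure. w ^ i * cnj w ^ i)"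
  proof (rule Fubini_product)
    fix z w :: complex assume "z \<in> ball 0 1" "w \<in> ball 0 1"
    then have b: "(z, w) \<in> bidisk" by (simp add: bidisk_def)
    have cc: "complex_of_real (1 / sqrt ?v) * of_real (1 / sqrt ?v) = of_real (1 / ?v)"
      using real_sqrt_mult_self[of ?v] v unfolding of_real_mult[symmetric] times_divide_times_eq by simp
    have alg: "z * (c * (p * w ^ i)) * cnj (c * (p * w ^ i)) = (c * c) * (z * (p * cnj p)) * (w ^ i * cnj w ^ i)" if "cnj c = c" for c p :: complex
      using that by (simp add: mult_ac)
    have "ev ?Z (z, w) = z * ev ?f (z, w)" by (simp add: ev_Mul, simp add: monom_symb_def)
    then show "ev ?Z (z, w) * cnj (ev ?f (z, w)) = of_real (1 / ?v) * (z * (peak e (Suc N) z * cnj (peak e (Suc N) z))) * (w ^ i * cnj w ^ i)"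
      unfolding ev_peak_fun[OF b] cc[symmetric] by (simp only:) (rule alg, rule complex_cnj_complex_of_real)
  qed
  also have "(LINT w|disc_measure. w ^ i * cnj w ^ i) = of_real (pi / real (Suc i))"
    using moment_eq[of i i] by (simp add: moment_def)
  also have "(LINT z|disc_measure. of_real (1 / ?v) * (z * (peak e (Suc N) z * cnj (peak e (Suc N) z)))) = e * of_real (real N / (real N + 2))"
  proof -
    have "(1 / ?v) * (pi * (real N * real (Suc N) / 2)) = real N / (real N + 2)"
      by (simp add: divide_simps) (simp add: algebra_simps)?
    then have "complex_of_real (1 / ?v) * of_real (pi * (real N * real (Suc N) / 2)) = of_real (real N / (real N + 2))"
      by (simp only: of_real_mult[symmetric])
    then show ?thesis
    proof -
      assume eq: "complex_of_real (1 / ?v) * of_real (pi * (real N * real (Suc N) / 2)) = of_real (real N / (real N + 2))"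
      have "of_real pi * e * (of_nat (Suc N - 1) * of_nat (Suc N) / 2) = e * complex_of_real (pi * (real N * real (Suc N) / 2))"
        by simp
      then show ?thesis
        unfolding integral_mult_right_zero peak_integrals(2)[OF e] by (simp only: mult.left_commute[of _ e] eq)
    qed
  qed
  finally have c: "cinner ?Z ?f = e * of_real (real N / (real N + 2)) * of_real (pi / real (Suc i))" .
  have "cinner ?Z (e *\<^sub>C ?f) = (cnj e * e) * of_real (real N / (real N + 2) * (pi / real (Suc i)))"
    unfolding cinner_cscale_right c by (simp add: mult_ac)
  also have "cnj e * e = 1" using e complex_norm_square[of e] by (simp add: mult.commute)
  finally have re: "Re (cinner ?Z (e *\<^sub>C ?f)) = real N / (real N + 2) * (pi / real (Suc i))" by (simp only: mult_1_left Re_complex_of_real)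
  have Z: "(norm ?Z)\<^sup>2 \<le> (norm ?f)\<^sup>2" by (intro power_mono norm_monom_symb_le) simp
  have "(norm (?Z - e *\<^sub>C ?f))\<^sup>2 \<le> 2 * (pi / real (Suc i)) - 2 * (real N / (real N + 2) * (pi / real (Suc i)))"
    unfolding norm_diff_expand re using Z e by (simp add: peak_fun_norm)
  also have "\<dots> = (pi / real (Suc i)) * (2 - 2 * (real N / (real N + 2)))" by (simp add: algebra_simps)
  also have "2 - 2 * (real N / (real N + 2)) = 4 / (real N + 2)" by (simp add: field_simps)
  also have "(pi / real (Suc i)) * (4 / (real N + 2)) \<le> pi * (4 / (real N + 2))"
    by (intro mult_right_mono) (auto simp: field_simps)
  finally show ?thesis by (simp add: X mult.commute)
qed

text \<open>Close to \<open>z = e\<close> uniform continuity makes the difference small. Elsewhere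
  the difference is at most \<open>M / d\<close> times \<open>|z - e|\<close>, and the peak
  functions make this factor small in norm.\<close>

lemma peak_localization:
  assumes cont: "continuous_on (closure bidisk) \<phi>" and e: "cmod e = 1"
  shows "(\<lambda>N. norm (Mul (\<lambda>p. \<phi> p - \<phi> (e, snd p)) (peak_fun e i N))) \<longlonglongrightarrow> 0"
proof (rule LIMSEQ_I)
  fix \<eta> :: real assume \<eta>: "0 < \<eta>"
  have s: "symb \<phi>" by (rule symb_continuous_closure[OF cont])
  have eb: "(e, snd p) \<in> closure bidisk" if "p \<in> closure bidisk" for p using e that by (auto simp: closure_bidisk)
  have s0: "symb (\<lambda>p. \<phi> (e, snd p))"
    by (rule symb_continuous_closure[OF continuous_on_compose2[OF cont]]) (use eb in \<open>auto intro!: continuous_intros\<close>)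
  let ?\<Delta> = "\<lambda>p. \<phi> p - \<phi> (e, snd p)"
  have s\<Delta>: "symb ?\<Delta>" by (intro symb_diff s s0)
  then obtain M where M: "0 \<le> M" "\<And>p. p \<in> bidisk \<Longrightarrow> cmod (?\<Delta> p) \<le> M" using symb_bound by blast
  have sz: "symb (\<lambda>p. fst p - e)" by (intro symb_fst_cont[of "\<lambda>z. z - e"] continuous_intros)
  \<comment> \<open>The quarter pays for the factor \<open>pi < 16\<close> in the squared
    norm.\<close>
  define \<epsilon> where "\<epsilon> = \<eta> / 4"
  have \<epsilon>: "0 < \<epsilon>" using \<eta> by (simp add: \<epsilon>_def)
  have "compact (closure bidisk)" unfolding closure_bidisk by (intro compact_Times) auto
  then have "uniformly_continuous_on (closure bidisk) \<phi>"
    using cont compact_uniformly_continuous by blast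
  then obtain d where d: "0 < d" "\<And>x x'. x \<in> closure bidisk \<Longrightarrow> x' \<in> closure bidisk \<Longrightarrow> dist x' x < d \<Longrightarrow> dist (\<phi> x') (\<phi> x) < \<epsilon>"
    using \<epsilon> unfolding uniformly_continuous_on_def by metis
  have pw: "(cmod (?\<Delta> p))\<^sup>2 \<le> \<epsilon>\<^sup>2 + (M / d)\<^sup>2 * (cmod (fst p - e))\<^sup>2" if p: "p \<in> bidisk" for p
  proof (cases "cmod (fst p - e) < d")
    case True
    have pc: "p \<in> closure bidisk" using p closure_subset by blast
    have "dist p (e, snd p) < d" using True by (cases p) (simp add: dist_Pair_Pair dist_norm)
    then have "cmod (?\<Delta> p) \<le> \<epsilon>" using d(2)[OF eb[OF pc] pc] by (simp add: dist_norm)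
    then have "(cmod (?\<Delta> p))\<^sup>2 \<le> \<epsilon>\<^sup>2" by (intro power_mono) auto
    then show ?thesis by (rule order_trans) simp
  next
    case False
    then have "1 \<le> cmod (fst p - e) / d" using d(1) by (simp add: field_simps)
    then have "M * 1 \<le> M * (cmod (fst p - e) / d)" using M(1) by (intro mult_left_mono)
    then have "cmod (?\<Delta> p) \<le> M / d * cmod (fst p - e)" using M(2)[OF p] by simp
    then have "(cmod (?\<Delta> p))\<^sup>2 \<le> (M / d * cmod (fst p - e))\<^sup>2" by (intro power_mono) auto
    then show ?thesis unfolding power_mult_distrib by (rule order_trans) simp
  qed
  have sqint: "integrable bidisk_measure (\<lambda>z. (cmod (ev F z))\<^sup>2)" for F
    using l2fun_ev by (simp add: l2fun_def)
  have bound: "(norm (Mul ?\<Delta> (peak_fun e i N)))\<^sup>2 \<le> \<epsilon>\<^sup>2 * pi + (M / d)\<^sup>2 * (4 * pi / (real N + 2))" for N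
  proof -
    let ?f = "peak_fun e i N"
    have "(norm (Mul ?\<Delta> ?f))\<^sup>2 \<le> (LINT z|bidisk_measure. \<epsilon>\<^sup>2 * (cmod (ev ?f z))\<^sup>2 + (M / d)\<^sup>2 * (cmod (ev (Mul (\<lambda>p. fst p - e) ?f) z))\<^sup>2)"
      unfolding norm_sq
    proof (intro integral_mono sqint Bochner_Integration.integrable_add integrable_mult_right)
      fix p assume "p \<in> space bidisk_measure"
      then have "(cmod (?\<Delta> p))\<^sup>2 * (cmod (ev ?f p))\<^sup>2 \<le> (\<epsilon>\<^sup>2 + (M / d)\<^sup>2 * (cmod (fst p - e))\<^sup>2) * (cmod (ev ?f p))\<^sup>2"
        by (intro mult_right_mono pw) auto
      then show "(cmod (ev (Mul ?\<Delta> ?f) p))\<^sup>2 \<le> \<epsilon>\<^sup>2 * (cmod (ev ?f p))\<^sup>2 + (M / d)\<^sup>2 * (cmod (ev (Mul (\<lambda>p. fst p - e) ?f) p))\<^sup>2"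
        by (simp add: ev_Mul s\<Delta> sz norm_mult power_mult_distrib distrib_right mult.assoc)
    qed
    also have "\<dots> = \<epsilon>\<^sup>2 * (norm ?f)\<^sup>2 + (M / d)\<^sup>2 * (norm (Mul (\<lambda>p. fst p - e) ?f))\<^sup>2"
      unfolding norm_sq by (subst Bochner_Integration.integral_add) (simp_all add: sqint)
    also have "\<dots> \<le> \<epsilon>\<^sup>2 * pi + (M / d)\<^sup>2 * (4 * pi / (real N + 2))"
      by (intro add_mono mult_left_mono peak_fun_norm_le peak_fun_concentrates e) auto
    finally show ?thesis .
  qed
  have "(\<lambda>N. \<epsilon>\<^sup>2 * pi + (M / d)\<^sup>2 * (4 * pi / (real N + 2))) \<longlonglongrightarrow> \<epsilon>\<^sup>2 * pi" by real_asymp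
  moreover have "\<epsilon>\<^sup>2 * pi < \<eta>\<^sup>2"
  proof -
    have "\<epsilon>\<^sup>2 * pi < \<epsilon>\<^sup>2 * 16" using \<epsilon> pi_less_4 by (intro mult_strict_left_mono) auto
    also have "\<dots> = \<eta>\<^sup>2" by (simp add: \<epsilon>_def power_divide)
    finally show ?thesis .
  qed
  ultimately have "\<forall>\<^sub>F N in sequentially. \<epsilon>\<^sup>2 * pi + (M / d)\<^sup>2 * (4 * pi / (real N + 2)) < \<eta>\<^sup>2"
    by (rule order_tendstoD)
  then have "\<forall>\<^sub>F N in sequentially. norm (norm (Mul ?\<Delta> (peak_fun e i N)) - 0) < \<eta>"
  proof eventually_elim
    case (elim N)
    then have "(norm (Mul ?\<Delta> (peak_fun e i N)))\<^sup>2 < \<eta>\<^sup>2" using bound[of N] by linarith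
    then show ?case using \<eta> by (simp add: power_less_imp_less_base)
  qed
  then show "\<exists>no. \<forall>N\<ge>no. norm (norm (Mul ?\<Delta> (peak_fun e i N)) - 0) < \<eta>" by (simp add: eventually_sequentially)
qed

text \<open>A fixed coefficient of the unnormalised function stays constant once the truncation has
  passed its index, while the normalising divisor grows without bound.\<close>

lemma peak_fun_weak_null: "(\<lambda>N. coef (peak_fun e i N) p) \<longlonglongrightarrow> 0" if e: "cmod e = 1"
proof -
  obtain m n where p: "p = (m, n)" by (cases p)
  let ?v = "\<lambda>N. sqrt (pi * (real (Suc N) * real (Suc (Suc N)) / 2))"
  define X where "X = of_nat (Suc m) * cnj e ^ m * moment m m * moment i n / of_real (sqnorm p)"
  define K where "K = cmod X"
  have b: "norm (coef (peak_fun e i N) p) \<le> K / ?v N" for N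
  proof -
    have "cinner (peak_fun e i N) (zmono p) = (LINT z|disc_measure. of_real (1 / ?v N) * (peak e (Suc N) z * cnj z ^ m)) * (LINT w|disc_measure. w ^ i * cnj w ^ n)"
      unfolding p by (rule Fubini_product) (simp add: ev_peak_fun ev_zmono bidisk_def)
    also have "(LINT z|disc_measure. of_real (1 / ?v N) * (peak e (Suc N) z * cnj z ^ m)) = of_real (1 / ?v N) * (\<Sum>l<Suc N. of_nat (Suc l) * cnj e ^ l * moment l m)"
      unfolding integral_mult_right_zero peak_def sum_distrib_right mult.assoc moment_def
      by (simp only: Bochner_Integration.integral_sum integrable_mult_right integrable_disc_monom integral_mult_right_zero)
    also have "(\<Sum>l<Suc N. of_nat (Suc l) * cnj e ^ l * moment l m) = (\<Sum>l<Suc N. if l = m then of_nat (Suc m) * cnj e ^ m * moment m m else 0)"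
      by (intro sum.cong refl) (auto simp: moment_eq)
    also have "\<dots> = (if m < Suc N then of_nat (Suc m) * cnj e ^ m * moment m m else 0)"
      by (simp only: sum.delta finite_lessThan lessThan_iff)
    finally have "coef (peak_fun e i N) p = of_real (1 / ?v N) * (if m < Suc N then X else 0)"
      by (simp add: coef_def moment_def X_def del: of_nat_Suc)
    then have "norm (coef (peak_fun e i N) p) = (1 / ?v N) * norm (if m < Suc N then X else 0)"
      by (simp only: norm_mult norm_of_real) simp
    also have "\<dots> \<le> (1 / ?v N) * K" by (intro mult_left_mono) (auto simp: K_def)
    finally show ?thesis by simp
  qed
  have "(\<lambda>N. K / ?v N) \<longlonglongrightarrow> 0" by real_asymp
  then show ?thesis by (rule Lim_null_comparison[rotated]) (use b in auto)
qed

lemma compact_hankel_prod_imp_fibre_orthogonal: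
  assumes cont: "continuous_on (closure bidisk) \<phi>" "continuous_on (closure bidisk) \<psi>"
    and comp: "compact_hankel_prod \<psi> \<phi>" and e: "cmod e = 1"
  shows "cinner (hankel_l2 (\<lambda>p. \<phi> (e, snd p)) (zmono (0, i))) (Mul (\<lambda>p. \<psi> (e, snd p)) (zmono (0, j))) = 0"
proof -
  let ?\<phi> = "\<lambda>p::complex \<times> complex. \<phi> (e, snd p)" and ?\<psi> = "\<lambda>p::complex \<times> complex. \<psi> (e, snd p)"
  let ?f = "peak_fun e i" and ?h = "peak_fun e j"
  let ?V = "hankel_l2 ?\<phi> (zmono (0, i))" and ?W = "Mul ?\<psi> (zmono (0, j))"
  have s: "symb \<phi>" "symb \<psi>" using cont symb_continuous_closure by auto
  have ca: "continuous_on (cball 0 1) (\<lambda>w. \<phi> (e, w))" "continuous_on (cball 0 1) (\<lambda>w. \<psi> (e, w))"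
    using e by (auto intro!: continuous_on_compose2[OF cont(1)] continuous_on_compose2[OF cont(2)] continuous_intros simp: closure_bidisk)
  have s0: "symb ?\<phi>" "symb ?\<psi>" using symb_snd_cont[OF ca(1)] symb_snd_cont[OF ca(2)] by auto
  obtain v where v: "\<And>z w. (z, w) \<in> bidisk \<Longrightarrow> ev ?V (z, w) = v w"
    using hankel_l2_snd_z_independent[OF ca(1)] by blast
  \<comment> \<open>Exact for every \<open>N\<close>. On the left the factor in \<open>z\<close> has
    norm 1, on the right it is the constant 1 with squared norm \<open>pi\<close>, hence the
    quotient.\<close>
  have const: "cinner (hankel_l2 ?\<phi> (?f N)) (Mul ?\<psi> (?h N)) = cinner ?V ?W / of_real pi" for N
  proof -
    let ?c = "complex_of_real (1 / sqrt (pi * (real (Suc N) * real (Suc (Suc N)) / 2)))"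
    let ?k = "\<lambda>p::complex \<times> complex. peak e (Suc N) (fst p)"
    have sk: "symb ?k" by (rule symb_fst_cont[OF peak_continuous])
    have MM: "Mul ?\<phi> (?f N) = ?c *\<^sub>C Mul ?k (Mul ?\<phi> (zmono (0, i)))"
      unfolding peak_fun_def by (rule l2c_eqI) (simp add: ev_Mul s0 sk)
    have "bproj (Mul ?\<phi> (?f N)) = ?c *\<^sub>C Mul ?k (bproj (Mul ?\<phi> (zmono (0, i))))"
    proof (rule bproj_unique)
      show "?c *\<^sub>C Mul ?k (bproj (Mul ?\<phi> (zmono (0, i)))) \<in> A2"
        by (intro A2_cscale A2_Mul sk bproj_in holomorphic2_on_fst peak_holomorphic)
      fix p
      have cinV: "cinner (Mul ?k ?V) (zmono (m, n)) = 0" for m n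
      proof -
        have "cinner ?V (zmono (0, n)) = (LINT z|disc_measure. 1) * (LINT w|disc_measure. v w * cnj w ^ n)"
          by (rule Fubini_product) (simp add: v ev_zmono bidisk_def)
        then have "(LINT w|disc_measure. v w * cnj w ^ n) = 0"
          using hankel_l2_orth(1)[OF A2_zmono] by (simp add: scaleR_conv_of_real)
        moreover have "cinner (Mul ?k ?V) (zmono (m, n)) = (LINT z|disc_measure. peak e (Suc N) z * cnj z ^ m) * (LINT w|disc_measure. v w * cnj w ^ n)"
          by (rule Fubini_product) (simp add: v ev_zmono bidisk_def ev_Mul sk mult_ac)
        ultimately show ?thesis by simp
      qed
      have "cinner (Mul ?k (Mul ?\<phi> (zmono (0, i)))) (zmono p) = cinner (Mul ?k (bproj (Mul ?\<phi> (zmono (0, i))))) (zmono p)"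
        using cinV[of "fst p" "snd p"] by (simp add: hankel_l2_def Mul_simps sk cinner_diff_left)
      then show "coef (Mul ?\<phi> (?f N)) p = coef (?c *\<^sub>C Mul ?k (bproj (Mul ?\<phi> (zmono (0, i))))) p"
        unfolding MM by (simp add: coef_def)
    qed
    then have H: "hankel_l2 ?\<phi> (?f N) = ?c *\<^sub>C Mul ?k ?V"
      by (simp add: hankel_l2_def MM Mul_simps sk cscale_simps)
    have "cinner (hankel_l2 ?\<phi> (?f N)) (Mul ?\<psi> (?h N)) = (LINT w|disc_measure. v w * cnj (\<psi> (e, w) * w ^ j))"
    proof (rule peak_fun_tensor[OF e])
      fix z w :: complex assume b: "(z, w) \<in> bidisk"
      show "ev (hankel_l2 ?\<phi> (?f N)) (z, w) = ?c * peak e (Suc N) z * v w"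
        unfolding H by (simp add: ev_Mul sk v b)
      show "ev (Mul ?\<psi> (?h N)) (z, w) = ?c * peak e (Suc N) z * (\<psi> (e, w) * w ^ j)"
        by (simp add: ev_Mul s0 ev_peak_fun b)
    qed
    moreover have "cinner ?V ?W = (LINT z|disc_measure. 1) * (LINT w|disc_measure. v w * cnj (\<psi> (e, w) * w ^ j))"
      by (rule Fubini_product) (simp add: v ev_Mul s0 ev_zmono bidisk_def)
    ultimately show ?thesis by (simp add: scaleR_conv_of_real)
  qed
  have "\<forall>n. ?f n \<in> A2 \<and> norm (?f n) \<le> 2" using peak_fun_A2 peak_fun_norm_le[OF e] by blast
  then obtain g r where g: "g \<in> A2" "strict_mono (r :: nat \<Rightarrow> nat)" "(\<lambda>n. norm (hankel_prod \<psi> \<phi> (?f (r n)) - g)) \<longlonglongrightarrow> 0"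
    using comp unfolding compact_hankel_prod_def by meson
  have lim1: "(\<lambda>n. cinner (hankel_prod \<psi> \<phi> (?f (r n))) (?h (r n))) \<longlonglongrightarrow> 0"
  proof -
    have "(\<lambda>n. cinner g (?h (r n))) \<longlonglongrightarrow> 0"
    proof (rule weak_null_cinner[OF g(1), where C=2])
      show "norm (?h (r n)) \<le> 2" for n by (rule peak_fun_norm_le(2)[OF e])
      show "(\<lambda>n. coef (?h (r n)) p) \<longlonglongrightarrow> 0" for p
        using LIMSEQ_subseq_LIMSEQ[OF peak_fun_weak_null[OF e] g(2)] by (simp add: o_def)
    qed
    moreover have "(\<lambda>n. cinner (hankel_prod \<psi> \<phi> (?f (r n)) - g) (?h (r n))) \<longlonglongrightarrow> 0"
    proof (rule Lim_null_comparison)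
      show "(\<lambda>n. norm (hankel_prod \<psi> \<phi> (?f (r n)) - g) * 2) \<longlonglongrightarrow> 0" by (rule tendsto_mult_left_zero[OF g(3)])
      show "\<forall>\<^sub>F n in sequentially. norm (cinner (hankel_prod \<psi> \<phi> (?f (r n)) - g) (?h (r n))) \<le> norm (hankel_prod \<psi> \<phi> (?f (r n)) - g) * 2"
        by (intro always_eventually allI order_trans[OF cmod_cinner_le] mult_left_mono peak_fun_norm_le(2)[OF e]) simp
    qed
    ultimately have "(\<lambda>n. cinner (hankel_prod \<psi> \<phi> (?f (r n)) - g) (?h (r n)) + cinner g (?h (r n))) \<longlonglongrightarrow> 0 + 0"
      by (intro tendsto_add)
    then show ?thesis by (simp add: cinner_diff_left)
  qed
  obtain M where M: "0 \<le> M" "\<And>p. p \<in> bidisk \<Longrightarrow> cmod (\<psi> p) \<le> M" using symb_bound[OF s(2)] by blast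
  obtain M' where M': "0 \<le> M'" "\<And>p. p \<in> bidisk \<Longrightarrow> cmod (?\<phi> p) \<le> M'" using symb_bound[OF s0(1)] by blast
  let ?d\<phi> = "\<lambda>N. norm (Mul (\<lambda>p. \<phi> p - ?\<phi> p) (?f N))" and ?d\<psi> = "\<lambda>N. norm (Mul (\<lambda>p. \<psi> p - ?\<psi> p) (?h N))"
  have dl: "(\<lambda>N. ?d\<phi> N * (M * 2) + (M' * 2) * ?d\<psi> N) \<longlonglongrightarrow> 0 * (M * 2) + (M' * 2) * 0"
    by (intro tendsto_add tendsto_mult tendsto_const peak_localization cont e)
  have diff: "cmod (cinner (hankel_prod \<psi> \<phi> (?f N)) (?h N) - cinner ?V ?W / of_real pi) \<le> ?d\<phi> N * (M * 2) + (M' * 2) * ?d\<psi> N" for N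
  proof -
    have "cinner (hankel_prod \<psi> \<phi> (?f N)) (?h N) = cinner (hankel_l2 \<phi> (?f N)) (Mul \<psi> (?h N))"
      by (rule cinner_hankel_prod[OF s(2) peak_fun_A2])
    moreover have "Mul (\<lambda>p. \<psi> p - ?\<psi> p) (?h N) = Mul \<psi> (?h N) - Mul ?\<psi> (?h N)"
      by (rule l2c_eqI) (simp add: ev_Mul s s0 symb_diff algebra_simps)
    \<comment> \<open>The symbols are frozen one after the other; each step costs the localisation
      error of one symbol times a bounded factor.\<close>
    ultimately have "cinner (hankel_prod \<psi> \<phi> (?f N)) (?h N) - cinner ?V ?W / of_real pi
        = cinner (hankel_l2 (\<lambda>p. \<phi> p - ?\<phi> p) (?f N)) (Mul \<psi> (?h N)) + cinner (hankel_l2 ?\<phi> (?f N)) (Mul (\<lambda>p. \<psi> p - ?\<psi> p) (?h N))"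
      unfolding const[of N, symmetric] hankel_l2_diff_symbol[OF s(1) s0(1), symmetric]
      by (simp add: cinner_diff_left cinner_diff_right)
    also have "cmod \<dots> \<le> ?d\<phi> N * (M * 2) + (M' * 2) * ?d\<psi> N"
    proof (intro norm_triangle_mono)
      have "norm (Mul \<psi> (?h N)) \<le> M * norm (?h N)" by (intro norm_Mul_le s M)
      also have "\<dots> \<le> M * 2" by (intro mult_left_mono peak_fun_norm_le(2)[OF e] M)
      finally have "norm (hankel_l2 (\<lambda>p. \<phi> p - ?\<phi> p) (?f N)) * norm (Mul \<psi> (?h N)) \<le> ?d\<phi> N * (M * 2)"
        by (intro mult_mono norm_hankel_l2_le_Mul) auto
      then show "cmod (cinner (hankel_l2 (\<lambda>p. \<phi> p - ?\<phi> p) (?f N)) (Mul \<psi> (?h N))) \<le> ?d\<phi> N * (M * 2)"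
        using cmod_cinner_le order_trans by blast
      have "norm (hankel_l2 ?\<phi> (?f N)) \<le> M' * norm (?f N)" by (intro order_trans[OF norm_hankel_l2_le_Mul] norm_Mul_le s0 M')
      also have "\<dots> \<le> M' * 2" by (intro mult_left_mono peak_fun_norm_le(2)[OF e] M')
      finally have "norm (hankel_l2 ?\<phi> (?f N)) * ?d\<psi> N \<le> (M' * 2) * ?d\<psi> N" by (intro mult_right_mono) auto
      then show "cmod (cinner (hankel_l2 ?\<phi> (?f N)) (Mul (\<lambda>p. \<psi> p - ?\<psi> p) (?h N))) \<le> (M' * 2) * ?d\<psi> N"
        using cmod_cinner_le order_trans by blast
    qed
    finally show ?thesis .
  qed
  have "(\<lambda>N. cinner (hankel_prod \<psi> \<phi> (?f N)) (?h N) - cinner ?V ?W / of_real pi) \<longlonglongrightarrow> 0"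
  proof (rule Lim_null_comparison[OF always_eventually])
    show "\<forall>N. norm (cinner (hankel_prod \<psi> \<phi> (?f N)) (?h N) - cinner ?V ?W / of_real pi) \<le> ?d\<phi> N * (M * 2) + (M' * 2) * ?d\<psi> N"
      using diff by blast
    show "(\<lambda>N. ?d\<phi> N * (M * 2) + (M' * 2) * ?d\<psi> N) \<longlonglongrightarrow> 0" using dl by simp
  qed
  then have "(\<lambda>N. cinner (hankel_prod \<psi> \<phi> (?f N)) (?h N)) \<longlonglongrightarrow> cinner ?V ?W / of_real pi" by (rule LIM_zero_cancel)
  from LIMSEQ_subseq_LIMSEQ[OF this g(2)] have "(\<lambda>n. cinner (hankel_prod \<psi> \<phi> (?f (r n))) (?h (r n))) \<longlonglongrightarrow> cinner ?V ?W / of_real pi"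
    by (simp add: o_def)
  from LIMSEQ_unique[OF this lim1] show ?thesis by simp
qed

section \<open>A maximum principle for moments\<close>

lemma has_integral_power_unit: "((\<lambda>t::real. t ^ n) has_integral 1 / real (n + 1)) {0..1}"
proof -
  have "((\<lambda>t::real. t ^ n) has_integral (1 ^ Suc n / real (Suc n) - 0 ^ Suc n / real (Suc n))) {0..1}"
  proof (rule fundamental_theorem_of_calculus)
    fix t :: real
    have "((\<lambda>t. t ^ Suc n / real (Suc n)) has_real_derivative t ^ n) (at t within {0..1})"
      by (rule derivative_eq_intros refl | simp del: of_nat_Suc)+
    then show "((\<lambda>t. t ^ Suc n / real (Suc n)) has_vector_derivative t ^ n) (at t within {0..1})"
      by (simp add: has_real_derivative_iff_has_vector_derivative)
  qed simp
  then show ?thesis by simp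
qed

text \<open>Absolute summability gives uniform convergence up to \<open>t = 1\<close>, hence
  continuity on the closed interval and termwise integration.\<close>

lemma moment_integral:
  fixes x :: "nat \<Rightarrow> real"
  assumes sm: "summable (\<lambda>m. \<bar>x m\<bar>)"
  shows "continuous_on {0..1} (\<lambda>t. \<Sum>m. x m * t ^ m)"
    and "(\<lambda>m. x m / real (m + n + 1)) sums integral {0..1} (\<lambda>t. t ^ n * (\<Sum>m. x m * t ^ m))"
proof -
  define \<Phi> where "\<Phi> t = (\<Sum>m. x m * t ^ m)" for t
  have ul: "uniform_limit {0..1} (\<lambda>n t. \<Sum>m<n. x m * t ^ m) \<Phi> sequentially"
    unfolding \<Phi>_def
  proof (rule Weierstrass_m_test[OF _ sm])
    fix n and t :: real assume "t \<in> {0..1}"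
    then show "norm (x n * t ^ n) \<le> \<bar>x n\<bar>" by (simp add: abs_mult power_abs mult_left_le power_le_one)
  qed
  have cont: "continuous_on {0..1} \<Phi>"
    by (rule uniform_limit_theorem[OF always_eventually ul]) (auto intro!: continuous_intros)
  have M: "(\<lambda>m. x m / real (m + n + 1)) sums integral {0..1} (\<lambda>t. t ^ n * \<Phi> t)"
  proof -
    have "uniform_limit {0..1} (\<lambda>k t. t ^ n * (\<Sum>m<k. x m * t ^ m)) (\<lambda>t. t ^ n * \<Phi> t) sequentially"
    proof (rule uniform_limitI)
      fix e :: real assume "0 < e"
      from uniform_limitD[OF ul this] show "\<forall>\<^sub>F k in sequentially. \<forall>t\<in>{0..1}. dist (t ^ n * (\<Sum>m<k. x m * t ^ m)) (t ^ n * \<Phi> t) < e"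
      proof eventually_elim
        case (elim k)
        show ?case
        proof
          fix t :: real assume t: "t \<in> {0..1}"
          have "dist (t ^ n * (\<Sum>m<k. x m * t ^ m)) (t ^ n * \<Phi> t) = t ^ n * dist (\<Sum>m<k. x m * t ^ m) (\<Phi> t)"
            using t by (simp add: dist_real_def abs_mult flip: right_diff_distrib)
          also have "\<dots> \<le> 1 * dist (\<Sum>m<k. x m * t ^ m) (\<Phi> t)"
            using t by (intro mult_right_mono) (auto simp: power_le_one)
          also have "\<dots> < e" using elim t by simp
          finally show "dist (t ^ n * (\<Sum>m<k. x m * t ^ m)) (t ^ n * \<Phi> t) < e" .
        qed
      qed
    qed
    note ul2 = this
    have "\<exists>I J. (\<forall>k. ((\<lambda>t. t ^ n * (\<Sum>m<k. x m * t ^ m)) has_integral I k) {0..1}) \<and>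
        ((\<lambda>t. t ^ n * \<Phi> t) has_integral J) {0..1} \<and> I \<longlonglongrightarrow> J"
    proof (rule uniform_limit_integral[OF ul2])
      show "continuous_on {0..1} (\<lambda>t. t ^ n * (\<Sum>m<k. x m * t ^ m))" for k
        by (intro continuous_intros)
    qed (simp, blast)
    then obtain I J where IJ: "\<And>k. ((\<lambda>t. t ^ n * (\<Sum>m<k. x m * t ^ m)) has_integral I k) {0..1}"
        "((\<lambda>t. t ^ n * \<Phi> t) has_integral J) {0..1}" "I \<longlonglongrightarrow> J" by blast
    have "((\<lambda>t. t ^ n * (\<Sum>m<k. x m * t ^ m)) has_integral (\<Sum>m<k. x m / real (m + n + 1))) {0..1}" for k
    proof -
      have "((\<lambda>t::real. t ^ (m + n)) has_integral 1 / real (m + n + 1)) {0..1}" for m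
        by (rule has_integral_power_unit)
      then have "((\<lambda>t. \<Sum>m<k. x m * t ^ (m + n)) has_integral (\<Sum>m<k. x m * (1 / real (m + n + 1)))) {0..1}"
        by (intro has_integral_sum has_integral_mult_right) auto
      then show ?thesis by (simp add: sum_distrib_left power_add mult_ac)
    qed
    then have "I k = (\<Sum>m<k. x m / real (m + n + 1))" for k using IJ(1) has_integral_unique by blast
    then have "I = (\<lambda>k. \<Sum>m<k. x m / real (m + n + 1))" by (rule ext)
    then show ?thesis using IJ(3) by (simp only: sums_def integral_unique[OF IJ(2)])
  qed
  show "continuous_on {0..1} (\<lambda>t. \<Sum>m. x m * t ^ m)" using cont unfolding \<Phi>_def .
  show "(\<lambda>m. x m / real (m + n + 1)) sums integral {0..1} (\<lambda>t. t ^ n * (\<Sum>m. x m * t ^ m))"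
    using M unfolding \<Phi>_def .
qed

text \<open>Multiplying the identity by \<open>s\<^sup>i\<close> and summing over \<open>i\<close> expresses \<open>\<Phi>(s) = \<Sum>m. x\<^sub>m s\<^sup>m\<close> as an average of \<open>\<Phi>\<close> over
  \<open>[0, 1]\<close> with positive weights, so a maximum attained at \<open>s < 1\<close> forces \<open>\<Phi>\<close> to be constant.\<close>

lemma moment_max_principle:
  fixes x :: "nat \<Rightarrow> real"
  assumes sm: "summable (\<lambda>m. \<bar>x m\<bar>)"
    and id: "\<And>i. (\<Sum>m. x m / real (m + d + i + 1)) * (real (i + 1) * real (i + d + 1)) = (\<Sum>m\<le>i. x m * real (i - m + 1))"
    and s: "0 \<le> s" "s < 1" and mx: "\<And>t. 0 \<le> t \<Longrightarrow> t \<le> 1 \<Longrightarrow> (\<Sum>m. x m * t ^ m) \<le> (\<Sum>m. x m * s ^ m)"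
    and t: "0 \<le> t" "t \<le> 1"
  shows "(\<Sum>m. x m * t ^ m) = (\<Sum>m. x m * s ^ m)"
proof -
  define \<Phi> where "\<Phi> t = (\<Sum>m. x m * t ^ m)" for t
  have cont: "continuous_on {0..1} \<Phi>" unfolding \<Phi>_def by (rule moment_integral(1)[OF sm])
  define M where "M n = integral {0..1} (\<lambda>t. t ^ n * \<Phi> t)" for n
  have M: "(\<lambda>m. x m / real (m + n + 1)) sums M n" for n
    unfolding M_def \<Phi>_def by (rule moment_integral(2)[OF sm])
  define L where "L = \<Phi> s"
  \<comment> \<open>The expression is the integral of \<open>t ^ n * (L - \<Phi> t)\<close>, whose
    integrand is nonnegative; it vanishes only if \<open>\<Phi>\<close> equals its maximum
    \<open>L\<close> throughout.\<close>
  have nonneg: "0 \<le> L / real (n + 1) - M n" and zero: "L / real (n + 1) - M n = 0 \<Longrightarrow> \<Phi> t = L" for n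
  proof -
    have c: "continuous_on {0..1} (\<lambda>t. t ^ n * (L - \<Phi> t))" by (intro continuous_intros cont)
    have nn: "0 \<le> t ^ n * (L - \<Phi> t)" if "t \<in> {0..1}" for t
      using that mx[of t] by (simp add: L_def \<Phi>_def)
    have "((\<lambda>t::real. t ^ n) has_integral 1 / real (n + 1)) {0..1}"
      by (rule has_integral_power_unit)
    then have "((\<lambda>t. L * t ^ n) has_integral L * (1 / real (n + 1))) {0..1}"
      by (rule has_integral_mult_right)
    moreover have "((\<lambda>t. t ^ n * \<Phi> t) has_integral M n) {0..1}"
      unfolding M_def by (intro integrable_integral integrable_continuous_interval continuous_intros cont)
    ultimately have "((\<lambda>t. L * t ^ n - t ^ n * \<Phi> t) has_integral L * (1 / real (n + 1)) - M n) {0..1}"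
      by (rule has_integral_diff)
    then have hi: "((\<lambda>t. t ^ n * (L - \<Phi> t)) has_integral (L / real (n + 1) - M n)) {0..1}"
      by (simp add: algebra_simps)
    show "0 \<le> L / real (n + 1) - M n"
      by (rule has_integral_nonneg[OF hi nn])
    assume "L / real (n + 1) - M n = 0"
    then have "integral {0..1} (\<lambda>t. t ^ n * (L - \<Phi> t)) = 0" using hi by (simp add: integral_unique)
    then have z: "t ^ n * (L - \<Phi> t) = 0" if "t \<in> {0..1}" for t
      using integral_eq_0_iff[OF c] nn that by simp
    have z': "\<Phi> t = L" if "0 < t" "t \<le> 1" for t using z[of t] that by simp
    show "\<Phi> t = L"
    proof (cases "t = 0")
      case True
      \<comment> \<open>At \<open>t = 0\<close> the weight \<open>t ^ n\<close> may vanish, so the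
        equality is carried over from the open interval by continuity.\<close>
      have "closed {t \<in> {0..1}. \<Phi> t = L}"
        using continuous_closed_preimage_constant[OF cont] by simp
      moreover have "{0<..<1} \<subseteq> {t \<in> {0..1}. \<Phi> t = L}" using z' by auto
      ultimately have "closure {0<..<(1::real)} \<subseteq> {t \<in> {0..1}. \<Phi> t = L}" by (rule closure_minimal[rotated])
      then have "0 \<in> {t \<in> {0..1}. \<Phi> t = L}" by (rule subsetD) simp
      then show ?thesis using True by simp
    next
      case False
      then show ?thesis using t z' by simp
    qed
  qed
  \<comment> \<open>The right side of the identity is a convolution with
    \<open>1, 2, 3, ...\<close>. Its generating function at \<open>s\<close> is therefore
    \<open>\<Phi> s\<close> times this series, and \<open>s < 1\<close> makes the product
    converge.\<close>
  have gd: "(\<lambda>n. real (Suc n) * s ^ n) sums (1 / (1 - s)\<^sup>2)"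
    using geometric_deriv_sums[of s] s by simp
  have sx: "summable (\<lambda>m. norm (x m * s ^ m))"
    using s by (intro summable_comparison_test'[OF sm, of 0]) (auto simp: abs_mult power_abs mult_left_le power_le_one)
  have sg: "summable (\<lambda>n. norm (real (Suc n) * s ^ n))" using sums_summable[OF gd] s by (simp add: abs_mult)
  have "(\<lambda>i. \<Sum>m\<le>i. (x m * s ^ m) * (real (Suc (i - m)) * s ^ (i - m))) sums (\<Phi> s * (1 / (1 - s)\<^sup>2))"
    using Cauchy_product_sums[OF sx sg] sums_unique[OF gd] by (simp add: \<Phi>_def)
  moreover have "(\<Sum>m\<le>i. (x m * s ^ m) * (real (Suc (i - m)) * s ^ (i - m))) = s ^ i * (real (i + 1) * real (i + d + 1)) * M (i + d)" for i
  proof -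
    have "(\<Sum>m\<le>i. (x m * s ^ m) * (real (Suc (i - m)) * s ^ (i - m))) = (\<Sum>m\<le>i. s ^ i * (x m * real (i - m + 1)))"
    proof (rule sum.cong[OF refl])
      fix m assume "m \<in> {..i}"
      then have "s ^ i = s ^ m * s ^ (i - m)" by (simp flip: power_add)
      then show "(x m * s ^ m) * (real (Suc (i - m)) * s ^ (i - m)) = s ^ i * (x m * real (i - m + 1))" by simp
    qed
    also have "\<dots> = s ^ i * (\<Sum>m\<le>i. x m * real (i - m + 1))" by (rule sum_distrib_left[symmetric])
    also have "(\<Sum>m\<le>i. x m * real (i - m + 1)) = M (i + d) * (real (i + 1) * real (i + d + 1))"
      using id[of i] sums_unique[OF M[of "i + d"]] by (simp add: add_ac)
    finally show ?thesis by (simp add: mult_ac)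
  qed
  ultimately have 1: "(\<lambda>i. s ^ i * (real (i + 1) * real (i + d + 1)) * M (i + d)) sums (L * (1 / (1 - s)\<^sup>2))"
    by (simp add: L_def)
  have "(\<lambda>i. L * (real (Suc i) * s ^ i)) sums (L * (1 / (1 - s)\<^sup>2))" by (rule sums_mult[OF gd])
  from sums_diff[OF this 1]
  have "(\<lambda>i. s ^ i * (real (i + 1) * real (i + d + 1)) * (L / real (i + d + 1) - M (i + d))) sums 0"
    by (simp add: right_diff_distrib mult_ac)
  then have sm0: "summable (\<lambda>i. s ^ i * (real (i + 1) * real (i + d + 1)) * (L / real (i + d + 1) - M (i + d)))"
    and su0: "(\<Sum>i. s ^ i * (real (i + 1) * real (i + d + 1)) * (L / real (i + d + 1) - M (i + d))) = 0"
    by (rule sums_summable, rule sums_unique[symmetric])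
  have "0 \<le> s ^ i * (real (i + 1) * real (i + d + 1)) * (L / real (i + d + 1) - M (i + d))" for i
    using s nonneg[of "i + d"] by (intro mult_nonneg_nonneg) auto
  \<comment> \<open>A sum of nonnegative terms is 0, so every term is. The term of index 0 has a
    positive weight even when \<open>s = 0\<close>.\<close>
  then have "s ^ 0 * (real (0 + 1) * real (0 + d + 1)) * (L / real (0 + d + 1) - M (0 + d)) = 0"
    using suminf_eq_zero_iff[OF sm0] su0 by blast
  then have "L / real (d + 1) - M d = 0" by simp
  then show ?thesis using zero by (simp add: L_def \<Phi>_def)
qed

text \<open>If the maximum of \<open>\<Phi>\<close> on \<open>[0, 1]\<close> or its minimum is
  attained before 1, the maximum principle for \<open>\<Phi>\<close> or \<open>- \<Phi>\<close>
  makes \<open>\<Phi>\<close> constant; if both are attained at 1 only the value there is possible.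
  The constant is \<open>x 0 = 0\<close>.\<close>

lemma moment_identity_real:
  fixes x :: "nat \<Rightarrow> real"
  assumes sm: "summable (\<lambda>m. \<bar>x m\<bar>)" and x0: "x 0 = 0"
    and id: "\<And>i. (\<Sum>m. x m / real (m + d + i + 1)) * (real (i + 1) * real (i + d + 1)) = (\<Sum>m\<le>i. x m * real (i - m + 1))"
  shows "x m = 0"
proof -
  define \<Phi> where "\<Phi> t = (\<Sum>m. x m * t ^ m)" for t :: real
  have sx: "summable (\<lambda>m. x m / real (m + d + i + 1))" for i
  proof (rule summable_comparison_test'[OF sm, of 0])
    fix m show "norm (x m / real (m + d + i + 1)) \<le> \<bar>x m\<bar>"
      by (simp add: abs_divide field_simps mult_left_le)
  qed
  have sp: "summable (\<lambda>m. x m * t ^ m)" if "0 \<le> t" "t \<le> 1" for t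
    using that by (intro summable_comparison_test'[OF sm, of 0]) (auto simp: abs_mult power_abs mult_left_le power_le_one)
  have cont: "continuous_on {0..1} \<Phi>" unfolding \<Phi>_def by (rule moment_integral(1)[OF sm])
  obtain p where p: "p \<in> {0..1}" "\<And>t. t \<in> {0..1} \<Longrightarrow> \<Phi> t \<le> \<Phi> p"
    using continuous_attains_sup[OF compact_Icc _ cont] by force
  obtain q where q: "q \<in> {0..1}" "\<And>t. t \<in> {0..1} \<Longrightarrow> \<Phi> q \<le> \<Phi> t"
    using continuous_attains_inf[OF compact_Icc _ cont] by force
  have const: "\<Phi> t = \<Phi> 0" if t: "t \<in> {0..1}" for t
  proof (cases "p < 1")
    case True
    then have "\<Phi> t = \<Phi> p" if "t \<in> {0..1}" for t
      unfolding \<Phi>_def using p that by (intro moment_max_principle[OF sm id]) (auto simp: \<Phi>_def)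
    then show ?thesis using t by (metis atLeastAtMost_iff order_refl zero_le_one)
  next
    case p1: False
    show ?thesis
    proof (cases "q < 1")
      case True
      have neg: "(\<Sum>m. - x m * t ^ m) = - \<Phi> t" if "t \<in> {0..1}" for t
        unfolding \<Phi>_def using suminf_minus[OF sp[of t]] that by simp
      have "- \<Phi> t = - \<Phi> q" if "t \<in> {0..1}" for t
      proof -
        have "(\<Sum>m. - x m * t ^ m) = (\<Sum>m. - x m * q ^ m)"
        proof (rule moment_max_principle)
          show "summable (\<lambda>m. \<bar>- x m\<bar>)" using sm by simp
          show "(\<Sum>m. - x m / real (m + d + i + 1)) * (real (i + 1) * real (i + d + 1)) = (\<Sum>m\<le>i. - x m * real (i - m + 1))" for i
            using id[of i] suminf_minus[OF sx[of i]] by (simp add: sum_negf)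
          show "(\<Sum>m. - x m * t ^ m) \<le> (\<Sum>m. - x m * q ^ m)" if "0 \<le> t" "t \<le> 1" for t
            using that q neg[of t] neg[of q] by simp
        qed (use q True that in auto)
        then show ?thesis using neg[OF that] neg[OF q(1)] by simp
      qed
      then have "\<Phi> t = \<Phi> q" if "t \<in> {0..1}" for t using that by simp
      then show ?thesis using t by (metis atLeastAtMost_iff order_refl zero_le_one)
    next
      case False
      then have "p = 1" "q = 1" using p1 p(1) q(1) by auto
      then have "\<Phi> t = \<Phi> 1" if "t \<in> {0..1}" for t using p(2)[OF that] q(2)[OF that] by simp
      then show ?thesis using t by (metis atLeastAtMost_iff order_refl zero_le_one)
    qed
  qed
  have "\<Phi> 0 = 0" unfolding \<Phi>_def using suminf_finite[of "{0}" "\<lambda>m. x m * 0 ^ m"] x0 by (simp add: power_0_left)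
  then have z: "\<Phi> t = 0" if "t \<in> {0..1}" for t using const[OF that] by simp
  have "(\<Sum>m. x m / real (m + d + i + 1)) = 0" for i
  proof -
    have "(\<lambda>m. x m / real (m + (d + i) + 1)) sums integral {0..1} (\<lambda>t. t ^ (d + i) * \<Phi> t)"
      unfolding \<Phi>_def by (rule moment_integral(2)[OF sm])
    moreover have "integral {0..1} (\<lambda>t. t ^ (d + i) * \<Phi> t) = integral {0..1} (\<lambda>t::real. 0::real)"
      by (rule Henstock_Kurzweil_Integration.integral_cong) (simp add: z)
    ultimately show ?thesis by (simp add: sums_unique[symmetric] add.assoc)
  qed
  \<comment> \<open>With \<open>\<Phi> = 0\<close> the integral sides vanish, and what remains is a
    triangular linear system with diagonal entries 1.\<close>
  then have tri: "(\<Sum>m\<le>i. x m * real (i - m + 1)) = 0" for i using id[of i] by simp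
  show ?thesis
  proof (induction m rule: less_induct)
    case (less m)
    have "(\<Sum>k\<le>m. x k * real (m - k + 1)) = (\<Sum>k\<in>{m}. x k * real (m - k + 1))"
      using less by (intro sum.mono_neutral_right) auto
    then show ?case using tri[of m] by simp
  qed
qed


section \<open>Harmonic symbols on the disc\<close>

text \<open>Schwarz's theorem on mixed derivatives. It is needed because \<open>harmonic_on\<close>
  names the two mixed partials separately, while the Cauchy-Riemann equations for
  \<open>ux - \<i> * uy\<close> use their equality.\<close>

lemma mixed_partials_eq:
  fixes U Ux Uy Uxx Uxy Uyx Uyy :: "complex \<Rightarrow> real"
  assumes S: "open S" "z0 \<in> S"
    and U: "\<And>z. z \<in> S \<Longrightarrow> (U has_derivative (\<lambda>h. Re h * Ux z + Im h * Uy z)) (at z)"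
    and Ux: "\<And>z. z \<in> S \<Longrightarrow> (Ux has_derivative (\<lambda>h. Re h * Uxx z + Im h * Uxy z)) (at z)"
    and Uy: "\<And>z. z \<in> S \<Longrightarrow> (Uy has_derivative (\<lambda>h. Re h * Uyx z + Im h * Uyy z)) (at z)"
    and c: "continuous_on S Uxy" "continuous_on S Uyx"
  shows "Uxy z0 = Uyx z0"
proof -
  define Z where "Z x y = z0 + Complex x y" for x y
  have Zx: "((\<lambda>x. Z x y) has_derivative (\<lambda>h. Complex h 0)) (at x)" for x y
    unfolding Z_def Complex_eq by (auto intro!: derivative_eq_intros)
  have Zy: "((\<lambda>y. Z x y) has_derivative (\<lambda>h. Complex 0 h)) (at y)" for x y
    unfolding Z_def Complex_eq by (auto intro!: derivative_eq_intros)
  have dx: "((\<lambda>x. f (Z x y)) has_real_derivative a (Z x y)) (at x)"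
    if "(f has_derivative (\<lambda>h. Re h * a (Z x y) + Im h * b (Z x y))) (at (Z x y))" for f a b x y
    using has_derivative_compose[OF Zx that] by (simp add: has_field_derivative_def mult_commute_abs)
  have dy: "((\<lambda>y. f (Z x y)) has_real_derivative b (Z x y)) (at y)"
    if "(f has_derivative (\<lambda>h. Re h * a (Z x y) + Im h * b (Z x y))) (at (Z x y))" for f a b x y
    using has_derivative_compose[OF Zy that] by (simp add: has_field_derivative_def mult_commute_abs)
  have dUx: "((\<lambda>x. U (Z x y)) has_real_derivative Ux (Z x y)) (at x)"
    and dUy: "((\<lambda>y. U (Z x y)) has_real_derivative Uy (Z x y)) (at y)"
    and dUxy: "((\<lambda>y. Ux (Z x y)) has_real_derivative Uxy (Z x y)) (at y)"
    and dUyx: "((\<lambda>x. Uy (Z x y)) has_real_derivative Uyx (Z x y)) (at x)" if "Z x y \<in> S" for x y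
    by (rule dx[of U Ux x y Uy, OF U[OF that]], rule dy[of U Ux x y Uy, OF U[OF that]],
        rule dy[of Ux Uxx x y Uxy, OF Ux[OF that]], rule dx[of Uy Uyx x y Uyy, OF Uy[OF that]])
  obtain r where r: "0 < r" "ball z0 r \<subseteq> S" using S open_contains_ball by blast
  have inS: "Z x y \<in> S" if "0 \<le> x" "x \<le> t" "0 \<le> y" "y \<le> t" "t < r / 2" for x y t
  proof -
    have "cmod (Complex x y) \<le> \<bar>x\<bar> + \<bar>y\<bar>" using cmod_le[of "Complex x y"] by simp
    then have "dist z0 (Z x y) < r" using that by (simp add: Z_def dist_norm)
    then show ?thesis using r(2) by auto
  qed
  have key: "\<exists>p q. 0 < fst p \<and> fst p < t \<and> 0 < snd p \<and> snd p < t \<and> 0 < fst q \<and> fst q < t \<and> 0 < snd q \<and> snd q < t \<and>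
      Uxy (Z (fst p) (snd p)) = Uyx (Z (fst q) (snd q))" if t: "0 < t" "t < r / 2" for t
  proof -
    \<comment> \<open>The second difference over a square of side \<open>t\<close>. The mean value
      theorem in the two possible orders writes it as \<open>t * t\<close> times a value of either
      mixed partial inside the square.\<close>
    define D where "D = U (Z t t) - U (Z t 0) - U (Z 0 t) + U (Z 0 0)"
    have "\<exists>x>0. x < t \<and> (U (Z t t) - U (Z t 0)) - (U (Z 0 t) - U (Z 0 0)) = (t - 0) * (Ux (Z x t) - Ux (Z x 0))"
      by (rule MVT2[OF t(1)]) (intro DERIV_diff dUx inS, use t in auto)
    then obtain x where x: "0 < x" "x < t" "D = t * (Ux (Z x t) - Ux (Z x 0))" by (auto simp: D_def algebra_simps)
    have "\<exists>y>0. y < t \<and> Ux (Z x t) - Ux (Z x 0) = (t - 0) * Uxy (Z x y)"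
      by (rule MVT2[OF t(1)]) (intro dUxy inS, use t x in auto)
    then obtain y where y: "0 < y" "y < t" "D = t * (t * Uxy (Z x y))" using x by auto
    have "\<exists>y>0. y < t \<and> (U (Z t t) - U (Z 0 t)) - (U (Z t 0) - U (Z 0 0)) = (t - 0) * (Uy (Z t y) - Uy (Z 0 y))"
      by (rule MVT2[OF t(1)]) (intro DERIV_diff dUy inS, use t in auto)
    then obtain y' where y': "0 < y'" "y' < t" "D = t * (Uy (Z t y') - Uy (Z 0 y'))" by (auto simp: D_def algebra_simps)
    have "\<exists>x>0. x < t \<and> Uy (Z t y') - Uy (Z 0 y') = (t - 0) * Uyx (Z x y')"
      by (rule MVT2[OF t(1)]) (intro dUyx inS, use t y' in auto)
    then obtain x' where x': "0 < x'" "x' < t" "D = t * (t * Uyx (Z x' y'))" using y' by auto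
    have "Uxy (Z x y) = Uyx (Z x' y')" using y(3) x'(3) t by simp
    then show ?thesis using x y x' y' by (intro exI[of _ "(x, y)"] exI[of _ "(x', y')"]) simp
  qed
  define t where "t n = r / 2 / real (n + 2)" for n
  have t: "0 < t n" "t n < r / 2" for n
  proof -
    show "0 < t n" using r(1) by (simp add: t_def)
    have "r / 2 / real (n + 2) < r / 2 / 1" using r(1) by (intro divide_strict_left_mono) auto
    then show "t n < r / 2" by (simp add: t_def)
  qed
  have tl: "t \<longlonglongrightarrow> 0" unfolding t_def by real_asymp
  obtain p q where pq: "\<And>n. 0 < fst (p n) \<and> fst (p n) < t n \<and> 0 < snd (p n) \<and> snd (p n) < t n"
    "\<And>n. 0 < fst (q n) \<and> fst (q n) < t n \<and> 0 < snd (q n) \<and> snd (q n) < t n"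
    "\<And>n. Uxy (Z (fst (p n)) (snd (p n))) = Uyx (Z (fst (q n)) (snd (q n)))"
    using key[OF t] by metis
  have lim: "(\<lambda>n. Z (fst (p n)) (snd (p n))) \<longlonglongrightarrow> z0" if "\<And>n. 0 < fst (p n) \<and> fst (p n) < t n \<and> 0 < snd (p n) \<and> snd (p n) < t n" for p
  proof -
    have "(\<lambda>n. fst (p n)) \<longlonglongrightarrow> 0" "(\<lambda>n. snd (p n)) \<longlonglongrightarrow> 0"
      by (rule tendsto_sandwich[OF _ _ tendsto_const tl]; use that less_imp_le in \<open>blast intro: always_eventually\<close>)+
    then have "(\<lambda>n. z0 + Complex (fst (p n)) (snd (p n))) \<longlonglongrightarrow> z0 + Complex 0 0" by (intro tendsto_intros)
    moreover have "z0 + Complex 0 0 = z0" by (simp add: complex_eq_iff)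
    ultimately show ?thesis by (simp add: Z_def)
  qed
  have "isCont Uxy z0" "isCont Uyx z0" using c S by (auto simp: continuous_on_eq_continuous_at)
  then have "(\<lambda>n. Uxy (Z (fst (p n)) (snd (p n)))) \<longlonglongrightarrow> Uxy z0" "(\<lambda>n. Uyx (Z (fst (q n)) (snd (q n)))) \<longlonglongrightarrow> Uyx z0"
    using isCont_tendsto_compose lim[OF pq(1)] lim[OF pq(2)] by blast+
  then show ?thesis unfolding pq(3) by (rule LIMSEQ_unique)
qed

text \<open>The \<open>z\<close>-derivative of \<open>u\<close> is holomorphic and has a primitive
  \<open>G\<close> on the disc; \<open>u - G\<close> has vanishing \<open>z\<close>-derivative, so
  it is antiholomorphic.\<close>

lemma harmonic_decomposition:
  assumes "harmonic_on u (ball 0 1)"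
  obtains f g where "f holomorphic_on ball 0 1" "g holomorphic_on ball 0 1" "g 0 = 0"
    "\<And>z. z \<in> ball 0 1 \<Longrightarrow> u z = f z + cnj (g z)"
proof -
  let ?S = "ball (0::complex) 1"
  obtain ux uy uxx uxy uyx uyy :: "complex \<Rightarrow> complex" where
    d: "\<And>z. z \<in> ?S \<Longrightarrow> (u has_derivative (\<lambda>h. Re h *\<^sub>R ux z + Im h *\<^sub>R uy z)) (at z)"
     "\<And>z. z \<in> ?S \<Longrightarrow> (ux has_derivative (\<lambda>h. Re h *\<^sub>R uxx z + Im h *\<^sub>R uxy z)) (at z)"
     "\<And>z. z \<in> ?S \<Longrightarrow> (uy has_derivative (\<lambda>h. Re h *\<^sub>R uyx z + Im h *\<^sub>R uyy z)) (at z)"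
    and c: "continuous_on ?S uxy" "continuous_on ?S uyx"
    and lap: "\<And>z. z \<in> ?S \<Longrightarrow> uxx z + uyy z = 0"
    using assms unfolding harmonic_on_def by blast
  have sym: "uxy z = uyx z" if z: "z \<in> ?S" for z
  proof (rule complex_eqI)
    show "Re (uxy z) = Re (uyx z)"
      by (rule mixed_partials_eq[of ?S z "\<lambda>z. Re (u z)" "\<lambda>z. Re (ux z)" "\<lambda>z. Re (uy z)" "\<lambda>z. Re (uxx z)" _ "\<lambda>z. Re (uyx z)" "\<lambda>z. Re (uyy z)"])
        (use z bounded_linear.has_derivative[OF bounded_linear_Re, OF d(1)] bounded_linear.has_derivative[OF bounded_linear_Re, OF d(2)] bounded_linear.has_derivative[OF bounded_linear_Re, OF d(3)] c in \<open>auto intro!: continuous_intros\<close>)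
    show "Im (uxy z) = Im (uyx z)"
      by (rule mixed_partials_eq[of ?S z "\<lambda>z. Im (u z)" "\<lambda>z. Im (ux z)" "\<lambda>z. Im (uy z)" "\<lambda>z. Im (uxx z)" _ "\<lambda>z. Im (uyx z)" "\<lambda>z. Im (uyy z)"])
        (use z bounded_linear.has_derivative[OF bounded_linear_Im, OF d(1)] bounded_linear.has_derivative[OF bounded_linear_Im, OF d(2)] bounded_linear.has_derivative[OF bounded_linear_Im, OF d(3)] c in \<open>auto intro!: continuous_intros\<close>)
  qed
  \<comment> \<open>The Wirtinger derivative of \<open>u\<close>; Laplace's equation and the
    symmetry of the mixed partials are its Cauchy-Riemann equations.\<close>
  define F where "F z = (ux z - \<i> * uy z) / 2" for z
  have "(F has_field_derivative (uxx z - \<i> * uyx z) / 2) (at z)" if z: "z \<in> ?S" for z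
    unfolding has_field_derivative_def F_def
  proof (rule has_derivative_eq_rhs)
    show "((\<lambda>z. (ux z - \<i> * uy z) / 2) has_derivative
      (\<lambda>h. ((Re h *\<^sub>R uxx z + Im h *\<^sub>R uxy z) - \<i> * (Re h *\<^sub>R uyx z + Im h *\<^sub>R uyy z)) / 2)) (at z)"
      using d(2)[OF z] d(3)[OF z] by (auto intro!: derivative_eq_intros simp: fun_eq_iff field_simps)
    have "uyy z = - uxx z" using lap[OF z] by (simp add: eq_neg_iff_add_eq_0 add.commute)
    then show "(\<lambda>h. ((Re h *\<^sub>R uxx z + Im h *\<^sub>R uxy z) - \<i> * (Re h *\<^sub>R uyx z + Im h *\<^sub>R uyy z)) / 2) = (*) ((uxx z - \<i> * uyx z) / 2)"
      using sym[OF z] by (auto simp: fun_eq_iff complex_eq_iff field_simps)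
  qed
  then have "F holomorphic_on ?S" using holomorphic_on_open open_ball by blast
  then obtain G where "\<And>z. z \<in> ?S \<Longrightarrow> (G has_field_derivative F z) (at z within ?S)"
    using holomorphic_convex_primitive'[OF convex_ball open_ball] by blast
  then have G: "(G has_field_derivative F z) (at z)" if "z \<in> ?S" for z
    using that by (metis at_within_open open_ball)
  define w where "w z = cnj (u z - G z)" for z
  have "(w has_field_derivative cnj ((ux z + \<i> * uy z) / 2)) (at z)" if z: "z \<in> ?S" for z
    unfolding has_field_derivative_def w_def
  proof (rule has_derivative_eq_rhs)
    show "((\<lambda>z. cnj (u z - G z)) has_derivative (\<lambda>h. cnj ((Re h *\<^sub>R ux z + Im h *\<^sub>R uy z) - F z * h))) (at z)"
      by (intro bounded_linear.has_derivative[OF bounded_linear_cnj] has_derivative_diff d(1) z G[OF z, unfolded has_field_derivative_def])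
    show "(\<lambda>h. cnj ((Re h *\<^sub>R ux z + Im h *\<^sub>R uy z) - F z * h)) = (*) (cnj ((ux z + \<i> * uy z) / 2))"
      by (auto simp: fun_eq_iff complex_eq_iff F_def field_simps)
  qed
  then have w: "w holomorphic_on ?S" using holomorphic_on_open open_ball by blast
  have Gh: "G holomorphic_on ?S" using G holomorphic_on_open open_ball by blast
  show thesis
  \<comment> \<open>The constant \<open>w 0\<close> is shifted to the holomorphic part so that the
    antiholomorphic part vanishes at 0.\<close>
  proof (rule that[of "\<lambda>z. G z + cnj (w 0)" "\<lambda>z. w z - w 0"])
    show "(\<lambda>z. G z + cnj (w 0)) holomorphic_on ?S" "(\<lambda>z. w z - w 0) holomorphic_on ?S"
      by (intro holomorphic_intros Gh w)+
  qed (simp_all add: w_def)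
qed

section \<open>Square-summable coefficients of the antiholomorphic part\<close>

abbreviation taylor :: "(complex \<Rightarrow> complex) \<Rightarrow> nat \<Rightarrow> complex" where
  "taylor g n \<equiv> (deriv ^^ n) g 0 / fact n"

lemma coef_to_l2_snd:
  assumes "l2fun (\<lambda>p. h (snd p))" "h holomorphic_on ball 0 1" "integrable disc_measure h"
  shows "coef (to_l2 (\<lambda>p. h (snd p))) (m, n) = (if m = 0 then taylor h n else 0)"
proof -
  have "cinner (to_l2 (\<lambda>p. h (snd p))) (zmono (m, n)) = moment 0 m * (LINT w|disc_measure. h w * cnj w ^ n)"
    unfolding moment_def by (rule Fubini_product) (simp add: ev_to_l2 assms(1) ev_zmono bidisk_def mult_ac)
  then show ?thesis
    using sqnorm_pos[of "(m, n)"] by (simp add: coef_def integral_disc_taylor[OF assms(2,3)] moment_eq sqnorm_def del: of_nat_Suc)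
qed

lemma norm_zmono: "(norm (zmono p))\<^sup>2 = sqnorm p"
proof -
  have "complex_of_real ((norm (zmono p))\<^sup>2) = of_real (sqnorm p)" unfolding cinner_self[symmetric] cinner_zmono by simp
  then show ?thesis by (simp only: of_real_eq_iff)
qed

text \<open>The coefficients of \<open>(g + cnj f) w\<^sup>K\<close> at \<open>w\<^bsup>K + m\<^esup>\<close> are those of \<open>g\<close>, and as \<open>K\<close> grows the norms of \<open>w\<^bsup>K + m\<^esup>\<close> and
  \<open>w\<^sup>K\<close> become comparable.\<close>

lemma hardy_bound_dilated:
  assumes f: "f holomorphic_on ball 0 1" and g: "g holomorphic_on ball 0 1"
    and M: "\<And>w. w \<in> ball 0 1 \<Longrightarrow> cmod (g w + cnj (f w)) \<le> M" and r: "0 < r" "r < 1"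
  shows "(\<Sum>m=1..<N. (cmod (taylor g m))\<^sup>2 * r ^ (2 * m)) \<le> M\<^sup>2"
proof -
  have M0: "0 \<le> M" using order_trans[OF norm_ge_zero M[of 0]] by simp
  \<comment> \<open>Dilation makes \<open>f\<close> and \<open>g\<close> continuous up to the
    circle, so each is a bounded symbol by itself; before it only the combination
    \<open>g + cnj f\<close> is known to be bounded.\<close>
  let ?d = "\<lambda>h::complex \<Rightarrow> complex. \<lambda>w. h (of_real r * w)"
  have inb: "of_real r * w \<in> ball 0 1" if "w \<in> cball 0 1" for w :: complex
  proof -
    have a: "r * cmod w \<le> r" using that r by (intro mult_left_le) auto
    have "r * cmod w < 1" using a r by linarith
    then show ?thesis using r by (simp add: norm_mult)
  qed
  have dh: "?d h holomorphic_on ball 0 1" if "h holomorphic_on ball 0 1" for h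
    by (rule holomorphic_on_compose_gen[OF _ that, of "\<lambda>w. of_real r * w", unfolded o_def])
      (use inb in \<open>auto intro!: holomorphic_intros\<close>)
  have dc: "continuous_on (cball 0 1) (?d h)" if "h holomorphic_on ball 0 1" for h
    by (rule continuous_on_compose2[OF holomorphic_on_imp_continuous_on[OF that]])
      (use inb in \<open>auto intro!: continuous_intros\<close>)
  have sh: "symb (\<lambda>p. ?d h (snd p))" if "h holomorphic_on ball 0 1" for h
    by (rule symb_snd_cont[OF dc[OF that]])
  have l2: "l2fun (\<lambda>p. ?d h (snd p))" if "h holomorphic_on ball 0 1" for h
    using symb_bound[OF sh[OF that]] sh[OF that] l2fun_bounded unfolding symb_def by blast
  have int: "integrable disc_measure (?d h)" if "h holomorphic_on ball 0 1" for h
  proof -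
    have "bounded (?d h ` cball 0 1)"
      by (rule compact_imp_bounded[OF compact_continuous_image[OF dc[OF that] compact_cball]])
    then obtain B where B0: "\<forall>y\<in>?d h ` cball 0 1. cmod y \<le> B" unfolding bounded_iff by (elim exE)
    have B: "cmod (?d h w) \<le> B" if "w \<in> cball 0 1" for w by (rule bspec[OF B0 imageI[OF that]])
    have "continuous_on (ball 0 1) (?d h)" by (rule continuous_on_subset[OF dc[OF that]]) auto
    then show ?thesis by (rule integrable_disc_bounded[where B=B]) (use B in auto)
  qed
  have tay: "taylor (?d h) n = of_real r ^ n * taylor h n" if "h holomorphic_on ball 0 1" for h n
  proof -
    have "(deriv ^^ n) (?d h) 0 = of_real r ^ n * (deriv ^^ n) h (of_real r * 0)"
      by (rule higher_deriv_compose_linear[where S="ball 0 1", OF that open_ball open_ball]) (use inb in \<open>auto simp del: norm_mult\<close>)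
    then show ?thesis by simp
  qed
  define G where "G = to_l2 (\<lambda>p. ?d g (snd p))"
  define F where "F = to_l2 (\<lambda>p. ?d f (snd p))"
  have GA: "G \<in> A2" "F \<in> A2"
    unfolding G_def F_def by (intro A2_to_l2 l2 f g holomorphic2_on_snd dh)+
  have cG: "coef G (0, m) = of_real r ^ m * taylor g m" for m
    unfolding G_def by (simp add: coef_to_l2_snd[OF l2[OF g] dh[OF g] int[OF g]] tay[OF g])
  have main: "(\<Sum>m=1..<N. (cmod (taylor g m))\<^sup>2 * r ^ (2 * m) * (real (K + 1) / real (K + m + 1))) \<le> M\<^sup>2" for K
  proof -
    let ?v = "\<lambda>p. ?d g (snd p) + cnj (?d f (snd p))"
    have sv: "symb ?v" by (intro symb_add symb_cnj sh f g)
    let ?Y = "Mul ?v (zmono (0, K))"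
    have Y: "?Y = Mul (monom_symb 0 0 K 0) G + Mul (\<lambda>p. cnj (?d f (snd p))) (zmono (0, K))"
      by (rule l2c_eqI) (simp add: ev_Mul sv symb_cnj[OF sh[OF f]] ev_zmono G_def ev_to_l2 l2[OF g], simp add: monom_symb_def algebra_simps)
    \<comment> \<open>For \<open>m \<ge> 1\<close> the conjugate part contributes nothing: moved to
      the other side it raises degrees and cannot reach the lower power \<open>K\<close>.\<close>
    have cY: "coef ?Y (0, K + m) = of_real r ^ m * taylor g m" if m: "1 \<le> m" for m
    proof -
      have 1: "cinner (Mul (monom_symb 0 0 K 0) G) (zmono (0, K + m)) = of_real r ^ m * taylor g m * of_real (sqnorm (0, K + m))"
        using cinner_Mul_monom_symb_zmono[OF GA(1), of 0 0 K 0 0 "K + m"] by (simp add: cG)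
      have "Mul (\<lambda>p. ?d f (snd p)) (zmono (0, K + m)) = Mul (monom_symb 0 0 (K + m) 0) F"
        by (rule l2c_eqI) (simp add: ev_Mul sh[OF f] ev_zmono F_def ev_to_l2 l2[OF f], simp add: monom_symb_def)
      then have "cinner (Mul (\<lambda>p. cnj (?d f (snd p))) (zmono (0, K))) (zmono (0, K + m)) = cinner (zmono (0, K)) (Mul (monom_symb 0 0 (K + m) 0) F)"
        using cinner_Mul[OF symb_cnj[OF sh[OF f]], of "zmono (0, K)" "zmono (0, K + m)"] by simp
      also have "\<dots> = cnj (cinner (Mul (monom_symb 0 0 (K + m) 0) F) (zmono (0, K)))" by (rule cinner_cnj[symmetric])
      also have "\<dots> = 0" using cinner_Mul_monom_symb_zmono[OF GA(2), of 0 0 "K + m" 0 0 K] m by simp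
      finally show ?thesis using 1 sqnorm_pos[of "(0, K + m)"] unfolding Y by (simp add: coef_def cinner_add_left)
    qed
    have "norm ?Y \<le> M * norm (zmono (0, K))"
      by (rule norm_Mul_le[OF sv _ M0]) (use M inb in \<open>auto simp: bidisk_def\<close>)
    then have "(norm ?Y)\<^sup>2 \<le> (M * norm (zmono (0, K)))\<^sup>2" by (rule power_mono) simp
    then have nY: "(norm ?Y)\<^sup>2 \<le> M\<^sup>2 * sqnorm (0, K)" by (simp add: power_mult_distrib norm_zmono)
    have "(\<Sum>m=1..<N. (cmod (coef ?Y (0, K + m)))\<^sup>2 * sqnorm (0, K + m)) = (\<Sum>p\<in>(\<lambda>m. (0, K + m)) ` {1..<N}. (cmod (coef ?Y p))\<^sup>2 * sqnorm p)"
      by (subst sum.reindex) (auto simp: inj_on_def)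
    also have "\<dots> \<le> (norm ?Y)\<^sup>2" by (rule bessel) simp
    finally have "(\<Sum>m=1..<N. (cmod (coef ?Y (0, K + m)))\<^sup>2 * sqnorm (0, K + m)) \<le> M\<^sup>2 * sqnorm (0, K)" using nY by linarith
    moreover have "(\<Sum>m=1..<N. (cmod (coef ?Y (0, K + m)))\<^sup>2 * sqnorm (0, K + m)) =
        (\<Sum>m=1..<N. (cmod (taylor g m))\<^sup>2 * r ^ (2 * m) * (real (K + 1) / real (K + m + 1))) * sqnorm (0, K)"
      unfolding sum_distrib_right
    proof (rule sum.cong[OF refl])
      fix m assume "m \<in> {1..<N}"
      then have "(cmod (coef ?Y (0, K + m)))\<^sup>2 = (cmod (taylor g m))\<^sup>2 * r ^ (2 * m)"
        using r by (subst cY) (auto simp: norm_mult norm_power power_mult_distrib power_mult[symmetric] mult.commute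
            simp del: times_divide_eq_right times_divide_eq_left)
      moreover have "sqnorm (0, K + m) = real (K + 1) / real (K + m + 1) * sqnorm (0, K)"
        by (simp add: sqnorm_def del: of_nat_Suc)
      ultimately show "(cmod (coef ?Y (0, K + m)))\<^sup>2 * sqnorm (0, K + m) = (cmod (taylor g m))\<^sup>2 * r ^ (2 * m) * (real (K + 1) / real (K + m + 1)) * sqnorm (0, K)"
        by simp
    qed
    ultimately show ?thesis using sqnorm_pos[of "(0, K)"] by simp
  qed
  show ?thesis
  proof (rule LIMSEQ_le_const2)
    have l: "(\<lambda>K. real (K + 1) / real (K + m + 1)) \<longlonglongrightarrow> 1" for m by real_asymp
    have "(\<lambda>K. \<Sum>m=1..<N. (cmod (taylor g m))\<^sup>2 * r ^ (2 * m) * (real (K + 1) / real (K + m + 1))) \<longlonglongrightarrow> (\<Sum>m=1..<N. (cmod (taylor g m))\<^sup>2 * r ^ (2 * m) * 1)"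
      by (intro tendsto_sum tendsto_mult tendsto_const l)
    then show "(\<lambda>K. \<Sum>m=1..<N. (cmod (taylor g m))\<^sup>2 * r ^ (2 * m) * (real (K + 1) / real (K + m + 1))) \<longlonglongrightarrow> (\<Sum>m=1..<N. (cmod (taylor g m))\<^sup>2 * r ^ (2 * m))"
      by simp
  qed (use main in blast)
qed

text \<open>The dilation is removed by letting the radius tend to 1 in a finite sum. The coefficient
  of index 0, missing in the dilated bound, is \<open>g 0 = 0\<close>.\<close>

lemma hardy_bound:
  assumes f: "f holomorphic_on ball 0 1" and g: "g holomorphic_on ball 0 1" "g 0 = 0"
    and M: "\<And>w. w \<in> ball 0 1 \<Longrightarrow> cmod (g w + cnj (f w)) \<le> M"
  shows "(\<Sum>m<N. (cmod (taylor g m))\<^sup>2) \<le> M\<^sup>2"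
proof -
  define r :: "nat \<Rightarrow> real" where "r k = 1 - 1 / (real k + 2)" for k
  have r: "0 < r k" "r k < 1" for k by (auto simp: r_def field_simps)
  have rl: "r \<longlonglongrightarrow> 1" unfolding r_def by real_asymp
  have "(\<Sum>m=1..<N. (cmod (taylor g m))\<^sup>2) \<le> M\<^sup>2"
  proof (rule LIMSEQ_le_const2)
    have "(\<lambda>k. \<Sum>m=1..<N. (cmod (taylor g m))\<^sup>2 * r k ^ (2 * m)) \<longlonglongrightarrow> (\<Sum>m=1..<N. (cmod (taylor g m))\<^sup>2 * 1 ^ (2 * m))"
      by (intro tendsto_sum tendsto_mult tendsto_const tendsto_power rl)
    then show "(\<lambda>k. \<Sum>m=1..<N. (cmod (taylor g m))\<^sup>2 * r k ^ (2 * m)) \<longlonglongrightarrow> (\<Sum>m=1..<N. (cmod (taylor g m))\<^sup>2)" by simp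
  qed (use hardy_bound_dilated[OF f g(1) M r] in blast)
  moreover have "(\<Sum>m<N. (cmod (taylor g m))\<^sup>2) = (\<Sum>m=1..<N. (cmod (taylor g m))\<^sup>2)"
    using g(2) by (intro sum.mono_neutral_right) (auto simp: not_less_eq_eq)
  ultimately show ?thesis by simp
qed

text \<open>Square summability dominates the Bergman norm because \<open>sqnorm (0, n)\<close> never
  exceeds \<open>pi * pi\<close>. So \<open>g\<close>, read as a function of \<open>w\<close>,
  belongs to the Bergman space of the bidisk.\<close>

lemma hardy_bergman:
  assumes g: "g holomorphic_on ball 0 1" and C: "\<And>N. (\<Sum>m<N. (cmod (taylor g m))\<^sup>2) \<le> C"
  obtains G where "G \<in> A2" "\<And>z w. (z, w) \<in> bidisk \<Longrightarrow> ev G (z, w) = g w"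
    "\<And>m n. coef G (m, n) = (if m = 0 then taylor g n else 0)"
proof -
  define c where "c p = (if fst p = 0 then taylor g (snd p) else 0)" for p :: "nat \<times> nat"
  have "(\<Sum>p\<in>S. (cmod (c p))\<^sup>2 * sqnorm p) \<le> pi * pi * C" if S: "finite S" for S
  proof -
    obtain K where K: "snd ` S \<subseteq> {..<K}" using finite_nat_iff_bounded[of "snd ` S"] S by auto
    have nn: "0 \<le> (cmod (c p))\<^sup>2 * sqnorm p" for p using sqnorm_pos[of p] by simp
    have "(\<Sum>p\<in>S. (cmod (c p))\<^sup>2 * sqnorm p) = (\<Sum>p\<in>{p \<in> S. fst p = 0}. (cmod (c p))\<^sup>2 * sqnorm p)"
      using S by (intro sum.mono_neutral_right) (auto simp: c_def)
    also have "\<dots> \<le> (\<Sum>p\<in>Pair 0 ` {..<K}. (cmod (c p))\<^sup>2 * sqnorm p)"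
    proof (intro sum_mono2 nn)
      show "{p \<in> S. fst p = 0} \<subseteq> Pair 0 ` {..<K}"
      proof
        fix p assume "p \<in> {p \<in> S. fst p = 0}"
        then show "p \<in> Pair 0 ` {..<K}" using K by (cases p) auto
      qed
    qed simp
    also have "\<dots> = (\<Sum>n<K. (cmod (taylor g n))\<^sup>2 * sqnorm (0, n))"
      by (subst sum.reindex) (auto simp: inj_on_def c_def)
    also have "\<dots> \<le> (\<Sum>n<K. (cmod (taylor g n))\<^sup>2 * (pi * pi))"
      by (intro sum_mono mult_left_mono) (auto simp: sqnorm_def field_simps)
    also have "\<dots> = (\<Sum>n<K. (cmod (taylor g n))\<^sup>2) * (pi * pi)" by (rule sum_distrib_right[symmetric])
    also have "\<dots> \<le> C * (pi * pi)" by (intro mult_right_mono C) simp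
    finally show ?thesis by (simp add: mult.commute)
  qed
  from riesz_fischer_ex[of c, OF this] obtain G where G: "G \<in> A2" "\<And>p. coef G p = c p" by blast
  show thesis
  proof (rule that[OF G(1)])
    show "coef G (m, n) = (if m = 0 then taylor g n else 0)" for m n by (simp add: G(2) c_def)
    fix z w assume b: "(z, w) \<in> bidisk"
    then have "cmod z < 1" "cmod w < 1" by (auto simp: bidisk_def)
    then obtain \<rho> where \<rho>: "max (cmod z) (cmod w) < \<rho>" "\<rho> < 1" using dense[of "max (cmod z) (cmod w)" 1] by auto
    then have \<rho>0: "0 < \<rho>" using norm_ge_zero[of z] by linarith
    have "(\<lambda>k. ev (lincomb (coef G) (sq k)) (z, w)) \<longlonglongrightarrow> ev G (z, w)"
      using \<rho> \<rho>0 by (auto intro!: tendsto_uniform_limitI[OF A2_expand(2)[OF G(1) \<rho>0 \<rho>(2)]])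
    then have "(\<lambda>k. ev (lincomb (coef G) (sq (Suc k))) (z, w)) \<longlonglongrightarrow> ev G (z, w)" by (rule LIMSEQ_Suc)
    moreover have "ev (lincomb (coef G) (sq (Suc k))) (z, w) = (\<Sum>n<Suc k. taylor g n * w ^ n)" for k
    proof -
      have "ev (lincomb (coef G) (sq (Suc k))) (z, w) = (\<Sum>m<Suc k. \<Sum>n<Suc k. c (m, n) * (z ^ m * w ^ n))"
        unfolding ev_lincomb[OF b] by (simp only: sum.cartesian_product G(2) split_beta' prod.collapse fst_conv snd_conv)
      also have "\<dots> = (\<Sum>m\<in>{0}. \<Sum>n<Suc k. c (m, n) * (z ^ m * w ^ n))"
        by (rule sum.mono_neutral_right) (auto simp: c_def intro!: sum.neutral)
      finally show ?thesis by (simp add: c_def)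
    qed
    ultimately have "(\<lambda>k. \<Sum>n<Suc k. taylor g n * w ^ n) \<longlonglongrightarrow> ev G (z, w)" by simp
    moreover have "(\<lambda>n. taylor g n * w ^ n) sums g w"
      using holomorphic_power_series[OF g, of w] \<open>cmod w < 1\<close> by simp
    then have "(\<lambda>k. \<Sum>n<Suc k. taylor g n * w ^ n) \<longlonglongrightarrow> g w" unfolding sums_def by (rule LIMSEQ_Suc)
    ultimately show "ev G (z, w) = g w" by (rule LIMSEQ_unique)
  qed
qed

text \<open>Parseval's identity, reduced to a single index because \<open>Y\<close> has no positive
  powers of \<open>z\<close>. \<open>X\<close> may be any element of \<open>l2c\<close>.\<close>

lemma cinner_z_independent_sums:
  assumes Y: "Y \<in> A2" "\<And>m n. 0 < m \<Longrightarrow> coef Y (m, n) = 0"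
  shows "(\<lambda>n. coef Y (0, n) * cnj (coef X (0, n)) * of_real (sqnorm (0, n))) sums cinner Y X"
proof -
  have "(\<lambda>k. cinner (lincomb (coef Y) (sq (Suc k))) X) \<longlonglongrightarrow> cinner Y X"
    by (rule LIMSEQ_Suc[OF tendsto_cinner[OF A2_expand(1)[OF Y(1)]]])
  moreover have "cinner (lincomb (coef Y) (sq (Suc k))) X = (\<Sum>n<Suc k. coef Y (0, n) * cnj (coef X (0, n)) * of_real (sqnorm (0, n)))" for k
  proof -
    have "cinner (lincomb (coef Y) (sq (Suc k))) X = (\<Sum>p\<in>sq (Suc k). coef Y p * cnj (coef X p) * of_real (sqnorm p))"
      unfolding lincomb_def cinner_sum_left
    proof (rule sum.cong[OF refl])
      fix p
      have "cinner (zmono p) X = cnj (coef X p) * of_real (sqnorm p)"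
        using cinner_cnj[of X "zmono p"] by (simp add: cinner_zmono_coef)
      then show "cinner (coef Y p *\<^sub>C zmono p) X = coef Y p * cnj (coef X p) * of_real (sqnorm p)" by simp
    qed
    also have "\<dots> = (\<Sum>m<Suc k. \<Sum>n<Suc k. coef Y (m, n) * cnj (coef X (m, n)) * of_real (sqnorm (m, n)))"
      by (simp only: sum.cartesian_product split_beta' prod.collapse)
    also have "\<dots> = (\<Sum>m\<in>{0}. \<Sum>n<Suc k. coef Y (m, n) * cnj (coef X (m, n)) * of_real (sqnorm (m, n)))"
      using Y(2) by (intro sum.mono_neutral_right) (auto intro!: sum.neutral)
    finally show ?thesis by simp
  qed
  ultimately have "(\<lambda>k. \<Sum>n<Suc k. coef Y (0, n) * cnj (coef X (0, n)) * of_real (sqnorm (0, n))) \<longlonglongrightarrow> cinner Y X" by simp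
  then show ?thesis unfolding sums_def by (rule LIMSEQ_imp_Suc)
qed

text \<open>The maximum principle needs real values; the identity has real coefficients and
  therefore splits into real and imaginary parts.\<close>

lemma moment_identity_complex:
  fixes x :: "nat \<Rightarrow> complex"
  assumes sm: "summable (\<lambda>m. cmod (x m))" and x0: "x 0 = 0"
    and id: "\<And>i. (\<Sum>m. x m / of_nat (m + d + i + 1)) * of_nat ((i + 1) * (i + d + 1)) = (\<Sum>m\<le>i. x m * of_nat (i - m + 1))"
  shows "x m = 0"
proof -
  have s: "summable (\<lambda>m. x m / of_nat (m + d + i + 1))" for i
  proof (rule summable_comparison_test'[OF sm, of 0])
    fix m show "norm (x m / of_nat (m + d + i + 1)) \<le> cmod (x m)"
      using mult_left_mono[of 1 "real (m + d + i + 1)" "cmod (x m)"]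
      by (simp only: norm_divide norm_of_nat) (simp add: field_simps)
  qed
  have "Re (x m) = 0"
  proof (rule moment_identity_real[where x="\<lambda>m. Re (x m)" and d=d])
    show "summable (\<lambda>m. \<bar>Re (x m)\<bar>)"
      by (rule summable_comparison_test'[OF sm, of 0]) (simp add: abs_Re_le_cmod)
    fix i
    have "(\<Sum>m. Re (x m) / real (m + d + i + 1)) = Re (\<Sum>m. x m / of_nat (m + d + i + 1))"
      by (subst Re_suminf[OF s]) (simp add: Re_divide_of_nat del: of_nat_add of_nat_Suc)
    then show "(\<Sum>m. Re (x m) / real (m + d + i + 1)) * (real (i + 1) * real (i + d + 1)) = (\<Sum>m\<le>i. Re (x m) * real (i - m + 1))"
      using arg_cong[OF id[of i], of Re] unfolding of_nat_mult[symmetric] by (simp add: Re_sum del: of_nat_add of_nat_Suc)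
  qed (use x0 in simp)
  moreover have "Im (x m) = 0"
  proof (rule moment_identity_real[where x="\<lambda>m. Im (x m)" and d=d])
    show "summable (\<lambda>m. \<bar>Im (x m)\<bar>)"
      by (rule summable_comparison_test'[OF sm, of 0]) (simp add: abs_Im_le_cmod)
    fix i
    have "(\<Sum>m. Im (x m) / real (m + d + i + 1)) = Im (\<Sum>m. x m / of_nat (m + d + i + 1))"
      by (subst Im_suminf[OF s]) (simp add: Im_divide_of_nat del: of_nat_add of_nat_Suc)
    then show "(\<Sum>m. Im (x m) / real (m + d + i + 1)) * (real (i + 1) * real (i + d + 1)) = (\<Sum>m\<le>i. Im (x m) * real (i - m + 1))"
      using arg_cong[OF id[of i], of Im] unfolding of_nat_mult[symmetric] by (simp add: Im_sum del: of_nat_add of_nat_Suc)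
  qed (use x0 in simp)
  ultimately show ?thesis by (simp add: complex_eq_iff)
qed

text \<open>The holomorphic part of the symbol goes into \<open>R\<close> and is invisible to the
  Hankel operator; \<open>B\<close> carries the antiholomorphic part. \<open>G\<close> is there to
  make \<open>cnj g\<close> an element of \<open>l2c\<close>, which \<open>g\<close> itself need not
  be by boundedness.\<close>

lemma hankel_l2_antiholomorphic_part:
  assumes a: "continuous_on (cball 0 1) a" "f holomorphic_on ball 0 1"
      "\<And>w. w \<in> ball 0 1 \<Longrightarrow> a w = f w + cnj (g w)"
    and G: "\<And>z w. (z, w) \<in> bidisk \<Longrightarrow> ev G (z, w) = g w"
  obtains B R where "R \<in> A2" "Mul (\<lambda>p. a (snd p)) (zmono (0, i)) = R + B"
    "\<And>z w. (z, w) \<in> bidisk \<Longrightarrow> ev B (z, w) = cnj (g w) * w ^ i"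
proof -
  have s: "symb (\<lambda>p. a (snd p))" by (rule symb_snd_cont[OF a(1)])
  define C where "C = to_l2 (\<lambda>p. cnj (ev G p))"
  have "l2fun (\<lambda>p. cnj (ev G p))"
    using l2fun_ev[of G] unfolding l2fun_def by (auto intro!: continuous_intros)
  then have C: "ev C p = cnj (ev G p)" if "p \<in> bidisk" for p
    unfolding C_def using that by (rule ev_to_l2)
  define B where "B = Mul (monom_symb 0 0 i 0) C"
  define R where "R = Mul (\<lambda>p. a (snd p)) (zmono (0, i)) - B"
  have B: "ev B (z, w) = cnj (g w) * w ^ i" if b: "(z, w) \<in> bidisk" for z w
    unfolding B_def by (simp add: ev_Mul C[OF b] G[OF b]) (simp add: monom_symb_def)
  show thesis
  proof (rule that[of R B])
    have "ev R p = f (snd p) * snd p ^ i" if "p \<in> bidisk" for p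
      using that a(3)[of "snd p"] B[of "fst p" "snd p"]
      by (auto simp: R_def ev_Mul s ev_zmono bidisk_def algebra_simps)
    moreover have "holomorphic2_on (\<lambda>p. f (snd p) * snd p ^ i) bidisk"
      by (intro holomorphic2_on_mult holomorphic2_on_snd a(2) holomorphic2_on_snd[of "\<lambda>z. z ^ i"] holomorphic_intros)
    ultimately show "R \<in> A2" unfolding A2_def using holomorphic2_on_cong[of bidisk "\<lambda>p. f (snd p) * snd p ^ i" "ev R"] by auto
    show "Mul (\<lambda>p. a (snd p)) (zmono (0, i)) = R + B" by (simp add: R_def)
  qed (rule B)
qed

text \<open>Only pairs with \<open>j = i + d\<close> are used, one diagonal at a time. Orthogonality
  says that the antiholomorphic parts and their projections have the same pairing; one side is an
  infinite series, the other a finite sum, and together they form the identity of the maximum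
  principle for \<open>x m = cnj (taylor g1 m) * taylor g2 (m + d)\<close>.\<close>

lemma hankel_product_coefficients:
  assumes a: "continuous_on (cball 0 1) a" "f1 holomorphic_on ball 0 1" "g1 holomorphic_on ball 0 1"
      "\<And>w. w \<in> ball 0 1 \<Longrightarrow> a w = f1 w + cnj (g1 w)" "g1 0 = 0" "\<And>N. (\<Sum>m<N. (cmod (taylor g1 m))\<^sup>2) \<le> C1"
    and b: "continuous_on (cball 0 1) b" "f2 holomorphic_on ball 0 1" "g2 holomorphic_on ball 0 1"
      "\<And>w. w \<in> ball 0 1 \<Longrightarrow> b w = f2 w + cnj (g2 w)" "\<And>N. (\<Sum>m<N. (cmod (taylor g2 m))\<^sup>2) \<le> C2"
    and orth: "\<And>i j. cinner (hankel_l2 (\<lambda>p. a (snd p)) (zmono (0, i))) (Mul (\<lambda>p. b (snd p)) (zmono (0, j))) = 0"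
  shows "cnj (taylor g1 m) * taylor g2 (m + d) = 0"
proof -
  let ?\<beta>1 = "taylor g1" and ?\<beta>2 = "taylor g2"
  obtain G1 where G1: "G1 \<in> A2" "\<And>z w. (z, w) \<in> bidisk \<Longrightarrow> ev G1 (z, w) = g1 w"
    "\<And>m n. coef G1 (m, n) = (if m = 0 then ?\<beta>1 n else 0)"
    using hardy_bergman[OF a(3,6)] by metis
  obtain G2 where G2: "G2 \<in> A2" "\<And>z w. (z, w) \<in> bidisk \<Longrightarrow> ev G2 (z, w) = g2 w"
    "\<And>m n. coef G2 (m, n) = (if m = 0 then ?\<beta>2 n else 0)"
    using hardy_bergman[OF b(3,5)] by metis
  have identity: "(\<lambda>m. cnj (?\<beta>1 m) * ?\<beta>2 (m + d) / of_nat (m + d + i + 1)) sums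
      ((\<Sum>m\<le>i. cnj (?\<beta>1 m) * ?\<beta>2 (m + d) * of_nat (i - m + 1)) / of_nat ((i + 1) * (i + d + 1)))" for i
  proof -
    define j where "j = i + d"
    obtain B1 R1 where B1: "R1 \<in> A2" "Mul (\<lambda>p. a (snd p)) (zmono (0, i)) = R1 + B1"
      "\<And>z w. (z, w) \<in> bidisk \<Longrightarrow> ev B1 (z, w) = cnj (g1 w) * w ^ i"
      using hankel_l2_antiholomorphic_part[OF a(1,2,4) G1(2), of i] by metis
    obtain B2 R2 where B2: "R2 \<in> A2" "Mul (\<lambda>p. b (snd p)) (zmono (0, j)) = R2 + B2"
      "\<And>z w. (z, w) \<in> bidisk \<Longrightarrow> ev B2 (z, w) = cnj (g2 w) * w ^ j"
      using hankel_l2_antiholomorphic_part[OF b(1,2,4) G2(2), of j] by metis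
    have "hankel_l2 (\<lambda>p. a (snd p)) (zmono (0, i)) = B1 - bproj B1"
      by (simp add: hankel_l2_def B1(2) bproj_linear bproj_A2 B1(1))
    then have "cinner (B1 - bproj B1) (R2 + B2) = 0" using orth[of i j] B2(2) by simp
    then have "cinner (B1 - bproj B1) B2 = 0" using bproj_orth(1)[OF B2(1), of B1] by (simp add: cinner_add_right)
    then have eq: "cinner B1 B2 = cinner (bproj B1) (bproj B2)" by (simp add: cinner_diff_left cinner_bproj)
    have coefM: "coef (Mul (monom_symb 0 0 k 0) G) (m, n) = (if k \<le> n then coef G (m, n - k) else 0)" if "G \<in> A2" for G k m n
      using cinner_Mul_monom_symb_zmono[OF that, of 0 0 k 0 m n] sqnorm_pos[of "(m, n)"] by (simp add: coef_def[of "Mul (monom_symb 0 0 k 0) G"])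
    \<comment> \<open>Conjugating the factors exchanges the roles: the conjugate of
      \<open>g1\<close> on the left becomes \<open>g1\<close> on the right, and likewise for
      \<open>g2\<close>. Both arguments are then holomorphic and Parseval's identity
      applies.\<close>
    have "cinner B1 B2 = cinner (Mul (monom_symb 0 0 i 0) G2) (Mul (monom_symb 0 0 j 0) G1)"
      unfolding cinner_eq
    proof (rule Bochner_Integration.integral_cong[OF refl])
      fix p assume "p \<in> space bidisk_measure"
      then have "(fst p, snd p) \<in> bidisk" by simp
      from B1(3)[OF this] B2(3)[OF this] G1(2)[OF this] G2(2)[OF this]
      show "ev B1 p * cnj (ev B2 p) = ev (Mul (monom_symb 0 0 i 0) G2) p * cnj (ev (Mul (monom_symb 0 0 j 0) G1) p)"
        by (simp add: ev_Mul, simp add: monom_symb_def mult_ac)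
    qed
    then have "(\<lambda>n. coef (Mul (monom_symb 0 0 i 0) G2) (0, n) * cnj (coef (Mul (monom_symb 0 0 j 0) G1) (0, n)) * of_real (sqnorm (0, n))) sums cinner B1 B2"
      using cinner_z_independent_sums[of "Mul (monom_symb 0 0 i 0) G2" "Mul (monom_symb 0 0 j 0) G1"] A2_Mul[OF symb_monom_symb holomorphic2_monom_symb G2(1), of 0 i]
      by (simp add: coefM G2 G1)
    then have "(\<lambda>n. (if i \<le> n then ?\<beta>2 (n - i) else 0) * cnj (if j \<le> n then ?\<beta>1 (n - j) else 0) * of_real (sqnorm (0, n))) sums cinner B1 B2"
      by (simp add: coefM G1 G2 cong: if_cong)
    \<comment> \<open>Index shift \<open>n = m + j\<close>: the terms with \<open>n < j\<close>
      vanish, and for the others \<open>i \<le> n\<close> is automatic.\<close>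
    moreover have "(\<lambda>m. (if i \<le> m + j then ?\<beta>2 (m + j - i) else 0) * cnj (if j \<le> m + j then ?\<beta>1 (m + j - j) else 0) * of_real (sqnorm (0, m + j)))
        = (\<lambda>m. of_real (pi * pi) * (cnj (?\<beta>1 m) * ?\<beta>2 (m + d) / of_nat (m + d + i + 1)))"
      by (simp add: fun_eq_iff j_def sqnorm_def add_ac mult_ac)
    ultimately have S1: "(\<lambda>m. of_real (pi * pi) * (cnj (?\<beta>1 m) * ?\<beta>2 (m + d) / of_nat (m + d + i + 1))) sums cinner B1 B2"
      using sums_zero_iff_shift[of j "\<lambda>n. (if i \<le> n then ?\<beta>2 (n - i) else 0) * cnj (if j \<le> n then ?\<beta>1 (n - j) else 0) * of_real (sqnorm (0, n))" "cinner B1 B2"]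
      by simp
    \<comment> \<open>The conjugate of \<open>g\<close> is moved to the other side, where the
      coefficient at \<open>w ^ k\<close> is read off. So the projection of
      \<open>cnj g * w ^ k\<close> is a polynomial in \<open>w\<close> of degree at most
      \<open>k\<close>.\<close>
    have cPB: "coef B (m, n) = (if m = 0 \<and> n \<le> k then cnj (coef G (0, k - n)) * of_real (real (Suc n) / real (Suc k)) else 0)"
      if B: "\<And>z w. (z, w) \<in> bidisk \<Longrightarrow> ev B (z, w) = cnj (g w) * w ^ k"
        and G: "G \<in> A2" "\<And>z w. (z, w) \<in> bidisk \<Longrightarrow> ev G (z, w) = g w" for B G g k m n
    proof -
      have "cinner B (zmono (m, n)) = cinner (zmono (0, k)) (Mul (monom_symb m 0 n 0) G)"
        unfolding cinner_eq
      proof (rule Bochner_Integration.integral_cong[OF refl])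
        fix p assume p: "p \<in> space bidisk_measure"
        then have "(fst p, snd p) \<in> bidisk" by simp
        from B[OF this] G(2)[OF this] p
        show "ev B p * cnj (ev (zmono (m, n)) p) = ev (zmono (0, k)) p * cnj (ev (Mul (monom_symb m 0 n 0) G) p)"
          by (simp add: ev_Mul ev_zmono, simp add: monom_symb_def mult_ac)
      qed
      also have "\<dots> = cnj (cinner (Mul (monom_symb m 0 n 0) G) (zmono (0, k)))" by (rule cinner_cnj[symmetric])
      also have "\<dots> = (if m = 0 \<and> n \<le> k then cnj (coef G (0, k - n)) * of_real (sqnorm (0, k)) else 0)"
        unfolding cinner_Mul_monom_symb_zmono[OF G(1)] by simp
      finally have "coef B (m, n) = (if m = 0 \<and> n \<le> k then cnj (coef G (0, k - n)) * of_real (sqnorm (0, k)) else 0) / of_real (sqnorm (m, n))"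
        by (simp only: coef_def)
      moreover have "complex_of_real (sqnorm (0, k)) / of_real (sqnorm (0, n)) = of_real (real (Suc n) / real (Suc k))"
        unfolding of_real_divide[symmetric] by (simp add: sqnorm_def)
      ultimately show ?thesis
        by (auto simp: times_divide_eq_right[symmetric] simp del: times_divide_eq_right of_nat_Suc)
    qed
    have c1: "coef (bproj B1) (m, n) = (if m = 0 \<and> n \<le> i then cnj (?\<beta>1 (i - n)) * of_real (real (Suc n) / real (Suc i)) else 0)" for m n
      using cPB[OF B1(3) G1(1,2), of m n] by (simp add: G1(3))
    have c2: "coef (bproj B2) (m, n) = (if m = 0 \<and> n \<le> j then cnj (?\<beta>2 (j - n)) * of_real (real (Suc n) / real (Suc j)) else 0)" for m n
      using cPB[OF B2(3) G2(1,2), of m n] by (simp add: G2(3))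
    have "(\<lambda>n. coef (bproj B1) (0, n) * cnj (coef (bproj B2) (0, n)) * of_real (sqnorm (0, n))) sums cinner (bproj B1) (bproj B2)"
      by (rule cinner_z_independent_sums[OF bproj_in]) (simp only: c1, simp)
    moreover have "(\<lambda>n. coef (bproj B1) (0, n) * cnj (coef (bproj B2) (0, n)) * of_real (sqnorm (0, n))) sums
        (\<Sum>n\<in>{..i}. coef (bproj B1) (0, n) * cnj (coef (bproj B2) (0, n)) * of_real (sqnorm (0, n)))"
      by (rule sums_finite) (simp_all only: c1, auto)
    ultimately have "cinner (bproj B1) (bproj B2) = (\<Sum>n\<in>{..i}. coef (bproj B1) (0, n) * cnj (coef (bproj B2) (0, n)) * of_real (sqnorm (0, n)))"
      by (rule sums_unique2)
    also have "\<dots> = (\<Sum>n\<le>i. of_real (pi * pi) * (cnj (?\<beta>1 (i - n)) * ?\<beta>2 (i - n + d) * of_nat (n + 1) / of_nat ((i + 1) * (i + d + 1))))"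
    proof (rule sum.cong[OF refl])
      fix n assume "n \<in> {..i}"
      then have n: "n \<le> i" "n \<le> j" "j - n = i - n + d" by (auto simp: j_def)
      have alg: "x * of_real (N / I) * (y * of_real (N / J)) * of_real (pi * (pi / N)) = of_real (pi * pi) * (x * y * of_real N / of_real (I * J))"
        if "N \<noteq> 0" for x y :: complex and N I J :: real
        using that by (simp add: field_simps)
      have c1': "coef (bproj B1) (0, n) = cnj (?\<beta>1 (i - n)) * of_real (real (Suc n) / real (Suc i))"
        by (simp only: c1 n simp_thms if_True)
      have c2': "coef (bproj B2) (0, n) = cnj (?\<beta>2 (i - n + d)) * of_real (real (Suc n) / real (Suc j))"
        by (simp only: c2 n simp_thms if_True)
      have gm: "sqnorm (0, n) = pi * (pi / real (Suc n))" by (simp add: sqnorm_def)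
      have IJ: "complex_of_nat ((i + 1) * (i + d + 1)) = of_real (real (Suc i) * real (Suc j))"
        by (simp add: j_def algebra_simps)
      have N: "complex_of_nat (n + 1) = of_real (real (Suc n))" by simp
      have ne: "real (Suc n) \<noteq> 0" by simp
      show "coef (bproj B1) (0, n) * cnj (coef (bproj B2) (0, n)) * of_real (sqnorm (0, n))
          = of_real (pi * pi) * (cnj (?\<beta>1 (i - n)) * ?\<beta>2 (i - n + d) * of_nat (n + 1) / of_nat ((i + 1) * (i + d + 1)))"
        unfolding c1' c2' gm IJ N complex_cnj_mult complex_cnj_cnj complex_cnj_complex_of_real by (rule alg[OF ne])
    qed
    also have "\<dots> = (\<Sum>m\<le>i. of_real (pi * pi) * (cnj (?\<beta>1 m) * ?\<beta>2 (m + d) * of_nat (i - m + 1) / of_nat ((i + 1) * (i + d + 1))))"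
      by (rule sum.reindex_bij_witness[where i="\<lambda>m. i - m" and j="\<lambda>m. i - m"]) auto
    also have "\<dots> = of_real (pi * pi) * ((\<Sum>m\<le>i. cnj (?\<beta>1 m) * ?\<beta>2 (m + d) * of_nat (i - m + 1)) / of_nat ((i + 1) * (i + d + 1)))"
      by (simp only: sum_distrib_left sum_divide_distrib)
    finally have S2: "cinner (bproj B1) (bproj B2) = of_real (pi * pi) * ((\<Sum>m\<le>i. cnj (?\<beta>1 m) * ?\<beta>2 (m + d) * of_nat (i - m + 1)) / of_nat ((i + 1) * (i + d + 1)))" .
    have ne: "complex_of_real (pi * pi) \<noteq> 0" by simp
    show ?thesis using S1 unfolding eq S2 sums_mult_iff[OF ne] .
  qed
  show ?thesis
  proof (rule moment_identity_complex[where x="\<lambda>m. cnj (?\<beta>1 m) * ?\<beta>2 (m + d)" and d=d])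
    show "cnj (?\<beta>1 0) * ?\<beta>2 (0 + d) = 0" by (simp add: a(5))
    \<comment> \<open>A product of two square-summable sequences; this is where the Hardy bounds
      enter.\<close>
    show "summable (\<lambda>m. cmod (cnj (?\<beta>1 m) * ?\<beta>2 (m + d)))"
    proof (rule summable_comparison_test'[where N=0])
      have 1: "summable (\<lambda>m. (cmod (?\<beta>1 m))\<^sup>2)" using a(6) by (intro summableI_nonneg_bounded) auto
      have 2: "summable (\<lambda>m. (cmod (?\<beta>2 m))\<^sup>2)" using b(5) by (intro summableI_nonneg_bounded) auto
      then have "summable (\<lambda>m. (cmod (?\<beta>2 (m + d)))\<^sup>2)" by (subst summable_iff_shift)
      with 1 show "summable (\<lambda>m. (cmod (?\<beta>1 m))\<^sup>2 + (cmod (?\<beta>2 (m + d)))\<^sup>2)" by (rule summable_add)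
      have "x * y \<le> x\<^sup>2 + y\<^sup>2" if "0 \<le> x" "0 \<le> y" for x y :: real
        using sum_squares_bound[of x y] mult_nonneg_nonneg[OF that] by linarith
      then show "norm (cmod (cnj (?\<beta>1 m) * ?\<beta>2 (m + d))) \<le> (cmod (?\<beta>1 m))\<^sup>2 + (cmod (?\<beta>2 (m + d)))\<^sup>2" for m
        unfolding norm_mult complex_mod_cnj real_norm_def abs_mult abs_norm_cancel by (metis norm_ge_zero)
    qed
    show "(\<Sum>m. cnj (?\<beta>1 m) * ?\<beta>2 (m + d) / of_nat (m + d + i + 1)) * of_nat ((i + 1) * (i + d + 1)) =
        (\<Sum>m\<le>i. cnj (?\<beta>1 m) * ?\<beta>2 (m + d) * of_nat (i - m + 1))" for i
      unfolding sums_unique[OF identity[of i], symmetric] by (simp del: of_nat_mult of_nat_add of_nat_Suc add: of_nat_eq_0_iff[where 'a=complex])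
  qed
qed

text \<open>If both antiholomorphic parts had a nonzero coefficient, say of indices \<open>m\<close>
  and \<open>n\<close>, their product would be one of the products that vanish, with
  \<open>d\<close> the distance of \<open>m\<close> and \<open>n\<close>.\<close>

lemma harmonic_hankel_product_zero:
  assumes a: "continuous_on (cball 0 1) a" "harmonic_on a (ball 0 1)"
    and b: "continuous_on (cball 0 1) b" "harmonic_on b (ball 0 1)"
    and orth: "\<And>i j. cinner (hankel_l2 (\<lambda>p. a (snd p)) (zmono (0, i))) (Mul (\<lambda>p. b (snd p)) (zmono (0, j))) = 0"
  shows "a holomorphic_on ball 0 1 \<or> b holomorphic_on ball 0 1"
proof -
  obtain f1 g1 where 1: "f1 holomorphic_on ball 0 1" "g1 holomorphic_on ball 0 1" "g1 0 = 0"
    "\<And>z. z \<in> ball 0 1 \<Longrightarrow> a z = f1 z + cnj (g1 z)" using harmonic_decomposition[OF a(2)] by metis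
  obtain f2 g2 where 2: "f2 holomorphic_on ball 0 1" "g2 holomorphic_on ball 0 1" "g2 0 = 0"
    "\<And>z. z \<in> ball 0 1 \<Longrightarrow> b z = f2 z + cnj (g2 z)" using harmonic_decomposition[OF b(2)] by metis
  have bnd: "\<exists>C. \<forall>N. (\<Sum>m<N. (cmod (taylor g m))\<^sup>2) \<le> C"
    if c: "continuous_on (cball 0 1) u" and d: "f holomorphic_on ball 0 1" "g holomorphic_on ball 0 1" "g 0 = 0"
      "\<And>z. z \<in> ball 0 1 \<Longrightarrow> u z = f z + cnj (g z)" for u f g
  proof -
    have "bounded (u ` cball 0 1)"
      by (rule compact_imp_bounded[OF compact_continuous_image[OF c compact_cball]])
    then obtain M where M0: "\<forall>y\<in>u ` cball 0 1. cmod y \<le> M" unfolding bounded_iff by (elim exE)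
    have M: "cmod (u w) \<le> M" if "w \<in> cball 0 1" for w by (rule bspec[OF M0 imageI[OF that]])
    have "cmod (g w + cnj (f w)) \<le> M" if "w \<in> ball 0 1" for w
    proof -
      have "g w + cnj (f w) = cnj (u w)" by (simp add: d(4)[OF that] add.commute)
      then show ?thesis using M[of w] that by simp
    qed
    then show ?thesis using hardy_bound[OF d(1,2,3)] by blast
  qed
  obtain C1 where C1: "\<And>N. (\<Sum>m<N. (cmod (taylor g1 m))\<^sup>2) \<le> C1" using bnd[OF a(1) 1] by blast
  obtain C2 where C2: "\<And>N. (\<Sum>m<N. (cmod (taylor g2 m))\<^sup>2) \<le> C2" using bnd[OF b(1) 2] by blast
  \<comment> \<open>\<open>hankel_product_coefficients\<close> covers only a second index at least
    as large as the first. The orthogonality is symmetric in the two symbols, so exchanging them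
    covers the other order.\<close>
  have orth': "cinner (hankel_l2 (\<lambda>p. b (snd p)) (zmono (0, i))) (Mul (\<lambda>p. a (snd p)) (zmono (0, j))) = 0" for i j
  proof -
    have "cinner (hankel_l2 (\<lambda>p. b (snd p)) (zmono (0, i))) (Mul (\<lambda>p. a (snd p)) (zmono (0, j)))
        = cnj (cinner (hankel_l2 (\<lambda>p. a (snd p)) (zmono (0, j))) (Mul (\<lambda>p. b (snd p)) (zmono (0, i))))"
      unfolding cinner_hankel_l2_Mul by (rule cinner_cnj[symmetric])
    then show ?thesis by (simp add: orth)
  qed
  note A = hankel_product_coefficients[OF a(1) 1(1,2,4,3) C1 b(1) 2(1,2,4) C2 orth]
  note B = hankel_product_coefficients[OF b(1) 2(1,2,4,3) C2 a(1) 1(1,2,4) C1 orth']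
  have z: "(\<forall>m. taylor g1 m = 0) \<or> (\<forall>n. taylor g2 n = 0)"
  proof (rule ccontr)
    assume "\<not> ((\<forall>m. taylor g1 m = 0) \<or> (\<forall>n. taylor g2 n = 0))"
    then obtain m n where mn: "taylor g1 m \<noteq> 0" "taylor g2 n \<noteq> 0" by blast
    show False
    proof (cases "m \<le> n")
      case True
      then show False using A[of m "n - m"] mn by simp
    next
      case False
      then show False using B[of n "m - n"] mn by simp
    qed
  qed
  have zero: "g w = 0" if g: "g holomorphic_on ball 0 1" "\<forall>m. taylor g m = 0" and w: "w \<in> ball 0 1" for g w
  proof -
    have "(\<lambda>n. taylor g n * (w - 0) ^ n) sums g w" by (rule holomorphic_power_series[OF g(1) w])
    then have "(\<lambda>n. 0) sums g w" using g(2) by simp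
    then show ?thesis using sums_unique2 sums_zero by blast
  qed
  from z show ?thesis
  proof
    assume "\<forall>m. taylor g1 m = 0"
    then have "a w = f1 w" if "w \<in> ball 0 1" for w using zero[OF 1(2) _ that] 1(4)[OF that] by simp
    then show ?thesis using holomorphic_transform[OF 1(1), of a] by auto
  next
    assume "\<forall>n. taylor g2 n = 0"
    then have "b w = f2 w" if "w \<in> ball 0 1" for w using zero[OF 2(2) _ that] 2(4)[OF that] by simp
    then show ?thesis using holomorphic_transform[OF 2(1), of b] by auto
  qed
qed

section \<open>Discs in the boundary\<close>

lemma frontier_bidisk: "p \<in> frontier bidisk \<longleftrightarrow> cmod (fst p) \<le> 1 \<and> cmod (snd p) \<le> 1 \<and> (cmod (fst p) = 1 \<or> cmod (snd p) = 1)"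
  unfolding frontier_def closure_bidisk interior_open[OF open_bidisk] by (cases p) (auto simp: bidisk_def)

lemma holomorphic_disc_const:
  assumes f: "f holomorphic_on ball 0 1" "\<And>z. z \<in> ball 0 1 \<Longrightarrow> cmod (f z) \<le> 1"
    and z0: "z0 \<in> ball 0 1" "cmod (f z0) = 1" and z: "z \<in> ball 0 1"
  shows "f z = f z0"
proof -
  have "f constant_on ball 0 1"
    by (rule maximum_modulus_principle[OF f(1), of "ball 0 1" z0]) (use f z0 in auto)
  then show ?thesis using z0(1) z unfolding constant_on_def by metis
qed

text \<open>\<open>k\<close> may touch the circle, where \<open>h\<close> need not be holomorphic;
  but then \<open>k\<close> is constant by the maximum modulus principle.\<close>

lemma disc_composition_holomorphic:
  assumes h: "h holomorphic_on ball 0 1" and k: "k holomorphic_on ball 0 1" "\<And>z. z \<in> ball 0 1 \<Longrightarrow> cmod (k z) \<le> 1"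
  shows "(\<lambda>z. h (k z)) holomorphic_on ball 0 1"
proof (cases "\<exists>z0\<in>ball 0 1. cmod (k z0) = 1")
  case True
  then obtain z0 where "z0 \<in> ball 0 1" "cmod (k z0) = 1" by blast
  then have "h (k z0) = h (k z)" if "z \<in> ball 0 1" for z
    using holomorphic_disc_const[OF k, of z0 z] that by simp
  then show ?thesis by (rule holomorphic_transform[OF holomorphic_on_const])
next
  case False
  then have "k ` ball 0 1 \<subseteq> ball 0 1" using k(2) by fastforce
  then show ?thesis using holomorphic_on_compose_gen[OF k(1) h] by (simp add: o_def)
qed

theorem corollary1:
  fixes \<phi> \<psi> :: "complex \<times> complex \<Rightarrow> complex"
  assumes "continuous_on (closure bidisk) \<phi>"
    and "continuous_on (closure bidisk) \<psi>"
    and "\<And>g. holomorphic_disc g (frontier bidisk) \<Longrightarrow>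
           harmonic_on (\<phi> \<circ> g) (ball 0 1) \<and> harmonic_on (\<psi> \<circ> g) (ball 0 1)"
  shows "compact_on_bergman bidisk (bergman_adjoint bidisk (hankel bidisk \<psi>) \<circ> hankel bidisk \<phi>) \<longleftrightarrow>
         (\<forall>g. holomorphic_disc g (frontier bidisk) \<longrightarrow>
            (\<phi> \<circ> g) holomorphic_on ball 0 1 \<or> (\<psi> \<circ> g) holomorphic_on ball 0 1)"
proof -
  note cont = assms(1,2)
  have s: "symb \<phi>" "symb \<psi>" using cont symb_continuous_closure by auto
  have disc1: "holomorphic_disc (\<lambda>w. (e, w)) (frontier bidisk)" if "cmod e = 1" for e
    using that by (auto simp: holomorphic_disc_def frontier_bidisk intro!: holomorphic_intros)
  have disc2: "holomorphic_disc (\<lambda>z. (z, e)) (frontier bidisk)" if "cmod e = 1" for e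
    using that by (auto simp: holomorphic_disc_def frontier_bidisk intro!: holomorphic_intros)
  show ?thesis unfolding compact_on_bergman_iff[OF s]
  proof
    assume comp: "compact_hankel_prod \<psi> \<phi>"
    have h1: "(\<lambda>w. \<phi> (e, w)) holomorphic_on ball 0 1 \<or> (\<lambda>w. \<psi> (e, w)) holomorphic_on ball 0 1" if e: "cmod e = 1" for e
    proof (rule harmonic_hankel_product_zero)
      show "continuous_on (cball 0 1) (\<lambda>w. \<phi> (e, w))" "continuous_on (cball 0 1) (\<lambda>w. \<psi> (e, w))"
        using e by (auto intro!: continuous_on_compose2[OF cont(1)] continuous_on_compose2[OF cont(2)] continuous_intros simp: closure_bidisk)
      show "harmonic_on (\<lambda>w. \<phi> (e, w)) (ball 0 1)" "harmonic_on (\<lambda>w. \<psi> (e, w)) (ball 0 1)"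
        using assms(3)[OF disc1[OF e]] by (simp_all add: o_def)
      show "cinner (hankel_l2 (\<lambda>p. \<phi> (e, snd p)) (zmono (0, i))) (Mul (\<lambda>p. \<psi> (e, snd p)) (zmono (0, j))) = 0" for i j
        by (rule compact_hankel_prod_imp_fibre_orthogonal[OF cont comp e])
    qed
    have h2: "(\<lambda>z. \<phi> (z, e)) holomorphic_on ball 0 1 \<or> (\<lambda>z. \<psi> (z, e)) holomorphic_on ball 0 1" if e: "cmod e = 1" for e
    proof (rule harmonic_hankel_product_zero)
      show "continuous_on (cball 0 1) (\<lambda>z. \<phi> (z, e))" "continuous_on (cball 0 1) (\<lambda>z. \<psi> (z, e))"
        using e by (auto intro!: continuous_on_compose2[OF cont(1)] continuous_on_compose2[OF cont(2)] continuous_intros simp: closure_bidisk)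
      show "harmonic_on (\<lambda>z. \<phi> (z, e)) (ball 0 1)" "harmonic_on (\<lambda>z. \<psi> (z, e)) (ball 0 1)"
        using assms(3)[OF disc2[OF e]] by (simp_all add: o_def)
      \<comment> \<open>The horizontal fibres are the vertical ones of the swapped symbols, whose
        Hankel product is compact as well.\<close>
      show "cinner (hankel_l2 (\<lambda>p. \<phi> (snd p, e)) (zmono (0, i))) (Mul (\<lambda>p. \<psi> (snd p, e)) (zmono (0, j))) = 0" for i j
        using compact_hankel_prod_imp_fibre_orthogonal[OF continuous_closure_swap[OF cont(1)] continuous_closure_swap[OF cont(2)]
            compact_hankel_prod_swap[OF s comp] e, of i j] by simp
    qed
    show "\<forall>g. holomorphic_disc g (frontier bidisk) \<longrightarrow> (\<phi> \<circ> g) holomorphic_on ball 0 1 \<or> (\<psi> \<circ> g) holomorphic_on ball 0 1"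
    proof (intro allI impI)
      fix g assume g: "holomorphic_disc g (frontier bidisk)"
      let ?u = "\<lambda>z. fst (g z)" and ?v = "\<lambda>z. snd (g z)"
      have uv: "?u holomorphic_on ball 0 1" "?v holomorphic_on ball 0 1"
        using g by (simp_all add: holomorphic_disc_def)
      have fr: "g z \<in> frontier bidisk" if "z \<in> ball 0 1" for z using g that by (auto simp: holomorphic_disc_def)
      have le: "cmod (?u z) \<le> 1" "cmod (?v z) \<le> 1" if "z \<in> ball 0 1" for z
        using fr[OF that] by (simp_all add: frontier_bidisk)
      have 0: "0 \<in> ball (0::complex) 1" by simp
      \<comment> \<open>The value at the centre already decides which coordinate is constant, so one
        fibre serves the whole disc.\<close>
      have "cmod (?u 0) = 1 \<or> cmod (?v 0) = 1" using fr[OF 0] by (simp add: frontier_bidisk)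
      then show "(\<phi> \<circ> g) holomorphic_on ball 0 1 \<or> (\<psi> \<circ> g) holomorphic_on ball 0 1"
      proof
        assume e: "cmod (?u 0) = 1"
        have "g z = (?u 0, ?v z)" if "z \<in> ball 0 1" for z
          using holomorphic_disc_const[OF uv(1) le(1) 0 e that] by (metis prod.collapse)
        then have tr: "F (?u 0, ?v z) = (F \<circ> g) z" if "z \<in> ball 0 1" for z and F :: "complex \<times> complex \<Rightarrow> complex"
          using that by (simp add: o_def)
        show ?thesis
          using h1[OF e] disc_composition_holomorphic[OF _ uv(2) le(2), of "\<lambda>w. \<phi> (?u 0, w)"]
            disc_composition_holomorphic[OF _ uv(2) le(2), of "\<lambda>w. \<psi> (?u 0, w)"] holomorphic_transform tr by blast
      next
        assume e: "cmod (?v 0) = 1"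
        have "g z = (?u z, ?v 0)" if "z \<in> ball 0 1" for z
          using holomorphic_disc_const[OF uv(2) le(2) 0 e that] by (metis prod.collapse)
        then have tr: "F (?u z, ?v 0) = (F \<circ> g) z" if "z \<in> ball 0 1" for z and F :: "complex \<times> complex \<Rightarrow> complex"
          using that by (simp add: o_def)
        show ?thesis
          using h2[OF e] disc_composition_holomorphic[OF _ uv(1) le(1), of "\<lambda>z. \<phi> (z, ?v 0)"]
            disc_composition_holomorphic[OF _ uv(1) le(1), of "\<lambda>z. \<psi> (z, ?v 0)"] holomorphic_transform tr by blast
      qed
    qed
  next
    assume hol: "\<forall>g. holomorphic_disc g (frontier bidisk) \<longrightarrow> (\<phi> \<circ> g) holomorphic_on ball 0 1 \<or> (\<psi> \<circ> g) holomorphic_on ball 0 1"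
    have h1: "(\<lambda>w. \<phi> (e, w)) holomorphic_on ball 0 1 \<or> (\<lambda>w. \<psi> (e, w)) holomorphic_on ball 0 1" if "cmod e = 1" for e
      using hol[rule_format, OF disc1[OF that]] by (simp add: o_def)
    have h2: "(\<lambda>z. \<phi> (z, e)) holomorphic_on ball 0 1 \<or> (\<lambda>z. \<psi> (z, e)) holomorphic_on ball 0 1" if "cmod e = 1" for e
      using hol[rule_format, OF disc2[OF that]] by (simp add: o_def)
    show "compact_hankel_prod \<psi> \<phi>"
      unfolding compact_hankel_prod_def using hankel_prod_compact[OF cont h1 h2] by blast
  qed
qed

end
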